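(* Let $C_0>0$. There exist constants $C,R_0>0$, depending only on $C_0$, such that the following holds. Let $V\in L^\infty(\mathbb R;\mathbb R)$ and $u\in L^\infty(\mathbb R;\mathbb R)$ satisfy \[ (-\Delta)^{1/4}u+Vu=0\quad\text{in }\mathcal S'(\mathbb R),\qquad \|V\|_{L^\infty(\mathbb R)}\le1,\qquad \|u\|_{L^\infty(\mathbb R)}\le C_0,\qquad \|u\|_{L^2(-1,1)}\ge1 . \] Then for every $R\ge R_0$, \[ \inf_{|x_0|=R}\|u\|_{L^\infty(x_0-1,x_0+1)}\ge \exp(-CR\log R). \]
   Context: $(-\Delta)^{1/4}$ is the fractional Laplacian on $\mathbb R$ with Fourier multiplier $|\xi|^{1/2}$. For $u\in L^\infty(\mathbb R)$, $(-\Delta)^{1/4}u\in\mathcal S'(\mathbb R)$ is defined by duality, $\langle(-\Delta)^{1/4}u,\phi\rangle=\int_{\mathbb R}u\,(-\Delta)^{1/4}\phi\,dx$ for Schwartz $\phi$ (note $(-\Delta)^{1/4}\phi\in L^1(\mathbb R)$). *)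

theory Defs
  imports "HOL-Analysis.Analysis" "HOL-Probability.Essential_Supremum"
begin

text \<open>Functions are representatives of Lebesgue classes on the real line, hence required to be
  Lebesgue (not necessarily Borel) measurable.\<close>

definition Linf_norm_on :: "real set \<Rightarrow> (real \<Rightarrow> real) \<Rightarrow> ereal" where
  "Linf_norm_on S f = esssup (lebesgue_on S) (\<lambda>x. ereal \<bar>f x\<bar>)"

definition Linf :: "(real \<Rightarrow> real) set" where
  "Linf = {f \<in> borel_measurable lebesgue. Linf_norm_on UNIV f < \<infinity>}"

text \<open>The Bochner integral is 0 on non-integrable functions, so this is the $L^2$ norm only for
  functions that are square integrable on \<open>S\<close>; essentially bounded ones on bounded intervals are.\<close>

definition L2_norm_on :: "real set \<Rightarrow> (real \<Rightarrow> real) \<Rightarrow> real" where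
  "L2_norm_on S f = sqrt (LINT x|lebesgue_on S. (f x)\<^sup>2)"

definition nth_deriv :: "nat \<Rightarrow> (real \<Rightarrow> complex) \<Rightarrow> real \<Rightarrow> complex" where
  "nth_deriv n f = ((\<lambda>g x. vector_derivative g (at x)) ^^ n) f"

definition schwartz :: "(real \<Rightarrow> complex) set" where
  "schwartz = {\<phi>. (\<forall>n x. nth_deriv n \<phi> differentiable (at x)) \<and>
                  (\<forall>k n. bounded (range (\<lambda>x. x ^ k *\<^sub>R nth_deriv n \<phi> x)))}"

text \<open>Normalised so that $-\Delta$ has multiplier $|\xi|^2$.\<close>

definition fourier :: "(real \<Rightarrow> complex) \<Rightarrow> real \<Rightarrow> complex" where
  "fourier \<phi> \<xi> = (LINT x|lborel. cis (- (x * \<xi>)) * \<phi> x)"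

definition inv_fourier :: "(real \<Rightarrow> complex) \<Rightarrow> real \<Rightarrow> complex" where
  "inv_fourier g x = (1 / (2 * pi)) *\<^sub>R (LINT \<xi>|lborel. cis (x * \<xi>) * g \<xi>)"

definition lap_quarter :: "(real \<Rightarrow> complex) \<Rightarrow> real \<Rightarrow> complex" where
  "lap_quarter \<phi> = inv_fourier (\<lambda>\<xi>. (\<bar>\<xi>\<bar> powr (1 / 2)) *\<^sub>R fourier \<phi> \<xi>)"

text \<open>Tempered distributions are represented by their pairing with (complex-valued) Schwartz
  functions; the pairing is bilinear, without conjugation.\<close>

definition dist_of_fun :: "(real \<Rightarrow> real) \<Rightarrow> (real \<Rightarrow> complex) \<Rightarrow> complex" where
  "dist_of_fun f \<phi> = (LINT x|lebesgue. f x *\<^sub>R \<phi> x)"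

definition lap_quarter_dist :: "(real \<Rightarrow> real) \<Rightarrow> (real \<Rightarrow> complex) \<Rightarrow> complex" where
  "lap_quarter_dist u \<phi> = (LINT x|lebesgue. u x *\<^sub>R lap_quarter \<phi> x)"

end

theory Submission
  imports Defs "HOL-Probability.Probability" "HOL-Complex_Analysis.Complex_Analysis" "HOL-Real_Asymp.Real_Asymp"
begin

text \<open>
  Put $f = -Vu$, so that $|f| \le |u|$. On Gaussians $(-\Delta)^{1/4}$ is, up to the constant
  \<open>frac_const\<close>, the singular integral $\int_0^\infty (2g(x)-g(x+t)-g(x-t))\,t^{-3/2}\,dt$, and applied
  to a Poisson kernel this integral is a combination of the real and the imaginary part of
  $w^{-3/2}$. Testing with Gaussians and averaging against Poisson kernels therefore turns the weak
  equation into a boundary relation for a holomorphic function (\<open>poisson_identity\<close>): if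
  $T u(z) = \int u(y)\,(y-z)^{-3/2}\,dy$ for $\mathrm{Im}\,z > 0$, then
  $\mathrm{Re}\,Tu - \mathrm{Im}\,Tu$ at $x + i\eta$ is $-\kappa$ times the Poisson average of $f$.
  The estimates that follow hold for all small $\eta$, up to remainders that vanish with $\eta$; the limit
  $\eta \to 0$ is taken only at the end.

  Move $x_0$ to the origin, scale by 2, and suppose that $|u| \le \epsilon$ on $(-2,2)$. With $u_R$ and
  $u_L$ the parts of $u$ on $[1,\infty)$ and $(-\infty,-1]$, consider $G = T u_R + i\,T u_L$. Near the
  right half-line $i\,T u_L$ is almost real, and near the left half-line $T u_R$ is, so the relation
  controls $\mathrm{Re}\,G - \mathrm{Im}\,G$ on the right and $\mathrm{Re}\,G + \mathrm{Im}\,G$ on the left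
  by $f$; in the gap $(-1,1)$ the relation bounds all of $G$ by a power of $\epsilon$ times a mild
  singularity at the end points (\<open>norm_outer_middle\<close>). Let $s = \sqrt{z^2-1}$ and $\zeta = z + s$. The integral of
  $G^2 s\,\zeta^{-2m}$ along the line vanishes by Cauchy's theorem, and the weight is real outside the
  gap with opposite signs on the two sides. As $|G|^2$ is the square of the controlled combination plus
  or minus $\mathrm{Im}\,G^2$, the imaginary part of this identity bounds $\int |G|^2\,|s|\,|\zeta|^{-2m}$
  outside the gap by the source $f$ and a power of $\epsilon$, with constants in front of
  either that do not grow with $m$ (\<open>mass_bound\<close>).

  The function $u_R$ is recovered from $T u_R$ by half-integration, that is by integrating against
  $(x-t)^{-1/2}$ (\<open>half_integral_jtrans\<close>). Between the weighted spaces this operator has squared norm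
  $O(1/m)$, because the weight decays fast at scale $x/m$ (\<open>schur_bound\<close>). Together this is the
  Carleman inequality \<open>carleman\<close>:
  $$\int_{x \ge 2} u^2 \zeta^{-2m} \le \frac{C}{m}\Big(\int_{|y| \ge 2} f^2\,|y|\,\zeta(|y|)^{-2m}
     + K^2 \epsilon^{1/4}\Big).$$
  Because of the factor $|y|$ the source can be absorbed only for $|y| \le X$ with $X$ a small
  multiple of $m$, so $m$ is chosen proportional to $X = 4R+4$; beyond $X$ it is negligible since
  $\zeta(y) \ge 3y/2$. The unit mass of $u$ near the original origin sits where
  $\zeta \le X$, so the left side is at least $X^{-2m}$. Hence $X^{-2m}$ is at most a constant times
  $\epsilon^{1/4}$, which is $\epsilon \ge \exp(-CR\log R)$.\<close>

section \<open>Integrals on the real line\<close>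

lemma nn_integral_powr_tail:
  fixes d p :: real
  assumes "d > 0" "p > 1"
  shows "(\<integral>\<^sup>+x. ennreal (x powr - p) * indicator {d..} x \<partial>lborel) = ennreal (d powr (1 - p) / (p - 1))"
proof -
  have "((\<lambda>x. x powr - p) has_integral - (d powr (- p + 1)) / (- p + 1)) {d..}"
    using assms by (intro has_integral_powr_to_inf) auto
  moreover have "- (d powr (- p + 1)) / (- p + 1) = d powr (1 - p) / (p - 1)"
    using assms by (simp add: field_simps)
  ultimately have "((\<lambda>x. x powr - p) has_integral d powr (1 - p) / (p - 1)) {d..}" by simp
  then have "((\<lambda>x. indicator {d..} x * x powr - p) has_integral d powr (1 - p) / (p - 1)) UNIV"
    by (subst (asm) has_integral_restrict_UNIV[symmetric]) (simp add: indicator_def of_bool_def if_distrib[of "\<lambda>z. z * _"] cong: if_cong)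
  then have "(\<integral>\<^sup>+x. ennreal (indicator {d..} x * x powr - p) \<partial>lborel) = ennreal (d powr (1 - p) / (p - 1))"
    by (intro nn_integral_has_integral_lborel) auto
  moreover have "ennreal (indicator {d..} x * x powr - p) = ennreal (x powr - p) * indicator {d..} x" for x :: real
    by (auto split: split_indicator)
  ultimately show ?thesis by simp
qed

lemma nn_integral_powr_head:
  fixes c a :: real
  assumes "c \<ge> 0" "a > -1"
  shows "(\<integral>\<^sup>+x. ennreal (x powr a) * indicator {0..c} x \<partial>lborel) = ennreal (c powr (a + 1) / (a + 1))"
proof -
  have "((\<lambda>x. x powr a) has_integral c powr (a + 1) / (a + 1)) {0..c}"
    using has_integral_powr_from_0[OF assms(2,1)] by simp
  then have "((\<lambda>x. indicator {0..c} x * x powr a) has_integral c powr (a + 1) / (a + 1)) UNIV"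
    by (subst (asm) has_integral_restrict_UNIV[symmetric]) (simp add: indicator_def of_bool_def if_distrib[of "\<lambda>z. z * _"] cong: if_cong)
  then have "(\<integral>\<^sup>+x. ennreal (indicator {0..c} x * x powr a) \<partial>lborel) = ennreal (c powr (a + 1) / (a + 1))"
    by (intro nn_integral_has_integral_lborel) auto
  moreover have "ennreal (indicator {0..c} x * x powr a) = ennreal (x powr a) * indicator {0..c} x" for x :: real
    by (auto split: split_indicator)
  ultimately show ?thesis by simp
qed

lemma norm_integral_le_of_nn_integral:
  fixes f :: "'a \<Rightarrow> 'b :: {banach, second_countable_topology}"
  assumes "(\<integral>\<^sup>+x. norm (f x) \<partial>M) \<le> ennreal B" "B \<ge> 0"
  shows "norm (integral\<^sup>L M f) \<le> B"
proof (cases "integrable M f")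
  case True
  then have "ennreal (norm (integral\<^sup>L M f)) \<le> (\<integral>\<^sup>+x. norm (f x) \<partial>M)"
    by (rule integral_norm_bound_ennreal)
  then have "ennreal (norm (integral\<^sup>L M f)) \<le> ennreal B"
    using assms by (meson order_trans)
  then show ?thesis using assms(2) by (simp add: ennreal_le_iff)
qed (use assms in \<open>simp add: not_integrable_integral_eq\<close>)

lemma integrable_of_nn_integral_le:
  fixes f :: "'a \<Rightarrow> 'b :: {banach, second_countable_topology}"
  assumes "f \<in> borel_measurable M" "(\<integral>\<^sup>+x. norm (f x) \<partial>M) \<le> ennreal B"
  shows "integrable M f"
  using assms by (intro integrableI_bounded) (auto simp: order.strict_trans1)

lemma nn_integral_Cauchy_density:
  assumes "\<eta> > (0::real)"
  shows "(\<integral>\<^sup>+x. ennreal (\<eta> / (pi * (x\<^sup>2 + \<eta>\<^sup>2))) \<partial>lborel) = 1"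
proof -
  have H: "(\<integral>\<^sup>+x. ennreal (\<eta> / (pi * (x\<^sup>2 + \<eta>\<^sup>2))) * indicator {0..} x \<partial>lborel) = ennreal (1/2 - arctan (0/\<eta>) / pi)"
  proof (rule nn_integral_FTC_atLeast)
    fix x :: real
    have "x\<^sup>2 + \<eta>\<^sup>2 > 0" using assms by (simp add: sum_power2_gt_zero_iff)
    then show "((\<lambda>x. arctan (x / \<eta>) / pi) has_real_derivative \<eta> / (pi * (x\<^sup>2 + \<eta>\<^sup>2))) (at x)"
      using assms
      by (auto intro!: derivative_eq_intros simp: divide_simps add_nonneg_eq_0_iff)
         (simp add: power2_eq_square algebra_simps)
    show "0 \<le> \<eta> / (pi * (x\<^sup>2 + \<eta>\<^sup>2))" using assms by simp
  next
    have "((\<lambda>x. arctan (x / \<eta>) / pi) \<longlongrightarrow> (pi/2) / pi) at_top"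
      using assms by (intro tendsto_divide filterlim_compose[OF tendsto_arctan_at_top] tendsto_const)
        (auto simp: filterlim_at_top_iff_inverse_0 divide_inverse intro!: filterlim_at_top_mult_tendsto_pos[OF _ _ filterlim_ident] tendsto_intros)
    then show "((\<lambda>x. arctan (x / \<eta>) / pi) \<longlongrightarrow> 1/2) at_top" by simp
  qed auto
  have E: "(\<integral>\<^sup>+x. ennreal (\<eta> / (pi * (x\<^sup>2 + \<eta>\<^sup>2))) * indicator {..0} x \<partial>lborel) =
     (\<integral>\<^sup>+x. ennreal (\<eta> / (pi * (x\<^sup>2 + \<eta>\<^sup>2))) * indicator {0..} x \<partial>lborel)"
    by (subst nn_integral_real_affine[where c="-1" and t=0]) (auto intro!: nn_integral_cong split: split_indicator)
  have "(\<integral>\<^sup>+x. ennreal (\<eta> / (pi * (x\<^sup>2 + \<eta>\<^sup>2))) \<partial>lborel)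
      = (\<integral>\<^sup>+x. ennreal (\<eta> / (pi * (x\<^sup>2 + \<eta>\<^sup>2))) * indicator {0..} x + ennreal (\<eta> / (pi * (x\<^sup>2 + \<eta>\<^sup>2))) * indicator {..0} x \<partial>lborel)"
    using AE_lborel_singleton[of "0::real"] by (intro nn_integral_cong_AE) (auto split: split_indicator)
  also have "\<dots> = ennreal (1/2) + ennreal (1/2)"
    using H E by (subst nn_integral_add) auto
  also have "\<dots> = ennreal (1/2 + 1/2)" by (subst ennreal_plus) auto
  finally show ?thesis by simp
qed

lemma nn_integral_inverse_1_plus_square:
  "(\<integral>\<^sup>+(x::real). ennreal (1 / (1 + x\<^sup>2)) \<partial>lborel) = ennreal pi"
proof -
  have "(\<integral>\<^sup>+(x::real). ennreal (1 / (1 + x\<^sup>2)) \<partial>lborel) = (\<integral>\<^sup>+x. ennreal pi * ennreal (1 / (pi * (x\<^sup>2 + 1\<^sup>2))) \<partial>lborel)"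
    by (intro nn_integral_cong) (simp add: ennreal_mult[symmetric] add.commute)
  then show ?thesis using nn_integral_Cauchy_density[of 1] by (simp add: nn_integral_cmult)
qed

lemma nn_integral_cmult_inverse_1_plus_square:
  assumes "C \<ge> 0"
  shows "(\<integral>\<^sup>+(x::real). ennreal (C / (1 + x\<^sup>2)) \<partial>lborel) = ennreal (pi * C)"
proof -
  have "(\<integral>\<^sup>+(x::real). ennreal (C / (1 + x\<^sup>2)) \<partial>lborel) = (\<integral>\<^sup>+(x::real). ennreal C * ennreal (1 / (1 + x\<^sup>2)) \<partial>lborel)"
    using assms by (intro nn_integral_cong) (simp add: ennreal_mult[symmetric])
  then show ?thesis
    using assms nn_integral_inverse_1_plus_square by (simp add: nn_integral_cmult ennreal_mult mult.commute)
qed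

section \<open>Singular integrals and convolutions\<close>

text \<open>The fractional Laplacian of order $1/2$ as a singular integral, without its normalising constant;
  the constant is \<open>frac_const\<close> below.\<close>

definition frac_lap :: "(real \<Rightarrow> real) \<Rightarrow> real \<Rightarrow> real" where
  "frac_lap g x = (LINT t|lborel. indicator {0<..} t * ((2 * g x - g (x + t) - g (x - t)) * t powr (-3/2)))"

text \<open>Correlation rather than convolution, so that the kernel centred at $x$ is $y \mapsto \phi(y-x)$; for
  even $\phi$ the two agree.\<close>

definition corr :: "(real \<Rightarrow> real) \<Rightarrow> (real \<Rightarrow> real) \<Rightarrow> real \<Rightarrow> real" where
  "corr \<phi> g x = (LINT y|lborel. g y * \<phi> (y - x))"

lemma nn_integral_min_powr:
  "(\<integral>\<^sup>+t. ennreal (indicator {0<..} t * (min 1 t * t powr (-3/2))) \<partial>lborel) \<le> ennreal 4"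
proof -
  have "ennreal (indicator {0<..} t * (min 1 t * t powr (-3/2))) \<le>
     ennreal (t powr (-1/2)) * indicator {0..1} t + ennreal (t powr - (3/2)) * indicator {1..} t" for t :: real
  proof (cases "0 < t \<and> t \<le> 1")
    case True
    then have "t * t powr (-3/2) = t powr (-1/2)"
      by (simp add: powr_mult_base)
    then show ?thesis using True by (auto split: split_indicator simp: min_def)
  qed (auto split: split_indicator simp: min_def)
  then have "(\<integral>\<^sup>+t. ennreal (indicator {0<..} t * (min 1 t * t powr (-3/2))) \<partial>lborel) \<le>
    (\<integral>\<^sup>+t. ennreal (t powr (-1/2)) * indicator {0..1} t + ennreal (t powr - (3/2)) * indicator {1..} t \<partial>lborel)"
    by (intro nn_integral_mono) auto
  also have "\<dots> = ennreal (1 / (1/2)) + ennreal (1 / (1/2))"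
    using nn_integral_powr_tail[of 1 "3/2"] nn_integral_powr_head[of 1 "-1/2"]
    by (subst nn_integral_add) auto
  also have "\<dots> = ennreal 4" by (simp add: ennreal_plus[symmetric] del: ennreal_plus)
  finally show ?thesis .
qed

lemma integrable_min_powr:
  "integrable lborel (\<lambda>t::real. indicator {0<..} t * (min 1 t * t powr (-3/2)))"
proof (rule integrable_of_nn_integral_le[where B=4])
  have "norm (indicator {0<..} t * (min 1 t * t powr (-3/2))) = indicator {0<..} t * (min 1 t * t powr (-3/2))" for t :: real
    by (auto split: split_indicator)
  then show "(\<integral>\<^sup>+t. ennreal (norm (indicator {0<..} t * (min 1 t * t powr (-3/2)) :: real)) \<partial>lborel) \<le> ennreal 4"
    using nn_integral_min_powr by simp
qed simp

text \<open>The class contains Gaussians and Poisson kernels. The Lipschitz bound with the same quadratic decay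
  is what makes second differences of $\phi$ integrable against $t^{-3/2}$ uniformly in $y$.\<close>

definition nice_kernel :: "real \<Rightarrow> (real \<Rightarrow> real) \<Rightarrow> bool" where
  "nice_kernel C \<phi> \<longleftrightarrow> \<phi> \<in> borel_measurable borel \<and> (\<forall>x. \<bar>\<phi> x\<bar> \<le> C / (1 + x\<^sup>2)) \<and>
     (\<forall>x t. \<bar>t\<bar> \<le> 1 \<longrightarrow> \<bar>\<phi> (x + t) - \<phi> x\<bar> \<le> C * \<bar>t\<bar> / (1 + x\<^sup>2))"

lemma nice_kernelI:
  assumes d: "\<And>x. (\<phi> has_real_derivative \<phi>' x) (at x)"
    and b: "\<And>x. \<bar>\<phi> x\<bar> \<le> C / (1 + x\<^sup>2)" and b': "\<And>x. \<bar>\<phi>' x\<bar> \<le> C / (1 + x\<^sup>2)"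
  shows "nice_kernel (3 * C) \<phi>"
proof -
  have "C \<ge> 0" using b[of 0] by (simp add: abs_le_iff)
  have "continuous_on UNIV \<phi>" using d by (meson DERIV_isCont continuous_at_imp_continuous_on)
  then have m: "\<phi> \<in> borel_measurable borel" by (rule borel_measurable_continuous_onI)
  have "\<bar>\<phi> x\<bar> \<le> 3 * C / (1 + x\<^sup>2)" for x
    using b[of x] \<open>C \<ge> 0\<close> by (smt (verit, ccfv_SIG) divide_right_mono zero_le_power2)
  moreover have "\<bar>\<phi> (x + t) - \<phi> x\<bar> \<le> 3 * C * \<bar>t\<bar> / (1 + x\<^sup>2)" if "\<bar>t\<bar> \<le> 1" for x t
  proof -
    have "\<bar>\<phi>' \<xi>\<bar> \<le> 3 * C / (1 + x\<^sup>2)" if "\<xi> \<in> {min x (x+t)..max x (x+t)}" for \<xi>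
    proof -
      have "\<bar>x - \<xi>\<bar> \<le> 1" using that \<open>\<bar>t\<bar> \<le> 1\<close> by (auto simp: abs_if min_def max_def split: if_splits)
      then have "(x - \<xi>)\<^sup>2 \<le> 1" using abs_square_le_1 by blast
      moreover have "x\<^sup>2 \<le> 2 * \<xi>\<^sup>2 + 2 * (x - \<xi>)\<^sup>2"
        using zero_le_power2[of "x - 2 * \<xi>"] by (simp add: power2_eq_square algebra_simps)
      ultimately have "1 + x\<^sup>2 \<le> 3 * (1 + \<xi>\<^sup>2)" by (smt (verit, ccfv_threshold) zero_le_power2)
      then have "C / (1 + \<xi>\<^sup>2) \<le> C / ((1 + x\<^sup>2) / 3)"
        using \<open>C \<ge> 0\<close> by (intro divide_left_mono mult_pos_pos) (auto simp: add_pos_nonneg)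
      then show ?thesis using b'[of \<xi>] by (simp add: mult.commute)
    qed
    then have "norm (\<phi> (x + t) - \<phi> x) \<le> 3 * C / (1 + x\<^sup>2) * norm ((x + t) - x)"
      using d by (intro field_differentiable_bound[of "{min x (x+t)..max x (x+t)}" \<phi> \<phi>'])
        (auto intro: has_field_derivative_at_within)
    then show ?thesis by (simp add: mult.commute)
  qed
  ultimately show ?thesis using m by (simp add: nice_kernel_def)
qed

lemma nice_kernel_const_nonneg: "nice_kernel C \<phi> \<Longrightarrow> C \<ge> 0"
proof -
  assume "nice_kernel C \<phi>"
  then have "\<bar>\<phi> 0\<bar> \<le> C / (1 + 0\<^sup>2)" unfolding nice_kernel_def by blast
  then show "C \<ge> 0" by simp
qed

lemma nice_kernel_nn_integral:
  assumes "nice_kernel C \<phi>"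
  shows "(\<integral>\<^sup>+y. ennreal \<bar>\<phi> (y - a)\<bar> \<partial>lborel) \<le> ennreal (pi * C)"
proof -
  have "C \<ge> 0" using assms by (rule nice_kernel_const_nonneg)
  have [measurable]: "\<phi> \<in> borel_measurable borel" using assms by (simp add: nice_kernel_def)
  have "(\<integral>\<^sup>+y. ennreal \<bar>\<phi> (y - a)\<bar> \<partial>lborel) = (\<integral>\<^sup>+y. ennreal \<bar>\<phi> y\<bar> \<partial>lborel)"
    by (subst nn_integral_real_affine[where c=1 and t=a]) auto
  also have "\<dots> \<le> (\<integral>\<^sup>+y. ennreal (C / (1 + y\<^sup>2)) \<partial>lborel)"
    using assms \<open>C \<ge> 0\<close> by (intro nn_integral_mono) (auto simp: nice_kernel_def)
  also have "\<dots> = ennreal (pi * C)"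
    using \<open>C \<ge> 0\<close> by (simp add: nn_integral_cmult_inverse_1_plus_square)
  finally show ?thesis .
qed

lemma nice_kernel_nn_integral_diff:
  assumes "nice_kernel C \<phi>" "\<bar>t\<bar> \<le> 1"
  shows "(\<integral>\<^sup>+y. ennreal \<bar>\<phi> (y + t - a) - \<phi> (y - a)\<bar> \<partial>lborel) \<le> ennreal (pi * C * \<bar>t\<bar>)"
proof -
  have "C \<ge> 0" using assms nice_kernel_const_nonneg by blast
  have [measurable]: "\<phi> \<in> borel_measurable borel" using assms by (simp add: nice_kernel_def)
  have "(\<integral>\<^sup>+y. ennreal \<bar>\<phi> (y + t - a) - \<phi> (y - a)\<bar> \<partial>lborel) = (\<integral>\<^sup>+y. ennreal \<bar>\<phi> (y + t) - \<phi> y\<bar> \<partial>lborel)"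
    by (subst nn_integral_real_affine[where c=1 and t=a]) (auto simp: algebra_simps)
  also have "\<dots> \<le> (\<integral>\<^sup>+y. ennreal (C * \<bar>t\<bar> / (1 + y\<^sup>2)) \<partial>lborel)"
    using assms \<open>C \<ge> 0\<close> by (intro nn_integral_mono) (auto simp: nice_kernel_def)
  also have "\<dots> = ennreal (pi * C * \<bar>t\<bar>)"
    using \<open>C \<ge> 0\<close> by (simp add: nn_integral_cmult_inverse_1_plus_square mult_ac)
  finally show ?thesis .
qed

lemma nice_kernel_nn_integral_second_diff:
  assumes "nice_kernel C \<phi>" "t > 0"
  shows "(\<integral>\<^sup>+y. ennreal \<bar>2 * \<phi> (y - a) - \<phi> (y - a + t) - \<phi> (y - a - t)\<bar> \<partial>lborel) \<le> ennreal (4 * pi * C * min 1 t)"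
proof -
  have "C \<ge> 0" using assms nice_kernel_const_nonneg by blast
  have [measurable]: "\<phi> \<in> borel_measurable borel" using assms by (simp add: nice_kernel_def)
  show ?thesis
  proof (cases "t \<le> 1")
    case True
    have "(\<integral>\<^sup>+y. ennreal \<bar>2 * \<phi> (y - a) - \<phi> (y - a + t) - \<phi> (y - a - t)\<bar> \<partial>lborel) \<le>
       (\<integral>\<^sup>+y. ennreal \<bar>\<phi> (y + t - a) - \<phi> (y - a)\<bar> + ennreal \<bar>\<phi> (y + (-t) - a) - \<phi> (y - a)\<bar> \<partial>lborel)"
      by (intro nn_integral_mono) (auto simp: ennreal_plus[symmetric] algebra_simps simp del: ennreal_plus)
    also have "\<dots> \<le> ennreal (pi * C * \<bar>t\<bar>) + ennreal (pi * C * \<bar>-t\<bar>)"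
      using True assms by (subst nn_integral_add) (simp, simp, intro add_mono nice_kernel_nn_integral_diff, auto)
    also have "\<dots> \<le> ennreal (4 * pi * C * min 1 t)"
      using True assms \<open>C \<ge> 0\<close> by (auto simp: ennreal_plus[symmetric] simp del: ennreal_plus)
    finally show ?thesis .
  next
    case False
    let ?I = "\<lambda>b. \<integral>\<^sup>+y. ennreal \<bar>\<phi> (y - b)\<bar> \<partial>lborel"
    have "ennreal \<bar>2 * \<phi> (y - a) - \<phi> (y - a + t) - \<phi> (y - a - t)\<bar> \<le>
       (ennreal \<bar>\<phi> (y - a)\<bar> + ennreal \<bar>\<phi> (y - a)\<bar>) + (ennreal \<bar>\<phi> (y - (a - t))\<bar> + ennreal \<bar>\<phi> (y - (a + t))\<bar>)" for y
      by (auto simp: ennreal_plus[symmetric] algebra_simps simp del: ennreal_plus intro!: ennreal_leI)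
    then have "(\<integral>\<^sup>+y. ennreal \<bar>2 * \<phi> (y - a) - \<phi> (y - a + t) - \<phi> (y - a - t)\<bar> \<partial>lborel) \<le>
       (\<integral>\<^sup>+y. (ennreal \<bar>\<phi> (y - a)\<bar> + ennreal \<bar>\<phi> (y - a)\<bar>) + (ennreal \<bar>\<phi> (y - (a - t))\<bar> + ennreal \<bar>\<phi> (y - (a + t))\<bar>) \<partial>lborel)"
      by (rule nn_integral_mono)
    also have "\<dots> = (?I a + ?I a) + (?I (a - t) + ?I (a + t))"
      by (simp add: nn_integral_add)
    also have "\<dots> \<le> (ennreal (pi * C) + ennreal (pi * C)) + (ennreal (pi * C) + ennreal (pi * C))"
      using assms by (intro add_mono nice_kernel_nn_integral)
    also have "\<dots> = ennreal (4 * pi * C * min 1 t)"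
      using False \<open>C \<ge> 0\<close> by (simp add: ennreal_plus[symmetric] del: ennreal_plus)
    finally show ?thesis .
  qed
qed

lemma integrable_bounded_mult_kernel:
  assumes "nice_kernel C \<phi>" and [measurable]: "g \<in> borel_measurable borel" and g: "\<And>y. \<bar>g y\<bar> \<le> K"
  shows "integrable lborel (\<lambda>y. g y * \<phi> (y - a))"
proof (rule integrable_of_nn_integral_le)
  have [measurable]: "\<phi> \<in> borel_measurable borel" using assms by (simp add: nice_kernel_def)
  show "(\<lambda>y. g y * \<phi> (y - a)) \<in> borel_measurable lborel" by measurable
  have "K \<ge> 0" using g[of 0] by (meson abs_ge_zero order_trans)
  have "(\<integral>\<^sup>+y. ennreal (norm (g y * \<phi> (y - a))) \<partial>lborel) \<le> (\<integral>\<^sup>+y. ennreal K * ennreal \<bar>\<phi> (y - a)\<bar> \<partial>lborel)"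
    using g \<open>K \<ge> 0\<close> by (intro nn_integral_mono) (auto simp: ennreal_mult[symmetric] abs_mult intro!: mult_right_mono ennreal_leI)
  also have "\<dots> \<le> ennreal K * ennreal (pi * C)"
    using assms by (subst nn_integral_cmult) (auto intro!: mult_left_mono nice_kernel_nn_integral)
  also have "\<dots> = ennreal (K * (pi * C))" using \<open>K \<ge> 0\<close> by (simp add: ennreal_mult')
  finally show "(\<integral>\<^sup>+y. ennreal (norm (g y * \<phi> (y - a))) \<partial>lborel) \<le> ennreal (K * (pi * C))" .
qed

lemma corr_bounded_lipschitz:
  assumes "nice_kernel C \<phi>" and [measurable]: "g \<in> borel_measurable borel" and g: "\<And>y. \<bar>g y\<bar> \<le> K"
  shows "\<bar>corr \<phi> g x\<bar> \<le> pi * C * K" and "\<bar>t\<bar> \<le> 1 \<Longrightarrow> \<bar>corr \<phi> g (x + t) - corr \<phi> g x\<bar> \<le> pi * C * K * \<bar>t\<bar>"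
    and "corr \<phi> g \<in> borel_measurable borel"
proof -
  have [measurable]: "\<phi> \<in> borel_measurable borel" using assms by (simp add: nice_kernel_def)
  have "K \<ge> 0" using g[of 0] by (meson abs_ge_zero order_trans)
  have "C \<ge> 0" using assms nice_kernel_const_nonneg by blast
  have "(\<integral>\<^sup>+y. ennreal (norm (g y * \<phi> (y - x))) \<partial>lborel) \<le> (\<integral>\<^sup>+y. ennreal K * ennreal \<bar>\<phi> (y - x)\<bar> \<partial>lborel)"
    using g \<open>K \<ge> 0\<close> by (intro nn_integral_mono) (auto simp: ennreal_mult[symmetric] abs_mult intro!: mult_right_mono ennreal_leI)
  also have "\<dots> \<le> ennreal K * ennreal (pi * C)"
    using assms by (subst nn_integral_cmult) (auto intro!: mult_left_mono nice_kernel_nn_integral)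
  also have "\<dots> = ennreal (pi * C * K)" using \<open>K \<ge> 0\<close> by (simp add: ennreal_mult'[symmetric] mult_ac)
  finally have "norm (LINT y|lborel. g y * \<phi> (y - x)) \<le> pi * C * K"
    using \<open>K \<ge> 0\<close> \<open>C \<ge> 0\<close> by (intro norm_integral_le_of_nn_integral) auto
  then show "\<bar>corr \<phi> g x\<bar> \<le> pi * C * K" by (simp add: corr_def)
  show "corr \<phi> g \<in> borel_measurable borel" unfolding corr_def by measurable
  assume t: "\<bar>t\<bar> \<le> 1"
  have "corr \<phi> g (x + t) - corr \<phi> g x = (LINT y|lborel. g y * \<phi> (y - (x + t)) - g y * \<phi> (y - x))"
    unfolding corr_def using assms by (intro Bochner_Integration.integral_diff[symmetric] integrable_bounded_mult_kernel) auto
  moreover have "norm (LINT y|lborel. g y * \<phi> (y - (x + t)) - g y * \<phi> (y - x)) \<le> pi * C * K * \<bar>t\<bar>"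
  proof (rule norm_integral_le_of_nn_integral)
    have "\<bar>g y * \<phi> (y - (x + t)) - g y * \<phi> (y - x)\<bar> \<le> K * \<bar>\<phi> (y + (-t) - x) - \<phi> (y - x)\<bar>" for y
    proof -
      have "g y * \<phi> (y - (x + t)) - g y * \<phi> (y - x) = g y * (\<phi> (y + (-t) - x) - \<phi> (y - x))"
        by (simp add: right_diff_distrib algebra_simps)
      then show ?thesis using g[of y] by (simp add: abs_mult mult_right_mono)
    qed
    then have "(\<integral>\<^sup>+y. ennreal (norm (g y * \<phi> (y - (x + t)) - g y * \<phi> (y - x))) \<partial>lborel) \<le> (\<integral>\<^sup>+y. ennreal K * ennreal \<bar>\<phi> (y + (-t) - x) - \<phi> (y - x)\<bar> \<partial>lborel)"
      using \<open>K \<ge> 0\<close> by (intro nn_integral_mono) (auto simp: ennreal_mult[symmetric] intro!: ennreal_leI)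
    also have "\<dots> \<le> ennreal K * ennreal (pi * C * \<bar>-t\<bar>)"
      using nice_kernel_nn_integral_diff[OF assms(1), of "-t" x] t by (subst nn_integral_cmult) (auto intro!: mult_left_mono)
    also have "\<dots> = ennreal (pi * C * K * \<bar>t\<bar>)" using \<open>K \<ge> 0\<close> by (simp add: ennreal_mult'[symmetric] mult_ac)
    finally show "(\<integral>\<^sup>+y. ennreal (norm (g y * \<phi> (y - (x + t)) - g y * \<phi> (y - x))) \<partial>lborel) \<le> ennreal (pi * C * K * \<bar>t\<bar>)" .
  qed (use \<open>K \<ge> 0\<close> \<open>C \<ge> 0\<close> in auto)
  ultimately show "\<bar>corr \<phi> g (x + t) - corr \<phi> g x\<bar> \<le> pi * C * K * \<bar>t\<bar>" by simp
qed

lemma Fubini_lborel: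
  fixes F :: "real \<Rightarrow> real \<Rightarrow> 'b :: {banach, second_countable_topology}"
  assumes [measurable]: "case_prod F \<in> borel_measurable (lborel \<Otimes>\<^sub>M lborel)"
    and "(\<integral>\<^sup>+x. (\<integral>\<^sup>+y. ennreal (norm (F x y)) \<partial>lborel) \<partial>lborel) < \<infinity>"
  shows "(LINT x|lborel. LINT y|lborel. F x y) = (LINT y|lborel. LINT x|lborel. F x y)"
proof -
  have "integrable (lborel \<Otimes>\<^sub>M lborel) (case_prod F)"
  proof (rule integrableI_bounded)
    have "(\<integral>\<^sup>+p. ennreal (norm (case_prod F p)) \<partial>(lborel \<Otimes>\<^sub>M lborel)) = (\<integral>\<^sup>+x. (\<integral>\<^sup>+y. ennreal (norm (F x y)) \<partial>lborel) \<partial>lborel)"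
      by (subst lborel.nn_integral_fst[symmetric]) auto
    then show "(\<integral>\<^sup>+p. ennreal (norm (case_prod F p)) \<partial>(lborel \<Otimes>\<^sub>M lborel)) < \<infinity>" using assms(2) by simp
  qed fact
  then show ?thesis by (rule lborel_pair.Fubini_integral[symmetric])
qed

text \<open>Fubini: the second differences of a nice kernel have $L^1$ norm $O(\min(1,t))$, which is integrable
  against $t^{-3/2}$. Here the kernel carries the regularity and $g$ is merely bounded, whereas in
  \<open>corr_frac_eq_frac_corr\<close> the function $h$ carries it.\<close>

lemma frac_corr_eq_corr_frac:
  assumes nk: "nice_kernel C \<phi>" and [measurable]: "g \<in> borel_measurable borel" and g: "\<And>y. \<bar>g y\<bar> \<le> K"
  shows "corr (frac_lap \<phi>) g a = frac_lap (corr \<phi> g) a"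
proof -
  have [measurable]: "\<phi> \<in> borel_measurable borel" using nk by (simp add: nice_kernel_def)
  have "K \<ge> 0" using g[of 0] by (meson abs_ge_zero order_trans)
  have "C \<ge> 0" using nk nice_kernel_const_nonneg by blast
  define D where "D = (\<lambda>y t. 2 * \<phi> (y - a) - \<phi> (y - a + t) - \<phi> (y - a - t))"
  define w where "w = (\<lambda>t::real. indicator {0<..} t * t powr (-3/2))"
  have [measurable]: "w \<in> borel_measurable borel" unfolding w_def by measurable
  have [measurable]: "case_prod D \<in> borel_measurable (borel \<Otimes>\<^sub>M borel)" unfolding D_def by measurable
  have w0: "w t \<ge> 0" for t by (simp add: w_def)
  have "corr (frac_lap \<phi>) g a = (LINT y|lborel. LINT t|lborel. g y * (D y t * w t))"
    unfolding corr_def frac_lap_def D_def w_def by (simp add: mult_ac)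
  also have "\<dots> = (LINT t|lborel. LINT y|lborel. g y * (D y t * w t))"
  proof (rule Fubini_lborel)
    show "(\<lambda>(y, t). g y * (D y t * w t)) \<in> borel_measurable (lborel \<Otimes>\<^sub>M lborel)" by measurable
    have "(\<integral>\<^sup>+y. (\<integral>\<^sup>+t. ennreal (norm (g y * (D y t * w t))) \<partial>lborel) \<partial>lborel)
        \<le> (\<integral>\<^sup>+y. (\<integral>\<^sup>+t. ennreal (K * w t) * ennreal \<bar>D y t\<bar> \<partial>lborel) \<partial>lborel)"
    proof (intro nn_integral_mono)
      fix y t
      have "norm (g y * (D y t * w t)) \<le> K * w t * \<bar>D y t\<bar>"
        using mult_right_mono[OF g[of y], of "\<bar>D y t\<bar> * w t"] w0[of t] by (simp add: abs_mult mult_ac)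
      then show "ennreal (norm (g y * (D y t * w t))) \<le> ennreal (K * w t) * ennreal \<bar>D y t\<bar>"
        using \<open>K \<ge> 0\<close> w0[of t] by (simp add: ennreal_mult[symmetric] ennreal_leI)
    qed
    also have "\<dots> = (\<integral>\<^sup>+t. (\<integral>\<^sup>+y. ennreal (K * w t) * ennreal \<bar>D y t\<bar> \<partial>lborel) \<partial>lborel)"
      by (rule lborel_pair.Fubini') measurable
    also have "\<dots> \<le> (\<integral>\<^sup>+t. ennreal (K * (4 * pi * C)) * ennreal (indicator {0<..} t * (min 1 t * t powr (-3/2))) \<partial>lborel)"
    proof (intro nn_integral_mono)
      fix t :: real
      show "(\<integral>\<^sup>+y. ennreal (K * w t) * ennreal \<bar>D y t\<bar> \<partial>lborel) \<le> ennreal (K * (4 * pi * C)) * ennreal (indicator {0<..} t * (min 1 t * t powr (-3/2)))"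
      proof (cases "t > 0")
        case True
        have "(\<integral>\<^sup>+y. ennreal (K * w t) * ennreal \<bar>D y t\<bar> \<partial>lborel) = ennreal (K * w t) * (\<integral>\<^sup>+y. ennreal \<bar>D y t\<bar> \<partial>lborel)"
          by (subst nn_integral_cmult) auto
        also have "\<dots> \<le> ennreal (K * w t) * ennreal (4 * pi * C * min 1 t)"
          unfolding D_def using nice_kernel_nn_integral_second_diff[OF nk True] by (intro mult_left_mono) auto
        also have "\<dots> = ennreal (K * w t * (4 * pi * C * min 1 t))"
          using \<open>K \<ge> 0\<close> \<open>C \<ge> 0\<close> True w0[of t] by (simp add: ennreal_mult)
        also have "\<dots> = ennreal (K * (4 * pi * C)) * ennreal (indicator {0<..} t * (min 1 t * t powr (-3/2)))"
          using \<open>K \<ge> 0\<close> \<open>C \<ge> 0\<close> True by (subst ennreal_mult[symmetric]) (auto simp: w_def mult_ac)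
        finally show ?thesis .
      qed (simp add: w_def)
    qed
    also have "\<dots> \<le> ennreal (K * (4 * pi * C)) * ennreal 4"
      by (subst nn_integral_cmult, measurable, intro mult_left_mono nn_integral_min_powr, simp)
    also have "\<dots> < \<infinity>" by (simp add: ennreal_mult_less_top)
    finally show "(\<integral>\<^sup>+y. (\<integral>\<^sup>+t. ennreal (norm (g y * (D y t * w t))) \<partial>lborel) \<partial>lborel) < \<infinity>" .
  qed
  also have "\<dots> = (LINT t|lborel. w t * (2 * corr \<phi> g a - corr \<phi> g (a + t) - corr \<phi> g (a - t)))"
  proof (intro Bochner_Integration.integral_cong refl)
    fix t
    have i: "integrable lborel (\<lambda>y. g y * \<phi> (y - b))" for b
      by (rule integrable_bounded_mult_kernel[OF nk _ g]) simp
    have "(LINT y|lborel. g y * (D y t * w t)) = (LINT y|lborel. w t * (2 * (g y * \<phi> (y - a)) - g y * \<phi> (y - (a - t)) - g y * \<phi> (y - (a + t))))"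
      unfolding D_def by (intro Bochner_Integration.integral_cong) (auto simp: algebra_simps)
    also have "\<dots> = w t * (2 * corr \<phi> g a - corr \<phi> g (a - t) - corr \<phi> g (a + t))"
      using i unfolding corr_def by (simp del: right_diff_distrib)
    finally show "(LINT y|lborel. g y * (D y t * w t)) = w t * (2 * corr \<phi> g a - corr \<phi> g (a + t) - corr \<phi> g (a - t))"
      by simp
  qed
  also have "\<dots> = frac_lap (corr \<phi> g) a"
    unfolding frac_lap_def w_def by (simp add: mult_ac)
  finally show ?thesis .
qed

lemma corr_frac_eq_frac_corr:
  assumes nk: "nice_kernel C \<phi>" and [measurable]: "h \<in> borel_measurable borel" and h: "\<And>y. \<bar>h y\<bar> \<le> L"
    and lip: "\<And>x t. \<bar>t\<bar> \<le> 1 \<Longrightarrow> \<bar>h (x + t) - h x\<bar> \<le> L * \<bar>t\<bar>"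
  shows "corr \<phi> (frac_lap h) a = frac_lap (corr \<phi> h) a"
proof -
  have [measurable]: "\<phi> \<in> borel_measurable borel" using nk by (simp add: nice_kernel_def)
  have "L \<ge> 0" using h[of 0] by (meson abs_ge_zero order_trans)
  have "C \<ge> 0" using nk nice_kernel_const_nonneg by blast
  define D where "D = (\<lambda>y t. 2 * h y - h (y + t) - h (y - t))"
  define w where "w = (\<lambda>t::real. indicator {0<..} t * t powr (-3/2))"
  have [measurable]: "w \<in> borel_measurable borel" unfolding w_def by measurable
  have [measurable]: "case_prod D \<in> borel_measurable (borel \<Otimes>\<^sub>M borel)" unfolding D_def by measurable
  have w0: "w t \<ge> 0" for t by (simp add: w_def)
  have Db: "\<bar>D y t\<bar> * w t \<le> 4 * L * (indicator {0<..} t * (min 1 t * t powr (-3/2)))" for y t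
  proof (cases "t > 0")
    case True
    have "\<bar>D y t\<bar> \<le> 4 * L * min 1 t"
    proof (cases "t \<le> 1")
      case le: True
      have "\<bar>h (y + t) - h y\<bar> \<le> L * t" "\<bar>h (y - t) - h y\<bar> \<le> L * t"
        using lip[of t y] lip[of "-t" y] le True by auto
      then have "\<bar>D y t\<bar> \<le> 2 * (L * t)" unfolding D_def by linarith
      also have "\<dots> \<le> 4 * L * min 1 t" using le True \<open>L \<ge> 0\<close> by (simp add: mult_ac)
      finally show ?thesis .
    next
      case False
      then show ?thesis using h[of y] h[of "y + t"] h[of "y - t"] unfolding D_def by simp
    qed
    then show ?thesis using True by (simp add: w_def mult_right_mono mult.assoc[symmetric])
  qed (simp add: w_def)
  have "corr \<phi> (frac_lap h) a = (LINT y|lborel. LINT t|lborel. \<phi> (y - a) * (D y t * w t))"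
  proof -
    have "frac_lap h y = (LINT t|lborel. D y t * w t)" for y
      by (simp add: frac_lap_def D_def w_def mult_ac)
    then show ?thesis by (simp add: corr_def mult.commute)
  qed
  also have "\<dots> = (LINT t|lborel. LINT y|lborel. \<phi> (y - a) * (D y t * w t))"
  proof (rule Fubini_lborel)
    show "(\<lambda>(y, t). \<phi> (y - a) * (D y t * w t)) \<in> borel_measurable (lborel \<Otimes>\<^sub>M lborel)" by measurable
    have "(\<integral>\<^sup>+y. (\<integral>\<^sup>+t. ennreal (norm (\<phi> (y - a) * (D y t * w t))) \<partial>lborel) \<partial>lborel)
        \<le> (\<integral>\<^sup>+y. (\<integral>\<^sup>+t. ennreal \<bar>\<phi> (y - a)\<bar> * (ennreal (4 * L) * ennreal (indicator {0<..} t * (min 1 t * t powr (-3/2)))) \<partial>lborel) \<partial>lborel)"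
    proof (intro nn_integral_mono)
      fix y t
      have "norm (\<phi> (y - a) * (D y t * w t)) \<le> \<bar>\<phi> (y - a)\<bar> * (4 * L * (indicator {0<..} t * (min 1 t * t powr (-3/2))))"
        using mult_left_mono[OF Db[of y t], of "\<bar>\<phi> (y - a)\<bar>"] w0[of t] by (simp add: abs_mult)
      moreover have "indicator {0<..} t * (min 1 t * t powr (-3/2)) \<ge> (0::real)" by (auto split: split_indicator)
      ultimately show "ennreal (norm (\<phi> (y - a) * (D y t * w t))) \<le> ennreal \<bar>\<phi> (y - a)\<bar> * (ennreal (4 * L) * ennreal (indicator {0<..} t * (min 1 t * t powr (-3/2))))"
        using \<open>L \<ge> 0\<close> by (subst ennreal_mult[symmetric], simp, simp, subst ennreal_mult[symmetric]) (auto intro!: ennreal_leI)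
    qed
    also have "\<dots> = (\<integral>\<^sup>+y. ennreal \<bar>\<phi> (y - a)\<bar> * (ennreal (4 * L) * (\<integral>\<^sup>+t. ennreal (indicator {0<..} t * (min 1 t * t powr (-3/2))) \<partial>lborel)) \<partial>lborel)"
      by (subst nn_integral_cmult, simp, subst nn_integral_cmult) auto
    also have "\<dots> \<le> (\<integral>\<^sup>+y. ennreal \<bar>\<phi> (y - a)\<bar> * (ennreal (4 * L) * ennreal 4) \<partial>lborel)"
      by (intro nn_integral_mono mult_left_mono nn_integral_min_powr) auto
    also have "\<dots> = (\<integral>\<^sup>+y. ennreal \<bar>\<phi> (y - a)\<bar> \<partial>lborel) * (ennreal (4 * L) * ennreal 4)"
      by (subst nn_integral_multc) auto
    also have "\<dots> \<le> ennreal (pi * C) * (ennreal (4 * L) * ennreal 4)"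
      by (intro mult_right_mono nice_kernel_nn_integral[OF nk]) auto
    also have "\<dots> < \<infinity>" by (simp add: ennreal_mult_less_top)
    finally show "(\<integral>\<^sup>+y. (\<integral>\<^sup>+t. ennreal (norm (\<phi> (y - a) * (D y t * w t))) \<partial>lborel) \<partial>lborel) < \<infinity>" .
  qed
  also have "\<dots> = (LINT t|lborel. w t * (2 * corr \<phi> h a - corr \<phi> h (a + t) - corr \<phi> h (a - t)))"
  proof (intro Bochner_Integration.integral_cong refl)
    fix t
    have i: "integrable lborel (\<lambda>y. h (y + b) * \<phi> (y - a))" for b
      by (rule integrable_bounded_mult_kernel[OF nk _ h]) simp
    have s: "(LINT y|lborel. h (y + b) * \<phi> (y - a)) = corr \<phi> h (a + b)" for b
      unfolding corr_def by (subst lborel_integral_real_affine[where c=1 and t="b"]) (auto simp: algebra_simps)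
    have "(LINT y|lborel. \<phi> (y - a) * (D y t * w t)) = (LINT y|lborel. w t * (2 * (h (y + 0) * \<phi> (y - a)) - h (y + t) * \<phi> (y - a) - h (y + (- t)) * \<phi> (y - a)))"
      unfolding D_def by (intro Bochner_Integration.integral_cong) (auto simp: algebra_simps)
    also have "\<dots> = w t * (2 * corr \<phi> h (a + 0) - corr \<phi> h (a + t) - corr \<phi> h (a + (- t)))"
      unfolding s[symmetric] using i[of 0] i[of t] i[of "-t"] by (simp del: right_diff_distrib)
    finally show "(LINT y|lborel. \<phi> (y - a) * (D y t * w t)) = w t * (2 * corr \<phi> h a - corr \<phi> h (a + t) - corr \<phi> h (a - t))"
      by simp
  qed
  also have "\<dots> = frac_lap (corr \<phi> h) a"
    unfolding frac_lap_def w_def by (simp add: mult_ac)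
  finally show ?thesis .
qed

lemma corr_commute:
  assumes n1: "nice_kernel C \<phi>" and n2: "nice_kernel C' \<psi>" and [measurable]: "g \<in> borel_measurable borel"
    and g: "\<And>y. \<bar>g y\<bar> \<le> K" and e1: "\<And>x. \<phi> (- x) = \<phi> x" and e2: "\<And>x. \<psi> (- x) = \<psi> x"
  shows "corr \<phi> (corr \<psi> g) a = corr \<psi> (corr \<phi> g) a"
proof -
  have [measurable]: "\<phi> \<in> borel_measurable borel" "\<psi> \<in> borel_measurable borel" using n1 n2 by (auto simp: nice_kernel_def)
  have "K \<ge> 0" using g[of 0] by (meson abs_ge_zero order_trans)
  have shift: "(LINT y|lborel. g' y * \<theta> (y - x)) = (LINT y|lborel. g' (y + x) * \<theta> y)" for g' \<theta> :: "real \<Rightarrow> real" and x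
    by (subst lborel_integral_real_affine[where c=1 and t="x"]) (auto simp: algebra_simps)
  have "corr \<phi> (corr \<psi> g) a = (LINT x|lborel. corr \<psi> g (x + a) * \<phi> x)"
    unfolding corr_def[of \<phi>] by (rule shift)
  also have "\<dots> = (LINT x|lborel. LINT y|lborel. g (y + (x + a)) * \<psi> y * \<phi> x)"
    unfolding corr_def shift by simp
  also have "\<dots> = (LINT y|lborel. LINT x|lborel. g (y + (x + a)) * \<psi> y * \<phi> x)"
  proof (rule Fubini_lborel)
    have "(\<integral>\<^sup>+x. (\<integral>\<^sup>+y. ennreal (norm (g (y + (x + a)) * \<psi> y * \<phi> x)) \<partial>lborel) \<partial>lborel)
      \<le> (\<integral>\<^sup>+x. (\<integral>\<^sup>+y. ennreal K * ennreal \<bar>\<phi> x\<bar> * ennreal \<bar>\<psi> y\<bar> \<partial>lborel) \<partial>lborel)"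
    proof (intro nn_integral_mono)
      fix x y
      have "norm (g (y + (x + a)) * \<psi> y * \<phi> x) \<le> K * \<bar>\<phi> x\<bar> * \<bar>\<psi> y\<bar>"
        using mult_right_mono[OF g[of "y + (x + a)"], of "\<bar>\<phi> x\<bar> * \<bar>\<psi> y\<bar>"] by (simp add: abs_mult mult_ac)
      then show "ennreal (norm (g (y + (x + a)) * \<psi> y * \<phi> x)) \<le> ennreal K * ennreal \<bar>\<phi> x\<bar> * ennreal \<bar>\<psi> y\<bar>"
        using \<open>K \<ge> 0\<close> by (simp add: ennreal_mult[symmetric] ennreal_leI)
    qed
    also have "\<dots> = (\<integral>\<^sup>+x. ennreal K * ennreal \<bar>\<phi> x\<bar> * (\<integral>\<^sup>+y. ennreal \<bar>\<psi> y\<bar> \<partial>lborel) \<partial>lborel)"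
      by (subst nn_integral_cmult) auto
    also have "\<dots> = ennreal K * (\<integral>\<^sup>+x. ennreal \<bar>\<phi> x\<bar> \<partial>lborel) * (\<integral>\<^sup>+y. ennreal \<bar>\<psi> y\<bar> \<partial>lborel)"
      by (subst nn_integral_multc, simp, subst nn_integral_cmult) auto
    also have "\<dots> \<le> ennreal K * ennreal (pi * C) * ennreal (pi * C')"
      using nice_kernel_nn_integral[OF n1, of 0] nice_kernel_nn_integral[OF n2, of 0] by (intro mult_mono) auto
    also have "\<dots> < \<infinity>" by (simp add: ennreal_mult_less_top)
    finally show "(\<integral>\<^sup>+x. (\<integral>\<^sup>+y. ennreal (norm (g (y + (x + a)) * \<psi> y * \<phi> x)) \<partial>lborel) \<partial>lborel) < \<infinity>" .
  qed measurable
  also have "\<dots> = (LINT y|lborel. corr \<phi> g (y + a) * \<psi> y)"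
  proof (intro Bochner_Integration.integral_cong refl)
    fix y
    have "corr \<phi> g (y + a) * \<psi> y = (LINT x|lborel. g (x + (y + a)) * \<phi> x * \<psi> y)"
      unfolding corr_def shift by simp
    then show "(LINT x|lborel. g (y + (x + a)) * \<psi> y * \<phi> x) = corr \<phi> g (y + a) * \<psi> y"
      by (simp add: add.left_commute mult.assoc mult.commute[of "\<psi> y"])
  qed
  also have "\<dots> = corr \<psi> (corr \<phi> g) a"
    unfolding corr_def[of \<psi>] by (rule shift[symmetric])
  finally show ?thesis .
qed

text \<open>Dominated convergence: a common Lipschitz bound makes $\min(1,t)\,t^{-3/2}$ a majorant.\<close>

lemma frac_tendsto:
  assumes [measurable]: "\<And>n. h n \<in> borel_measurable borel" "g \<in> borel_measurable borel"
    and lim: "\<And>x. (\<lambda>n. h n x) \<longlonglongrightarrow> g x"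
    and b: "\<And>n y. \<bar>h n y\<bar> \<le> L" and lip: "\<And>n x t. \<bar>t\<bar> \<le> 1 \<Longrightarrow> \<bar>h n (x + t) - h n x\<bar> \<le> L * \<bar>t\<bar>"
  shows "(\<lambda>n. frac_lap (h n) a) \<longlonglongrightarrow> frac_lap g a"
  unfolding frac_lap_def
proof (rule integral_dominated_convergence[where w="\<lambda>t. 4 * L * (indicator {0<..} t * (min 1 t * t powr (-3/2)))"])
  have "L \<ge> 0" using b[of 0 0] by (meson abs_ge_zero order_trans)
  show "integrable lborel (\<lambda>t. 4 * L * (indicator {0<..} t * (min 1 t * t powr (-3/2))))"
    by (intro integrable_mult_right integrable_min_powr)
  show "AE t in lborel. (\<lambda>n. indicator {0<..} t * ((2 * h n a - h n (a + t) - h n (a - t)) * t powr (-3/2))) \<longlonglongrightarrow> indicator {0<..} t * ((2 * g a - g (a + t) - g (a - t)) * t powr (-3/2))"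
    using lim by (intro AE_I2 tendsto_intros)
  have "norm (indicator {0<..} t * ((2 * h n a - h n (a + t) - h n (a - t)) * t powr (-3/2))) \<le> 4 * L * (indicator {0<..} t * (min 1 t * t powr (-3/2)))" for t :: real and n
  proof (cases "t > 0")
    case True
    have "\<bar>2 * h n a - h n (a + t) - h n (a - t)\<bar> \<le> 4 * L * min 1 t"
    proof (cases "t \<le> 1")
      case le: True
      have "\<bar>h n (a + t) - h n a\<bar> \<le> L * t" "\<bar>h n (a - t) - h n a\<bar> \<le> L * t"
        using lip[of t n a] lip[of "-t" n a] le True by auto
      then have "\<bar>2 * h n a - h n (a + t) - h n (a - t)\<bar> \<le> 2 * (L * t)" by linarith
      also have "\<dots> \<le> 4 * L * min 1 t" using le True \<open>L \<ge> 0\<close> by (simp add: mult_ac)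
      finally show ?thesis .
    next
      case False
      then show ?thesis using b[of n a] b[of n "a + t"] b[of n "a - t"] by simp
    qed
    then show ?thesis using True by (simp add: abs_mult mult_right_mono mult.assoc[symmetric])
  qed simp
  then show "\<And>n. AE t in lborel. norm (indicator {0<..} t * ((2 * h n a - h n (a + t) - h n (a - t)) * t powr (-3/2))) \<le> 4 * L * (indicator {0<..} t * (min 1 t * t powr (-3/2)))"
    by simp
qed measurable

section \<open>Gaussians as test functions\<close>

lemma gauss_moment_bounded:
  fixes \<sigma> :: real
  assumes "\<sigma> > 0"
  shows "\<exists>B. \<forall>y. \<bar>y ^ k * exp (- (y\<^sup>2 / (2 * \<sigma>\<^sup>2)))\<bar> \<le> B"
proof -
  define c where "c = 1 / (2 * \<sigma>\<^sup>2)"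
  have c: "c > 0" using assms by (simp add: c_def)
  have even: "y ^ (2 * k) * exp (- (c * y\<^sup>2)) \<le> fact k / c ^ k" for y
  proof -
    have "(c * y\<^sup>2) ^ k / fact k \<le> exp (c * y\<^sup>2)"
    proof -
      have "(\<Sum>i\<in>{k}. (c * y\<^sup>2) ^ i / fact i) \<le> (\<Sum>i. (c * y\<^sup>2) ^ i / fact i)"
        using c summable_exp[of "c * y\<^sup>2"] by (intro sum_le_suminf) (auto simp: divide_inverse mult.commute)
      then show ?thesis by (simp add: exp_def divide_inverse mult.commute)
    qed
    then have "c ^ k * y ^ (2 * k) \<le> fact k * exp (c * y\<^sup>2)"
      by (simp add: power_mult_distrib field_simps flip: power_mult)
    then have "c ^ k * y ^ (2 * k) * exp (- (c * y\<^sup>2)) \<le> fact k * exp (c * y\<^sup>2) * exp (- (c * y\<^sup>2))"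
      by (intro mult_right_mono) auto
    also have "\<dots> = fact k" by (simp add: exp_minus)
    finally show ?thesis using c by (simp add: field_simps)
  qed
  have "\<bar>y ^ k * exp (- (y\<^sup>2 / (2 * \<sigma>\<^sup>2)))\<bar> \<le> 1 + fact k / c ^ k" for y
  proof -
    have "\<bar>y ^ k\<bar> \<le> 1 + y ^ (2 * k)"
    proof -
      have "0 \<le> (\<bar>y ^ k\<bar> - 1)\<^sup>2" by simp
      then have "2 * \<bar>y ^ k\<bar> \<le> 1 + (y ^ k)\<^sup>2" by (simp add: power2_eq_square algebra_simps flip: abs_mult)
      moreover have "(y ^ k)\<^sup>2 = y ^ (2 * k)" by (simp add: power_mult[symmetric] mult.commute)
      ultimately show ?thesis using abs_ge_zero[of "y ^ k"] by linarith
    qed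
    then have "\<bar>y ^ k\<bar> * exp (- (c * y\<^sup>2)) \<le> (1 + y ^ (2 * k)) * exp (- (c * y\<^sup>2))"
      by (intro mult_right_mono) auto
    also have "\<dots> \<le> 1 + fact k / c ^ k"
      using even[of y] c by (simp add: distrib_right add_mono)
    finally show ?thesis by (simp add: abs_mult c_def)
  qed
  then show ?thesis by blast
qed

lemma poly_gauss_bounded:
  fixes \<sigma> :: real
  assumes "\<sigma> > 0"
  shows "\<exists>B. \<forall>y. \<bar>y ^ k * poly q y * exp (- (y\<^sup>2 / (2 * \<sigma>\<^sup>2)))\<bar> \<le> B"
proof (induction q arbitrary: k)
  case 0
  show ?case by (rule exI[of _ 0]) simp
next
  case (pCons c q)
  obtain B1 where B1: "\<bar>y ^ k * exp (- (y\<^sup>2 / (2 * \<sigma>\<^sup>2)))\<bar> \<le> B1" for y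
    using gauss_moment_bounded[OF assms] by blast
  obtain B2 where B2: "\<bar>y ^ Suc k * poly q y * exp (- (y\<^sup>2 / (2 * \<sigma>\<^sup>2)))\<bar> \<le> B2" for y
    using pCons.IH by blast
  have "\<bar>y ^ k * poly (pCons c q) y * exp (- (y\<^sup>2 / (2 * \<sigma>\<^sup>2)))\<bar> \<le> \<bar>c\<bar> * B1 + B2" for y
  proof -
    have "y ^ k * poly (pCons c q) y * exp (- (y\<^sup>2 / (2 * \<sigma>\<^sup>2))) =
      c * (y ^ k * exp (- (y\<^sup>2 / (2 * \<sigma>\<^sup>2)))) + y ^ Suc k * poly q y * exp (- (y\<^sup>2 / (2 * \<sigma>\<^sup>2)))"
      by (simp add: algebra_simps)
    also have "\<bar>\<dots>\<bar> \<le> \<bar>c\<bar> * \<bar>y ^ k * exp (- (y\<^sup>2 / (2 * \<sigma>\<^sup>2)))\<bar> + \<bar>y ^ Suc k * poly q y * exp (- (y\<^sup>2 / (2 * \<sigma>\<^sup>2)))\<bar>"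
      by (rule order_trans[OF abs_triangle_ineq]) (simp add: abs_mult)
    also have "\<dots> \<le> \<bar>c\<bar> * B1 + B2"
      using B1[of y] B2[of y] by (intro add_mono mult_left_mono) auto
    finally show ?thesis .
  qed
  then show ?case by blast
qed

lemma poly_normal_density_bounded:
  assumes "\<sigma> > 0"
  shows "\<exists>B\<ge>0. \<forall>x. \<bar>poly q x * normal_density a \<sigma> x\<bar> \<le> B"
proof -
  obtain B where B: "\<bar>y ^ 0 * poly (pcompose q [:a, 1:]) y * exp (- (y\<^sup>2 / (2 * \<sigma>\<^sup>2)))\<bar> \<le> B" for y
    using poly_gauss_bounded[OF assms] by blast
  have "\<bar>poly q x * normal_density a \<sigma> x\<bar> \<le> B / sqrt (2 * pi * \<sigma>\<^sup>2)" for x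
  proof -
    have "poly q x * normal_density a \<sigma> x = poly (pcompose q [:a, 1:]) (x - a) * exp (- ((x - a)\<^sup>2 / (2 * \<sigma>\<^sup>2))) / sqrt (2 * pi * \<sigma>\<^sup>2)"
      by (simp add: normal_density_def poly_pcompose)
    then show ?thesis using B[of "x - a"] assms by (simp add: abs_mult divide_right_mono)
  qed
  moreover have "B / sqrt (2 * pi * \<sigma>\<^sup>2) \<ge> 0" using B[of 0] by (auto intro!: divide_nonneg_nonneg)
  ultimately show ?thesis by blast
qed

lemma poly_normal_density_has_derivative:
  assumes "\<sigma> > 0"
  shows "((\<lambda>x. poly q x * normal_density a \<sigma> x) has_real_derivative
     poly (pderiv q - q * [:- a / \<sigma>\<^sup>2, 1 / \<sigma>\<^sup>2:]) x * normal_density a \<sigma> x) (at x)"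
proof -
  have "(normal_density a \<sigma> has_real_derivative - ((x - a) / \<sigma>\<^sup>2) * normal_density a \<sigma> x) (at x)"
  proof -
    define c where "c = 1 / sqrt (2 * pi * \<sigma>\<^sup>2)"
    have "((\<lambda>x. c * exp (- (x - a)\<^sup>2 / (2 * \<sigma>\<^sup>2))) has_real_derivative
        - ((x - a) / \<sigma>\<^sup>2) * (c * exp (- (x - a)\<^sup>2 / (2 * \<sigma>\<^sup>2)))) (at x)"
      using assms by (auto intro!: derivative_eq_intros simp: divide_simps power2_eq_square)
    then show ?thesis by (simp add: normal_density_def[abs_def] c_def)
  qed
  from DERIV_mult[OF poly_DERIV[of q x] this] show ?thesis
    using assms by (simp add: algebra_simps diff_divide_distrib add_divide_distrib)
qed

text \<open>All derivatives of a Gaussian are polynomial multiples of it, with the polynomials given by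
  \<open>poly_normal_density_has_derivative\<close>; this gives the Schwartz property.\<close>

lemma nth_deriv_normal_density:
  assumes "\<sigma> > 0"
  shows "\<exists>q. nth_deriv n (\<lambda>x. complex_of_real (normal_density a \<sigma> x)) = (\<lambda>x. complex_of_real (poly q x * normal_density a \<sigma> x))"
proof (induction n)
  case 0
  show ?case by (rule exI[of _ 1]) (simp add: nth_deriv_def)
next
  case (Suc n)
  then obtain q where q: "nth_deriv n (\<lambda>x. complex_of_real (normal_density a \<sigma> x)) = (\<lambda>x. complex_of_real (poly q x * normal_density a \<sigma> x))"
    by blast
  have "vector_derivative (\<lambda>x. complex_of_real (poly q x * normal_density a \<sigma> x)) (at x) =
     complex_of_real (poly (pderiv q - q * [:- a / \<sigma>\<^sup>2, 1 / \<sigma>\<^sup>2:]) x * normal_density a \<sigma> x)" for x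
    using poly_normal_density_has_derivative[OF assms]
    by (intro vector_derivative_at has_vector_derivative_of_real) (simp add: has_real_derivative_iff_has_vector_derivative)
  then have "nth_deriv (Suc n) (\<lambda>x. complex_of_real (normal_density a \<sigma> x)) =
     (\<lambda>x. complex_of_real (poly (pderiv q - q * [:- a / \<sigma>\<^sup>2, 1 / \<sigma>\<^sup>2:]) x * normal_density a \<sigma> x))"
    using q by (simp add: nth_deriv_def)
  then show ?case by blast
qed

lemma normal_density_schwartz:
  assumes "\<sigma> > 0"
  shows "(\<lambda>x. complex_of_real (normal_density a \<sigma> x)) \<in> schwartz"
  unfolding schwartz_def
proof (intro CollectI conjI allI)
  fix n x
  obtain q where q: "nth_deriv n (\<lambda>x. complex_of_real (normal_density a \<sigma> x)) = (\<lambda>x. complex_of_real (poly q x * normal_density a \<sigma> x))"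
    using nth_deriv_normal_density[OF assms] by blast
  have "((\<lambda>x. complex_of_real (poly q x * normal_density a \<sigma> x)) has_vector_derivative
     complex_of_real (poly (pderiv q - q * [:- a / \<sigma>\<^sup>2, 1 / \<sigma>\<^sup>2:]) x * normal_density a \<sigma> x)) (at x)"
    using poly_normal_density_has_derivative[OF assms]
    by (intro has_vector_derivative_of_real) (simp add: has_real_derivative_iff_has_vector_derivative)
  then show "nth_deriv n (\<lambda>x. complex_of_real (normal_density a \<sigma> x)) differentiable at x"
    unfolding q by (rule differentiableI_vector)
next
  fix k n
  obtain q where q: "nth_deriv n (\<lambda>x. complex_of_real (normal_density a \<sigma> x)) = (\<lambda>x. complex_of_real (poly q x * normal_density a \<sigma> x))"
    using nth_deriv_normal_density[OF assms] by blast
  obtain B where "\<bar>poly (monom 1 k * q) x * normal_density a \<sigma> x\<bar> \<le> B" for x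
    using poly_normal_density_bounded[OF assms] by blast
  then have "norm (x ^ k *\<^sub>R nth_deriv n (\<lambda>x. complex_of_real (normal_density a \<sigma> x)) x) \<le> B" for x
    unfolding q by (simp add: poly_monom abs_mult norm_mult mult_ac)
  then show "bounded (range (\<lambda>x. x ^ k *\<^sub>R nth_deriv n (\<lambda>x. complex_of_real (normal_density a \<sigma> x)) x))"
    by (auto simp: bounded_iff)
qed

lemma normal_density_nice:
  assumes "\<sigma> > 0"
  shows "\<exists>C. nice_kernel C (normal_density a \<sigma>)"
proof -
  obtain B1 where B1: "\<bar>poly [:1, 0, 1:] x * normal_density a \<sigma> x\<bar> \<le> B1" for x
    using poly_normal_density_bounded[OF assms] by blast
  define q where "q = pderiv 1 - 1 * [:- a / \<sigma>\<^sup>2, 1 / \<sigma>\<^sup>2:]"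
  obtain B2 where B2: "\<bar>poly ([:1, 0, 1:] * q) x * normal_density a \<sigma> x\<bar> \<le> B2" for x
    using poly_normal_density_bounded[OF assms] by blast
  have pos: "1 + x\<^sup>2 > 0" for x :: real by (simp add: add_pos_nonneg)
  have "nice_kernel (3 * max B1 B2) (normal_density a \<sigma>)"
  proof (rule nice_kernelI)
    fix x
    show "(normal_density a \<sigma> has_real_derivative poly q x * normal_density a \<sigma> x) (at x)"
      using poly_normal_density_has_derivative[OF assms, of 1 a x] by (simp add: q_def)
    have "\<bar>normal_density a \<sigma> x\<bar> * (1 + x\<^sup>2) \<le> max B1 B2"
      using B1[of x] pos[of x] by (simp add: abs_mult power2_eq_square mult_ac)
    then show "\<bar>normal_density a \<sigma> x\<bar> \<le> max B1 B2 / (1 + x\<^sup>2)"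
      using pos[of x] by (simp add: pos_le_divide_eq)
    have "\<bar>poly q x * normal_density a \<sigma> x\<bar> * (1 + x\<^sup>2) = \<bar>poly ([:1, 0, 1:] * q) x * normal_density a \<sigma> x\<bar>"
    proof -
      have "poly ([:1, 0, 1:] * q) x = (1 + x\<^sup>2) * poly q x"
        by (simp add: power2_eq_square algebra_simps)
      then show ?thesis using pos[of x] by (simp add: abs_mult)
    qed
    also have "\<dots> \<le> max B1 B2" using B2[of x] by simp
    finally show "\<bar>poly q x * normal_density a \<sigma> x\<bar> \<le> max B1 B2 / (1 + x\<^sup>2)"
      using pos[of x] by (simp add: pos_le_divide_eq)
  qed
  then show ?thesis by blast
qed

lemma fourier_normal_density:
  assumes "\<sigma> > 0"
  shows "(LINT x|lborel. cis (x * \<xi>) * complex_of_real (normal_density a \<sigma> x)) = cis (a * \<xi>) * exp (- (\<sigma> * \<xi>)\<^sup>2 / 2)"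
proof -
  have "(LINT x|lborel. cis (x * \<xi>) * complex_of_real (normal_density a \<sigma> x))
     = \<sigma> *\<^sub>R (LINT x|lborel. cis ((a + \<sigma> * x) * \<xi>) * complex_of_real (normal_density a \<sigma> (a + \<sigma> * x)))"
    using assms by (subst lborel_integral_real_affine[where c=\<sigma> and t=a]) auto
  also have "(\<lambda>x. cis ((a + \<sigma> * x) * \<xi>) * complex_of_real (normal_density a \<sigma> (a + \<sigma> * x)))
     = (\<lambda>x. (cis (a * \<xi>) / \<sigma>) * (std_normal_density x *\<^sub>R cis (\<sigma> * \<xi> * x)))"
  proof
    fix x
    have "normal_density a \<sigma> (a + \<sigma> * x) = std_normal_density x / \<sigma>"
      using assms by (simp add: normal_density_def real_sqrt_mult power_mult_distrib)
    moreover have "cis ((a + \<sigma> * x) * \<xi>) = cis (a * \<xi>) * cis (\<sigma> * \<xi> * x)"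
      by (simp add: cis_mult algebra_simps)
    ultimately show "cis ((a + \<sigma> * x) * \<xi>) * complex_of_real (normal_density a \<sigma> (a + \<sigma> * x)) = (cis (a * \<xi>) / \<sigma>) * (std_normal_density x *\<^sub>R cis (\<sigma> * \<xi> * x))"
      by (simp add: scaleR_conv_of_real)
  qed
  also have "\<sigma> *\<^sub>R (LINT x|lborel. (cis (a * \<xi>) / \<sigma>) * (std_normal_density x *\<^sub>R cis (\<sigma> * \<xi> * x)))
    = cis (a * \<xi>) * (LINT x|lborel. std_normal_density x *\<^sub>R cis (\<sigma> * \<xi> * x))"
    using assms by (simp add: scaleR_conv_of_real)
  also have "(LINT x|lborel. std_normal_density x *\<^sub>R cis (\<sigma> * \<xi> * x)) = char std_normal_distribution (\<sigma> * \<xi>)"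
    unfolding char_def by (subst integral_density) (auto simp: cis_conv_exp mult_ac)
  also have "\<dots> = exp (- (\<sigma> * \<xi>)\<^sup>2 / 2)"
    by (simp add: char_std_normal_distribution)
  finally show ?thesis .
qed

text \<open>The value at $\xi = 1$ of the symbol of \<open>frac_lap\<close>; by homogeneity it determines the symbol
  (\<open>frac_const_scaled\<close>).\<close>

definition frac_const :: real where
  "frac_const = (LINT t|lborel. indicator {0<..} t * ((2 - 2 * cos t) * t powr (-3/2)))"

lemma two_minus_two_cos_le: "0 \<le> 2 - 2 * cos t" "2 - 2 * cos t \<le> 4 * min 1 \<bar>t\<bar>" for t :: real
proof -
  show "0 \<le> 2 - 2 * cos t" by simp
  have "2 - 2 * cos t = 4 * \<bar>sin (t / 2)\<bar>\<^sup>2" using cos_double_sin[of "t / 2"] by simp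
  also have "\<dots> \<le> 4 * \<bar>sin (t / 2)\<bar>"
    using power_le_one_iff[of "\<bar>sin (t / 2)\<bar>"] abs_sin_le_one[of "t / 2"]
    by (simp add: power2_eq_square mult_left_le del: abs_mult_self_eq)
  finally show "2 - 2 * cos t \<le> 4 * min 1 \<bar>t\<bar>"
    using abs_sin_x_le_abs_x[of "t / 2"] cos_ge_minus_one[of t] by (smt (verit) field_sum_of_halves)
qed

lemma frac_const_integrable:
  "integrable lborel (\<lambda>t::real. indicator {0<..} t * ((2 - 2 * cos (t * \<xi>)) * t powr (-3/2)))"
proof (rule Bochner_Integration.integrable_bound)
  show "integrable lborel (\<lambda>t::real. (4 * max 1 \<bar>\<xi>\<bar>) * (indicator {0<..} t * (min 1 t * t powr (-3/2))))"
    by (intro integrable_mult_right integrable_min_powr)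
  have "norm (indicator {0<..} t * ((2 - 2 * cos (t * \<xi>)) * t powr (-3/2))) \<le> norm ((4 * max 1 \<bar>\<xi>\<bar>) * (indicator {0<..} t * (min 1 t * t powr (-3/2))))" for t :: real
  proof (cases "t > 0")
    case True
    have "2 - 2 * cos (t * \<xi>) \<le> 4 * min 1 \<bar>t * \<xi>\<bar>" by (rule two_minus_two_cos_le)
    also have "\<dots> \<le> 4 * max 1 \<bar>\<xi>\<bar> * min 1 t"
    proof (cases "t \<le> 1")
      case True
      have "min 1 \<bar>t * \<xi>\<bar> \<le> \<bar>\<xi>\<bar> * t" using \<open>t > 0\<close> by (simp add: abs_mult mult.commute)
      also have "\<dots> \<le> max 1 \<bar>\<xi>\<bar> * t" using \<open>t > 0\<close> by (intro mult_right_mono) auto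
      finally show ?thesis using True by simp
    qed (auto simp: min_def max_def)
    finally show ?thesis using True two_minus_two_cos_le(1)[of "t * \<xi>"]
      by (simp add: abs_mult mult.assoc[symmetric] mult_right_mono)
  qed simp
  then show "AE t in lborel. norm (indicator {0<..} t * ((2 - 2 * cos (t * \<xi>)) * t powr (-3/2))) \<le> norm ((4 * max 1 \<bar>\<xi>\<bar>) * (indicator {0<..} t * (min 1 t * t powr (-3/2))))"
    by simp
qed measurable

lemma frac_const_scaled:
  "(LINT t|lborel. indicator {0<..} t * ((2 - 2 * cos (t * \<xi>)) * t powr (-3/2))) = frac_const * \<bar>\<xi>\<bar> powr (1/2)"
proof (cases "\<xi> = 0")
  case False
  define r where "r = \<bar>\<xi>\<bar>"
  define L where "L = (LINT t|lborel. indicator {0<..} t * ((2 - 2 * cos (t * \<xi>)) * t powr (-3/2)))"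
  have r: "r > 0" using False by (simp add: r_def)
  have "frac_const = r * (LINT t|lborel. indicator {0<..} (r * t) * ((2 - 2 * cos (r * t)) * (r * t) powr (-3/2)))"
    unfolding frac_const_def using r by (subst lborel_integral_real_affine[where c=r and t=0]) auto
  also have "(\<lambda>t. indicator {0<..} (r * t) * ((2 - 2 * cos (r * t)) * (r * t) powr (-3/2)))
     = (\<lambda>t. r powr (-3/2) * (indicator {0<..} t * ((2 - 2 * cos (t * \<xi>)) * t powr (-3/2))))"
  proof
    fix t
    have "cos (r * t) = cos (t * \<xi>)" by (auto simp: r_def abs_if mult.commute)
    then show "indicator {0<..} (r * t) * ((2 - 2 * cos (r * t)) * (r * t) powr (-3/2)) = r powr (-3/2) * (indicator {0<..} t * ((2 - 2 * cos (t * \<xi>)) * t powr (-3/2)))"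
      using r by (auto simp: powr_mult zero_less_mult_iff split: split_indicator)
  qed
  finally have "frac_const = (r * r powr (-3/2)) * L"
    by (simp add: L_def)
  moreover have "r * r powr (-3/2) = r powr (-1/2)" using r by (simp add: powr_mult_base)
  moreover have "r powr (-1/2) * r powr (1/2) = 1" using r by (simp flip: powr_add)
  ultimately have "L = frac_const * r powr (1/2)" by (metis mult.commute mult.left_commute mult_1)
  then show ?thesis by (simp add: r_def L_def)
qed simp

lemma frac_const_pos: "frac_const > 0"
proof -
  have "frac_const \<ge> 0" unfolding frac_const_def
    by (intro Bochner_Integration.integral_nonneg) (auto simp: two_minus_two_cos_le)
  moreover have "frac_const \<noteq> 0"
  proof
    assume "frac_const = 0"
    then have "AE t in lborel. indicator {0<..} t * ((2 - 2 * cos t) * t powr (-3/2)) = (0::real)"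
      unfolding frac_const_def using frac_const_integrable[of 1]
      by (subst (asm) integral_nonneg_eq_0_iff_AE) (auto simp: two_minus_two_cos_le)
    then have "AE t::real in lborel. \<not> (t \<in> {1..2})"
    proof eventually_elim
      case (elim t)
      show ?case
      proof
        assume "t \<in> {1..2}"
        then have "cos t < cos 0" using pi_gt3 by (intro cos_monotone_0_pi) auto
        then show False using elim \<open>t \<in> {1..2}\<close> by auto
      qed
    qed
    then have "{1..2::real} \<in> null_sets lborel" by (subst AE_iff_null_sets) auto
    then have "emeasure lborel {1..2::real} = 0" by (rule null_setsD1)
    then show False by simp
  qed
  ultimately show ?thesis by simp
qed

text \<open>Insert $c\,|\xi|^{1/2} = \int_0^\infty (2 - 2\cos t\xi)\,t^{-3/2}\,dt$ into the Fourier integral and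
  exchange the integrals. For fixed $t$ the factor $2 - 2\cos t\xi$ is the symbol of the second
  difference with step $t$, so the inner integral is a second difference of the Gaussian.\<close>

lemma lap_quarter_normal_density:
  assumes "\<sigma> > 0"
  shows "lap_quarter (\<lambda>x. complex_of_real (normal_density a \<sigma> x)) x = complex_of_real (frac_lap (normal_density a \<sigma>) x / frac_const)"
proof -
  define E where "E = (\<lambda>\<xi>. exp (- (\<sigma> * \<xi>)\<^sup>2 / 2))"
  have [measurable]: "E \<in> borel_measurable borel" unfolding E_def by measurable
  have E_normal: "E \<xi> = sqrt (2 * pi) / \<sigma> * normal_density 0 (1 / \<sigma>) \<xi>" for \<xi>
    using assms by (simp add: E_def normal_density_def real_sqrt_mult real_sqrt_divide power_mult_distrib power_divide field_simps)
  have fourier: "fourier (\<lambda>x. complex_of_real (normal_density a \<sigma> x)) \<xi> = cis (- (a * \<xi>)) * E \<xi>" for \<xi>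
    using fourier_normal_density[OF assms, of "- \<xi>" a] by (simp add: fourier_def E_def)
  have inv: "(LINT \<xi>|lborel. cis (b * \<xi>) * complex_of_real (E \<xi>)) = 2 * pi * normal_density 0 \<sigma> b" for b
  proof -
    have "(LINT \<xi>|lborel. cis (b * \<xi>) * complex_of_real (E \<xi>)) = complex_of_real (sqrt (2 * pi) / \<sigma>) * (LINT \<xi>|lborel. cis (\<xi> * b) * complex_of_real (normal_density 0 (1 / \<sigma>) \<xi>))"
      unfolding E_normal Bochner_Integration.integral_mult_right_zero[symmetric] of_real_mult
      by (intro Bochner_Integration.integral_cong) (auto simp: mult_ac)
    also have "\<dots> = complex_of_real (sqrt (2 * pi) / \<sigma> * exp (- (b / \<sigma>)\<^sup>2 / 2))"
      using assms by (subst fourier_normal_density) (auto simp: exp_of_real[symmetric])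
    also have "sqrt (2 * pi) / \<sigma> * exp (- (b / \<sigma>)\<^sup>2 / 2) = 2 * pi * normal_density 0 \<sigma> b"
    proof -
      define s where "s = sqrt (2 * pi)"
      have s: "s > 0" "2 * pi = s * s" by (auto simp: s_def)
      have "sqrt (2 * pi * \<sigma>\<^sup>2) = s * \<sigma>" using assms by (simp add: s_def real_sqrt_mult)
      then show ?thesis using assms s(1) unfolding normal_density_def s_def[symmetric] s(2)
        by (simp add: power_divide)
    qed
    finally show ?thesis .
  qed
  have EI: "integrable lborel E"
    unfolding E_normal[abs_def] using assms by (intro integrable_mult_right) auto
  have [measurable]: "cis \<in> borel_measurable borel"
    by (intro borel_measurable_continuous_onI continuous_intros)
  have Eint: "integrable lborel (\<lambda>\<xi>. cis (b * \<xi>) * complex_of_real (E \<xi>))" for b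
    by (rule Bochner_Integration.integrable_bound[OF EI]) (auto simp: norm_mult)
  define w where "w = (\<lambda>t::real. indicator {0<..} t * t powr (-3/2))"
  have [measurable]: "w \<in> borel_measurable borel" unfolding w_def by measurable
  have w0: "w t \<ge> 0" for t by (simp add: w_def)
  have wint: "(LINT t|lborel. (2 - 2 * cos (t * \<xi>)) * w t) = frac_const * \<bar>\<xi>\<bar> powr (1/2)" for \<xi>
    using frac_const_scaled[of \<xi>] by (simp add: w_def mult_ac)
  have wI: "integrable lborel (\<lambda>t. (2 - 2 * cos (t * \<xi>)) * w t)" for \<xi>
    using frac_const_integrable[of \<xi>] by (simp add: w_def mult_ac)
  have "2 * pi * frac_const * lap_quarter (\<lambda>x. complex_of_real (normal_density a \<sigma> x)) x =
     (LINT \<xi>|lborel. cis ((x - a) * \<xi>) * complex_of_real (frac_const * \<bar>\<xi>\<bar> powr (1/2) * E \<xi>))"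
  proof -
    define J where "J = (LINT \<xi>|lborel. cis (x * \<xi>) * (\<bar>\<xi>\<bar> powr (1/2) *\<^sub>R (cis (- (a * \<xi>)) * complex_of_real (E \<xi>))))"
    have "lap_quarter (\<lambda>x. complex_of_real (normal_density a \<sigma> x)) x = (1 / (2 * pi)) *\<^sub>R J"
      unfolding lap_quarter_def inv_fourier_def fourier J_def ..
    then have "2 * pi * frac_const * lap_quarter (\<lambda>x. complex_of_real (normal_density a \<sigma> x)) x = complex_of_real frac_const * J"
      by (simp add: scaleR_conv_of_real)
    also have "\<dots> = (LINT \<xi>|lborel. complex_of_real frac_const * (cis (x * \<xi>) * (\<bar>\<xi>\<bar> powr (1/2) *\<^sub>R (cis (- (a * \<xi>)) * complex_of_real (E \<xi>)))))"
      unfolding J_def by (rule Bochner_Integration.integral_mult_right_zero[symmetric])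
    also have "\<dots> = (LINT \<xi>|lborel. cis ((x - a) * \<xi>) * complex_of_real (frac_const * \<bar>\<xi>\<bar> powr (1/2) * E \<xi>))"
    proof (intro Bochner_Integration.integral_cong refl)
      fix \<xi>
      have "cis ((x - a) * \<xi>) = cis (x * \<xi>) * cis (- (a * \<xi>))" by (simp add: cis_mult algebra_simps)
      then show "complex_of_real frac_const * (cis (x * \<xi>) * (\<bar>\<xi>\<bar> powr (1/2) *\<^sub>R (cis (- (a * \<xi>)) * complex_of_real (E \<xi>)))) =
        cis ((x - a) * \<xi>) * complex_of_real (frac_const * \<bar>\<xi>\<bar> powr (1/2) * E \<xi>)"
        by (simp add: scaleR_conv_of_real mult_ac)
    qed
    finally show ?thesis .
  qed
  also have "\<dots> = (LINT \<xi>|lborel. LINT t|lborel. cis ((x - a) * \<xi>) * complex_of_real ((2 - 2 * cos (t * \<xi>)) * w t * E \<xi>))"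
  proof (intro Bochner_Integration.integral_cong refl)
    fix \<xi>
    have "(LINT t|lborel. cis ((x - a) * \<xi>) * complex_of_real ((2 - 2 * cos (t * \<xi>)) * w t * E \<xi>)) =
      cis ((x - a) * \<xi>) * (LINT t|lborel. complex_of_real ((2 - 2 * cos (t * \<xi>)) * w t * E \<xi>))"
      by (rule Bochner_Integration.integral_mult_right_zero)
    also have "(LINT t|lborel. complex_of_real ((2 - 2 * cos (t * \<xi>)) * w t * E \<xi>)) = complex_of_real (LINT t|lborel. (2 - 2 * cos (t * \<xi>)) * w t * E \<xi>)"
      by (rule integral_complex_of_real)
    also have "(LINT t|lborel. (2 - 2 * cos (t * \<xi>)) * w t * E \<xi>) = frac_const * \<bar>\<xi>\<bar> powr (1/2) * E \<xi>"
      unfolding wint[symmetric] by (rule Bochner_Integration.integral_mult_left_zero)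
    finally show "cis ((x - a) * \<xi>) * complex_of_real (frac_const * \<bar>\<xi>\<bar> powr (1/2) * E \<xi>) =
      (LINT t|lborel. cis ((x - a) * \<xi>) * complex_of_real ((2 - 2 * cos (t * \<xi>)) * w t * E \<xi>))" by (rule sym)
  qed
  also have "\<dots> = (LINT t|lborel. LINT \<xi>|lborel. cis ((x - a) * \<xi>) * complex_of_real ((2 - 2 * cos (t * \<xi>)) * w t * E \<xi>))"
  proof (rule Fubini_lborel)
    have "(\<integral>\<^sup>+\<xi>. (\<integral>\<^sup>+t. ennreal (norm (cis ((x - a) * \<xi>) * complex_of_real ((2 - 2 * cos (t * \<xi>)) * w t * E \<xi>))) \<partial>lborel) \<partial>lborel)
      = (\<integral>\<^sup>+\<xi>. (\<integral>\<^sup>+t. ennreal ((2 - 2 * cos (t * \<xi>)) * w t * E \<xi>) \<partial>lborel) \<partial>lborel)"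
    proof (intro nn_integral_cong)
      fix \<xi> t
      have "(2 - 2 * cos (t * \<xi>)) * w t * E \<xi> \<ge> 0"
        using two_minus_two_cos_le(1)[of "t * \<xi>"] w0[of t] by (intro mult_nonneg_nonneg) (auto simp: E_def)
      then have "norm (cis ((x - a) * \<xi>) * complex_of_real ((2 - 2 * cos (t * \<xi>)) * w t * E \<xi>)) = (2 - 2 * cos (t * \<xi>)) * w t * E \<xi>"
        by (simp only: norm_mult[of "cis ((x - a) * \<xi>)"] norm_cis norm_of_real mult_1 abs_of_nonneg)
      then show "ennreal (norm (cis ((x - a) * \<xi>) * complex_of_real ((2 - 2 * cos (t * \<xi>)) * w t * E \<xi>))) = ennreal ((2 - 2 * cos (t * \<xi>)) * w t * E \<xi>)"
        by simp
    qed
    also have "\<dots> = (\<integral>\<^sup>+\<xi>. ennreal (frac_const * \<bar>\<xi>\<bar> powr (1/2) * E \<xi>) \<partial>lborel)"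
    proof (intro nn_integral_cong)
      fix \<xi>
      show "(\<integral>\<^sup>+t. ennreal ((2 - 2 * cos (t * \<xi>)) * w t * E \<xi>) \<partial>lborel) = ennreal (frac_const * \<bar>\<xi>\<bar> powr (1/2) * E \<xi>)"
        using wI[of \<xi>] wint[of \<xi>] two_minus_two_cos_le(1)[of "t * \<xi>" for t] w0
        by (subst nn_integral_eq_integral) (auto simp: E_def intro!: mult_nonneg_nonneg)
    qed
    also have "\<dots> \<le> (\<integral>\<^sup>+\<xi>. ennreal (frac_const * sqrt (2 * pi) / \<sigma> * (normal_density 0 (1 / \<sigma>) \<xi> + normal_density 0 (1 / \<sigma>) \<xi> * \<xi>^2)) \<partial>lborel)"
    proof (intro nn_integral_mono ennreal_leI)
      fix \<xi> :: real
      have "\<bar>\<xi>\<bar> powr (1/2) \<le> 1 + \<xi>\<^sup>2"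
      proof (cases "\<bar>\<xi>\<bar> \<le> 1")
        case True
        then have "\<bar>\<xi>\<bar> powr (1/2) \<le> 1" by (intro powr_le1) auto
        then show ?thesis by (simp add: add_increasing2)
      next
        case False
        then have "\<bar>\<xi>\<bar> powr (1/2) \<le> \<bar>\<xi>\<bar> powr 2" by (intro powr_mono) auto
        then show ?thesis using False by (simp add: powr_numeral)
      qed
      then have "frac_const * \<bar>\<xi>\<bar> powr (1/2) * E \<xi> \<le> frac_const * (1 + \<xi>\<^sup>2) * E \<xi>"
        using frac_const_pos by (intro mult_right_mono mult_left_mono) (auto simp: E_def)
      then show "frac_const * \<bar>\<xi>\<bar> powr (1/2) * E \<xi> \<le> frac_const * sqrt (2 * pi) / \<sigma> * (normal_density 0 (1 / \<sigma>) \<xi> + normal_density 0 (1 / \<sigma>) \<xi> * \<xi>^2)"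
        by (simp add: E_normal algebra_simps add_divide_distrib)
    qed
    also have "\<dots> < \<infinity>"
    proof -
      have "integrable lborel (\<lambda>\<xi>. normal_density 0 (1 / \<sigma>) \<xi> * (\<xi> - 0) ^ 2)"
        using assms by (intro integrable_normal_moment) auto
      then have "integrable lborel (\<lambda>\<xi>. frac_const * sqrt (2 * pi) / \<sigma> * (normal_density 0 (1 / \<sigma>) \<xi> + normal_density 0 (1 / \<sigma>) \<xi> * \<xi>^2))"
        using assms by (intro integrable_mult_right Bochner_Integration.integrable_add) auto
      then show ?thesis using assms frac_const_pos by (simp add: integrable_iff_bounded)
    qed
    finally show "(\<integral>\<^sup>+\<xi>. (\<integral>\<^sup>+t. ennreal (norm (cis ((x - a) * \<xi>) * complex_of_real ((2 - 2 * cos (t * \<xi>)) * w t * E \<xi>))) \<partial>lborel) \<partial>lborel) < \<infinity>" .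
  qed measurable
  also have "\<dots> = (LINT t|lborel. complex_of_real (2 * pi * ((2 * normal_density 0 \<sigma> (x - a) - normal_density 0 \<sigma> (x - a + t) - normal_density 0 \<sigma> (x - a - t)) * w t)))"
  proof (intro Bochner_Integration.integral_cong refl)
    fix t
    have "cis ((x - a) * \<xi>) * complex_of_real ((2 - 2 * cos (t * \<xi>)) * w t * E \<xi>) =
      w t * (2 * (cis ((x - a) * \<xi>) * E \<xi>) - cis ((x - a + t) * \<xi>) * E \<xi> - cis ((x - a - t) * \<xi>) * E \<xi>)" for \<xi>
    proof -
      have "cis ((x - a + t) * \<xi>) + cis ((x - a - t) * \<xi>) = cis ((x - a) * \<xi>) * (2 * cos (t * \<xi>))"
        by (simp add: complex_eq_iff distrib_right left_diff_distrib cos_add cos_diff sin_add sin_diff)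
      then have cs: "2 * cis ((x - a) * \<xi>) - cis ((x - a + t) * \<xi>) - cis ((x - a - t) * \<xi>) = cis ((x - a) * \<xi>) * complex_of_real (2 - 2 * cos (t * \<xi>))"
        by (simp add: algebra_simps)
      have alg: "v * (2 * (X * e) - Y * e - Z * e) = v * e * (2 * X - Y - Z)" for v e X Y Z :: complex
        by (simp add: algebra_simps)
      show ?thesis unfolding alg cs by (simp only: of_real_mult mult_ac)
    qed
    then have "(LINT \<xi>|lborel. cis ((x - a) * \<xi>) * complex_of_real ((2 - 2 * cos (t * \<xi>)) * w t * E \<xi>)) =
      (LINT \<xi>|lborel. w t * (2 * (cis ((x - a) * \<xi>) * E \<xi>) - cis ((x - a + t) * \<xi>) * E \<xi> - cis ((x - a - t) * \<xi>) * E \<xi>))"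
      by (intro Bochner_Integration.integral_cong refl)
    also have "\<dots> = w t * (LINT \<xi>|lborel. 2 * (cis ((x - a) * \<xi>) * E \<xi>) - cis ((x - a + t) * \<xi>) * E \<xi> - cis ((x - a - t) * \<xi>) * E \<xi>)"
      by (rule Bochner_Integration.integral_mult_right_zero)
    also have "(LINT \<xi>|lborel. 2 * (cis ((x - a) * \<xi>) * E \<xi>) - cis ((x - a + t) * \<xi>) * E \<xi> - cis ((x - a - t) * \<xi>) * E \<xi>) =
       2 * (LINT \<xi>|lborel. cis ((x - a) * \<xi>) * E \<xi>) - (LINT \<xi>|lborel. cis ((x - a + t) * \<xi>) * E \<xi>) - (LINT \<xi>|lborel. cis ((x - a - t) * \<xi>) * E \<xi>)"
      by (simp only: Bochner_Integration.integral_diff Bochner_Integration.integrable_diff integrable_mult_right Eint Bochner_Integration.integral_mult_right_zero)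
    also have "w t * (2 * (LINT \<xi>|lborel. cis ((x - a) * \<xi>) * E \<xi>) - (LINT \<xi>|lborel. cis ((x - a + t) * \<xi>) * E \<xi>) - (LINT \<xi>|lborel. cis ((x - a - t) * \<xi>) * E \<xi>)) =
       complex_of_real (2 * pi * ((2 * normal_density 0 \<sigma> (x - a) - normal_density 0 \<sigma> (x - a + t) - normal_density 0 \<sigma> (x - a - t)) * w t))"
      unfolding inv by (simp add: algebra_simps)
    finally show "(LINT \<xi>|lborel. cis ((x - a) * \<xi>) * complex_of_real ((2 - 2 * cos (t * \<xi>)) * w t * E \<xi>)) =
       complex_of_real (2 * pi * ((2 * normal_density 0 \<sigma> (x - a) - normal_density 0 \<sigma> (x - a + t) - normal_density 0 \<sigma> (x - a - t)) * w t))" .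
  qed
  also have "\<dots> = complex_of_real (2 * pi * frac_lap (normal_density a \<sigma>) x)"
  proof -
    have "normal_density 0 \<sigma> (y - a) = normal_density a \<sigma> y" for y by (simp add: normal_density_def)
    then have shift: "normal_density 0 \<sigma> (x - a) = normal_density a \<sigma> x" "normal_density 0 \<sigma> (x - a + t) = normal_density a \<sigma> (x + t)"
      "normal_density 0 \<sigma> (x - a - t) = normal_density a \<sigma> (x - t)" for t
      by (simp_all add: normal_density_def algebra_simps)
    have "frac_lap (normal_density a \<sigma>) x = (LINT t|lborel. (2 * normal_density a \<sigma> x - normal_density a \<sigma> (x + t) - normal_density a \<sigma> (x - t)) * w t)"
      unfolding frac_lap_def w_def by (simp add: mult_ac)
    then show ?thesis
      unfolding shift integral_complex_of_real Bochner_Integration.integral_mult_right_zero by simp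
  qed
  finally show ?thesis using frac_const_pos by (simp add: field_simps)
qed

section \<open>The Poisson kernel and its fractional Laplacian\<close>

text \<open>The principal branch of $w^{-3/2}$. It is used for $w = y - z$ with $\mathrm{Im}\,z > 0$, hence in the
  lower half-plane, where it is holomorphic.\<close>

definition jker :: "complex \<Rightarrow> complex" where
  "jker w = 1 / (w * csqrt w)"

definition poisson :: "real \<Rightarrow> real \<Rightarrow> real" where
  "poisson \<eta> x = \<eta> / (pi * (x\<^sup>2 + \<eta>\<^sup>2))"

lemma poisson_nice:
  assumes "\<eta> > 0"
  shows "\<exists>C. nice_kernel C (poisson \<eta>)"
proof -
  define m where "m = min 1 (\<eta>\<^sup>2)"
  define C where "C = max \<eta> 1 / (pi * m)"
  have m: "m > 0" using assms by (simp add: m_def)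
  have pos: "x\<^sup>2 + \<eta>\<^sup>2 > 0" "1 + x\<^sup>2 > 0" for x :: real
    using assms by (auto simp: add_nonneg_pos add_pos_nonneg)
  have low: "m * (1 + x\<^sup>2) \<le> x\<^sup>2 + \<eta>\<^sup>2" for x
  proof -
    have "m * 1 \<le> \<eta>\<^sup>2" by (simp add: m_def)
    moreover have "m * x\<^sup>2 \<le> 1 * x\<^sup>2" by (intro mult_right_mono) (auto simp: m_def)
    ultimately show ?thesis by (simp add: distrib_left)
  qed
  have bound: "c / (pi * (x\<^sup>2 + \<eta>\<^sup>2)) \<le> C / (1 + x\<^sup>2)" if "0 \<le> c" "c \<le> max \<eta> 1" for c x
  proof -
    have "c / (pi * (x\<^sup>2 + \<eta>\<^sup>2)) \<le> c / (pi * (m * (1 + x\<^sup>2)))"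
      using that low[of x] m pos[of x] by (intro divide_left_mono mult_left_mono mult_pos_pos) auto
    also have "\<dots> \<le> max \<eta> 1 / (pi * (m * (1 + x\<^sup>2)))"
      using that m pos[of x] by (intro divide_right_mono) auto
    finally show ?thesis by (simp add: C_def mult_ac)
  qed
  have "nice_kernel (3 * C) (poisson \<eta>)"
  proof (rule nice_kernelI)
    fix x
    show "(poisson \<eta> has_real_derivative - (2 * x * \<eta>) / (pi * (x\<^sup>2 + \<eta>\<^sup>2)\<^sup>2)) (at x)"
      unfolding poisson_def[abs_def] using pos[of x]
      by (auto intro!: derivative_eq_intros simp: divide_simps power2_eq_square)
    show "\<bar>poisson \<eta> x\<bar> \<le> C / (1 + x\<^sup>2)"
      using bound[of \<eta> x] assms by (simp add: poisson_def)
    have "\<bar>2 * x * \<eta>\<bar> \<le> x\<^sup>2 + \<eta>\<^sup>2"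
      using zero_le_power2[of "x - \<eta>"] zero_le_power2[of "x + \<eta>"] by (simp add: power2_eq_square algebra_simps abs_if)
    then have "\<bar>- (2 * x * \<eta>) / (pi * (x\<^sup>2 + \<eta>\<^sup>2)\<^sup>2)\<bar> \<le> (x\<^sup>2 + \<eta>\<^sup>2) / (pi * (x\<^sup>2 + \<eta>\<^sup>2)\<^sup>2)"
      using pos[of x] by (simp add: abs_mult divide_right_mono)
    also have "\<dots> = 1 / (pi * (x\<^sup>2 + \<eta>\<^sup>2))"
      using pos[of x] by (simp add: power2_eq_square)
    also have "\<dots> \<le> C / (1 + x\<^sup>2)" by (rule bound) auto
    finally show "\<bar>- (2 * x * \<eta>) / (pi * (x\<^sup>2 + \<eta>\<^sup>2)\<^sup>2)\<bar> \<le> C / (1 + x\<^sup>2)" .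
  qed
  then show ?thesis by blast
qed

lemma inverse_shift_bound:
  fixes \<omega> :: complex
  assumes "Im \<omega> \<noteq> 0" "t > 0"
  shows "1 / cmod (complex_of_real t + \<omega>) \<le> (1 / \<bar>Im \<omega>\<bar> + cmod \<omega> / \<bar>Im \<omega>\<bar>) * (min 1 t / t)"
proof -
  define M where "M = 1 / \<bar>Im \<omega>\<bar> + cmod \<omega> / \<bar>Im \<omega>\<bar>"
  have nz: "complex_of_real t + \<omega> \<noteq> 0" for t using assms by (auto simp: complex_eq_iff)
  have l1: "\<bar>Im \<omega>\<bar> \<le> cmod (complex_of_real t + \<omega>)" using abs_Im_le_cmod[of "complex_of_real t + \<omega>"] by simp
  have "(t * \<bar>Im \<omega>\<bar>)\<^sup>2 \<le> (cmod \<omega> * cmod (complex_of_real t + \<omega>))\<^sup>2"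
  proof -
    have "(cmod \<omega> * cmod (complex_of_real t + \<omega>))\<^sup>2 = (t * Im \<omega>)\<^sup>2 + (t * Re \<omega> + (Re \<omega>)\<^sup>2 + (Im \<omega>)\<^sup>2)\<^sup>2"
      by (simp add: power_mult_distrib cmod_power2) (simp add: power2_eq_square algebra_simps)
    then show ?thesis by (simp add: power_mult_distrib)
  qed
  then have l2: "t * \<bar>Im \<omega>\<bar> \<le> cmod \<omega> * cmod (complex_of_real t + \<omega>)"
    by (rule power2_le_imp_le) simp
  have "1 / cmod (complex_of_real t + \<omega>) \<le> M * (min 1 t / t)"
  proof (cases "t \<le> 1")
    case True
    have "1 / cmod (complex_of_real t + \<omega>) \<le> 1 / \<bar>Im \<omega>\<bar>"
      using l1 assms by (intro divide_left_mono) (auto intro!: mult_pos_pos simp: nz)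
    also have "\<dots> \<le> M" by (simp add: M_def)
    finally show ?thesis using True assms by simp
  next
    case False
    have "1 / cmod (complex_of_real t + \<omega>) \<le> cmod \<omega> / \<bar>Im \<omega>\<bar> / t"
      using l2 assms nz[of t] by (simp add: field_simps)
    also have "\<dots> \<le> M / t" using assms by (intro divide_right_mono) (auto simp: M_def)
    finally show ?thesis using False by simp
  qed
  then show ?thesis by (simp add: M_def)
qed

text \<open>With $b = \sqrt\omega$, an antiderivative is
  $(\mathrm{Ln}(\sqrt t - ib) - \mathrm{Ln}(\sqrt t + ib))/(ib)$; it tends to 0 at infinity and to $-\pi/b$
  at 0.\<close>

lemma integral_inverse_sqrt_over_shift:
  assumes "Im \<omega> \<noteq> 0"
  defines "f \<equiv> (\<lambda>t. complex_of_real (t powr (-1/2)) / (complex_of_real t + \<omega>))"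
  shows "set_integrable lborel {0<..} f" "(LINT t:{0<..}|lborel. f t) = pi / csqrt \<omega>"
proof -
  define b where "b = csqrt \<omega>"
  have b2: "b\<^sup>2 = \<omega>" by (simp add: b_def)
  have "Re b \<noteq> 0"
  proof
    assume "Re b = 0"
    then have "Im (b\<^sup>2) = 0" by (simp add: power2_eq_square)
    then show False using assms b2 by simp
  qed
  then have Reb: "Re b > 0" using Re_csqrt[of \<omega>] by (simp add: b_def)
  then have b0: "b \<noteq> 0" by auto
  have nz: "complex_of_real t + \<omega> \<noteq> 0" for t using assms by (auto simp: complex_eq_iff)
  define M where "M = 1 / \<bar>Im \<omega>\<bar> + cmod \<omega> / \<bar>Im \<omega>\<bar>"
  show int: "set_integrable lborel {0<..} f"
    unfolding set_integrable_def
  proof (rule Bochner_Integration.integrable_bound)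
    show "integrable lborel (\<lambda>t::real. M * (indicator {0<..} t * (min 1 t * t powr (-3/2))))"
      by (intro integrable_mult_right integrable_min_powr)
    show "(\<lambda>t. indicator {0<..} t *\<^sub>R f t) \<in> borel_measurable lborel"
      unfolding f_def by measurable
    have "norm (indicator {0<..} t *\<^sub>R f t) \<le> norm (M * (indicator {0<..} t * (min 1 t * t powr (-3/2))))" for t :: real
    proof (cases "t > 0")
      case True
      have "1 / cmod (complex_of_real t + \<omega>) \<le> M * (min 1 t / t)"
        unfolding M_def using assms(1) True by (rule inverse_shift_bound)
      then have "t powr (-1/2) * (1 / cmod (complex_of_real t + \<omega>)) \<le> t powr (-1/2) * (M * (min 1 t / t))"
        by (intro mult_left_mono) auto
      also have "\<dots> = M * (min 1 t * t powr (-3/2))"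
      proof -
        have "t powr (-1/2) / t = t powr (-3/2)" using True by (simp add: powr_diff[of t "-1/2" 1, simplified] )
        then show ?thesis by (metis (no_types, opaque_lifting) mult.assoc mult.commute times_divide_eq_right)
      qed
      finally show ?thesis using True by (simp add: f_def norm_divide M_def)
    qed simp
    then show "AE t in lborel. norm (indicator {0<..} t *\<^sub>R f t) \<le> norm (M * (indicator {0<..} t * (min 1 t * t powr (-3/2))))"
      by simp
  qed
  define F where "F = (\<lambda>t::real. (Ln (complex_of_real (sqrt t) - \<i> * b) - Ln (complex_of_real (sqrt t) + \<i> * b)) / (\<i> * b))"
  have slit: "complex_of_real s - \<i> * b \<notin> \<real>\<^sub>\<le>\<^sub>0" "complex_of_real s + \<i> * b \<notin> \<real>\<^sub>\<le>\<^sub>0" for s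
    using Reb by (auto simp: complex_nonpos_Reals_iff)
  have "(LBINT t=0..\<infinity>. f t) = 0 - (- (pi / b))"
  proof (rule interval_integral_FTC_integrable)
    fix t :: real assume "0 < ereal t"
    then have t: "t > 0" by simp
    have nn: "complex_of_real (sqrt t) - \<i> * b \<noteq> 0" "complex_of_real (sqrt t) + \<i> * b \<noteq> 0"
      using slit[of "sqrt t"] by auto
    have "((\<lambda>t. complex_of_real (sqrt t)) has_vector_derivative complex_of_real (inverse (sqrt t) / 2)) (at t)"
      using DERIV_real_sqrt[OF t] by (intro has_vector_derivative_of_real) (simp add: has_real_derivative_iff_has_vector_derivative)
    then have d: "((\<lambda>t. complex_of_real (sqrt t) - \<i> * b) has_vector_derivative complex_of_real (inverse (sqrt t) / 2)) (at t)"
      "((\<lambda>t. complex_of_real (sqrt t) + \<i> * b) has_vector_derivative complex_of_real (inverse (sqrt t) / 2)) (at t)"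
      using has_vector_derivative_diff[OF _ has_vector_derivative_const] has_vector_derivative_add[OF _ has_vector_derivative_const]
      by fastforce+
    have "((\<lambda>t. Ln (complex_of_real (sqrt t) - \<i> * b)) has_vector_derivative complex_of_real (inverse (sqrt t) / 2) * inverse (complex_of_real (sqrt t) - \<i> * b)) (at t)"
      using field_vector_diff_chain_at[OF d(1) has_field_derivative_Ln[OF slit(1)]] by (simp add: o_def)
    moreover have "((\<lambda>t. Ln (complex_of_real (sqrt t) + \<i> * b)) has_vector_derivative complex_of_real (inverse (sqrt t) / 2) * inverse (complex_of_real (sqrt t) + \<i> * b)) (at t)"
      using field_vector_diff_chain_at[OF d(2) has_field_derivative_Ln[OF slit(2)]] by (simp add: o_def)
    ultimately have "(F has_vector_derivative
       (complex_of_real (inverse (sqrt t) / 2) * inverse (complex_of_real (sqrt t) - \<i> * b) - complex_of_real (inverse (sqrt t) / 2) * inverse (complex_of_real (sqrt t) + \<i> * b)) / (\<i> * b)) (at t)"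
      unfolding F_def by (intro has_vector_derivative_divide has_vector_derivative_diff)
    moreover have "(complex_of_real (inverse (sqrt t) / 2) * inverse (complex_of_real (sqrt t) - \<i> * b) - complex_of_real (inverse (sqrt t) / 2) * inverse (complex_of_real (sqrt t) + \<i> * b)) / (\<i> * b) = f t"
    proof -
      define s where "s = complex_of_real (sqrt t)"
      have s: "s * s = complex_of_real t" "s \<noteq> 0" using t by (auto simp: s_def simp flip: of_real_mult)
      have "(s - \<i> * b) * (s + \<i> * b) = complex_of_real t + \<omega>"
        using s b2 by (simp add: algebra_simps power2_eq_square)
      moreover have "t powr (-1/2) = inverse (sqrt t)" using t by (simp add: powr_minus powr_half_sqrt)
      ultimately have ft: "f t = inverse s / ((s - \<i> * b) * (s + \<i> * b))" by (simp add: f_def s_def)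
      have "inverse s / 2 * inverse (s - \<i> * b) - inverse s / 2 * inverse (s + \<i> * b) = inverse s / 2 * (2 * (\<i> * b) / ((s - \<i> * b) * (s + \<i> * b)))"
        using nn unfolding s_def[symmetric] by (simp add: divide_simps)
      then show ?thesis unfolding ft s_def[symmetric] using b0 by (simp add: s_def)
    qed
    ultimately show "(F has_vector_derivative f t) (at t)" by simp
    show "isCont f t" unfolding f_def using t nz[of t] by (intro continuous_intros) auto
  next
    show "set_integrable lborel (einterval 0 \<infinity>) f" using int by (simp add: einterval_def greaterThan_def)
    have "((\<lambda>t. (Ln (complex_of_real (sqrt t) - \<i> * b) - Ln (complex_of_real (sqrt t) + \<i> * b)) / (\<i> * b)) \<longlongrightarrow>
       (Ln (complex_of_real (sqrt 0) - \<i> * b) - Ln (complex_of_real (sqrt 0) + \<i> * b)) / (\<i> * b)) (at_right 0)"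
      using b0 slit[of "sqrt 0"] by (intro tendsto_intros) auto
    moreover have "(Ln (complex_of_real (sqrt 0) - \<i> * b) - Ln (complex_of_real (sqrt 0) + \<i> * b)) / (\<i> * b) = - (pi / b)"
    proof -
      have "Ln (- (\<i> * b)) = Ln (\<i> * b) - \<i> * pi" using Reb b0 by (subst Ln_minus) auto
      then show ?thesis using b0 by simp
    qed
    ultimately have "(F \<longlongrightarrow> - (pi / b)) (at_right 0)" by (simp add: F_def)
    then show "((F \<circ> real_of_ereal) \<longlongrightarrow> - (pi / b)) (at_right 0)"
      by (simp add: zero_ereal_def ereal_tendsto_simps)
    have "((\<lambda>t. (Ln (1 - \<i> * b * complex_of_real (inverse (sqrt t))) - Ln (1 + \<i> * b * complex_of_real (inverse (sqrt t)))) / (\<i> * b)) \<longlongrightarrow> (Ln (1 - \<i> * b * complex_of_real 0) - Ln (1 + \<i> * b * complex_of_real 0)) / (\<i> * b)) at_top"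
      using b0 by (intro tendsto_intros tendsto_inverse_0_at_top sqrt_at_top) auto
    then have "((\<lambda>t. (Ln (1 - \<i> * b * complex_of_real (inverse (sqrt t))) - Ln (1 + \<i> * b * complex_of_real (inverse (sqrt t)))) / (\<i> * b)) \<longlongrightarrow> 0) at_top"
      by simp
    moreover have "eventually (\<lambda>t. (Ln (1 - \<i> * b * complex_of_real (inverse (sqrt t))) - Ln (1 + \<i> * b * complex_of_real (inverse (sqrt t)))) / (\<i> * b) = F t) at_top"
      using eventually_gt_at_top[of 0]
    proof eventually_elim
      case (elim t)
      define s where "s = sqrt t"
      have s: "s > 0" using elim by (simp add: s_def)
      have e: "complex_of_real s - \<i> * b = complex_of_real s * (1 - \<i> * b * complex_of_real (inverse s))"
        "complex_of_real s + \<i> * b = complex_of_real s * (1 + \<i> * b * complex_of_real (inverse s))"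
        using s by (auto simp: field_simps)
      have n: "1 - \<i> * b * complex_of_real (inverse s) \<noteq> 0" "1 + \<i> * b * complex_of_real (inverse s) \<noteq> 0"
        using slit[of s] e by (metis mult_zero_right nonpos_Reals_zero_I)+
      show ?case unfolding F_def s_def[symmetric] e using s n by (simp add: Ln_times_of_real)
    qed
    ultimately have "(F \<longlongrightarrow> 0) at_top" by (rule Lim_transform_eventually)
    then show "((F \<circ> real_of_ereal) \<longlongrightarrow> 0) (at_left \<infinity>)"
      by (simp add: ereal_tendsto_simps)
  qed auto
  then show "(LINT t:{0<..}|lborel. f t) = pi / csqrt \<omega>"
    by (simp add: interval_lebesgue_integral_def b_def einterval_def greaterThan_def)
qed

text \<open>The Poisson kernel is $\mathrm{Im}(1/\omega)/\pi$ for $\omega = x - i\eta$. By partial fractions its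
  second difference leads to two integrals of the type above, with $\omega$ and $-\omega$, and
  $\sqrt{-\omega} = i\sqrt\omega$ turns their sum into $(1-i)\,\omega^{-3/2}$.\<close>

lemma frac_poisson:
  assumes "\<eta> > 0"
  shows "frac_lap (poisson \<eta>) x = Im (jker (Complex x (- \<eta>))) - Re (jker (Complex x (- \<eta>)))"
proof -
  define \<omega> where "\<omega> = Complex x (- \<eta>)"
  define f where "f = (\<lambda>\<omega> t. complex_of_real (t powr (-1/2)) / (complex_of_real t + \<omega>))"
  have im: "Im \<omega> \<noteq> 0" "Im (- \<omega>) \<noteq> 0" using assms by (auto simp: \<omega>_def)
  have w0: "\<omega> \<noteq> 0" using im by auto
  have I: "set_integrable lborel {0<..} (f \<omega>)" "set_integrable lborel {0<..} (f (- \<omega>))"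
    and V: "(LINT t:{0<..}|lborel. f \<omega> t) = pi / csqrt \<omega>" "(LINT t:{0<..}|lborel. f (- \<omega>) t) = pi / csqrt (- \<omega>)"
    unfolding f_def using integral_inverse_sqrt_over_shift[OF im(1)] integral_inverse_sqrt_over_shift[OF im(2)] by auto
  have I2: "set_integrable lborel {0<..} (\<lambda>t. (f \<omega> t + f (- \<omega>) t) / (pi * \<omega>))"
    using I by (intro set_integral_divide_zero set_integrable_divide set_integral_add) auto
  have P: "poisson \<eta> y = Im (1 / (\<omega> + complex_of_real (y - x))) / pi" for y
    using assms by (simp add: poisson_def \<omega>_def Im_divide divide_simps)
  have pw: "(2 * poisson \<eta> x - poisson \<eta> (x + t) - poisson \<eta> (x - t)) * t powr (-3/2) = Im ((f \<omega> t + f (- \<omega>) t) / (pi * \<omega>))" if "t > 0" for t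
  proof -
    have nz: "\<omega> + complex_of_real s \<noteq> 0" for s using im by (auto simp: complex_eq_iff)
    have e: "2 / \<omega> - 1 / (\<omega> + t) - 1 / (\<omega> - t) = t * (1 / (t + \<omega>) + 1 / (t + - \<omega>)) / \<omega>"
      using w0 nz[of t] nz[of "-t"] by (simp add: divide_simps) (simp add: algebra_simps)
    have tp: "t powr (-3/2) * t = t powr (-1/2)" using that by (simp add: powr_mult_base mult.commute)
    have "(2 * poisson \<eta> x - poisson \<eta> (x + t) - poisson \<eta> (x - t)) * t powr (-3/2) = Im ((2 / \<omega> - 1 / (\<omega> + t) - 1 / (\<omega> - t)) * complex_of_real (t powr (-3/2) / pi))"
    proof -
      have Im_scale: "Im (z * complex_of_real r) = Im z * r" for z r by simp
      have "Im (2 / \<omega>) = Im (1 / \<omega> + 1 / \<omega>)" by simp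
      then have "Im (2 / \<omega>) = 2 * Im (1 / \<omega>)" by (simp only: plus_complex.sel)
      then show ?thesis unfolding Im_scale P by (simp add: algebra_simps diff_divide_distrib)
    qed
    also have "(2 / \<omega> - 1 / (\<omega> + t) - 1 / (\<omega> - t)) * complex_of_real (t powr (-3/2) / pi) = complex_of_real (t powr (-3/2) * t) * (1 / (t + \<omega>) + 1 / (t + - \<omega>)) / (pi * \<omega>)"
      unfolding e by (simp add: mult_ac)
    also have "\<dots> = (f \<omega> t + f (- \<omega>) t) / (pi * \<omega>)"
      unfolding tp f_def by (simp add: distrib_left)
    finally show ?thesis .
  qed
  have "frac_lap (poisson \<eta>) x = (LINT t|lborel. Im (indicator {0<..} t *\<^sub>R ((f \<omega> t + f (- \<omega>) t) / (pi * \<omega>))))"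
    unfolding frac_lap_def
  proof (intro Bochner_Integration.integral_cong refl)
    fix t
    show "indicator {0<..} t * ((2 * poisson \<eta> x - poisson \<eta> (x + t) - poisson \<eta> (x - t)) * t powr (-3/2)) = Im (indicator {0<..} t *\<^sub>R ((f \<omega> t + f (- \<omega>) t) / (pi * \<omega>)))"
      using pw[of t] by (cases "t > 0") simp_all
  qed
  also have "\<dots> = Im (LINT t:{0<..}|lborel. (f \<omega> t + f (- \<omega>) t) / (pi * \<omega>))"
    using I2 unfolding set_integrable_def set_lebesgue_integral_def by (rule integral_Im)
  also have "(LINT t:{0<..}|lborel. (f \<omega> t + f (- \<omega>) t) / (pi * \<omega>)) = (pi / csqrt \<omega> + pi / csqrt (- \<omega>)) / (pi * \<omega>)"
    using I V by (simp add: set_integral_divide_zero set_integral_add)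
  also have "csqrt (- \<omega>) = \<i> * csqrt \<omega>" using assms by (intro csqrt_minus) (auto simp: \<omega>_def)
  also have "(pi / csqrt \<omega> + pi / (\<i> * csqrt \<omega>)) / (pi * \<omega>) = (1 - \<i>) * jker \<omega>"
    using w0 by (simp add: jker_def field_simps)
  finally show ?thesis by (simp add: \<omega>_def)
qed

section \<open>The equation for Poisson averages\<close>

lemma corr_normal_density_shift:
  assumes "\<sigma> > 0"
  shows "corr (normal_density 0 \<sigma>) h x = (LINT s|lborel. h (x + \<sigma> * s) * std_normal_density s)"
proof -
  have "corr (normal_density 0 \<sigma>) h x = \<sigma> * (LINT s|lborel. h (x + \<sigma> * s) * normal_density 0 \<sigma> (x + \<sigma> * s - x))"
    unfolding corr_def using assms by (subst lborel_integral_real_affine[where c=\<sigma> and t=x]) auto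
  also have "\<dots> = (LINT s|lborel. \<sigma> * (h (x + \<sigma> * s) * normal_density 0 \<sigma> (x + \<sigma> * s - x)))"
    by simp
  also have "\<dots> = (LINT s|lborel. h (x + \<sigma> * s) * std_normal_density s)"
    using assms by (intro Bochner_Integration.integral_cong)
      (auto simp: normal_density_def real_sqrt_mult power_mult_distrib)
  finally show ?thesis .
qed

lemma
  assumes [measurable]: "h \<in> borel_measurable borel" and b: "\<And>y. \<bar>h y\<bar> \<le> L"
    and lip: "\<And>x t. \<bar>t\<bar> \<le> 1 \<Longrightarrow> \<bar>h (x + t) - h x\<bar> \<le> L * \<bar>t\<bar>"
  shows corr_normal_density_bounded: "\<sigma> > 0 \<Longrightarrow> \<bar>corr (normal_density 0 \<sigma>) h x\<bar> \<le> L"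
    and corr_normal_density_lipschitz: "\<sigma> > 0 \<Longrightarrow> \<bar>t\<bar> \<le> 1 \<Longrightarrow> \<bar>corr (normal_density 0 \<sigma>) h (x + t) - corr (normal_density 0 \<sigma>) h x\<bar> \<le> L * \<bar>t\<bar>"
    and corr_normal_density_tendsto: "(\<lambda>n. corr (normal_density 0 (1 / Suc n)) h x) \<longlonglongrightarrow> h x"
proof -
  have "L \<ge> 0" using b[of 0] by (meson abs_ge_zero order_trans)
  have I: "integrable lborel (\<lambda>s. h (y + r * s) * std_normal_density s)" for y r
    by (rule Bochner_Integration.integrable_bound[of _ "\<lambda>s. L * std_normal_density s"])
       (use b \<open>L \<ge> 0\<close> in \<open>auto simp: abs_mult intro!: mult_right_mono\<close>)
  have N: "(LINT s|lborel. std_normal_density s) = 1" by simp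
  show "\<bar>corr (normal_density 0 \<sigma>) h x\<bar> \<le> L" if "\<sigma> > 0"
  proof -
    have "\<bar>LINT s|lborel. h (x + \<sigma> * s) * std_normal_density s\<bar> \<le> (LINT s|lborel. L * std_normal_density s)"
    proof (intro integral_abs_bound[THEN order_trans] integral_mono)
      show "integrable lborel (\<lambda>s. \<bar>h (x + \<sigma> * s) * std_normal_density s\<bar>)"
        using I[of x \<sigma>] by (rule integrable_abs)
    qed (use b in \<open>auto simp: abs_mult intro!: mult_right_mono\<close>)
    then show ?thesis using that N by (simp add: corr_normal_density_shift)
  qed
  show "\<bar>corr (normal_density 0 \<sigma>) h (x + t) - corr (normal_density 0 \<sigma>) h x\<bar> \<le> L * \<bar>t\<bar>" if "\<sigma> > 0" "\<bar>t\<bar> \<le> 1"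
  proof -
    have "corr (normal_density 0 \<sigma>) h (x + t) - corr (normal_density 0 \<sigma>) h x =
      (LINT s|lborel. (h ((x + \<sigma> * s) + t) - h (x + \<sigma> * s)) * std_normal_density s)"
      using that I[of "x + t" \<sigma>] I[of x \<sigma>]
      by (simp add: corr_normal_density_shift left_diff_distrib add_ac)
    also have "\<bar>\<dots>\<bar> \<le> (LINT s|lborel. L * \<bar>t\<bar> * std_normal_density s)"
    proof (intro integral_abs_bound[THEN order_trans] integral_mono)
      show "integrable lborel (\<lambda>s. \<bar>(h ((x + \<sigma> * s) + t) - h (x + \<sigma> * s)) * std_normal_density s\<bar>)"
        using I[of "x + t" \<sigma>] I[of x \<sigma>] by (intro integrable_abs) (simp add: left_diff_distrib add_ac)
    qed (use lip that in \<open>auto simp: abs_mult intro!: mult_right_mono\<close>)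
    finally show ?thesis using N by simp
  qed
  have cont: "isCont h x"
  proof -
    have "eventually (\<lambda>y. norm (h y - h x) \<le> L * \<bar>y - x\<bar>) (at x)"
      using lip[of "y - x" x for y] unfolding eventually_at by (intro exI[of _ 1]) (auto simp: dist_real_def)
    moreover have "((\<lambda>y. L * \<bar>y - x\<bar>) \<longlongrightarrow> L * \<bar>x - x\<bar>) (at x)" by (intro tendsto_intros)
    ultimately have "((\<lambda>y. h y - h x) \<longlongrightarrow> 0) (at x)"
      by (intro Lim_null_comparison[of "\<lambda>y. h y - h x" "\<lambda>y. L * \<bar>y - x\<bar>"]) auto
    then show ?thesis by (simp add: isCont_def Lim_null[of h])
  qed
  have "(\<lambda>n. LINT s|lborel. h (x + (1 / Suc n) * s) * std_normal_density s) \<longlonglongrightarrow> (LINT s|lborel. h x * std_normal_density s)"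
  proof (rule integral_dominated_convergence[where w="\<lambda>s. L * std_normal_density s"])
    show "AE s in lborel. (\<lambda>n. h (x + (1 / Suc n) * s) * std_normal_density s) \<longlonglongrightarrow> h x * std_normal_density s"
    proof (intro AE_I2 tendsto_intros)
      fix s :: real
      have "(\<lambda>n. x + (1 / real (Suc n)) * s) \<longlonglongrightarrow> x + 0 * s"
        by (intro tendsto_intros LIMSEQ_Suc[OF lim_1_over_n])
      then show "(\<lambda>n. h (x + (1 / real (Suc n)) * s)) \<longlonglongrightarrow> h x"
        using isCont_tendsto_compose[OF cont] by simp
    qed
  qed (use b in \<open>auto simp: abs_mult intro!: mult_right_mono\<close>)
  then show "(\<lambda>n. corr (normal_density 0 (1 / Suc n)) h x) \<longlonglongrightarrow> h x"
    by (simp add: corr_normal_density_shift)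
qed

text \<open>The hypothesis says that the equation holds for Gaussian averages of $u$ and $f$. Since averaging
  commutes with \<open>frac_lap\<close>, it then holds for the Gaussian averages of the Poisson averages. The Poisson
  averages are bounded and Lipschitz, so the width of the Gaussian can go to 0 pointwise. Finally
  \<open>frac_lap\<close> is moved onto the Poisson kernel, where \<open>frac_poisson\<close> evaluates it.\<close>

lemma poisson_identity:
  assumes [measurable]: "u \<in> borel_measurable borel" "f \<in> borel_measurable borel"
    and u: "\<And>y. \<bar>u y\<bar> \<le> K" and f: "\<And>y. \<bar>f y\<bar> \<le> K"
    and weak: "\<And>a \<sigma>. \<sigma> > 0 \<Longrightarrow> (LINT y|lborel. u y * frac_lap (normal_density a \<sigma>) y) = frac_const * (LINT y|lborel. f y * normal_density a \<sigma> y)"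
    and "\<eta> > 0"
  shows "(LINT y|lborel. u y * (Re (jker (Complex (y - x) (- \<eta>))) - Im (jker (Complex (y - x) (- \<eta>))))) = - frac_const * corr (poisson \<eta>) f x"
proof -
  obtain C where nP: "nice_kernel C (poisson \<eta>)" using poisson_nice[OF \<open>\<eta> > 0\<close>] by blast
  have eP: "poisson \<eta> (- y) = poisson \<eta> y" for y by (simp add: poisson_def)
  define \<gamma> where "\<gamma> = (\<lambda>n. normal_density 0 (1 / real (Suc n)))"
  have e\<gamma>: "\<gamma> n (- y) = \<gamma> n y" for n y by (simp add: \<gamma>_def normal_density_def)
  define L where "L = pi * C * K"
  note Pu = corr_bounded_lipschitz[OF nP _ u] corr_bounded_lipschitz[OF nP _ f]
  have Pm [measurable]: "corr (poisson \<eta>) u \<in> borel_measurable borel" "corr (poisson \<eta>) f \<in> borel_measurable borel"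
    using Pu(3,6) by auto
  have bu: "\<bar>corr (poisson \<eta>) u y\<bar> \<le> L" and bf: "\<bar>corr (poisson \<eta>) f y\<bar> \<le> L" for y
    using Pu(1,4) by (auto simp: L_def)
  have lu: "\<bar>corr (poisson \<eta>) u (y + t) - corr (poisson \<eta>) u y\<bar> \<le> L * \<bar>t\<bar>"
    and lf: "\<bar>corr (poisson \<eta>) f (y + t) - corr (poisson \<eta>) f y\<bar> \<le> L * \<bar>t\<bar>" if "\<bar>t\<bar> \<le> 1" for y t
    using Pu(2,5) that by (auto simp: L_def)
  have step: "frac_lap (corr (\<gamma> n) (corr (poisson \<eta>) u)) x = frac_const * corr (\<gamma> n) (corr (poisson \<eta>) f) x" for n
  proof -
    obtain C' where n\<gamma>: "nice_kernel C' (\<gamma> n)" unfolding \<gamma>_def using normal_density_nice[of "1 / real (Suc n)"] by auto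
    define L' where "L' = pi * C' * K"
    note gu = corr_bounded_lipschitz[OF n\<gamma> _ u]
    have [measurable]: "corr (\<gamma> n) u \<in> borel_measurable borel" using gu(3) by simp
    have "frac_lap (corr (\<gamma> n) u) a = frac_const * corr (\<gamma> n) f a" for a
    proof -
      have sh: "normal_density a (1 / real (Suc n)) y = \<gamma> n (y - a)" for y by (simp add: \<gamma>_def normal_density_def)
      have "frac_lap (normal_density a (1 / real (Suc n))) y = frac_lap (\<gamma> n) (y - a)" for y
        unfolding frac_lap_def sh by (simp add: algebra_simps)
      then have "corr (frac_lap (\<gamma> n)) u a = frac_const * corr (\<gamma> n) f a"
        using weak[of "1 / real (Suc n)" a] unfolding corr_def sh by simp
      then show ?thesis using frac_corr_eq_corr_frac[OF n\<gamma> _ u] by simp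
    qed
    then have "corr (poisson \<eta>) (frac_lap (corr (\<gamma> n) u)) x = corr (poisson \<eta>) (\<lambda>a. frac_const * corr (\<gamma> n) f a) x"
      by (simp add: corr_def)
    also have "\<dots> = frac_const * corr (poisson \<eta>) (corr (\<gamma> n) f) x"
      unfolding corr_def[of "poisson \<eta>"] mult.assoc by (rule Bochner_Integration.integral_mult_right_zero)
    also have "\<dots> = frac_const * corr (\<gamma> n) (corr (poisson \<eta>) f) x"
      using corr_commute[OF nP n\<gamma> _ f eP e\<gamma>] by simp
    finally have A: "corr (poisson \<eta>) (frac_lap (corr (\<gamma> n) u)) x = frac_const * corr (\<gamma> n) (corr (poisson \<eta>) f) x" .
    have "corr (poisson \<eta>) (frac_lap (corr (\<gamma> n) u)) x = frac_lap (corr (poisson \<eta>) (corr (\<gamma> n) u)) x"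
      using gu(1,2) by (intro corr_frac_eq_frac_corr[OF nP, where L=L']) (auto simp: L'_def)
    moreover have "corr (poisson \<eta>) (corr (\<gamma> n) u) = corr (\<gamma> n) (corr (poisson \<eta>) u)"
      using corr_commute[OF nP n\<gamma> _ u eP e\<gamma>] by auto
    ultimately show ?thesis using A by simp
  qed
  have "(\<lambda>n. frac_lap (corr (\<gamma> n) (corr (poisson \<eta>) u)) x) \<longlonglongrightarrow> frac_lap (corr (poisson \<eta>) u) x"
  proof (rule frac_tendsto[where L=L])
    fix n
    obtain C' where n\<gamma>: "nice_kernel C' (\<gamma> n)" unfolding \<gamma>_def using normal_density_nice[of "1 / real (Suc n)"] by auto
    show "corr (\<gamma> n) (corr (poisson \<eta>) u) \<in> borel_measurable borel"
      using corr_bounded_lipschitz(3)[OF n\<gamma> Pm(1) bu] .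
  qed (use corr_normal_density_tendsto[OF Pm(1) bu lu] corr_normal_density_bounded[OF Pm(1) bu lu]
         corr_normal_density_lipschitz[OF Pm(1) bu lu] in \<open>auto simp: \<gamma>_def\<close>)
  moreover have "(\<lambda>n. frac_const * corr (\<gamma> n) (corr (poisson \<eta>) f) x) \<longlonglongrightarrow> frac_const * corr (poisson \<eta>) f x"
    using corr_normal_density_tendsto[OF Pm(2) bf lf] unfolding \<gamma>_def by (intro tendsto_intros) auto
  ultimately have "frac_lap (corr (poisson \<eta>) u) x = frac_const * corr (poisson \<eta>) f x"
    unfolding step by (rule LIMSEQ_unique)
  moreover have "frac_lap (corr (poisson \<eta>) u) x = corr (frac_lap (poisson \<eta>)) u x"
    using frac_corr_eq_corr_frac[OF nP _ u] by simp
  moreover have "corr (frac_lap (poisson \<eta>)) u x = - (LINT y|lborel. u y * (Re (jker (Complex (y - x) (- \<eta>))) - Im (jker (Complex (y - x) (- \<eta>)))))"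
    unfolding corr_def frac_poisson[OF \<open>\<eta> > 0\<close>] integral_minus[symmetric]
    by (intro Bochner_Integration.integral_cong refl) (simp add: algebra_simps)
  ultimately show ?thesis by simp
qed

section \<open>The transform with kernel $w^{-3/2}$\<close>

lemma measurable_Complex [measurable]:
  assumes [measurable]: "f \<in> borel_measurable M" "g \<in> borel_measurable M"
  shows "(\<lambda>x. Complex (f x) (g x)) \<in> borel_measurable M"
  unfolding Complex_eq by measurable

lemma measurable_csqrt [measurable]: "csqrt \<in> borel_measurable borel"
proof -
  have [measurable]: "Re \<in> borel_measurable borel" "Im \<in> borel_measurable borel"
    by (auto intro!: borel_measurable_continuous_onI continuous_intros)
  have eq: "csqrt = (\<lambda>z. Complex (sqrt ((cmod z + Re z) / 2))
     ((if Im z \<ge> 0 then 1 else -1) * sqrt ((cmod z - Re z) / 2)))"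
    by (auto simp: fun_eq_iff complex_eq_iff sgn_if)
  show ?thesis unfolding eq by measurable
qed

lemma measurable_jker [measurable]: "jker \<in> borel_measurable borel"
  unfolding jker_def[abs_def] by measurable

lemma inverse_mult_sqrt:
  fixes r :: real
  assumes "r > 0"
  shows "1 / (r * sqrt r) = r powr (-3/2)"
proof -
  have "r * sqrt r = r powr (3/2)"
    using assms powr_mult_base[of r "1/2"] by (simp add: powr_half_sqrt)
  then show ?thesis using powr_minus_divide[of r "3/2"] by simp
qed

lemma norm_jker: "norm (jker w) = norm w powr (-3/2)"
proof (cases "w = 0")
  case False
  then have "0 < norm w" by simp
  from inverse_mult_sqrt[OF this] show ?thesis by (simp add: jker_def norm_divide norm_mult)
qed (simp add: jker_def)

lemma jker_has_field_derivative:
  assumes "w \<notin> \<real>\<^sub>\<le>\<^sub>0"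
  shows "(jker has_field_derivative - (3/2) * (jker w / w)) (at w)"
proof -
  have w: "w \<noteq> 0" using assms by auto
  have "((\<lambda>w. 1 / (w * csqrt w)) has_field_derivative - (csqrt w + w * (1 / (2 * csqrt w))) / (w * csqrt w)\<^sup>2) (at w)"
    using w assms by (auto intro!: derivative_eq_intros simp: divide_simps power2_eq_square)
  moreover have "- (csqrt w + w * (1 / (2 * csqrt w))) / (w * csqrt w)\<^sup>2 = - (3/2) * (jker w / w)"
  proof -
    have "w = csqrt w * csqrt w" by (simp flip: power2_eq_square)
    then have "w / (2 * csqrt w) = csqrt w / 2" using w by (metis (no_types, lifting) csqrt_eq_0 divide_divide_eq_left' nonzero_mult_div_cancel_right)
    then have num: "csqrt w + w * (1 / (2 * csqrt w)) = (3/2) * csqrt w" by simp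
    show ?thesis unfolding num using w by (simp add: jker_def power2_eq_square)
  qed
  ultimately show ?thesis by (simp add: jker_def[abs_def])
qed

lemma powr_minus_3_2_divide: "(r::real) > 0 \<Longrightarrow> r powr (-3/2) / r = r powr (-5/2)"
  using powr_diff[of r "-3/2" 1] by simp

lemma norm_jker_deriv:
  assumes "w \<noteq> 0"
  shows "norm (- (3/2) * (jker w / w)) = 3/2 * norm w powr (-5/2)"
proof -
  have "norm (- (3/2) * (jker w / w)) = 3/2 * (norm w powr (-3/2) / norm w)"
    by (simp add: norm_mult norm_divide norm_jker)
  also have "norm w powr (-3/2) / norm w = norm w powr (-5/2)"
    using assms by (intro powr_minus_3_2_divide) simp
  finally show ?thesis .
qed

lemma norm_Complex_ge_Re: "\<bar>a\<bar> \<le> norm (Complex a b)"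
  and norm_Complex_ge_Im: "\<bar>b\<bar> \<le> norm (Complex a b)"
  using abs_Re_le_cmod[of "Complex a b"] abs_Im_le_cmod[of "Complex a b"] by auto

lemma jker_vertical_lipschitz:
  assumes "t > 0"
  shows "norm (jker (Complex t a) - jker (Complex t b)) \<le> 3/2 * t powr (-5/2) * \<bar>a - b\<bar>"
proof -
  have "norm (jker (Complex t a) - jker (Complex t b)) \<le> 3/2 * t powr (-5/2) * norm (Complex t a - Complex t b)"
  proof (rule field_differentiable_bound[where S="{z. Re z \<ge> t}" and f'="\<lambda>w. - (3/2) * (jker w / w)"])
    fix z assume z: "z \<in> {z. t \<le> Re z}"
    then have "z \<notin> \<real>\<^sub>\<le>\<^sub>0" using assms by (auto simp: complex_nonpos_Reals_iff)
    then show "(jker has_field_derivative - (3/2) * (jker z / z)) (at z within {z. t \<le> Re z})"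
      by (rule has_field_derivative_at_within[OF jker_has_field_derivative])
    have "t \<le> norm z" using z complex_Re_le_cmod[of z] by simp
    then have "norm z powr (-5/2) \<le> t powr (-5/2)" "z \<noteq> 0"
      using assms by (auto intro: powr_mono2')
    then show "norm (- (3/2) * (jker z / z)) \<le> 3/2 * t powr (-5/2)"
      unfolding norm_jker_deriv[OF \<open>z \<noteq> 0\<close>] by simp
  qed (auto simp: convex_halfspace_Re_ge)
  moreover have "Complex t a - Complex t b = Complex 0 (a - b)" by (simp add: complex_eq_iff)
  then have "norm (Complex t a - Complex t b) = \<bar>a - b\<bar>" by (simp add: complex_norm)
  ultimately show ?thesis by simp
qed

lemma Im_jker_real:
  assumes "t > 0"
  shows "Im (jker (Complex t 0)) = 0"
proof -
  have "jker (Complex t 0) = complex_of_real (1 / (t * sqrt t))"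
    using assms by (simp add: jker_def complex_of_real_def[symmetric] csqrt_of_real)
  then show ?thesis by simp
qed

text \<open>The kernel is real on the positive axis, so its imaginary part gains a factor $\eta/t$ compared with
  its size.\<close>

lemma Im_jker_le:
  assumes "t > 0" "\<eta> > 0"
  shows "\<bar>Im (jker (Complex t (- \<eta>)))\<bar> \<le> 3/2 * t powr (-5/2) * \<eta>"
proof -
  have "\<bar>Im (jker (Complex t (- \<eta>)))\<bar> = \<bar>Im (jker (Complex t (- \<eta>)) - jker (Complex t 0))\<bar>"
    by (simp only: minus_complex.sel Im_jker_real[OF assms(1)] diff_0_right)
  also have "\<dots> \<le> norm (jker (Complex t (- \<eta>)) - jker (Complex t 0))" by (rule abs_Im_le_cmod)
  also have "\<dots> \<le> 3/2 * t powr (-5/2) * \<bar>- \<eta> - 0\<bar>" by (rule jker_vertical_lipschitz[OF assms(1)])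
  finally show ?thesis using assms by simp
qed

lemma jker_cnj: "w \<notin> \<real>\<^sub>\<le>\<^sub>0 \<Longrightarrow> jker (cnj w) = cnj (jker w)"
  by (simp add: jker_def cnj_csqrt)

lemma jker_minus: "Im w < 0 \<Longrightarrow> jker (- w) = \<i> * jker w"
  by (simp add: jker_def divide_inverse)

lemma nn_integral_abs_powr_tail:
  fixes p d :: real
  assumes "p > 1" "d > 0"
  shows "(\<integral>\<^sup>+y. ennreal (\<bar>y\<bar> powr - p) * indicator {y. \<bar>y\<bar> \<ge> d} y \<partial>lborel) = ennreal (2 * (d powr (1 - p) / (p - 1)))"
proof -
  let ?I = "\<integral>\<^sup>+y. ennreal (y powr - p) * indicator {d..} y \<partial>lborel"
  have "(\<integral>\<^sup>+y. ennreal (\<bar>y\<bar> powr - p) * indicator {y. \<bar>y\<bar> \<ge> d} y \<partial>lborel) =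
    (\<integral>\<^sup>+y. ennreal (y powr - p) * indicator {d..} y + ennreal ((-y) powr - p) * indicator {d..} (-y) \<partial>lborel)"
    using assms by (intro nn_integral_cong) (auto split: split_indicator)
  also have "\<dots> = ?I + (\<integral>\<^sup>+y. ennreal ((-y) powr - p) * indicator {d..} (-y) \<partial>lborel)"
    by (rule nn_integral_add) auto
  also have "(\<integral>\<^sup>+y. ennreal ((-y) powr - p) * indicator {d..} (-y) \<partial>lborel) = ?I"
    by (subst (2) nn_integral_real_affine[where c="-1" and t=0]) auto
  finally show ?thesis
    using assms nn_integral_powr_tail[of d p] by (simp add: ennreal_plus[symmetric] del: ennreal_plus)
qed

lemma nn_integral_norm_jker:
  assumes "\<eta> > 0"
  shows "(\<integral>\<^sup>+y. ennreal (norm (jker (Complex (y - x) (- \<eta>)))) \<partial>lborel) \<le> ennreal (6 * \<eta> powr (-1/2))"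
proof -
  have "(\<integral>\<^sup>+y. ennreal (norm (jker (Complex (y - x) (- \<eta>)))) \<partial>lborel) = (\<integral>\<^sup>+y. ennreal (norm (jker (Complex y (- \<eta>)))) \<partial>lborel)"
    by (subst nn_integral_real_affine[where c=1 and t=x]) auto
  also have "\<dots> \<le> (\<integral>\<^sup>+y. ennreal (\<eta> powr (-3/2)) * indicator {-\<eta>..\<eta>} y + ennreal (\<bar>y\<bar> powr - (3/2)) * indicator {y. \<bar>y\<bar> \<ge> \<eta>} y \<partial>lborel)"
  proof (rule nn_integral_mono)
    fix y
    show "ennreal (norm (jker (Complex y (- \<eta>)))) \<le> ennreal (\<eta> powr (-3/2)) * indicator {-\<eta>..\<eta>} y + ennreal (\<bar>y\<bar> powr - (3/2)) * indicator {y. \<bar>y\<bar> \<ge> \<eta>} y"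
    proof (cases "\<bar>y\<bar> \<ge> \<eta>")
      case True
      then have "norm (jker (Complex y (- \<eta>))) \<le> \<bar>y\<bar> powr (-3/2)"
        unfolding norm_jker using norm_Complex_ge_Re[of y "-\<eta>"] True assms by (intro powr_mono2') auto
      then show ?thesis using True by (auto intro!: ennreal_leI add_increasing)
    next
      case False
      have "norm (jker (Complex y (- \<eta>))) \<le> \<eta> powr (-3/2)"
        unfolding norm_jker using norm_Complex_ge_Im[of "-\<eta>" y] assms by (intro powr_mono2') auto
      then show ?thesis using False by (auto intro!: ennreal_leI add_increasing2 simp: indicator_def)
    qed
  qed
  also have "\<dots> = (\<integral>\<^sup>+y. ennreal (\<eta> powr (-3/2)) * indicator {-\<eta>..\<eta>} y \<partial>lborel) + (\<integral>\<^sup>+y. ennreal (\<bar>y\<bar> powr - (3/2)) * indicator {y. \<bar>y\<bar> \<ge> \<eta>} y \<partial>lborel)"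
    by (rule nn_integral_add) auto
  also have "(\<integral>\<^sup>+y. ennreal (\<eta> powr (-3/2)) * indicator {-\<eta>..\<eta>} y \<partial>lborel) = ennreal (\<eta> powr (-3/2) * (2 * \<eta>))"
    using assms by (subst nn_integral_cmult_indicator) (auto simp: ennreal_mult)
  also have "(\<integral>\<^sup>+y. ennreal (\<bar>y\<bar> powr - (3/2)) * indicator {y. \<bar>y\<bar> \<ge> \<eta>} y \<partial>lborel) = ennreal (2 * (\<eta> powr (1 - 3/2) / (3/2 - 1)))"
    using assms by (intro nn_integral_abs_powr_tail) auto
  also have "ennreal (\<eta> powr (-3/2) * (2 * \<eta>)) + ennreal (2 * (\<eta> powr (1 - 3/2) / (3/2 - 1))) = ennreal (\<eta> powr (-3/2) * (2 * \<eta>) + 2 * (\<eta> powr (1 - 3/2) / (3/2 - 1)))"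
    using assms by (intro ennreal_plus[symmetric]) auto
  also have "\<eta> powr (-3/2) * (2 * \<eta>) + 2 * (\<eta> powr (1 - 3/2) / (3/2 - 1)) = 6 * \<eta> powr (-1/2)"
    using assms powr_mult_base[of \<eta> "-3/2"] by (simp add: mult.commute)
  finally show ?thesis .
qed

lemma nn_integral_norm_jker_right:
  assumes "d > 0"
  shows "(\<integral>\<^sup>+y. ennreal (norm (jker (Complex (y - x) b))) * indicator {x + d..} y \<partial>lborel) \<le> ennreal (2 * d powr (-1/2))"
proof -
  have "(\<integral>\<^sup>+y. ennreal (norm (jker (Complex (y - x) b))) * indicator {x + d..} y \<partial>lborel)
     = (\<integral>\<^sup>+y. ennreal (norm (jker (Complex y b))) * indicator {d..} y \<partial>lborel)"
    by (subst nn_integral_real_affine[where c=1 and t=x]) (auto simp: indicator_def)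
  also have "\<dots> \<le> (\<integral>\<^sup>+y. ennreal (y powr - (3/2)) * indicator {d..} y \<partial>lborel)"
  proof (rule nn_integral_mono)
    fix y
    have "norm (jker (Complex y b)) \<le> y powr (-3/2)" if "y \<ge> d"
      unfolding norm_jker using norm_Complex_ge_Re[of y b] assms that by (intro powr_mono2') auto
    then show "ennreal (norm (jker (Complex y b))) * indicator {d..} y \<le> ennreal (y powr - (3/2)) * indicator {d..} y"
      by (auto split: split_indicator intro!: ennreal_leI)
  qed
  also have "\<dots> = ennreal (2 * d powr (-1/2))"
    using nn_integral_powr_tail[of d "3/2"] assms by simp
  finally show ?thesis .
qed

lemma nn_integral_powr_52:
  assumes "d > 0" "c \<ge> 0" "\<And>y. y \<ge> d \<Longrightarrow> f y \<le> 3/2 * y powr (-5/2) * c"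
    and [measurable]: "f \<in> borel_measurable borel"
  shows "(\<integral>\<^sup>+y. ennreal (f (y - x)) * indicator {x + d..} y \<partial>lborel) \<le> ennreal (c * d powr (-3/2))"
proof -
  have "(\<integral>\<^sup>+y. ennreal (f (y - x)) * indicator {x + d..} y \<partial>lborel)
     = (\<integral>\<^sup>+y. ennreal (f y) * indicator {d..} y \<partial>lborel)"
    by (subst nn_integral_real_affine[where c=1 and t=x]) (auto simp: indicator_def)
  also have "\<dots> \<le> (\<integral>\<^sup>+y. ennreal (3/2 * c) * (ennreal (y powr - (5/2)) * indicator {d..} y) \<partial>lborel)"
    using assms by (intro nn_integral_mono) (auto split: split_indicator simp: ennreal_mult[symmetric] mult_ac intro!: ennreal_leI)
  also have "\<dots> = ennreal (3/2 * c) * ennreal (d powr (1 - 5/2) / (5/2 - 1))"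
    using assms nn_integral_powr_tail[of d "5/2"] by (subst nn_integral_cmult) auto
  also have "\<dots> = ennreal (c * d powr (-3/2))"
    using assms by (simp add: ennreal_mult[symmetric])
  finally show ?thesis .
qed

text \<open>Formally the $3/2$-order analogue of the Cauchy transform. It is holomorphic in the upper half-plane
  for bounded $g$, as the kernel is integrable there.\<close>

definition jtrans :: "(real \<Rightarrow> real) \<Rightarrow> complex \<Rightarrow> complex" where
  "jtrans g z = (LINT y|lborel. g y *\<^sub>R jker (complex_of_real y - z))"

lemma of_real_minus_Complex: "complex_of_real y - Complex x \<eta> = Complex (y - x) (- \<eta>)"
  by (simp add: complex_eq_iff)

lemma jtrans_Complex: "jtrans g (Complex x \<eta>) = (LINT y|lborel. g y *\<^sub>R jker (Complex (y - x) (- \<eta>)))"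
  by (simp add: jtrans_def of_real_minus_Complex)

definition bdd_fun :: "real \<Rightarrow> (real \<Rightarrow> real) \<Rightarrow> bool" where
  "bdd_fun K g \<longleftrightarrow> g \<in> borel_measurable borel \<and> (\<forall>y. \<bar>g y\<bar> \<le> K)"

lemma bdd_funD: "bdd_fun K g \<Longrightarrow> g \<in> borel_measurable borel" "bdd_fun K g \<Longrightarrow> \<bar>g y\<bar> \<le> K" "bdd_fun K g \<Longrightarrow> K \<ge> 0"
  unfolding bdd_fun_def by (auto intro: order_trans[OF abs_ge_zero])

lemma bdd_fun_nn_integral_le:
  fixes F :: "real \<Rightarrow> 'b :: real_normed_vector"
  assumes "bdd_fun K g" "(\<integral>\<^sup>+y. ennreal (norm (F y)) * indicator S y \<partial>lborel) \<le> ennreal B" "\<And>y. y \<notin> S \<Longrightarrow> g y = 0"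
    and [measurable]: "(\<lambda>y. norm (F y)) \<in> borel_measurable borel" "S \<in> sets borel"
  shows "(\<integral>\<^sup>+y. ennreal (norm (g y *\<^sub>R F y)) \<partial>lborel) \<le> ennreal (K * B)"
proof -
  have K: "K \<ge> 0" using bdd_funD(3)[OF assms(1)] .
  have "(\<integral>\<^sup>+y. ennreal (norm (g y *\<^sub>R F y)) \<partial>lborel) \<le> (\<integral>\<^sup>+y. ennreal K * (ennreal (norm (F y)) * indicator S y) \<partial>lborel)"
    using bdd_funD(2)[OF assms(1)] assms(3) K
    by (intro nn_integral_mono) (auto split: split_indicator simp: ennreal_mult[symmetric] intro!: ennreal_leI mult_right_mono)
  also have "\<dots> \<le> ennreal K * ennreal B"
    using assms(2) by (subst nn_integral_cmult) (auto intro!: mult_left_mono)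
  also have "\<dots> = ennreal (K * B)" using K by (simp add: ennreal_mult')
  finally show ?thesis .
qed

lemma jtrans_integrable:
  assumes "bdd_fun K g" "\<eta> > 0"
  shows "integrable lborel (\<lambda>y. g y *\<^sub>R jker (Complex (y - x) (- \<eta>)))"
proof (rule integrable_of_nn_integral_le)
  have [measurable]: "g \<in> borel_measurable borel" using bdd_funD(1)[OF assms(1)] .
  show "(\<lambda>y. g y *\<^sub>R jker (Complex (y - x) (- \<eta>))) \<in> borel_measurable lborel" by measurable
  show "(\<integral>\<^sup>+y. ennreal (norm (g y *\<^sub>R jker (Complex (y - x) (- \<eta>)))) \<partial>lborel) \<le> ennreal (K * (6 * \<eta> powr (-1/2)))"
    using nn_integral_norm_jker[OF assms(2)] by (intro bdd_fun_nn_integral_le[OF assms(1), of _ UNIV]) auto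
qed

lemma jtrans_bound:
  assumes "bdd_fun K g" "\<eta> > 0"
  shows "norm (jtrans g (Complex x \<eta>)) \<le> K * (6 * \<eta> powr (-1/2))"
  unfolding jtrans_Complex using nn_integral_norm_jker[OF assms(2)] bdd_funD(3)[OF assms(1)]
  by (intro norm_integral_le_of_nn_integral bdd_fun_nn_integral_le[OF assms(1), of _ UNIV]) auto

text \<open>If $g$ vanishes on a neighbourhood of $(-\infty, x]$, the bound is uniform up to the real axis. This
  and the two lemmas on its vertical variation and imaginary part are used with $x$ at distance $d$ to
  the left of the support.\<close>

lemma jtrans_right_bound:
  assumes "bdd_fun K g" "d > 0" "\<And>y. y < x + d \<Longrightarrow> g y = 0"
  shows "norm (jtrans g (Complex x \<eta>)) \<le> K * (2 * d powr (-1/2))"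
  unfolding jtrans_Complex using nn_integral_norm_jker_right[OF assms(2)] bdd_funD(3)[OF assms(1)] assms(3)
  by (intro norm_integral_le_of_nn_integral bdd_fun_nn_integral_le[OF assms(1), of _ "{x + d..}"]) auto

lemma jtrans_right_vertical:
  assumes "bdd_fun K g" "d > 0" "\<And>y. y < x + d \<Longrightarrow> g y = 0" "\<eta> > 0" "\<eta>' > 0"
  shows "norm (jtrans g (Complex x \<eta>) - jtrans g (Complex x \<eta>')) \<le> K * (\<bar>\<eta> - \<eta>'\<bar> * d powr (-3/2))"
proof -
  have "jtrans g (Complex x \<eta>) - jtrans g (Complex x \<eta>') = (LINT y|lborel. g y *\<^sub>R (jker (Complex (y - x) (- \<eta>)) - jker (Complex (y - x) (- \<eta>'))))"
    unfolding jtrans_Complex scaleR_right_diff_distrib using assms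
    by (intro Bochner_Integration.integral_diff[symmetric] jtrans_integrable[OF assms(1)])
  moreover have "(\<integral>\<^sup>+y. ennreal (norm (jker (Complex (y - x) (- \<eta>)) - jker (Complex (y - x) (- \<eta>')))) * indicator {x + d..} y \<partial>lborel) \<le> ennreal (\<bar>\<eta> - \<eta>'\<bar> * d powr (-3/2))"
    using jker_vertical_lipschitz[of _ "- \<eta>" "- \<eta>'"] assms(2)
    by (intro nn_integral_powr_52[where f="\<lambda>y. norm (jker (Complex y (- \<eta>)) - jker (Complex y (- \<eta>')))"])
       (auto simp: abs_minus_commute)
  then have "norm (LINT y|lborel. g y *\<^sub>R (jker (Complex (y - x) (- \<eta>)) - jker (Complex (y - x) (- \<eta>')))) \<le> K * (\<bar>\<eta> - \<eta>'\<bar> * d powr (-3/2))"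
    using bdd_funD(3)[OF assms(1)] assms(3)
    by (intro norm_integral_le_of_nn_integral bdd_fun_nn_integral_le[OF assms(1), of _ "{x + d..}"]) auto
  ultimately show ?thesis by simp
qed

lemma Im_jtrans:
  assumes "bdd_fun K g" "\<eta> > 0"
  shows "Im (jtrans g (Complex x \<eta>)) = (LINT y|lborel. g y * Im (jker (Complex (y - x) (- \<eta>))))"
    and "Re (jtrans g (Complex x \<eta>)) = (LINT y|lborel. g y * Re (jker (Complex (y - x) (- \<eta>))))"
  unfolding jtrans_Complex using jtrans_integrable[OF assms, of x]
  by (simp_all flip: integral_Im integral_Re)

lemma jtrans_right_Im:
  assumes "bdd_fun K g" "d > 0" "\<And>y. y < x + d \<Longrightarrow> g y = 0" "\<eta> > 0"
  shows "\<bar>Im (jtrans g (Complex x \<eta>))\<bar> \<le> K * (\<eta> * d powr (-3/2))"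
proof -
  have "(\<integral>\<^sup>+y. ennreal (norm (Im (jker (Complex (y - x) (- \<eta>))))) * indicator {x + d..} y \<partial>lborel) \<le> ennreal (\<eta> * d powr (-3/2))"
    using Im_jker_le assms(2,4)
    by (intro nn_integral_powr_52[where f="\<lambda>y. norm (Im (jker (Complex y (- \<eta>))))"]) auto
  then have "norm (LINT y|lborel. g y *\<^sub>R Im (jker (Complex (y - x) (- \<eta>)))) \<le> K * (\<eta> * d powr (-3/2))"
    using bdd_funD(3)[OF assms(1)] assms(3,4)
    by (intro norm_integral_le_of_nn_integral bdd_fun_nn_integral_le[OF assms(1), of _ "{x + d..}"]) auto
  then show ?thesis by (simp add: Im_jtrans[OF assms(1,4)])
qed

text \<open>The reflection $y \mapsto -y$ exchanges the two half-lines; the branch of $w^{-3/2}$ contributes the factor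
  $i$. Every estimate to the right of the support follows from its mirror image.\<close>

lemma jtrans_reflect:
  assumes "Im z > 0"
  shows "\<i> * jtrans g z = cnj (jtrans (\<lambda>y. g (- y)) (- cnj z))"
proof -
  have "jtrans (\<lambda>y. g (- y)) (- cnj z) = (LINT y|lborel. g y *\<^sub>R jker (complex_of_real (- y) + cnj z))"
    unfolding jtrans_def by (subst lborel_integral_real_affine[where c="-1" and t=0]) auto
  also have "\<dots> = (LINT y|lborel. cnj (g y *\<^sub>R (\<i> * jker (complex_of_real y - z))))"
  proof (intro Bochner_Integration.integral_cong refl)
    fix y
    have c: "complex_of_real (- y) + cnj z = cnj (- (complex_of_real y - z))" by simp
    have "- (complex_of_real y - z) \<notin> \<real>\<^sub>\<le>\<^sub>0" using assms by (auto simp: complex_nonpos_Reals_iff)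
    then have "jker (complex_of_real (- y) + cnj z) = cnj (jker (- (complex_of_real y - z)))"
      unfolding c by (rule jker_cnj)
    also have "jker (- (complex_of_real y - z)) = \<i> * jker (complex_of_real y - z)"
      using assms by (intro jker_minus) simp
    finally show "g y *\<^sub>R jker (complex_of_real (- y) + cnj z) = cnj (g y *\<^sub>R (\<i> * jker (complex_of_real y - z)))"
      by simp
  qed
  also have "\<dots> = cnj (LINT y|lborel. g y *\<^sub>R (\<i> * jker (complex_of_real y - z)))"
    by (rule Bochner_Integration.integral_cnj)
  also have "(LINT y|lborel. g y *\<^sub>R (\<i> * jker (complex_of_real y - z))) = \<i> * jtrans g z"
    unfolding jtrans_def mult_scaleR_right[symmetric] by (rule Bochner_Integration.integral_mult_right_zero)
  finally show ?thesis by simp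
qed

lemma jtrans_add:
  assumes "bdd_fun K g" "bdd_fun K' h" "\<eta> > 0"
  shows "jtrans (\<lambda>y. g y + h y) (Complex x \<eta>) = jtrans g (Complex x \<eta>) + jtrans h (Complex x \<eta>)"
  unfolding jtrans_Complex scaleR_left_distrib
  by (intro Bochner_Integration.integral_add jtrans_integrable[OF assms(1,3)] jtrans_integrable[OF assms(2,3)])

text \<open>Differentiation under the integral: difference quotients of the kernel at $z_0$ are dominated by a
  multiple of the kernel itself, because $|w|^{-5/2} \le |w|^{-3/2}/\mathrm{Im}\,z_0$ there.\<close>

lemma jtrans_field_differentiable:
  assumes g: "bdd_fun K g" and z0: "Im z0 > 0"
  shows "jtrans g field_differentiable (at z0)"
proof -
  have [measurable]: "g \<in> borel_measurable borel" using bdd_funD(1)[OF g] .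
  have K: "K \<ge> 0" using bdd_funD(3)[OF g] .
  define r where "r = Im z0 / 2"
  have r: "r > 0" using z0 by (simp add: r_def)
  define D where "D = (\<lambda>y. 3/2 * (jker (complex_of_real y - z0) / (complex_of_real y - z0)))"
  define A where "A = 3/2 * (1/2) powr (-5/2) / Im z0"
  have I: "integrable lborel (\<lambda>y. g y *\<^sub>R jker (complex_of_real y - z))" if "Im z > 0" for z
    using jtrans_integrable[OF g that, of "Re z"] by (simp flip: of_real_minus_Complex)
  have bound: "norm ((jker (complex_of_real y - (z0 + h)) - jker (complex_of_real y - z0)) / h) \<le> A * norm (jker (complex_of_real y - z0))"
    if h: "norm h < r" "h \<noteq> 0" for y h
  proof -
    define w where "w = complex_of_real y - z0"
    have w: "norm w \<ge> Im z0" using abs_Im_le_cmod[of w] by (simp add: w_def)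
    have w0: "norm w > 0" using w z0 by linarith
    have "norm (jker (w - h) - jker w) \<le> 3/2 * (norm w / 2) powr (-5/2) * norm ((w - h) - w)"
    proof (rule field_differentiable_bound[where S="ball w r" and f'="\<lambda>w. - (3/2) * (jker w / w)"])
      fix v assume v: "v \<in> ball w r"
      have "Im v < 0"
      proof -
        have "\<bar>Im v - Im w\<bar> < r" using v abs_Im_le_cmod[of "v - w"] by (simp add: dist_norm norm_minus_commute)
        then have "Im v - Im w < r" by (simp only: abs_less_iff)
        then show ?thesis using z0 by (simp add: w_def r_def)
      qed
      then show "(jker has_field_derivative - (3/2) * (jker v / v)) (at v within ball w r)"
        by (intro has_field_derivative_at_within[OF jker_has_field_derivative]) (auto simp: complex_nonpos_Reals_iff)
      have "norm w - norm v \<le> norm (w - v)" by (rule norm_triangle_ineq2)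
      then have *: "norm w / 2 \<le> norm v" using v w by (simp add: dist_norm r_def)
      show "norm (- (3/2) * (jker v / v)) \<le> 3/2 * (norm w / 2) powr (-5/2)"
      proof -
        from * have "norm v powr (-5/2) \<le> (norm w / 2) powr (-5/2)" "v \<noteq> 0" using w0 by (auto intro: powr_mono2')
        then show ?thesis unfolding norm_jker_deriv[OF \<open>v \<noteq> 0\<close>] by simp
      qed
    qed (use h r in \<open>auto simp: dist_norm\<close>)
    also have "(norm w / 2) powr (-5/2) = (1/2) powr (-5/2) * (norm w powr (-3/2) * norm w powr (-1))"
    proof -
      have e: "-3/2 + (-1) = (-5/2::real)" by simp
      have "norm w powr (-3/2 + (-1)) = norm w powr (-3/2) * norm w powr (-1)" by (rule powr_add)
      moreover have "(1/2 * norm w) powr (-5/2) = (1/2) powr (-5/2) * norm w powr (-5/2)" by (rule powr_mult)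
      ultimately show ?thesis unfolding e by simp
    qed
    finally have "norm (jker (w - h) - jker w) / norm h \<le> 3/2 * ((1/2) powr (-5/2) * (norm w powr (-3/2) * norm w powr (-1)))"
      using h by (simp add: pos_divide_le_eq)
    also have "\<dots> \<le> 3/2 * ((1/2) powr (-5/2) * (norm w powr (-3/2) * (1 / Im z0)))"
    proof -
      have "norm w powr (-1) \<le> 1 / Im z0" using w z0 w0 by (simp add: powr_minus divide_inverse le_imp_inverse_le)
      then show ?thesis by (intro mult_left_mono) auto
    qed
    finally show ?thesis by (simp add: A_def w_def norm_jker norm_divide algebra_simps)
  qed
  have "((\<lambda>h. (jtrans g (z0 + h) - jtrans g z0) / h) \<longlongrightarrow> (LINT y|lborel. g y *\<^sub>R D y)) (at 0)"
    unfolding tendsto_at_iff_sequentially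
  proof (intro allI impI)
    fix X :: "nat \<Rightarrow> complex"
    assume X0: "\<forall>i. X i \<in> UNIV - {0}" and X: "X \<longlonglongrightarrow> 0"
    obtain N where N: "\<And>n. n \<ge> N \<Longrightarrow> norm (X n) < r"
      using X r unfolding LIMSEQ_iff by auto
    have "(\<lambda>n. LINT y|lborel. g y *\<^sub>R ((jker (complex_of_real y - (z0 + X (n + N))) - jker (complex_of_real y - z0)) / X (n + N))) \<longlonglongrightarrow> (LINT y|lborel. g y *\<^sub>R D y)"
    proof (rule integral_dominated_convergence[where w="\<lambda>y. A * norm (g y *\<^sub>R jker (complex_of_real y - z0))"])
      show "integrable lborel (\<lambda>y. A * norm (g y *\<^sub>R jker (complex_of_real y - z0)))"
        using I[OF z0] by (intro integrable_mult_right integrable_norm)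
      show "AE y in lborel. (\<lambda>n. g y *\<^sub>R ((jker (complex_of_real y - (z0 + X (n + N))) - jker (complex_of_real y - z0)) / X (n + N))) \<longlonglongrightarrow> g y *\<^sub>R D y"
      proof (intro AE_I2 tendsto_scaleR tendsto_const)
        fix y
        have "((\<lambda>z. jker (complex_of_real y - z)) has_field_derivative - (- (3/2) * (jker (complex_of_real y - z0) / (complex_of_real y - z0)))) (at z0)"
        proof -
          have "complex_of_real y - z0 \<notin> \<real>\<^sub>\<le>\<^sub>0" using z0 by (auto simp: complex_nonpos_Reals_iff)
          note d = jker_has_field_derivative[OF this]
          have "((\<lambda>z. complex_of_real y - z) has_field_derivative -1) (at z0)" by (auto intro!: derivative_eq_intros)
          from DERIV_chain2[where g="\<lambda>z. complex_of_real y - z", OF d this] show ?thesis by simp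
        qed
        then have "((\<lambda>h. (jker (complex_of_real y - (z0 + h)) - jker (complex_of_real y - z0)) / h) \<longlongrightarrow> D y) (at 0)"
          by (simp add: DERIV_def D_def)
        then show "(\<lambda>n. (jker (complex_of_real y - (z0 + X (n + N))) - jker (complex_of_real y - z0)) / X (n + N)) \<longlonglongrightarrow> D y"
          unfolding tendsto_at_iff_sequentially o_def
          using X0 LIMSEQ_ignore_initial_segment[OF X, of N] by (auto dest!: spec[of _ "\<lambda>n. X (n + N)"])
      qed
      show "AE y in lborel. norm (g y *\<^sub>R ((jker (complex_of_real y - (z0 + X (n + N))) - jker (complex_of_real y - z0)) / X (n + N))) \<le> A * norm (g y *\<^sub>R jker (complex_of_real y - z0))" for n
      proof (intro AE_I2)
        fix y
        show "norm (g y *\<^sub>R ((jker (complex_of_real y - (z0 + X (n + N))) - jker (complex_of_real y - z0)) / X (n + N))) \<le> A * norm (g y *\<^sub>R jker (complex_of_real y - z0))"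
          using mult_left_mono[OF bound[of "X (n + N)" y], of "\<bar>g y\<bar>"] N[of "n + N"] X0 by (simp add: mult_ac)
      qed
    qed (unfold D_def, measurable)
    moreover have "(LINT y|lborel. g y *\<^sub>R ((jker (complex_of_real y - (z0 + X (n + N))) - jker (complex_of_real y - z0)) / X (n + N))) = (jtrans g (z0 + X (n + N)) - jtrans g z0) / X (n + N)" for n
    proof -
      have "Im (z0 + X (n + N)) > 0"
        using N[of "n + N"] abs_Im_le_cmod[of "X (n + N)"] z0 by (simp add: r_def)
      note I1 = I[OF this]
      have "(LINT y|lborel. g y *\<^sub>R ((jker (complex_of_real y - (z0 + X (n + N))) - jker (complex_of_real y - z0)) / X (n + N))) =
        (LINT y|lborel. (g y *\<^sub>R jker (complex_of_real y - (z0 + X (n + N))) - g y *\<^sub>R jker (complex_of_real y - z0)) / X (n + N))"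
        by (intro Bochner_Integration.integral_cong refl) (simp add: scaleR_conv_of_real right_diff_distrib diff_divide_distrib)
      also have "\<dots> = (jtrans g (z0 + X (n + N)) - jtrans g z0) / X (n + N)"
        unfolding jtrans_def Bochner_Integration.integral_diff[OF I1 I[OF z0], symmetric] by (rule Bochner_Integration.integral_divide_zero)
      finally show ?thesis .
    qed
    ultimately have "(\<lambda>n. (jtrans g (z0 + X (n + N)) - jtrans g z0) / X (n + N)) \<longlonglongrightarrow> (LINT y|lborel. g y *\<^sub>R D y)"
      by simp
    then have "(\<lambda>n. (jtrans g (z0 + X n) - jtrans g z0) / X n) \<longlonglongrightarrow> (LINT y|lborel. g y *\<^sub>R D y)"
      by (rule LIMSEQ_offset)
    then show "((\<lambda>h. (jtrans g (z0 + h) - jtrans g z0) / h) \<circ> X) \<longlonglongrightarrow> (LINT y|lborel. g y *\<^sub>R D y)"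
      by (simp add: o_def)
  qed
  then show ?thesis
    unfolding field_differentiable_def DERIV_def by blast
qed

section \<open>Half-integration of the transform\<close>

lemma csqrt_of_real_mult:
  assumes "r > 0"
  shows "csqrt (complex_of_real r * z) = complex_of_real (sqrt r) * csqrt z"
proof (rule csqrt_unique)
  show "(complex_of_real (sqrt r) * csqrt z)\<^sup>2 = complex_of_real r * z"
    using assms by (simp add: power_mult_distrib flip: of_real_power)
  show "0 < Re (complex_of_real (sqrt r) * csqrt z) \<or> Re (complex_of_real (sqrt r) * csqrt z) = 0 \<and> 0 \<le> Im (complex_of_real (sqrt r) * csqrt z)"
    using csqrt_principal[of z] assms by (auto simp del: csqrt.simps)
qed

text \<open>An antiderivative is $\frac{2}{\omega}\sqrt{s/(s+\omega)}$.\<close>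

lemma half_integral_jker:
  assumes "Im \<omega> < 0"
  defines "f \<equiv> (\<lambda>s. s powr (-1/2) *\<^sub>R jker (complex_of_real s + \<omega>))"
  shows "set_integrable lborel {0<..} f" "(LINT s:{0<..}|lborel. f s) = 2 / \<omega>"
proof -
  have w0: "\<omega> \<noteq> 0" "Im \<omega> \<noteq> 0" using assms by auto
  have slit: "complex_of_real s + \<omega> \<notin> \<real>\<^sub>\<le>\<^sub>0" for s using assms by (auto simp: complex_nonpos_Reals_iff)
  have nz: "complex_of_real s + \<omega> \<noteq> 0" for s using slit[of s] by auto
  define M where "M = 1 / \<bar>Im \<omega>\<bar> + cmod \<omega> / \<bar>Im \<omega>\<bar>"
  have M: "M \<ge> 0" by (simp add: M_def)
  show int: "set_integrable lborel {0<..} f"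
    unfolding set_integrable_def
  proof (rule Bochner_Integration.integrable_bound)
    show "integrable lborel (\<lambda>t::real. M powr (3/2) * (indicator {0<..} t * (min 1 t * t powr (-3/2))))"
      by (intro integrable_mult_right integrable_min_powr)
    show "(\<lambda>t. indicator {0<..} t *\<^sub>R f t) \<in> borel_measurable lborel"
      unfolding f_def by measurable
    have "norm (indicator {0<..} t *\<^sub>R f t) \<le> norm (M powr (3/2) * (indicator {0<..} t * (min 1 t * t powr (-3/2))))" for t :: real
    proof (cases "t > 0")
      case True
      define q where "q = min 1 t / t"
      have q: "0 < q" "q \<le> 1" using True by (auto simp: q_def)
      have "norm (jker (complex_of_real t + \<omega>)) = (1 / cmod (complex_of_real t + \<omega>)) powr (3/2)"
      proof -
        have "cmod (complex_of_real t + \<omega>) powr - (3/2) = 1 / cmod (complex_of_real t + \<omega>) powr (3/2)" by (rule powr_minus_divide)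
        moreover have "(1 / cmod (complex_of_real t + \<omega>)) powr (3/2) = 1 powr (3/2) / cmod (complex_of_real t + \<omega>) powr (3/2)" by (rule powr_divide)
        ultimately show ?thesis by (simp add: norm_jker)
      qed
      also have "\<dots> \<le> (M * q) powr (3/2)"
        using inverse_shift_bound[OF w0(2) True] by (intro powr_mono2) (auto simp: M_def q_def)
      also have "\<dots> = M powr (3/2) * q powr (3/2)" by (rule powr_mult)
      also have "\<dots> \<le> M powr (3/2) * q"
      proof (rule mult_left_mono)
        have "q powr (3/2) \<le> q powr 1" using q by (intro powr_mono') auto
        then show "q powr (3/2) \<le> q" using q by simp
      qed simp
      finally have "t powr (-1/2) * norm (jker (complex_of_real t + \<omega>)) \<le> t powr (-1/2) * (M powr (3/2) * q)"
        by (rule mult_left_mono) simp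
      also have "\<dots> = M powr (3/2) * (min 1 t * (t powr (-1/2) / t))" by (simp add: q_def)
      also have "t powr (-1/2) / t = t powr (-3/2)" using powr_diff[of t "-1/2" 1] True by simp
      finally show ?thesis using True by (simp add: f_def)
    qed simp
    then show "AE t in lborel. norm (indicator {0<..} t *\<^sub>R f t) \<le> norm (M powr (3/2) * (indicator {0<..} t * (min 1 t * t powr (-3/2))))"
      by simp
  qed
  define F where "F = (\<lambda>s::real. 2 / \<omega> * (complex_of_real (sqrt s) * (1 / csqrt (complex_of_real s + \<omega>))))"
  have "(LBINT t=0..\<infinity>. f t) = 2 / \<omega> - 0"
  proof (rule interval_integral_FTC_integrable)
    fix t :: real assume "0 < ereal t"
    then have t: "t > 0" by simp
    define c where "c = csqrt (complex_of_real t + \<omega>)"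
    have c0: "c \<noteq> 0" using nz[of t] by (simp add: c_def)
    have c2: "c * c = complex_of_real t + \<omega>" by (simp add: c_def flip: power2_eq_square)
    have d1: "((\<lambda>t. complex_of_real (sqrt t)) has_vector_derivative complex_of_real (inverse (sqrt t) / 2)) (at t)"
      using DERIV_real_sqrt[OF t] by (intro has_vector_derivative_of_real) (simp add: has_real_derivative_iff_has_vector_derivative)
    have d: "((\<lambda>z. 1 / csqrt (z + \<omega>)) has_field_derivative - (1 / (2 * c)) / (c * c)) (at (complex_of_real t))"
      using c0 slit[of t] unfolding c_def by (auto intro!: derivative_eq_intros simp: power2_eq_square)
    have d2: "((\<lambda>t. 1 / csqrt (complex_of_real t + \<omega>)) has_vector_derivative - (1 / (2 * c)) / (c * c)) (at t)"
    proof -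
      have "((\<lambda>x. complex_of_real x) has_vector_derivative of_real 1) (at t)"
        by (rule has_vector_derivative_of_real[OF DERIV_ident])
      from field_vector_diff_chain_at[OF this d] show ?thesis by (simp add: o_def)
    qed
    have "(F has_vector_derivative 2 / \<omega> * (complex_of_real (sqrt t) * (- (1 / (2 * c)) / (c * c)) + complex_of_real (inverse (sqrt t) / 2) * (1 / c))) (at t)"
      unfolding F_def using has_vector_derivative_mult[OF d1 d2] by (intro has_vector_derivative_mult_right) (simp add: c_def)
    moreover have "2 / \<omega> * (complex_of_real (sqrt t) * (- (1 / (2 * c)) / (c * c)) + complex_of_real (inverse (sqrt t) / 2) * (1 / c)) = f t"
    proof -
      define s where "s = complex_of_real (sqrt t)"
      have s: "s * s = complex_of_real t" "s \<noteq> 0" using t by (auto simp: s_def simp flip: of_real_mult)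
      have w: "\<omega> = c * c - s * s" using c2 s by (simp add: algebra_simps)
      have "t powr (-1/2) = inverse (sqrt t)" using t by (simp add: powr_minus powr_half_sqrt)
      then have "f t = inverse s * (1 / ((complex_of_real t + \<omega>) * c))"
        by (simp add: f_def jker_def c_def s_def scaleR_conv_of_real)
      also have "\<dots> = 1 / (s * (c * c * c))"
        unfolding c2[symmetric] by (simp add: divide_inverse)
      finally have "f t = 1 / (s * (c * c * c))" .
      moreover have "2 / \<omega> * (s * (- (1 / (2 * c)) / (c * c)) + inverse s / 2 * (1 / c)) = 1 / (s * (c * c * c))"
      proof -
        have "s * (- (1 / (2 * c)) / (c * c)) + inverse s / 2 * (1 / c) = \<omega> / (2 * s * (c * c * c))"
          unfolding w using s c0 by (simp add: divide_simps)
        then show ?thesis using w0 by simp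
      qed
      ultimately show ?thesis by (simp add: s_def)
    qed
    ultimately show "(F has_vector_derivative f t) (at t)" by simp
    show "isCont f t" unfolding f_def jker_def using t nz[of t] slit[of t] by (intro continuous_intros) auto
  next
    show "set_integrable lborel (einterval 0 \<infinity>) f" using int by (simp add: einterval_def greaterThan_def)
    have "(F \<longlongrightarrow> 2 / \<omega> * (complex_of_real (sqrt 0) * (1 / csqrt (complex_of_real 0 + \<omega>)))) (at_right 0)"
    proof -
      have "((\<lambda>x. csqrt (complex_of_real x + \<omega>)) \<longlongrightarrow> csqrt (complex_of_real 0 + \<omega>)) (at_right 0)"
        by (rule isCont_tendsto_compose[OF continuous_at_csqrt[OF slit]]) (intro tendsto_intros)
      then show ?thesis unfolding F_def using nz[of 0] by (intro tendsto_mult tendsto_const tendsto_divide tendsto_of_real tendsto_real_sqrt tendsto_ident_at) auto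
    qed
    then show "((F \<circ> real_of_ereal) \<longlongrightarrow> 0) (at_right 0)"
      by (simp add: zero_ereal_def ereal_tendsto_simps)
    have "((\<lambda>t. 2 / \<omega> * (1 / csqrt (1 + complex_of_real (inverse t) * \<omega>))) \<longlongrightarrow> 2 / \<omega> * (1 / csqrt (1 + complex_of_real 0 * \<omega>))) at_top"
    proof -
      have "1 + complex_of_real 0 * \<omega> \<notin> \<real>\<^sub>\<le>\<^sub>0" by (simp add: complex_nonpos_Reals_iff)
      then have "((\<lambda>t. csqrt (1 + complex_of_real (inverse t) * \<omega>)) \<longlongrightarrow> csqrt (1 + complex_of_real 0 * \<omega>)) at_top"
        by (intro isCont_tendsto_compose[OF continuous_at_csqrt] tendsto_intros tendsto_inverse_0_at_top filterlim_ident)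
      then show ?thesis by (intro tendsto_mult tendsto_const tendsto_divide) auto
    qed
    moreover have "eventually (\<lambda>t. 2 / \<omega> * (1 / csqrt (1 + complex_of_real (inverse t) * \<omega>)) = F t) at_top"
      using eventually_gt_at_top[of 0]
    proof eventually_elim
      case (elim t)
      have "complex_of_real t + \<omega> = complex_of_real t * (1 + complex_of_real (inverse t) * \<omega>)"
        using elim by (simp add: field_simps)
      then have "csqrt (complex_of_real t + \<omega>) = complex_of_real (sqrt t) * csqrt (1 + complex_of_real (inverse t) * \<omega>)"
        using csqrt_of_real_mult[OF elim] by simp
      then show ?case using elim by (simp add: F_def)
    qed
    ultimately have "(F \<longlongrightarrow> 2 / \<omega>) at_top" by (simp add: Lim_transform_eventually)
    then show "((F \<circ> real_of_ereal) \<longlongrightarrow> 2 / \<omega>) (at_left \<infinity>)"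
      by (simp add: ereal_tendsto_simps)
  qed auto
  then show "(LINT s:{0<..}|lborel. f s) = 2 / \<omega>"
    by (simp add: interval_lebesgue_integral_def einterval_def greaterThan_def)
qed

text \<open>Half-integration of order $1/2$ turns $w^{-3/2}$ into $2/w$, whose imaginary part is the Poisson kernel.
  For the exchange of integrals the support of $g$ matters: for large $s$ the point $x - s$ lies far
  to the left of it, and taking the imaginary part gives the extra decay $\eta\,s^{-3/2}$.\<close>

lemma half_integral_jtrans:
  assumes g: "bdd_fun K g" and supp: "\<And>y. y < 1 \<Longrightarrow> g y = 0" and \<eta>: "\<eta> > 0"
  shows "(LINT s|lborel. indicator {0<..} s * (s powr (-1/2) * Im (jtrans g (Complex (x - s) \<eta>)))) = 2 * pi * corr (poisson \<eta>) g x"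
proof -
  have [measurable]: "g \<in> borel_measurable borel" using bdd_funD(1)[OF g] .
  have K: "K \<ge> 0" using bdd_funD(3)[OF g] .
  define J where "J = (\<lambda>s y. Im (jker (Complex (y - (x - s)) (- \<eta>))))"
  have [measurable]: "Im \<in> borel_measurable borel"
    by (auto intro!: borel_measurable_continuous_onI continuous_intros)
  have J_meas[measurable]: "(\<lambda>(s, y). J s y) \<in> borel_measurable (lborel \<Otimes>\<^sub>M lborel)" unfolding J_def by measurable
  (* Beyond S the distance from x - s to the support is at least s / 2. *)
  define S where "S = 2 * (\<bar>x\<bar> + 1)"
  define M where "M = max (6 * \<eta> powr (-1/2) * S) (3 * \<eta>)"
  have S: "S \<ge> 2" by (simp add: S_def)
  have M: "M \<ge> 0" using \<eta> by (simp add: M_def)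
  have Jm: "J s \<in> borel_measurable borel" for s unfolding J_def by measurable
  have inner: "(\<integral>\<^sup>+y. ennreal (norm (g y *\<^sub>R J s y)) \<partial>lborel) * ennreal (s powr (-1/2)) \<le> ennreal (K * M * (min 1 s * s powr (-3/2)))" if s: "s > 0" for s
  proof (cases "s \<le> S")
    case True
    have "(\<integral>\<^sup>+y. ennreal (norm (J s y)) * indicator UNIV y \<partial>lborel) \<le> (\<integral>\<^sup>+y. ennreal (norm (jker (Complex (y - (x - s)) (- \<eta>)))) \<partial>lborel)"
      unfolding J_def by (intro nn_integral_mono) (auto intro!: ennreal_leI simp: abs_Im_le_cmod)
    also have "\<dots> \<le> ennreal (6 * \<eta> powr (-1/2))" by (rule nn_integral_norm_jker[OF \<eta>])
    finally have "(\<integral>\<^sup>+y. ennreal (norm (g y *\<^sub>R J s y)) \<partial>lborel) \<le> ennreal (K * (6 * \<eta> powr (-1/2)))"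
      using Jm by (intro bdd_fun_nn_integral_le[OF g, of _ UNIV]) auto
    then have "(\<integral>\<^sup>+y. ennreal (norm (g y *\<^sub>R J s y)) \<partial>lborel) * ennreal (s powr (-1/2)) \<le> ennreal (K * (6 * \<eta> powr (-1/2))) * ennreal (s powr (-1/2))"
      by (rule mult_right_mono) auto
    also have "\<dots> = ennreal (K * (6 * \<eta> powr (-1/2)) * s powr (-1/2))" using K by (simp add: ennreal_mult)
    also have "\<dots> \<le> ennreal (K * M * (min 1 s * s powr (-3/2)))"
    proof (intro ennreal_leI)
      have "s powr (-1/2) = s * s powr (-3/2)" using s by (simp add: powr_mult_base)
      also have "\<dots> \<le> S * min 1 s * s powr (-3/2)"
      proof -
        have "s \<le> S * min 1 s" using True S s by (cases "s \<le> 1") (auto intro: order_trans[of s "2 * s"])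
        then show ?thesis by (intro mult_right_mono) auto
      qed
      finally have "6 * \<eta> powr (-1/2) * s powr (-1/2) \<le> 6 * \<eta> powr (-1/2) * (S * min 1 s * s powr (-3/2))"
        by (intro mult_left_mono) auto
      also have "\<dots> = (6 * \<eta> powr (-1/2) * S) * (min 1 s * s powr (-3/2))" by simp
      also have "\<dots> \<le> M * (min 1 s * s powr (-3/2))" using s by (intro mult_right_mono) (auto simp: M_def)
      finally show "K * (6 * \<eta> powr (-1/2)) * s powr (-1/2) \<le> K * M * (min 1 s * s powr (-3/2))"
        using K by (simp add: mult.assoc mult_left_mono)
    qed
    finally show ?thesis .
  next
    case False
    define d where "d = 1 - (x - s)"
    have d: "d \<ge> s / 2" "d > 0" using False by (auto simp: d_def S_def abs_if split: if_splits)
    have "(\<integral>\<^sup>+y. ennreal (norm (Im (jker (Complex (y - (x - s)) (- \<eta>))))) * indicator {(x - s) + d..} y \<partial>lborel) \<le> ennreal (\<eta> * d powr (-3/2))"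
      using Im_jker_le \<eta> d by (intro nn_integral_powr_52[where f="\<lambda>y. norm (Im (jker (Complex y (- \<eta>))))"]) auto
    then have "(\<integral>\<^sup>+y. ennreal (norm (g y *\<^sub>R J s y)) \<partial>lborel) \<le> ennreal (K * (\<eta> * d powr (-3/2)))"
      using supp Jm by (intro bdd_fun_nn_integral_le[OF g, of _ "{(x - s) + d..}"]) (auto simp: d_def J_def)
    then have "(\<integral>\<^sup>+y. ennreal (norm (g y *\<^sub>R J s y)) \<partial>lborel) * ennreal (s powr (-1/2)) \<le> ennreal (K * (\<eta> * d powr (-3/2))) * ennreal (s powr (-1/2))"
      by (rule mult_right_mono) auto
    also have "\<dots> = ennreal (K * (\<eta> * d powr (-3/2)) * s powr (-1/2))" using K \<eta> by (simp add: ennreal_mult)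
    also have "\<dots> \<le> ennreal (K * M * (min 1 s * s powr (-3/2)))"
    proof (intro ennreal_leI)
      have "d powr (-3/2) \<le> (s / 2) powr (-3/2)" using d s by (intro powr_mono2') auto
      also have "\<dots> = (1/2) powr (-3/2) * s powr (-3/2)" using s powr_mult[of "1/2" s "-3/2"] by simp
      also have "\<dots> \<le> 3 * s powr (-3/2)"
      proof -
        have "(1/2::real) powr (-3/2) = 2 powr (3/2)" by (simp add: powr_minus powr_divide)
        also have "\<dots> = 2 * sqrt 2" using powr_mult_base[of 2 "1/2"] by (simp add: powr_half_sqrt)
        also have "\<dots> \<le> 3"
        proof -
          have "sqrt 2 \<le> (3/2::real)" by (rule real_le_lsqrt) (auto simp: power2_eq_square)
          then show ?thesis by simp
        qed
        finally show ?thesis by (intro mult_right_mono) auto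
      qed
      finally have d3: "d powr (-3/2) \<le> 3 * s powr (-3/2)" .
      have "s powr (-1/2) \<le> 1 powr (-1/2)" using False S by (intro powr_mono2') auto
      then have "s powr (-1/2) \<le> 1" by simp
      with d3 have "d powr (-3/2) * s powr (-1/2) \<le> 3 * s powr (-3/2) * 1"
        by (intro mult_mono) auto
      then have "\<eta> * (d powr (-3/2) * s powr (-1/2)) \<le> \<eta> * (3 * s powr (-3/2))"
        using \<eta> by (intro mult_left_mono) auto
      also have "\<dots> \<le> M * (min 1 s * s powr (-3/2))"
      proof -
        have "min 1 s = 1" using False S by simp
        moreover have "3 * \<eta> * s powr (-3/2) \<le> M * s powr (-3/2)" by (intro mult_right_mono) (auto simp: M_def)
        ultimately show ?thesis by (simp add: mult_ac)
      qed
      finally have "K * (\<eta> * (d powr (-3/2) * s powr (-1/2))) \<le> K * (M * (min 1 s * s powr (-3/2)))"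
        using K by (rule mult_left_mono)
      then show "K * (\<eta> * d powr (-3/2)) * s powr (-1/2) \<le> K * M * (min 1 s * s powr (-3/2))"
        by (simp add: mult.assoc)
    qed
    finally show ?thesis .
  qed
  have "(LINT s|lborel. indicator {0<..} s * (s powr (-1/2) * Im (jtrans g (Complex (x - s) \<eta>)))) =
    (LINT s|lborel. LINT y|lborel. indicator {0<..} s * s powr (-1/2) * (g y * J s y))"
    unfolding Im_jtrans[OF g \<eta>] J_def by (simp add: mult.assoc)
  also have "\<dots> = (LINT y|lborel. LINT s|lborel. indicator {0<..} s * s powr (-1/2) * (g y * J s y))"
  proof (rule Fubini_lborel)
    have "(\<integral>\<^sup>+s. (\<integral>\<^sup>+y. ennreal (norm (indicator {0<..} s * s powr (-1/2) * (g y * J s y))) \<partial>lborel) \<partial>lborel)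
      \<le> (\<integral>\<^sup>+s. ennreal (K * M) * ennreal (indicator {0<..} s * (min 1 s * s powr (-3/2))) \<partial>lborel)"
    proof (intro nn_integral_mono)
      fix s :: real
      show "(\<integral>\<^sup>+y. ennreal (norm (indicator {0<..} s * s powr (-1/2) * (g y * J s y))) \<partial>lborel) \<le> ennreal (K * M) * ennreal (indicator {0<..} s * (min 1 s * s powr (-3/2)))"
      proof (cases "s > 0")
        case True
        have "(\<integral>\<^sup>+y. ennreal (norm (indicator {0<..} s * s powr (-1/2) * (g y * J s y))) \<partial>lborel) = (\<integral>\<^sup>+y. ennreal (norm (g y *\<^sub>R J s y)) * ennreal (s powr (-1/2)) \<partial>lborel)"
          using True by (intro nn_integral_cong) (simp add: abs_mult ennreal_mult mult_ac)
        also have "\<dots> = (\<integral>\<^sup>+y. ennreal (norm (g y *\<^sub>R J s y)) \<partial>lborel) * ennreal (s powr (-1/2))"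
          using Jm[of s] by (intro nn_integral_multc) simp
        also have "\<dots> \<le> ennreal (K * M * (min 1 s * s powr (-3/2)))" by (rule inner[OF True])
        finally show ?thesis using True K M by (simp add: ennreal_mult)
      qed simp
    qed
    also have "\<dots> \<le> ennreal (K * M) * ennreal 4"
      by (subst nn_integral_cmult, measurable, intro mult_left_mono nn_integral_min_powr, simp)
    also have "\<dots> < \<infinity>" by (simp add: ennreal_mult_less_top)
    finally show "(\<integral>\<^sup>+s. (\<integral>\<^sup>+y. ennreal (norm (indicator {0<..} s * s powr (-1/2) * (g y * J s y))) \<partial>lborel) \<partial>lborel) < \<infinity>" .
  qed measurable
  also have "\<dots> = (LINT y|lborel. 2 * pi * (g y * poisson \<eta> (y - x)))"
  proof (intro Bochner_Integration.integral_cong refl)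
    fix y
    define \<omega> where "\<omega> = Complex (y - x) (- \<eta>)"
    have w: "Im \<omega> < 0" using \<eta> by (simp add: \<omega>_def)
    have eq: "Complex (y - (x - s)) (- \<eta>) = complex_of_real s + \<omega>" for s by (simp add: \<omega>_def complex_eq_iff)
    note H = half_integral_jker[OF w]
    have "(LINT s|lborel. indicator {0<..} s * s powr (-1/2) * (g y * J s y)) = (LINT s|lborel. g y * Im (indicator {0<..} s *\<^sub>R (s powr (-1/2) *\<^sub>R jker (complex_of_real s + \<omega>))))"
      unfolding J_def eq by (intro Bochner_Integration.integral_cong refl) simp
    also have "\<dots> = g y * Im (LINT s|lborel. indicator {0<..} s *\<^sub>R (s powr (-1/2) *\<^sub>R jker (complex_of_real s + \<omega>)))"
      unfolding Bochner_Integration.integral_mult_right_zero using integral_Im[OF H(1)[unfolded set_integrable_def]] by simp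
    also have "\<dots> = g y * Im (2 / \<omega>)" using H(2) by (simp add: set_lebesgue_integral_def)
    also have "Im (2 / \<omega>) = 2 * pi * poisson \<eta> (y - x)"
      using \<eta> by (simp add: \<omega>_def poisson_def Im_divide power2_eq_square)
    finally show "(LINT s|lborel. indicator {0<..} s * s powr (-1/2) * (g y * J s y)) = 2 * pi * (g y * poisson \<eta> (y - x))" by simp
  qed
  also have "\<dots> = 2 * pi * corr (poisson \<eta>) g x"
    unfolding corr_def by (rule Bochner_Integration.integral_mult_right_zero)
  finally show ?thesis .
qed

section \<open>The Zhukovsky weight and its contour integral\<close>

text \<open>Writing $\sqrt{z^2-1}$ as a product of two principal roots makes it continuous up to the real axis from
  above and gives it the behaviour $z + O(1/z)$ at infinity.\<close>

definition sqx :: "complex \<Rightarrow> complex" where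
  "sqx z = csqrt (z - 1) * csqrt (z + 1)"

text \<open>The inverse of the Zhukovsky map $(\zeta + 1/\zeta)/2$; it sends the upper half-plane to the part
  of it outside the unit disc.\<close>

definition zhuk :: "complex \<Rightarrow> complex" where
  "zhuk z = z + sqx z"

text \<open>On the rays $|x| > 1$ this weight is real, and for even $n$ it changes sign from one ray to the other;
  on the gap $|x| < 1$ it has modulus $\sqrt{1-x^2}$, without any growth in $n$.\<close>

definition wgt :: "nat \<Rightarrow> complex \<Rightarrow> complex" where
  "wgt n z = sqx z / zhuk z ^ n"

lemma continuous_on_csqrt_upper: "continuous_on {z. Im z \<ge> 0} csqrt"
proof -
  have "continuous_on {z. Im z \<ge> 0} (\<lambda>z. Complex (sqrt ((cmod z + Re z) / 2)) (sqrt ((cmod z - Re z) / 2)))"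
    unfolding Complex_eq by (intro continuous_intros) auto
  then show ?thesis
    by (rule continuous_on_eq) (auto simp: complex_eq_iff sgn_if)
qed

lemma sqx_square: "sqx z * sqx z = z * z - 1"
proof -
  have "sqx z * sqx z = (csqrt (z - 1))\<^sup>2 * (csqrt (z + 1))\<^sup>2" by (simp add: sqx_def power2_eq_square mult_ac)
  then show ?thesis by (simp add: algebra_simps)
qed

lemma zhuk_nonzero: "zhuk z \<noteq> 0"
proof
  assume "zhuk z = 0"
  then have "sqx z = - z" by (simp add: zhuk_def eq_neg_iff_add_eq_0 add.commute)
  then show False using sqx_square[of z] by simp
qed

lemma continuous_on_sqx: "continuous_on {z. Im z \<ge> 0} sqx"
  unfolding sqx_def[abs_def]
  by (intro continuous_intros continuous_on_compose2[OF continuous_on_csqrt_upper]) auto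

lemma continuous_on_wgt: "continuous_on {z. Im z \<ge> 0} (wgt n)"
  unfolding wgt_def[abs_def] using zhuk_nonzero
  by (intro continuous_intros continuous_on_sqx) (auto simp: zhuk_def[abs_def] intro!: continuous_intros continuous_on_sqx)

lemma wgt_field_differentiable:
  assumes "Im z > 0"
  shows "wgt n field_differentiable (at z)"
proof -
  have "z - 1 \<notin> \<real>\<^sub>\<le>\<^sub>0" "z + 1 \<notin> \<real>\<^sub>\<le>\<^sub>0" using assms by (auto simp: complex_nonpos_Reals_iff)
  then have "(\<lambda>z. csqrt (z - 1)) field_differentiable (at z)" "(\<lambda>z. csqrt (z + 1)) field_differentiable (at z)"
    unfolding field_differentiable_def by (auto intro!: exI derivative_eq_intros)
  then have s: "sqx field_differentiable (at z)"
    unfolding sqx_def[abs_def] by (intro field_differentiable_mult)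
  then have "zhuk field_differentiable (at z)"
    unfolding zhuk_def[abs_def] by (intro field_differentiable_add) auto
  then show ?thesis
    unfolding wgt_def[abs_def] using s zhuk_nonzero
    by (intro field_differentiable_divide field_differentiable_power) auto
qed

text \<open>The numbers $z + s$ and $z - s$ have product 1, and $z + s$ is the larger of the two in modulus.\<close>

lemma norm_zhuk_ge:
  assumes "Im z \<ge> 0"
  shows "norm (zhuk z) \<ge> 1" "norm (zhuk z) \<ge> norm z"
proof -
  define a b where "a = csqrt (z - 1)" and "b = csqrt (z + 1)"
  have quad: "Re a \<ge> 0" "Im a \<ge> 0" "Re b \<ge> 0" "Im b \<ge> 0"
  proof -
    have "Im (csqrt w) \<ge> 0" if "Im w \<ge> 0" for w
      using that complex_Re_le_cmod[of w] by (simp add: sgn_if)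
    then show "Im a \<ge> 0" "Im b \<ge> 0" using assms by (simp_all add: a_def b_def del: csqrt.simps)
    show "Re a \<ge> 0" "Re b \<ge> 0" unfolding a_def b_def by (rule Re_csqrt)+
  qed
  have "a\<^sup>2 = z - 1" "b\<^sup>2 = z + 1" by (simp_all add: a_def b_def)
  then have "2 * zhuk z = (a + b)\<^sup>2"
    unfolding zhuk_def sqx_def a_def[symmetric] b_def[symmetric] by (simp add: power2_sum)
  then have "norm (2 * zhuk z) = (norm (a + b))\<^sup>2" by (simp add: norm_power)
  moreover have "(norm a)\<^sup>2 + (norm b)\<^sup>2 \<le> (norm (a + b))\<^sup>2"
    using quad by (simp add: cmod_power2 power2_sum)
  moreover have "(norm a)\<^sup>2 = norm (z - 1)" "(norm b)\<^sup>2 = norm (z + 1)" by (simp_all add: a_def b_def)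
  ultimately have main: "norm (z - 1) + norm (z + 1) \<le> 2 * norm (zhuk z)" by (simp add: norm_mult)
  have "norm ((z + 1) - (z - 1)) \<le> norm (z + 1) + norm (z - 1)" by (rule norm_triangle_ineq4)
  then show "norm (zhuk z) \<ge> 1" using main by simp
  have "norm ((z + 1) + (z - 1)) \<le> norm (z + 1) + norm (z - 1)" by (rule norm_triangle_ineq)
  moreover have "(z + 1) + (z - 1) = 2 * z" by simp
  ultimately show "norm (zhuk z) \<ge> norm z" using main by (simp add: norm_mult)
qed

lemma norm_wgt_le:
  assumes "Im z \<ge> 0" "n \<ge> 4"
  shows "norm (wgt n z) \<le> 16 / (1 + norm z)\<^sup>2"
proof -
  define M where "M = norm (zhuk z)"
  have M: "M \<ge> 1" "M \<ge> norm z" using norm_zhuk_ge[OF assms(1)] by (auto simp: M_def)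
  have "(norm (sqx z))\<^sup>2 = norm (z * z - 1)" by (simp flip: sqx_square add: norm_mult power2_eq_square)
  also have "\<dots> \<le> norm z * norm z + 1" using norm_triangle_ineq4[of "z * z" 1] by (simp add: norm_mult)
  also have "\<dots> \<le> (norm z + 1)\<^sup>2" by (simp add: power2_eq_square algebra_simps)
  finally have s: "norm (sqx z) \<le> norm z + 1" by (rule power2_le_imp_le) simp
  have h: "(1 + norm z) / 2 \<le> M" using M by simp
  have "((1 + norm z) / 2) ^ 4 \<le> M ^ 4" using h by (intro power_mono) auto
  also have "\<dots> \<le> M ^ n" using M assms by (intro power_increasing) auto
  finally have p: "((1 + norm z) / 2) ^ 4 \<le> M ^ n" .
  have pos: "1 + norm z > 0" by (simp add: add_pos_nonneg)
  have "norm (wgt n z) = norm (sqx z) / M ^ n" by (simp add: wgt_def norm_divide norm_power M_def)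
  also have "\<dots> \<le> (1 + norm z) / ((1 + norm z) / 2) ^ 4"
    using s p pos by (intro frac_le) (auto simp: add.commute)
  also have "\<dots> = 16 / (1 + norm z) ^ 3"
  proof -
    have "X / (X / 2) ^ 4 = 16 / X ^ 3" if "X > 0" for X :: real
      using that by (simp add: field_simps eval_nat_numeral)
    then show ?thesis using pos by blast
  qed
  also have "\<dots> \<le> 16 / (1 + norm z) ^ 2" using pos by (intro divide_left_mono power_increasing mult_pos_pos) auto
  finally show ?thesis .
qed

text \<open>The real counterparts \<open>rt\<close> and \<open>zh\<close> of \<open>sqx\<close> and \<open>zhuk\<close> on $[1,\infty)$.\<close>

definition rt :: "real \<Rightarrow> real" where "rt x = sqrt (x\<^sup>2 - 1)"
definition zh :: "real \<Rightarrow> real" where "zh x = x + rt x"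

lemma sqx_right: "x > 1 \<Longrightarrow> sqx (complex_of_real x) = complex_of_real (rt x)"
proof -
  assume x: "x > 1"
  have "csqrt (complex_of_real x - 1) = complex_of_real (sqrt (x - 1))" using x csqrt_of_real[of "x - 1"] by simp
  moreover have "csqrt (complex_of_real x + 1) = complex_of_real (sqrt (x + 1))" using x csqrt_of_real[of "x + 1"] by simp
  moreover have "sqrt (x - 1) * sqrt (x + 1) = rt x" by (simp add: rt_def power2_eq_square algebra_simps flip: real_sqrt_mult)
  ultimately show ?thesis by (simp add: sqx_def flip: of_real_mult)
qed

lemma sqx_left: "x < -1 \<Longrightarrow> sqx (complex_of_real x) = - complex_of_real (rt x)"
proof -
  assume x: "x < -1"
  have "csqrt (complex_of_real x - 1) = \<i> * complex_of_real (sqrt (1 - x))" using x csqrt_of_real'[of "x - 1"] by (simp add: mult.commute)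
  moreover have "csqrt (complex_of_real x + 1) = \<i> * complex_of_real (sqrt (- x - 1))" using x csqrt_of_real'[of "x + 1"] by (simp add: mult.commute)
  moreover have "sqrt (1 - x) * sqrt (- x - 1) = rt x" by (simp add: rt_def power2_eq_square algebra_simps flip: real_sqrt_mult)
  moreover have "(\<i> * complex_of_real p) * (\<i> * complex_of_real q) = - complex_of_real (p * q)" for p q
    by (simp add: complex_eq_iff)
  ultimately show ?thesis by (simp only: sqx_def)
qed

lemma wgt_right: "x > 1 \<Longrightarrow> wgt n (complex_of_real x) = complex_of_real (rt x / zh x ^ n)"
  by (simp add: wgt_def zhuk_def sqx_right zh_def)

lemma wgt_left: "x < -1 \<Longrightarrow> wgt (2 * m) (complex_of_real x) = - complex_of_real (rt (- x) / zh (- x) ^ (2 * m))"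
proof -
  assume x: "x < -1"
  have "zhuk (complex_of_real x) = - complex_of_real (zh (- x))" using x by (simp add: zhuk_def sqx_left zh_def rt_def)
  then have "zhuk (complex_of_real x) ^ (2 * m) = complex_of_real (zh (- x)) ^ (2 * m)" by simp
  then show ?thesis using x by (simp add: wgt_def sqx_left rt_def)
qed

lemma norm_wgt_middle:
  assumes "\<bar>x\<bar> < 1"
  shows "norm (wgt n (complex_of_real x)) \<le> sqrt (1 - x\<^sup>2)"
proof -
  have "(norm (sqx (complex_of_real x)))\<^sup>2 = norm (complex_of_real (x * x - 1))"
    using sqx_square[of "complex_of_real x"] by (simp add: norm_mult[symmetric] power2_eq_square)
  also have "\<dots> = 1 - x\<^sup>2"
    using assms abs_square_less_1[of x] unfolding norm_of_real by (simp add: power2_eq_square)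
  finally have "norm (sqx (complex_of_real x)) = sqrt (1 - x\<^sup>2)" by (simp add: real_sqrt_unique)
  moreover have "1 \<le> norm (zhuk (complex_of_real x)) ^ n" using norm_zhuk_ge(1)[of "complex_of_real x"] by simp
  moreover have "sqrt (1 - x\<^sup>2) \<ge> 0" using assms abs_square_less_1[of x] by simp
  ultimately show ?thesis
    using mult_left_mono[of 1 "norm (zhuk (complex_of_real x)) ^ n" "sqrt (1 - x\<^sup>2)"] zhuk_nonzero[of "complex_of_real x"]
    by (simp add: wgt_def norm_divide norm_power divide_le_eq)
qed

text \<open>Close the segment $[-\rho,\rho]$ by a semicircle, on which the integral is $O(1/\rho)$.\<close>

lemma integral_real_line_eq_0:
  fixes F :: "complex \<Rightarrow> complex"
  assumes cont: "continuous_on {z. Im z \<ge> 0} F"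
    and diff: "\<And>z. Im z > 0 \<Longrightarrow> F field_differentiable (at z)"
    and bound: "\<And>z. Im z \<ge> 0 \<Longrightarrow> norm (F z) \<le> C / (1 + norm z)\<^sup>2"
  shows "integrable lborel (\<lambda>x. F (complex_of_real x))" "(LINT x|lborel. F (complex_of_real x)) = 0"
proof -
  have C: "C \<ge> 0" using order_trans[OF norm_ge_zero bound[of 0]] by simp
  have cont_real: "continuous_on UNIV (\<lambda>x. F (complex_of_real x))"
    by (rule continuous_on_compose2[OF cont]) (auto intro!: continuous_intros)
  then have [measurable]: "(\<lambda>x. F (complex_of_real x)) \<in> borel_measurable borel" by (rule borel_measurable_continuous_onI)
  show int: "integrable lborel (\<lambda>x. F (complex_of_real x))"
  proof (rule integrable_of_nn_integral_le)
    have "(\<integral>\<^sup>+x. ennreal (norm (F (complex_of_real x))) \<partial>lborel) \<le> (\<integral>\<^sup>+x. ennreal (C / (1 + x\<^sup>2)) \<partial>lborel)"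
    proof (intro nn_integral_mono ennreal_leI)
      fix x :: real
      have "norm (F (complex_of_real x)) \<le> C / (1 + \<bar>x\<bar>)\<^sup>2" using bound[of "complex_of_real x"] by simp
      also have "\<dots> \<le> C / (1 + x\<^sup>2)"
      proof (rule divide_left_mono[OF _ C])
        show "1 + x\<^sup>2 \<le> (1 + \<bar>x\<bar>)\<^sup>2" by (simp add: power2_sum)
        show "0 < (1 + \<bar>x\<bar>)\<^sup>2 * (1 + x\<^sup>2)" by (intro mult_pos_pos) (auto simp: add_pos_nonneg)
      qed
      finally show "norm (F (complex_of_real x)) \<le> C / (1 + x\<^sup>2)" .
    qed
    also have "\<dots> = ennreal (pi * C)" by (rule nn_integral_cmult_inverse_1_plus_square[OF C])
    finally show "(\<integral>\<^sup>+x. ennreal (norm (F (complex_of_real x))) \<partial>lborel) \<le> ennreal (pi * C)" .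
  qed simp
  have small: "norm (LINT x:{-\<rho>..\<rho>}|lborel. F (complex_of_real x)) \<le> C * pi / (1 + \<rho>)" if \<rho>: "\<rho> > 0" for \<rho>
  proof -
    let ?S = "{z. Im z \<ge> 0}"
    let ?l = "linepath (complex_of_real (-\<rho>)) (complex_of_real \<rho>)"
    let ?c = "part_circlepath 0 \<rho> 0 pi"
    have convex: "convex ?S" by (rule convex_halfspace_Im_ge)
    have pc: "path_image ?c \<subseteq> ?S"
    proof
      fix z assume "z \<in> path_image ?c"
      then obtain t where "t \<in> closed_segment 0 pi" "z = 0 + of_real \<rho> * exp (\<i> * of_real t)"
        using path_image_part_circlepath'[of 0 \<rho> 0 pi] by (auto simp: cis_conv_exp)
      then show "z \<in> ?S" using \<rho> by (auto simp: closed_segment_eq_real_ivl Im_exp intro!: mult_nonneg_nonneg sin_ge_zero)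
    qed
    have pl: "path_image ?l \<subseteq> ?S" by (intro closed_segment_subset[OF _ _ convex, folded path_image_linepath]) auto
    have join: "pathfinish ?l = pathstart ?c" "pathfinish ?c = pathstart ?l"
      by (auto simp: exp_pi_i exp_pi_i')
    have "(F has_contour_integral 0) (?l +++ ?c)"
    proof (rule Cauchy_theorem_convex[where K="{}", OF cont convex])
      show "F field_differentiable at x" if "x \<in> interior ?S - {}" for x
        using that diff interior_halfspace_ge[of \<i> 0] by (simp add: inner_complex_def)
      show "path_image (?l +++ ?c) \<subseteq> ?S" using pl pc join by (simp add: path_image_join)
    qed (use join in auto)
    moreover have Fl: "F contour_integrable_on ?l"
      by (intro contour_integrable_continuous_linepath continuous_on_subset[OF cont]) (use pl in auto)
    moreover have Fc: "F contour_integrable_on ?c"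
      by (intro contour_integrable_continuous_part_circlepath continuous_on_subset[OF cont pc])
    ultimately have sum: "contour_integral ?l F + contour_integral ?c F = 0"
      using contour_integral_unique contour_integral_join[OF Fl Fc] by force
    have "norm (contour_integral ?c F) \<le> C / (1 + \<rho>)\<^sup>2 * \<rho> * \<bar>pi - 0\<bar>"
    proof (rule contour_integral_bound_part_circlepath[OF Fc])
      fix z assume z: "z \<in> path_image ?c"
      then have "norm z = \<rho>" using \<rho> path_image_part_circlepath_subset'[of \<rho> 0 0 pi] by auto
      then show "norm (F z) \<le> C / (1 + \<rho>)\<^sup>2" using bound[of z] pc z by auto
    qed (use \<rho> C in auto)
    also have "\<dots> \<le> C * pi / (1 + \<rho>)"
    proof -
      have "C / (1 + \<rho>)\<^sup>2 * \<rho> * \<bar>pi - 0\<bar> = C * pi / (1 + \<rho>) * (\<rho> / (1 + \<rho>))" by (simp add: power2_eq_square)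
      also have "\<dots> \<le> C * pi / (1 + \<rho>) * 1" using \<rho> C by (intro mult_left_mono) auto
      finally show ?thesis by simp
    qed
    finally have c: "norm (contour_integral ?c F) \<le> C * pi / (1 + \<rho>)" .
    have "(F has_contour_integral contour_integral ?l F) ?l" using Fl by (rule has_contour_integral_integral)
    then have "((\<lambda>x. F (complex_of_real x)) has_integral contour_integral ?l F) {-\<rho>..\<rho>}"
      using \<rho> by (subst (asm) has_contour_integral_linepath_Reals_iff) auto
    moreover have "set_integrable lborel {-\<rho>..\<rho>} (\<lambda>x. F (complex_of_real x))"
      by (intro borel_integrable_atLeastAtMost' continuous_on_subset[OF cont_real]) auto
    ultimately have "(LINT x:{-\<rho>..\<rho>}|lborel. F (complex_of_real x)) = contour_integral ?l F"
      by (simp add: set_borel_integral_eq_integral(2) integral_unique)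
    moreover have "norm (contour_integral ?l F) = norm (contour_integral ?c F)"
      using sum by (metis add_eq_0_iff2 norm_minus_cancel)
    ultimately show ?thesis using c by simp
  qed
  have "(\<lambda>n. LINT x:{- real (Suc n)..real (Suc n)}|lborel. F (complex_of_real x)) \<longlonglongrightarrow> (LINT x|lborel. F (complex_of_real x))"
    unfolding set_lebesgue_integral_def
  proof (rule integral_dominated_convergence[where w="\<lambda>x. norm (F (complex_of_real x))"])
    show "AE x in lborel. (\<lambda>n. indicator {- real (Suc n)..real (Suc n)} x *\<^sub>R F (complex_of_real x)) \<longlonglongrightarrow> F (complex_of_real x)"
    proof (intro AE_I2)
      fix x :: real
      have "eventually (\<lambda>n. indicator {- real (Suc n)..real (Suc n)} x *\<^sub>R F (complex_of_real x) = F (complex_of_real x)) sequentially"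
        using eventually_ge_at_top[of "nat \<lceil>\<bar>x\<bar>\<rceil>"]
      proof eventually_elim
        case (elim n)
        then have "\<bar>x\<bar> \<le> real n" by linarith
        then show ?case by (auto simp: indicator_def)
      qed
      then show "(\<lambda>n. indicator {- real (Suc n)..real (Suc n)} x *\<^sub>R F (complex_of_real x)) \<longlonglongrightarrow> F (complex_of_real x)"
        by (rule tendsto_eventually)
    qed
  qed (use int in \<open>auto split: split_indicator\<close>)
  moreover have "(\<lambda>n. LINT x:{- real (Suc n)..real (Suc n)}|lborel. F (complex_of_real x)) \<longlonglongrightarrow> 0"
  proof (rule Lim_null_comparison)
    show "eventually (\<lambda>n. norm (LINT x:{- real (Suc n)..real (Suc n)}|lborel. F (complex_of_real x)) \<le> C * pi / (1 + real (Suc n))) sequentially"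
      using small by (intro always_eventually allI) (metis of_nat_0_less_iff zero_less_Suc)
    show "(\<lambda>n. C * pi / (1 + real (Suc n))) \<longlonglongrightarrow> 0" by real_asymp
  qed
  ultimately show "(LINT x|lborel. F (complex_of_real x)) = 0" by (rule LIMSEQ_unique)
qed

text \<open>The line is kept at height $\eta$ in the argument of $G$ and at height 0 in the weight: the integrand is
  $G(z+i\eta)^2$ times the weight at $z$. There $G$ is bounded and the weight is explicit.\<close>

lemma contour_identity:
  assumes g: "bdd_fun K g1" "bdd_fun K g2" and \<eta>: "\<eta> > 0" and n: "n \<ge> 4"
  defines "G \<equiv> (\<lambda>z. jtrans g1 z + \<i> * jtrans g2 z)"
  shows "integrable lborel (\<lambda>x. (G (Complex x \<eta>))\<^sup>2 * wgt n (complex_of_real x))"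
    "(LINT x|lborel. (G (Complex x \<eta>))\<^sup>2 * wgt n (complex_of_real x)) = 0"
proof -
  have K: "K \<ge> 0" using bdd_funD(3)[OF g(1)] .
  define F where "F = (\<lambda>z. (G (z + \<i> * complex_of_real \<eta>))\<^sup>2 * wgt n z)"
  define B where "B = (2 * (K * (6 * \<eta> powr (-1/2))))\<^sup>2"
  have Gd: "G field_differentiable at z" if "Im z > 0" for z
    unfolding G_def using g that
    by (intro field_differentiable_add field_differentiable_mult jtrans_field_differentiable) auto
  have sd: "(\<lambda>z. G (z + \<i> * complex_of_real \<eta>)) field_differentiable at z" if "Im z \<ge> 0" for z
  proof -
    have "(G \<circ> (\<lambda>z. z + \<i> * complex_of_real \<eta>)) field_differentiable at z"
      using that \<eta> by (intro field_differentiable_compose Gd field_differentiable_add) auto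
    then show ?thesis by (simp add: o_def)
  qed
  have Gb: "norm (G z) \<le> 2 * (K * (6 * \<eta> powr (-1/2)))" if "Im z \<ge> \<eta>" for z
  proof -
    have "norm (jtrans h z) \<le> K * (6 * \<eta> powr (-1/2))" if "bdd_fun K h" for h
    proof -
      have "norm (jtrans h z) \<le> K * (6 * Im z powr (-1/2))" using jtrans_bound[OF that, of "Im z" "Re z"] \<open>Im z \<ge> \<eta>\<close> \<eta> by simp
      also have "\<dots> \<le> K * (6 * \<eta> powr (-1/2))"
        using K \<eta> \<open>Im z \<ge> \<eta>\<close> by (intro mult_left_mono powr_mono2') auto
      finally show ?thesis .
    qed
    from this[OF g(1)] this[OF g(2)] show ?thesis
      unfolding G_def using norm_triangle_ineq[of "jtrans g1 z" "\<i> * jtrans g2 z"] by (simp add: norm_mult)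
  qed
  have 1: "continuous_on {z. Im z \<ge> 0} F"
    unfolding F_def
  proof (intro continuous_intros continuous_on_wgt)
    show "continuous_on {z. Im z \<ge> 0} (\<lambda>z. G (z + \<i> * complex_of_real \<eta>))"
      using sd by (intro continuous_at_imp_continuous_on ballI field_differentiable_imp_continuous_at) auto
  qed
  have 2: "F field_differentiable at z" if "Im z > 0" for z
    unfolding F_def using that
    by (intro field_differentiable_mult wgt_field_differentiable field_differentiable_power sd) auto
  have 3: "norm (F z) \<le> (B * 16) / (1 + norm z)\<^sup>2" if "Im z \<ge> 0" for z
  proof -
    have "norm (F z) = (norm (G (z + \<i> * complex_of_real \<eta>)))\<^sup>2 * norm (wgt n z)" by (simp add: F_def norm_mult norm_power)
    also have "\<dots> \<le> B * (16 / (1 + norm z)\<^sup>2)"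
      unfolding B_def using Gb[of "z + \<i> * complex_of_real \<eta>"] norm_wgt_le[OF that n] that by (intro mult_mono power_mono) auto
    finally show ?thesis by simp
  qed
  have eq: "F (complex_of_real x) = (G (Complex x \<eta>))\<^sup>2 * wgt n (complex_of_real x)" for x
    by (simp add: F_def Complex_eq)
  show "integrable lborel (\<lambda>x. (G (Complex x \<eta>))\<^sup>2 * wgt n (complex_of_real x))"
    "(LINT x|lborel. (G (Complex x \<eta>))\<^sup>2 * wgt n (complex_of_real x)) = 0"
    using integral_real_line_eq_0[OF 1 2 3] unfolding eq by auto
qed

section \<open>A weighted Schur estimate for half-integration\<close>

text \<open>Cauchy-Schwarz with products and squares taken in the reals, which is how the integrands arise.\<close>

lemma nn_integral_Cauchy_Schwarz:
  fixes f g :: "'a \<Rightarrow> real"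
  assumes [measurable]: "f \<in> borel_measurable M" "g \<in> borel_measurable M"
    and f: "\<And>x. f x \<ge> 0" and g: "\<And>x. g x \<ge> 0"
  shows "(\<integral>\<^sup>+x. ennreal (f x * g x) \<partial>M)\<^sup>2 \<le> (\<integral>\<^sup>+x. ennreal ((f x)\<^sup>2) \<partial>M) * (\<integral>\<^sup>+x. ennreal ((g x)\<^sup>2) \<partial>M)"
proof -
  have "(\<integral>\<^sup>+x. ennreal (f x) * ennreal (g x) \<partial>M)\<^sup>2 \<le> (\<integral>\<^sup>+x. (ennreal (f x))\<^sup>2 \<partial>M) * (\<integral>\<^sup>+x. (ennreal (g x))\<^sup>2 \<partial>M)"
    by (rule Cauchy_Schwarz_nn_integral) measurable
  then show ?thesis using f g by (simp add: ennreal_mult ennreal_power)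
qed

lemma ennreal_le_mult_add_mult:
  fixes X a r b s :: real
  assumes "X \<le> a * r + b * s" "0 \<le> a" "0 \<le> r" "0 \<le> b" "0 \<le> s"
  shows "ennreal X \<le> ennreal a * ennreal r + ennreal b * ennreal s"
  using assms by (simp add: ennreal_mult[symmetric] ennreal_plus[symmetric] ennreal_leI del: ennreal_plus)

lemma one_minus_power_le:
  fixes s :: real
  assumes "0 \<le> s" "s \<le> 1"
  shows "(1 - s) ^ k \<le> 1 / (1 + real k * s)"
proof -
  have pos: "1 + real k * s > 0" using assms by (simp add: add_pos_nonneg)
  have "1 + real k * s \<le> (1 + s) ^ k" using Bernoulli_inequality[of s k] assms by simp
  then have "(1 - s) ^ k * (1 + real k * s) \<le> (1 - s) ^ k * (1 + s) ^ k"
    using assms by (intro mult_left_mono) auto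
  also have "\<dots> = (1 - s\<^sup>2) ^ k" by (simp add: power_mult_distrib[symmetric] power2_eq_square algebra_simps)
  also have "\<dots> \<le> 1" using assms by (intro power_le_one) (auto simp: power_le_one)
  finally show ?thesis using pos by (simp add: pos_le_divide_eq)
qed

lemma nn_integral_inverse_sqrt_linear:
  assumes "l > 0"
  shows "(\<integral>\<^sup>+s. ennreal (s powr (-1/2) / (1 + l * s)) * indicator {0<..} s \<partial>lborel) \<le> ennreal (4 * l powr (-1/2))"
proof -
  have "(\<integral>\<^sup>+s. ennreal (s powr (-1/2) / (1 + l * s)) * indicator {0<..} s \<partial>lborel) \<le>
    (\<integral>\<^sup>+s. ennreal (s powr (-1/2)) * indicator {0..1/l} s + ennreal (1 / l) * (ennreal (s powr - (3/2)) * indicator {1/l..} s) \<partial>lborel)"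
  proof (intro nn_integral_mono)
    fix s :: real
    show "ennreal (s powr (-1/2) / (1 + l * s)) * indicator {0<..} s \<le> ennreal (s powr (-1/2)) * indicator {0..1/l} s + ennreal (1 / l) * (ennreal (s powr - (3/2)) * indicator {1/l..} s)"
    proof (cases "s > 0")
      case True
      have p: "1 + l * s > 0" using True assms by (simp add: add_pos_pos)
      show ?thesis
      proof (cases "s \<le> 1 / l")
        case le: True
        have "s powr (-1/2) / (1 + l * s) \<le> s powr (-1/2) / 1"
          using p True assms by (intro divide_left_mono) auto
        then show ?thesis using True le by (auto intro!: add_increasing2 ennreal_leI)
      next
        case False
        have "s powr (-1/2) / (1 + l * s) \<le> s powr (-1/2) / (l * s)"
          using p True assms by (intro divide_left_mono) auto
        also have "\<dots> = 1 / l * s powr - (3/2)" using powr_diff[of s "-1/2" 1] True by simp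
        finally show ?thesis using True False assms by (auto simp: ennreal_mult[symmetric] intro!: add_increasing ennreal_leI)
      qed
    qed simp
  qed
  also have "\<dots> = (\<integral>\<^sup>+s. ennreal (s powr (-1/2)) * indicator {0..1/l} s \<partial>lborel) + ennreal (1 / l) * (\<integral>\<^sup>+s. ennreal (s powr - (3/2)) * indicator {1/l..} s \<partial>lborel)"
    by (subst nn_integral_add, simp, simp, subst nn_integral_cmult) auto
  also have "\<dots> = ennreal ((1/l) powr (-1/2 + 1) / (-1/2 + 1)) + ennreal (1 / l) * ennreal ((1/l) powr (1 - 3/2) / (3/2 - 1))"
    using assms by (subst nn_integral_powr_head, simp, simp, subst nn_integral_powr_tail) auto
  also have "\<dots> = ennreal (2 * (1/l) powr (1/2) + (1 / l) * (2 * (1/l) powr (-1/2)))"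
    using assms by (simp add: ennreal_mult[symmetric] ennreal_plus[symmetric] del: ennreal_plus)
  also have "(1 / l) * (2 * (1/l) powr (-1/2)) = 2 * (1/l) powr (1/2)"
    using powr_mult_base[of "1/l" "-1/2"] assms by simp
  also have "(1/l) powr (1/2) = l powr (-1/2)"
    using assms powr_minus_divide[of l "1/2"] by (simp add: powr_divide)
  finally show ?thesis by simp
qed

lemma rt_pos: "x > 1 \<Longrightarrow> rt x > 0"
  by (simp add: rt_def power2_eq_square less_1_mult)

lemma rt_le: "x \<ge> 1 \<Longrightarrow> rt x \<le> x"
  unfolding rt_def by (rule real_le_lsqrt) (auto simp: power2_eq_square)

lemma zh_ge: "x \<ge> 1 \<Longrightarrow> zh x \<ge> x"
  by (simp add: zh_def rt_def one_le_power)

lemma zh_pos: "x \<ge> 1 \<Longrightarrow> zh x > 0"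
  using zh_ge[of x] by linarith

text \<open>The quotient $\zeta(x)/x = 1 + \sqrt{1 - x^{-2}}$ increases with $x$.\<close>

lemma zh_ratio:
  assumes "1 \<le> t" "t \<le> x"
  shows "zh t / zh x \<le> t / x"
proof -
  have "x * rt t \<le> t * rt x"
  proof -
    have "x * rt t = sqrt (x\<^sup>2 * (t\<^sup>2 - 1))" using assms by (simp add: rt_def real_sqrt_mult)
    also have "\<dots> \<le> sqrt (t\<^sup>2 * (x\<^sup>2 - 1))"
      using assms by (intro real_sqrt_le_mono) (simp add: algebra_simps power_mono)
    also have "\<dots> = t * rt x" using assms by (simp add: rt_def real_sqrt_mult)
    finally show ?thesis .
  qed
  then have "x * zh t \<le> t * zh x" by (simp add: zh_def algebra_simps)
  then show ?thesis using assms zh_pos[of x] by (simp add: divide_simps mult.commute)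
qed

lemma zh_mono: "1 \<le> t \<Longrightarrow> t \<le> x \<Longrightarrow> zh t \<le> zh x"
  unfolding zh_def rt_def by (intro add_mono real_sqrt_le_mono diff_right_mono power_mono) auto

lemma zh_power_ratio:
  assumes "1 \<le> t" "t \<le> x"
  shows "zh t ^ m \<le> zh x ^ m * (t / x) ^ m"
proof -
  have "(zh t / zh x) ^ m \<le> (t / x) ^ m"
    using assms zh_ratio[OF assms] zh_pos[of t] zh_pos[of x] by (intro power_mono) auto
  then show ?thesis using zh_pos[of x] assms by (simp add: power_divide divide_simps mult.commute)
qed

lemma measurable_rt [measurable]: "rt \<in> borel_measurable borel"
  unfolding rt_def[abs_def] by measurable

lemma measurable_zh [measurable]: "zh \<in> borel_measurable borel"
  unfolding zh_def[abs_def] by measurable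

lemma three_quarters_power: "(3/4::real) ^ m \<le> real m powr (-1/2)" if "m \<ge> 1"
proof -
  have "(3/4::real) ^ m \<le> 1 / (1 + real m * (1/4))" using one_minus_power_le[of "1/4" m] by simp
  also have "\<dots> \<le> 1 / sqrt (real m)"
  proof (intro divide_left_mono)
    have "0 \<le> (sqrt (real m) / 2 - 1)\<^sup>2" by simp
    then show "sqrt (real m) \<le> 1 + real m * (1/4)" by (simp add: power2_eq_square algebra_simps)
  qed (use that in \<open>auto intro!: mult_pos_pos add_pos_nonneg\<close>)
  also have "\<dots> = real m powr (-1/2)" using that powr_minus_divide[of "real m" "1/2"] by (simp add: powr_half_sqrt)
  finally show ?thesis .
qed

text \<open>First half of the Schur test. The function $\zeta(t)^m$ increases to its value at $x$ like
  $(1 + (m-1)(x-t)/x)^{-1}$ at worst, so the integral is concentrated on an interval of length about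
  $x/m$, where $(x-t)^{-1/2}$ integrates to $O(\sqrt{x/m})$.\<close>

lemma schur_first:
  assumes x: "x \<ge> 2" and m: "m \<ge> 2"
  shows "(\<integral>\<^sup>+t. ennreal (indicator {1<..<x} t * (x - t) powr (-1/2) * (zh t ^ m / rt t)) \<partial>lborel)
    \<le> ennreal (12 * (real m powr (-1/2) * x powr (-1/2)) * zh x ^ m)"
proof -
  define Z where "Z = zh x ^ m"
  have Z: "Z \<ge> 0" using zh_pos[of x] x by (simp add: Z_def)
  (* The singularity of 1 / rt at 1 is treated separately on (1, 3/2), where (t / x)^m is exponentially small; c is the constant there and l the decay rate on the rest. *)
  define c where "c = 3/2 * (3 / (2 * x)) ^ m"
  have c: "c \<ge> 0" using x by (simp add: c_def)
  define l where "l = real (m - 1) / x"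
  have l: "l > 0" using m x by (simp add: l_def)
  have pw: "indicator {1<..<x} t * (x - t) powr (-1/2) * (zh t ^ m / rt t) \<le>
     Z * c * (indicator {0..1/2} (t - 1) * (t - 1) powr (-1/2)) + Z * (3/2) / x * (indicator {0<..} (x - t) * ((x - t) powr (-1/2) / (1 + l * (x - t))))" (is "?L \<le> ?R1 + ?R2") for t
  proof (cases "1 < t \<and> t < x")
    case True
    then have t: "1 < t" "t < x" by auto
    have rp: "rt t > 0" using rt_pos t by simp
    have zt: "zh t ^ m \<le> Z * (t / x) ^ m" using zh_power_ratio[of t x m] t by (simp add: Z_def)
    have R: "?R1 \<ge> 0" "?R2 \<ge> 0" using Z c l x t by (auto intro!: mult_nonneg_nonneg divide_nonneg_nonneg add_nonneg_nonneg)
    show ?thesis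
    proof (cases "t < 3/2")
      case True
      have a: "(x - t) powr (-1/2) \<le> 3/2"
      proof -
        have "(x - t) powr (-1/2) \<le> (1/2) powr (-1/2)" using True x by (intro powr_mono2') auto
        also have "\<dots> = sqrt 2" using powr_minus_divide[of "1/2::real" "1/2"] by (simp add: powr_half_sqrt real_sqrt_divide)
        also have "\<dots> \<le> 3/2" by (rule real_le_lsqrt) (auto simp: power2_eq_square)
        finally show ?thesis .
      qed
      have b: "1 / rt t \<le> (t - 1) powr (-1/2)"
      proof -
        have "sqrt (t - 1) \<le> rt t" unfolding rt_def using t by (intro real_sqrt_le_mono) (simp add: power2_eq_square algebra_simps mult_left_mono)
        then have "1 / rt t \<le> 1 / sqrt (t - 1)" using t rp by (intro divide_left_mono) auto
        also have "\<dots> = (t - 1) powr (-1/2)" using t powr_minus_divide[of "t - 1" "1/2"] by (simp add: powr_half_sqrt)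
        finally show ?thesis .
      qed
      have "zh t ^ m \<le> Z * (3 / (2 * x)) ^ m"
      proof -
        have "(t / x) ^ m \<le> (3 / (2 * x)) ^ m" using True t x by (intro power_mono) (auto simp: field_simps)
        then show ?thesis using zt Z by (meson mult_left_mono order_trans)
      qed
      then have "(x - t) powr (-1/2) * (zh t ^ m * (1 / rt t)) \<le> 3/2 * ((Z * (3 / (2 * x)) ^ m) * (t - 1) powr (-1/2))"
        using a b Z x t rp zh_pos[of t] by (intro mult_mono) auto
      then have "?L \<le> ?R1" using t True by (simp add: c_def indicator_def mult_ac)
      then show ?thesis using R by linarith
    next
      case False
      have b: "1 / rt t \<le> (3/2) / t"
      proof -
        have "(3/2)\<^sup>2 \<le> t\<^sup>2" using False by (intro power_mono) auto
        then have "(2/3 * t)\<^sup>2 \<le> t\<^sup>2 - 1" by (simp add: power_mult_distrib power2_eq_square)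
        then have "2/3 * t \<le> rt t" unfolding rt_def by (rule real_le_rsqrt)
        then have "1 / rt t \<le> 1 / (2/3 * t)" using t rp by (intro divide_left_mono) auto
        then show ?thesis by simp
      qed
      have "zh t ^ m * (1 / rt t) \<le> Z * (t / x) ^ m * ((3/2) / t)"
        using zt b Z t x zh_pos[of t] rp by (intro mult_mono) auto
      also have "\<dots> = Z * (3/2) / x * (t / x) ^ (m - 1)"
      proof -
        have "(t / x) ^ m = (t / x) * (t / x) ^ (m - 1)" using m by (metis One_nat_def Suc_pred less_le_trans pos2 power_Suc)
        then show ?thesis using t by simp
      qed
      finally have e1: "zh t ^ m * (1 / rt t) \<le> Z * (3/2) / x * (t / x) ^ (m - 1)" .
      have e2: "(t / x) ^ (m - 1) \<le> 1 / (1 + l * (x - t))"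
      proof -
        have "(1 - (x - t) / x) ^ (m - 1) \<le> 1 / (1 + real (m - 1) * ((x - t) / x))"
          using t x by (intro one_minus_power_le) auto
        moreover have "1 - (x - t) / x = t / x" using x by (simp add: field_simps)
        ultimately show ?thesis by (simp add: l_def)
      qed
      have "zh t ^ m * (1 / rt t) \<le> Z * (3/2) / x * (1 / (1 + l * (x - t)))"
        using Z x by (intro order_trans[OF e1 mult_left_mono[OF e2]]) auto
      then have "(x - t) powr (-1/2) * (zh t ^ m * (1 / rt t)) \<le> (x - t) powr (-1/2) * (Z * (3/2) / x * (1 / (1 + l * (x - t))))"
        by (rule mult_left_mono) simp
      then have "?L \<le> ?R2" using t by (simp add: indicator_def mult_ac)
      then show ?thesis using R by linarith
    qed
  next
    case False
    then have "?L = 0" by auto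
    moreover have "?R1 \<ge> 0" using Z c by (auto intro!: mult_nonneg_nonneg)
    moreover have "?R2 \<ge> 0" using Z l x by (cases "t < x") (auto intro!: mult_nonneg_nonneg divide_nonneg_nonneg add_nonneg_nonneg)
    ultimately show ?thesis by linarith
  qed
  have I1: "(\<integral>\<^sup>+t. ennreal (indicator {0..1/2} (t - 1) * (t - 1) powr (-1/2)) \<partial>lborel) \<le> ennreal (3/2)"
  proof -
    have "(\<integral>\<^sup>+t. ennreal (indicator {0..1/2} (t - 1) * (t - 1) powr (-1/2)) \<partial>lborel) = (\<integral>\<^sup>+t. ennreal (t powr (-1/2)) * indicator {0..1/2} t \<partial>lborel)"
      by (subst nn_integral_real_affine[where c=1 and t=1]) (auto intro!: nn_integral_cong split: split_indicator)
    also have "\<dots> = ennreal ((1/2) powr (-1/2 + 1) / (-1/2 + 1))" by (rule nn_integral_powr_head) auto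
    also have "(1/2::real) powr (-1/2 + 1) / (-1/2 + 1) = 2 * sqrt (1/2)" by (simp add: powr_half_sqrt)
    also have "\<dots> \<le> 3/2"
    proof -
      have "sqrt (1/2) \<le> (3/4::real)" by (rule real_le_lsqrt) (auto simp: power2_eq_square)
      then show ?thesis by simp
    qed
    finally show ?thesis by (simp add: ennreal_leI)
  qed
  have I2: "(\<integral>\<^sup>+t. ennreal (indicator {0<..} (x - t) * ((x - t) powr (-1/2) / (1 + l * (x - t)))) \<partial>lborel) \<le> ennreal (4 * l powr (-1/2))"
  proof -
    have "(\<integral>\<^sup>+t. ennreal (indicator {0<..} (x - t) * ((x - t) powr (-1/2) / (1 + l * (x - t)))) \<partial>lborel) = (\<integral>\<^sup>+s. ennreal (s powr (-1/2) / (1 + l * s)) * indicator {0<..} s \<partial>lborel)"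
      by (subst nn_integral_real_affine[where c="-1" and t=x]) (auto intro!: nn_integral_cong split: split_indicator)
    then show ?thesis using nn_integral_inverse_sqrt_linear[OF l] by simp
  qed
  have n1: "indicator {0..1/2} (t - 1) * (t - 1) powr (-1/2) \<ge> (0::real)" for t by simp
  have n2: "indicator {0<..} (x - t) * ((x - t) powr (-1/2) / (1 + l * (x - t))) \<ge> (0::real)" for t
    using l by (cases "t < x") (auto intro!: divide_nonneg_nonneg add_nonneg_nonneg)
  have "(\<integral>\<^sup>+t. ennreal (indicator {1<..<x} t * (x - t) powr (-1/2) * (zh t ^ m / rt t)) \<partial>lborel) \<le>
    (\<integral>\<^sup>+t. ennreal (Z * c) * ennreal (indicator {0..1/2} (t - 1) * (t - 1) powr (-1/2)) + ennreal (Z * (3/2) / x) * ennreal (indicator {0<..} (x - t) * ((x - t) powr (-1/2) / (1 + l * (x - t)))) \<partial>lborel)"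
  proof (intro nn_integral_mono)
    fix t
    show "ennreal (indicator {1<..<x} t * (x - t) powr (-1/2) * (zh t ^ m / rt t)) \<le> ennreal (Z * c) * ennreal (indicator {0..1/2} (t - 1) * (t - 1) powr (-1/2)) + ennreal (Z * (3/2) / x) * ennreal (indicator {0<..} (x - t) * ((x - t) powr (-1/2) / (1 + l * (x - t))))"
      using Z c x by (intro ennreal_le_mult_add_mult pw n1 n2) auto
  qed
  also have "\<dots> = ennreal (Z * c) * (\<integral>\<^sup>+t. ennreal (indicator {0..1/2} (t - 1) * (t - 1) powr (-1/2)) \<partial>lborel) + ennreal (Z * (3/2) / x) * (\<integral>\<^sup>+t. ennreal (indicator {0<..} (x - t) * ((x - t) powr (-1/2) / (1 + l * (x - t)))) \<partial>lborel)"
    by (subst nn_integral_add, simp, simp, subst nn_integral_cmult, simp, subst nn_integral_cmult) auto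
  also have "\<dots> \<le> ennreal (Z * c) * ennreal (3/2) + ennreal (Z * (3/2) / x) * ennreal (4 * l powr (-1/2))"
    using I1 I2 by (intro add_mono mult_left_mono) auto
  also have "\<dots> = ennreal (Z * c * (3/2) + Z * (3/2) / x * (4 * l powr (-1/2)))"
    using Z c x by (simp add: ennreal_mult[symmetric] ennreal_plus[symmetric] del: ennreal_plus)
  also have "\<dots> \<le> ennreal (12 * (real m powr (-1/2) * x powr (-1/2)) * zh x ^ m)"
  proof (rule ennreal_leI)
    define q where "q = real m powr (-1/2) * x powr (-1/2)"
    have c1: "c * (3/2) \<le> 3.5 * q"
    proof -
      have "3 / (2 * x) = 3/4 * (2 / x)" by simp
      then have "(3 / (2 * x)) ^ m = (3/4) ^ m * (2 / x) ^ m" by (simp only: power_mult_distrib)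
      also have "\<dots> \<le> real m powr (-1/2) * (3/2 * x powr (-1/2))"
      proof (rule mult_mono)
        show "(3/4::real) ^ m \<le> real m powr (-1/2)" using three_quarters_power m by simp
        have y: "0 \<le> 2 / x" "2 / x \<le> 1" using x by auto
        have "(2 / x) ^ m \<le> (2 / x) ^ 1" using y m by (intro power_decreasing) auto
        also have "\<dots> = sqrt (2 / x) * sqrt (2 / x)" using y by simp
        also have "\<dots> \<le> sqrt (2 / x) * 1" using y by (intro mult_left_mono) (auto simp: real_sqrt_le_1_iff)
        also have "\<dots> = sqrt 2 * x powr (-1/2)" using x powr_minus_divide[of x "1/2"] by (simp add: powr_half_sqrt real_sqrt_divide)
        also have "\<dots> \<le> 3/2 * x powr (-1/2)"
          by (intro mult_right_mono real_le_lsqrt) (auto simp: power2_eq_square)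
        finally show "(2 / x) ^ m \<le> 3/2 * x powr (-1/2)" .
      qed (use x in auto)
      finally have "c * (3/2) \<le> 27/8 * q" by (simp add: c_def q_def mult_ac)
      moreover have "q \<ge> 0" by (simp add: q_def)
      ultimately show ?thesis by linarith
    qed
    have c2: "(3/2) / x * (4 * l powr (-1/2)) \<le> 8.5 * q"
    proof -
      have "real m / 2 / x \<le> l" using m x unfolding l_def by (intro divide_right_mono) auto
      then have "l powr (-1/2) \<le> (real m / 2 / x) powr (-1/2)" using m x by (intro powr_mono2') auto
      also have "\<dots> = sqrt 2 * (real m powr (-1/2) * (x * x powr (-1/2)))"
      proof -
        have h: "a powr (-1/2) = 1 / sqrt a" if "a > 0" for a :: real
          using that powr_minus_divide[of a "1/2"] by (simp add: powr_half_sqrt)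
        have px: "x * x powr (-1/2) = sqrt x" using x powr_mult_base[of x "-1/2"] by (simp add: powr_half_sqrt)
        have "real m / 2 / x > 0" "real m > 0" using m x by auto
        from this[THEN h] show ?thesis unfolding px by (simp add: real_sqrt_divide real_sqrt_mult)
      qed
      also have "\<dots> \<le> 17/12 * (real m powr (-1/2) * (x * x powr (-1/2)))"
        using x by (intro mult_right_mono real_le_lsqrt) (auto simp: power2_eq_square)
      finally have "(3/2) / x * (4 * l powr (-1/2)) \<le> (3/2) / x * (4 * (17/12 * (real m powr (-1/2) * (x * x powr (-1/2)))))"
        using x by (intro mult_left_mono) auto
      also have "\<dots> = 8.5 * q" using x by (simp add: q_def)
      finally show ?thesis .
    qed
    have "Z * c * (3/2) + Z * (3/2) / x * (4 * l powr (-1/2)) = Z * (c * (3/2) + (3/2) / x * (4 * l powr (-1/2)))"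
      by (simp add: algebra_simps)
    also have "\<dots> \<le> Z * (12 * q)" using c1 c2 Z by (intro mult_left_mono) auto
    finally show "Z * c * (3/2) + Z * (3/2) / x * (4 * l powr (-1/2)) \<le> 12 * (real m powr (-1/2) * x powr (-1/2)) * zh x ^ m"
      by (simp add: Z_def q_def mult_ac)
  qed
  finally show ?thesis .
qed

text \<open>The dual half of the Schur test: Bernoulli's inequality for $(x/t)^m$ shows that the integral is
  concentrated on $x - t = O(t/m)$.\<close>

lemma schur_second:
  assumes t: "t > 1" and m: "m \<ge> 1"
  shows "(\<integral>\<^sup>+x. ennreal (indicator {t<..} x * (x - t) powr (-1/2) * (x powr (-1/2) / zh x ^ m)) \<partial>lborel)
    \<le> ennreal (4 * real m powr (-1/2) / zh t ^ m)"
proof -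
  define l where "l = real m / t"
  have l: "l > 0" using m t by (simp add: l_def)
  have zt: "zh t > 0" using zh_pos t by simp
  have n2: "indicator {0<..} (x - t) * ((x - t) powr (-1/2) / (1 + l * (x - t))) \<ge> (0::real)" for x
    using l by (cases "t < x") (auto intro!: divide_nonneg_nonneg add_nonneg_nonneg)
  have pw: "indicator {t<..} x * (x - t) powr (-1/2) * (x powr (-1/2) / zh x ^ m) \<le>
     t powr (-1/2) / zh t ^ m * (indicator {0<..} (x - t) * ((x - t) powr (-1/2) / (1 + l * (x - t))))" for x
  proof (cases "x > t")
    case True
    have zx: "zh x > 0" using zh_pos t True by simp
    have "1 / zh x ^ m \<le> 1 / zh t ^ m * (t / x) ^ m"
      using zh_power_ratio[of t x m] t True zt zx by (simp add: divide_simps mult.commute)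
    also have "(t / x) ^ m \<le> 1 / (1 + l * (x - t))"
    proof -
      have "1 + real m * ((x - t) / t) \<le> (1 + (x - t) / t) ^ m" using t True by (intro Bernoulli_inequality) (auto intro: order_trans[of _ 0])
      also have "1 + (x - t) / t = x / t" using t by (simp add: field_simps)
      finally have "1 + l * (x - t) \<le> (x / t) ^ m" by (simp add: l_def)
      moreover have "1 + l * (x - t) > 0" using l True by (simp add: add_pos_pos)
      ultimately have "1 / (x / t) ^ m \<le> 1 / (1 + l * (x - t))" using t True by (intro divide_left_mono) auto
      then show ?thesis by (simp add: power_divide)
    qed
    finally have a: "1 / zh x ^ m \<le> 1 / zh t ^ m * (1 / (1 + l * (x - t)))" using zt by (simp add: divide_right_mono)
    have b: "x powr (-1/2) \<le> t powr (-1/2)" using t True by (intro powr_mono2') auto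
    have "x powr (-1/2) * (1 / zh x ^ m) \<le> t powr (-1/2) * (1 / zh t ^ m * (1 / (1 + l * (x - t))))"
      using a b zx by (intro mult_mono) auto
    then have "(x - t) powr (-1/2) * (x powr (-1/2) * (1 / zh x ^ m)) \<le> (x - t) powr (-1/2) * (t powr (-1/2) * (1 / zh t ^ m * (1 / (1 + l * (x - t)))))"
      by (rule mult_left_mono) simp
    then show ?thesis using True by (simp add: indicator_def mult_ac)
  qed (use n2 zt in auto)
  have I2: "(\<integral>\<^sup>+x. ennreal (indicator {0<..} (x - t) * ((x - t) powr (-1/2) / (1 + l * (x - t)))) \<partial>lborel) \<le> ennreal (4 * l powr (-1/2))"
  proof -
    have "(\<integral>\<^sup>+x. ennreal (indicator {0<..} (x - t) * ((x - t) powr (-1/2) / (1 + l * (x - t)))) \<partial>lborel) = (\<integral>\<^sup>+s. ennreal (s powr (-1/2) / (1 + l * s)) * indicator {0<..} s \<partial>lborel)"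
      by (subst nn_integral_real_affine[where c=1 and t=t]) (auto intro!: nn_integral_cong split: split_indicator)
    then show ?thesis using nn_integral_inverse_sqrt_linear[OF l] by simp
  qed
  have "(\<integral>\<^sup>+x. ennreal (indicator {t<..} x * (x - t) powr (-1/2) * (x powr (-1/2) / zh x ^ m)) \<partial>lborel)
    \<le> (\<integral>\<^sup>+x. ennreal (t powr (-1/2) / zh t ^ m) * ennreal (indicator {0<..} (x - t) * ((x - t) powr (-1/2) / (1 + l * (x - t)))) \<partial>lborel)"
    using pw n2 zt by (intro nn_integral_mono) (simp add: ennreal_mult[symmetric] ennreal_leI)
  also have "\<dots> \<le> ennreal (t powr (-1/2) / zh t ^ m) * ennreal (4 * l powr (-1/2))"
    using I2 by (subst nn_integral_cmult) (auto intro!: mult_left_mono)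
  also have "\<dots> = ennreal (t powr (-1/2) / zh t ^ m * (4 * l powr (-1/2)))" using zt by (intro ennreal_mult[symmetric]) auto
  also have "t powr (-1/2) / zh t ^ m * (4 * l powr (-1/2)) = 4 * real m powr (-1/2) / zh t ^ m"
  proof -
    have "(t * l) powr (-1/2) = t powr (-1/2) * l powr (-1/2)" by (rule powr_mult)
    moreover have "t * l = real m" using t by (simp add: l_def)
    ultimately show ?thesis by simp
  qed
  finally show ?thesis .
qed

text \<open>The Schur test with test function $q(t) = \zeta(t)^m/\sqrt{t^2-1}$: Cauchy-Schwarz in $t$ for the
  factors $k\,q$ and $k\,g^2/q$, then integration in $x$. Each half contributes $m^{-1/2}$, and the constant
  is $12 \cdot 4$.\<close>

lemma schur_bound:
  fixes g :: "real \<Rightarrow> real"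
  assumes [measurable]: "g \<in> borel_measurable borel" and g: "\<And>t. g t \<ge> 0" and m: "m \<ge> 2"
  shows "(\<integral>\<^sup>+x. (\<integral>\<^sup>+t. ennreal (indicator {1<..<x} t * (x - t) powr (-1/2) * g t) \<partial>lborel)\<^sup>2 * ennreal (indicator {2..} x / zh x ^ (2 * m)) \<partial>lborel)
    \<le> ennreal (48 / real m) * (\<integral>\<^sup>+t. ennreal (indicator {1<..} t * ((g t)\<^sup>2 * (rt t / zh t ^ (2 * m)))) \<partial>lborel)"
proof -
  define k where "k = (\<lambda>x t::real. indicator {1<..<x} t * (x - t) powr (-1/2))"
  have k0: "k x t \<ge> 0" for x t by (simp add: k_def)
  have [measurable]: "(\<lambda>(x, t). k x t) \<in> borel_measurable (borel \<Otimes>\<^sub>M borel)"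
  proof -
    have "(\<lambda>(x, t). k x t) = (\<lambda>(x, t). if 1 < t \<and> t < x then (x - t) powr (-1/2) else 0)"
      by (auto simp: k_def fun_eq_iff indicator_def)
    then show ?thesis by simp
  qed
  (* The Schur test function; D x is the second factor after Cauchy-Schwarz. *)
  define q where "q = (\<lambda>t. zh t ^ m / rt t)"
  have [measurable]: "q \<in> borel_measurable borel" unfolding q_def by measurable
  have q0: "q t > 0" if "t > 1" for t using that rt_pos zh_pos[of t] by (simp add: q_def)
  define D where "D = (\<lambda>x. \<integral>\<^sup>+t. ennreal (k x t / q t * (g t)\<^sup>2) \<partial>lborel)"
  define M where "M = real m powr (-1/2)"
  have M: "M \<ge> 0" by (simp add: M_def)
  have cs: "(\<integral>\<^sup>+t. ennreal (k x t * g t) \<partial>lborel)\<^sup>2 \<le> ennreal (12 * (M * x powr (-1/2)) * zh x ^ m) * D x" if x: "x \<ge> 2" for x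
  proof -
    have "(\<integral>\<^sup>+t. ennreal (k x t * g t) \<partial>lborel) = (\<integral>\<^sup>+t. ennreal (sqrt (k x t * q t) * (sqrt (k x t / q t) * g t)) \<partial>lborel)"
    proof (intro nn_integral_cong)
      fix t
      show "ennreal (k x t * g t) = ennreal (sqrt (k x t * q t) * (sqrt (k x t / q t) * g t))"
      proof (cases "1 < t")
        case True
        then have "sqrt (k x t * q t) * sqrt (k x t / q t) = k x t"
          using q0[OF True] k0[of x t] by (simp add: real_sqrt_mult[symmetric])
        then show ?thesis by (simp flip: mult.assoc)
      qed (simp add: k_def)
    qed
    also have "\<dots>\<^sup>2 \<le> (\<integral>\<^sup>+t. ennreal ((sqrt (\<bar>k x t * q t\<bar>))\<^sup>2) \<partial>lborel) * (\<integral>\<^sup>+t. ennreal ((sqrt (\<bar>k x t / q t\<bar>) * g t)\<^sup>2) \<partial>lborel)"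
    proof -
      have "sqrt (k x t * q t) * (sqrt (k x t / q t) * g t) = sqrt (\<bar>k x t * q t\<bar>) * (sqrt (\<bar>k x t / q t\<bar>) * g t)" for t
        using q0[of t] k0[of x t] by (cases "t > 1") (auto simp: k_def abs_mult)
      then show ?thesis using g by (simp only:) (intro nn_integral_Cauchy_Schwarz, auto)
    qed
    also have "(\<integral>\<^sup>+t. ennreal ((sqrt (\<bar>k x t * q t\<bar>))\<^sup>2) \<partial>lborel) = (\<integral>\<^sup>+t. ennreal (indicator {1<..<x} t * (x - t) powr (-1/2) * (zh t ^ m / rt t)) \<partial>lborel)"
    proof (intro nn_integral_cong)
      fix t
      have "\<bar>k x t * q t\<bar> = k x t * q t" using q0[of t] k0[of x t] by (cases "t > 1") (auto simp: k_def)
      moreover have "(sqrt \<bar>k x t * q t\<bar>)\<^sup>2 = \<bar>k x t * q t\<bar>" by simp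
      ultimately show "ennreal ((sqrt (\<bar>k x t * q t\<bar>))\<^sup>2) = ennreal (indicator {1<..<x} t * (x - t) powr (-1/2) * (zh t ^ m / rt t))"
        by (simp only: k_def q_def)
    qed
    also have "(\<integral>\<^sup>+t. ennreal ((sqrt (\<bar>k x t / q t\<bar>) * g t)\<^sup>2) \<partial>lborel) = D x"
      unfolding D_def
    proof (intro nn_integral_cong)
      fix t
      have "\<bar>k x t / q t\<bar> = k x t / q t" using q0[of t] k0[of x t] by (cases "t > 1") (auto simp: k_def)
      moreover have "(sqrt (\<bar>k x t / q t\<bar>) * g t)\<^sup>2 = \<bar>k x t / q t\<bar> * (g t)\<^sup>2" by (simp add: power_mult_distrib)
      ultimately show "ennreal ((sqrt (\<bar>k x t / q t\<bar>) * g t)\<^sup>2) = ennreal (k x t / q t * (g t)\<^sup>2)"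
        by (simp only:)
    qed
    finally have "(\<integral>\<^sup>+t. ennreal (k x t * g t) \<partial>lborel)\<^sup>2 \<le> (\<integral>\<^sup>+t. ennreal (indicator {1<..<x} t * (x - t) powr (-1/2) * (zh t ^ m / rt t)) \<partial>lborel) * D x" .
    also have "\<dots> \<le> ennreal (12 * (M * x powr (-1/2)) * zh x ^ m) * D x"
      unfolding M_def using schur_first[OF x m] by (rule mult_right_mono) simp
    finally show ?thesis .
  qed
  have "(\<integral>\<^sup>+x. (\<integral>\<^sup>+t. ennreal (indicator {1<..<x} t * (x - t) powr (-1/2) * g t) \<partial>lborel)\<^sup>2 * ennreal (indicator {2..} x / zh x ^ (2 * m)) \<partial>lborel)
     \<le> (\<integral>\<^sup>+x. (\<integral>\<^sup>+t. ennreal (12 * M * (x powr (-1/2) * (indicator {2..} x / zh x ^ m))) * ennreal (k x t / q t * (g t)\<^sup>2) \<partial>lborel) \<partial>lborel)"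
  proof (intro nn_integral_mono)
    fix x :: real
    show "(\<integral>\<^sup>+t. ennreal (indicator {1<..<x} t * (x - t) powr (-1/2) * g t) \<partial>lborel)\<^sup>2 * ennreal (indicator {2..} x / zh x ^ (2 * m))
      \<le> (\<integral>\<^sup>+t. ennreal (12 * M * (x powr (-1/2) * (indicator {2..} x / zh x ^ m))) * ennreal (k x t / q t * (g t)\<^sup>2) \<partial>lborel)"
    proof (cases "x \<ge> 2")
      case True
      have zx: "zh x > 0" using zh_pos True by simp
      have "(\<integral>\<^sup>+t. ennreal (k x t * g t) \<partial>lborel)\<^sup>2 * ennreal (1 / zh x ^ (2 * m)) \<le> ennreal (12 * (M * x powr (-1/2)) * zh x ^ m) * D x * ennreal (1 / zh x ^ (2 * m))"
        using cs[OF True] by (rule mult_right_mono) simp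
      also have "\<dots> = ennreal (12 * (M * x powr (-1/2)) * zh x ^ m * (1 / zh x ^ (2 * m))) * D x"
      proof -
        have "ennreal (12 * (M * x powr (-1/2)) * zh x ^ m * (1 / zh x ^ (2 * m))) = ennreal (12 * (M * x powr (-1/2)) * zh x ^ m) * ennreal (1 / zh x ^ (2 * m))"
          using zx M by (intro ennreal_mult) auto
        then show ?thesis by (simp only: mult_ac)
      qed
      also have "12 * (M * x powr (-1/2)) * zh x ^ m * (1 / zh x ^ (2 * m)) = 12 * M * (x powr (-1/2) * (1 / zh x ^ m))"
        using zx by (simp add: power_mult power2_eq_square[symmetric] power_mult[symmetric] mult.commute[of 2] power_add[symmetric] mult_2_right divide_simps)
      finally have main: "(\<integral>\<^sup>+t. ennreal (k x t * g t) \<partial>lborel)\<^sup>2 * ennreal (1 / zh x ^ (2 * m)) \<le> ennreal (12 * M * (x powr (-1/2) * (1 / zh x ^ m))) * D x" .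
      have D: "ennreal c * D x = (\<integral>\<^sup>+t. ennreal c * ennreal (k x t / q t * (g t)\<^sup>2) \<partial>lborel)" for c
        unfolding D_def by (rule nn_integral_cmult[symmetric]) measurable
      have kk: "indicator {1<..<x} t * (x - t) powr (-1/2) * g t = k x t * g t" for t by (simp only: k_def)
      have ind: "indicator {2..} x = (1::real)" using True by simp
      show ?thesis unfolding kk ind D[symmetric] by (rule main)
    qed simp
  qed
  also have "\<dots> = (\<integral>\<^sup>+t. (\<integral>\<^sup>+x. ennreal (12 * M * (x powr (-1/2) * (indicator {2..} x / zh x ^ m))) * ennreal (k x t / q t * (g t)\<^sup>2) \<partial>lborel) \<partial>lborel)"
    by (rule lborel_pair.Fubini') measurable
  also have "\<dots> \<le> (\<integral>\<^sup>+t. ennreal (48 / real m) * ennreal (indicator {1<..} t * ((g t)\<^sup>2 * (rt t / zh t ^ (2 * m)))) \<partial>lborel)"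
  proof (intro nn_integral_mono)
    fix t
    show "(\<integral>\<^sup>+x. ennreal (12 * M * (x powr (-1/2) * (indicator {2..} x / zh x ^ m))) * ennreal (k x t / q t * (g t)\<^sup>2) \<partial>lborel)
      \<le> ennreal (48 / real m) * ennreal (indicator {1<..} t * ((g t)\<^sup>2 * (rt t / zh t ^ (2 * m))))"
    proof (cases "t > 1")
      case True
      have zt: "zh t > 0" "rt t > 0" using zh_pos rt_pos True by auto
      define c where "c = 12 * M * ((g t)\<^sup>2 / q t)"
      have c0: "c \<ge> 0" using M q0[OF True] by (simp add: c_def)
      have "(\<integral>\<^sup>+x. ennreal (12 * M * (x powr (-1/2) * (indicator {2..} x / zh x ^ m))) * ennreal (k x t / q t * (g t)\<^sup>2) \<partial>lborel)
        \<le> (\<integral>\<^sup>+x. ennreal c * ennreal (indicator {t<..} x * (x - t) powr (-1/2) * (x powr (-1/2) / zh x ^ m)) \<partial>lborel)"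
      proof (intro nn_integral_mono)
        fix x
        show "ennreal (12 * M * (x powr (-1/2) * (indicator {2..} x / zh x ^ m))) * ennreal (k x t / q t * (g t)\<^sup>2) \<le> ennreal c * ennreal (indicator {t<..} x * (x - t) powr (-1/2) * (x powr (-1/2) / zh x ^ m))"
        proof (cases "x \<ge> 2 \<and> t < x")
          case xt: True
          then have zx: "zh x > 0" using zh_pos by simp
          show ?thesis using xt True zx M q0[OF True]
            by (subst (1 2) ennreal_mult[symmetric]) (auto simp: k_def c_def indicator_def mult_ac)
        qed (auto simp: k_def)
      qed
      also have "\<dots> = ennreal c * (\<integral>\<^sup>+x. ennreal (indicator {t<..} x * (x - t) powr (-1/2) * (x powr (-1/2) / zh x ^ m)) \<partial>lborel)"
        by (rule nn_integral_cmult) measurable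
      also have "\<dots> \<le> ennreal c * ennreal (4 * real m powr (-1/2) / zh t ^ m)"
        using schur_second[OF True, of m] m by (intro mult_left_mono) auto
      also have "\<dots> = ennreal (c * (4 * real m powr (-1/2) / zh t ^ m))" using c0 zt by (intro ennreal_mult[symmetric]) auto
      also have "c * (4 * real m powr (-1/2) / zh t ^ m) = 48 / real m * ((g t)\<^sup>2 * (rt t / zh t ^ (2 * m)))"
      proof -
        have "M * M = 1 / real m" using m by (simp add: M_def powr_add[symmetric] powr_minus_divide)
        have "c * (4 * real m powr (-1/2) / zh t ^ m) = 48 * (M * M) * ((g t)\<^sup>2 * (rt t / (zh t ^ m * zh t ^ m)))"
          by (simp add: c_def q_def M_def)
        also have "zh t ^ m * zh t ^ m = zh t ^ (2 * m)" by (simp add: mult_2 power_add)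
        finally show ?thesis using \<open>M * M = 1 / real m\<close> by simp
      qed
      also have "ennreal (48 / real m * ((g t)\<^sup>2 * (rt t / zh t ^ (2 * m)))) = ennreal (48 / real m) * ennreal (indicator {1<..} t * ((g t)\<^sup>2 * (rt t / zh t ^ (2 * m))))"
      proof -
        have ind: "indicator {1<..} t = (1::real)" using True by simp
        show ?thesis unfolding ind mult_1 using zt by (intro ennreal_mult) auto
      qed
      finally show ?thesis .
    qed (simp add: k_def)
  qed
  also have "\<dots> = ennreal (48 / real m) * (\<integral>\<^sup>+t. ennreal (indicator {1<..} t * ((g t)\<^sup>2 * (rt t / zh t ^ (2 * m)))) \<partial>lborel)"
    by (rule nn_integral_cmult) measurable
  finally show ?thesis .
qed

section \<open>Poisson averages in weighted spaces\<close>

lemma poisson_nonneg: "\<eta> > 0 \<Longrightarrow> poisson \<eta> x \<ge> 0"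
  by (simp add: poisson_def)

lemma measurable_poisson [measurable]: "poisson \<eta> \<in> borel_measurable borel"
  unfolding poisson_def[abs_def] by measurable

lemma nn_integral_poisson:
  assumes "\<eta> > 0"
  shows "(\<integral>\<^sup>+y. ennreal (poisson \<eta> (y - x)) \<partial>lborel) = 1" "(\<integral>\<^sup>+x. ennreal (poisson \<eta> (y - x)) \<partial>lborel) = 1"
proof -
  have 1: "(\<integral>\<^sup>+y. ennreal (poisson \<eta> y) \<partial>lborel) = 1"
    using nn_integral_Cauchy_density[OF assms] by (simp add: poisson_def)
  show "(\<integral>\<^sup>+y. ennreal (poisson \<eta> (y - x)) \<partial>lborel) = 1"
    by (subst nn_integral_real_affine[where c=1 and t=x]) (auto simp: 1)
  show "(\<integral>\<^sup>+x. ennreal (poisson \<eta> (y - x)) \<partial>lborel) = 1"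
    by (subst nn_integral_real_affine[where c="-1" and t=y]) (auto simp: 1)
qed

lemma nn_integral_poisson_far:
  assumes "\<eta> > 0" "d > 0"
  shows "(\<integral>\<^sup>+y. ennreal (poisson \<eta> (y - x)) * indicator {y. \<bar>y - x\<bar> \<ge> d} y \<partial>lborel) \<le> ennreal (\<eta> / d)"
proof -
  have "(\<integral>\<^sup>+y. ennreal (poisson \<eta> (y - x)) * indicator {y. \<bar>y - x\<bar> \<ge> d} y \<partial>lborel) = (\<integral>\<^sup>+y. ennreal (poisson \<eta> y) * indicator {y. \<bar>y\<bar> \<ge> d} y \<partial>lborel)"
    by (subst nn_integral_real_affine[where c=1 and t=x]) (auto intro!: nn_integral_cong split: split_indicator)
  also have "\<dots> \<le> (\<integral>\<^sup>+y. ennreal (\<eta> / pi) * (ennreal (\<bar>y\<bar> powr - 2) * indicator {y. \<bar>y\<bar> \<ge> d} y) \<partial>lborel)"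
  proof (intro nn_integral_mono)
    fix y
    have "poisson \<eta> y \<le> \<eta> / pi * \<bar>y\<bar> powr - 2" if "\<bar>y\<bar> \<ge> d"
    proof -
      have y: "y\<^sup>2 > 0" using that assms by auto
      have "poisson \<eta> y \<le> \<eta> / (pi * y\<^sup>2)"
        unfolding poisson_def using y assms by (intro divide_left_mono mult_left_mono mult_pos_pos) (auto simp: add_pos_nonneg)
      also have "\<dots> = \<eta> / pi * \<bar>y\<bar> powr - 2"
        using y powr_minus_divide[of "\<bar>y\<bar>" 2] by (simp add: powr_numeral)
      finally show ?thesis .
    qed
    then show "ennreal (poisson \<eta> y) * indicator {y. \<bar>y\<bar> \<ge> d} y \<le> ennreal (\<eta> / pi) * (ennreal (\<bar>y\<bar> powr - 2) * indicator {y. \<bar>y\<bar> \<ge> d} y)"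
      using assms by (auto split: split_indicator simp: ennreal_mult[symmetric] intro!: ennreal_leI)
  qed
  also have "\<dots> = ennreal (\<eta> / pi) * ennreal (2 * (d powr (1 - 2) / (2 - 1)))"
    using assms nn_integral_abs_powr_tail[of 2 d] by (subst nn_integral_cmult) auto
  also have "\<dots> = ennreal (2 / pi * (\<eta> / d))"
    using assms powr_minus_divide[of d 1] by (simp add: ennreal_mult[symmetric])
  also have "\<dots> \<le> ennreal (\<eta> / d)"
    using assms pi_ge_two by (intro ennreal_leI mult_left_le_one_le) auto
  finally show ?thesis .
qed

lemma corr_poisson_near:
  assumes f: "bdd_fun K f" and small: "\<And>y. \<bar>y\<bar> < 2 \<Longrightarrow> \<bar>f y\<bar> \<le> \<epsilon>" and x: "\<bar>x\<bar> < 1" and "\<eta> > 0"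
  shows "\<bar>corr (poisson \<eta>) f x\<bar> \<le> \<epsilon> + K * \<eta>"
proof -
  have [measurable]: "f \<in> borel_measurable borel" using bdd_funD(1)[OF f] .
  have K: "K \<ge> 0" using bdd_funD(3)[OF f] .
  have \<epsilon>: "\<epsilon> \<ge> 0" using small[of 0] by (simp add: order_trans[OF abs_ge_zero])
  have "(\<integral>\<^sup>+y. ennreal (norm (f y * poisson \<eta> (y - x))) \<partial>lborel) \<le>
     (\<integral>\<^sup>+y. ennreal \<epsilon> * ennreal (poisson \<eta> (y - x)) + ennreal K * (ennreal (poisson \<eta> (y - x)) * indicator {y. \<bar>y - x\<bar> \<ge> 1} y) \<partial>lborel)"
  proof (intro nn_integral_mono)
    fix y
    have P: "poisson \<eta> (y - x) \<ge> 0" using poisson_nonneg assms by simp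
    have "\<bar>f y\<bar> \<le> \<epsilon> + K * indicator {y. \<bar>y - x\<bar> \<ge> 1} y"
    proof (cases "\<bar>y - x\<bar> \<ge> 1")
      case True
      then show ?thesis using bdd_funD(2)[OF f, of y] \<epsilon> by simp
    next
      case False
      then have "\<bar>y\<bar> < 2" using x by linarith
      then show ?thesis using small[of y] K False by simp
    qed
    then have "\<bar>f y\<bar> * poisson \<eta> (y - x) \<le> (\<epsilon> + K * indicator {y. \<bar>y - x\<bar> \<ge> 1} y) * poisson \<eta> (y - x)"
      using P by (rule mult_right_mono)
    then have "norm (f y * poisson \<eta> (y - x)) \<le> \<epsilon> * poisson \<eta> (y - x) + K * (poisson \<eta> (y - x) * indicator {y. \<bar>y - x\<bar> \<ge> 1} y)"
      using P by (simp add: abs_mult algebra_simps)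
    then show "ennreal (norm (f y * poisson \<eta> (y - x))) \<le> ennreal \<epsilon> * ennreal (poisson \<eta> (y - x)) + ennreal K * (ennreal (poisson \<eta> (y - x)) * indicator {y. \<bar>y - x\<bar> \<ge> 1} y)"
      using P K \<epsilon> by (cases "\<bar>y - x\<bar> \<ge> 1") (simp_all add: ennreal_mult[symmetric] ennreal_plus[symmetric] ennreal_leI del: ennreal_plus)
  qed
  also have "\<dots> = ennreal \<epsilon> * (\<integral>\<^sup>+y. ennreal (poisson \<eta> (y - x)) \<partial>lborel) + ennreal K * (\<integral>\<^sup>+y. ennreal (poisson \<eta> (y - x)) * indicator {y. \<bar>y - x\<bar> \<ge> 1} y \<partial>lborel)"
    by (subst nn_integral_add, simp, simp, subst nn_integral_cmult, simp, subst nn_integral_cmult) auto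
  also have "\<dots> \<le> ennreal \<epsilon> * 1 + ennreal K * ennreal (\<eta> / 1)"
    using nn_integral_poisson(1)[OF \<open>\<eta> > 0\<close>, of x] nn_integral_poisson_far[OF \<open>\<eta> > 0\<close>, of 1 x] by (intro add_mono mult_left_mono) auto
  also have "\<dots> = ennreal (\<epsilon> + K * \<eta>)" using K \<epsilon> assms by (simp add: ennreal_mult)
  finally have "norm (LINT y|lborel. f y * poisson \<eta> (y - x)) \<le> \<epsilon> + K * \<eta>"
    using K \<epsilon> assms by (intro norm_integral_le_of_nn_integral) auto
  then show ?thesis by (simp add: corr_def)
qed

text \<open>The Poisson kernel has total mass 1, so this is Jensen's inequality; it is derived from
  Cauchy-Schwarz.\<close>

lemma corr_poisson_Jensen:
  assumes f: "bdd_fun K f" and "\<eta> > 0"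
  shows "ennreal ((corr (poisson \<eta>) f x)\<^sup>2) \<le> (\<integral>\<^sup>+y. ennreal ((f y)\<^sup>2) * ennreal (poisson \<eta> (y - x)) \<partial>lborel)"
proof -
  have [measurable]: "f \<in> borel_measurable borel" using bdd_funD(1)[OF f] .
  have P: "poisson \<eta> y \<ge> 0" for y using poisson_nonneg assms by simp
  obtain C where nP: "nice_kernel C (poisson \<eta>)" using poisson_nice[OF assms(2)] by blast
  have int: "integrable lborel (\<lambda>y. f y * poisson \<eta> (y - x))"
    using integrable_bounded_mult_kernel[OF nP bdd_funD(1)[OF f] bdd_funD(2)[OF f]] .
  have e: "ennreal (norm (f y * poisson \<eta> (y - x))) = ennreal ((\<bar>f y\<bar> * sqrt (poisson \<eta> (y - x))) * sqrt (poisson \<eta> (y - x)))" for y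
    using P[of "y - x"] by (simp add: abs_mult mult.assoc)
  have "ennreal ((corr (poisson \<eta>) f x)\<^sup>2) = (ennreal (norm (LINT y|lborel. f y * poisson \<eta> (y - x))))\<^sup>2"
    by (simp add: corr_def ennreal_power)
  also have "\<dots> \<le> (\<integral>\<^sup>+y. ennreal (norm (f y * poisson \<eta> (y - x))) \<partial>lborel)\<^sup>2"
    using integral_norm_bound_ennreal[OF int] by (intro power_mono) auto
  also have "\<dots> \<le> (\<integral>\<^sup>+y. ennreal ((\<bar>f y\<bar> * sqrt (poisson \<eta> (y - x)))\<^sup>2) \<partial>lborel) * (\<integral>\<^sup>+y. ennreal ((sqrt (poisson \<eta> (y - x)))\<^sup>2) \<partial>lborel)"
    unfolding e using P by (intro nn_integral_Cauchy_Schwarz) auto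
  also have "(\<integral>\<^sup>+y. ennreal ((sqrt (poisson \<eta> (y - x)))\<^sup>2) \<partial>lborel) = 1"
    using P nn_integral_poisson(1)[OF assms(2), of x] by simp
  also have "(\<integral>\<^sup>+y. ennreal ((\<bar>f y\<bar> * sqrt (poisson \<eta> (y - x)))\<^sup>2) \<partial>lborel) = (\<integral>\<^sup>+y. ennreal ((f y)\<^sup>2) * ennreal (poisson \<eta> (y - x)) \<partial>lborel)"
    using P by (intro nn_integral_cong) (simp add: power_mult_distrib ennreal_mult)
  finally show ?thesis by simp
qed

text \<open>For $y \ge 2$ a shift by $a$ is at most a dilation by $1 - a/2$, and $\zeta$ loses at most a factor
  $1 - a$ under it; the power $2m$ then loses a bounded factor for $a = 1/(2m)$.\<close>

lemma zh_scaled_ge: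
  assumes a: "0 < a" "a \<le> 1/4" and y: "y \<ge> 2" and x: "x \<ge> y - a"
  shows "zh x \<ge> (1 - a) * zh y"
proof -
  define l where "l = 1 - a / 2"
  have "l * y \<le> y - a" using mult_left_mono[OF y, of "a / 2"] a by (simp add: l_def algebra_simps)
  then have lx: "l * y \<le> x" using x by linarith
  have l1: "1 \<le> l * y"
  proof -
    have "1/2 * 2 \<le> l * y" using a y by (intro mult_mono) (auto simp: l_def)
    then show ?thesis by simp
  qed
  have "(1 - a) * rt y \<le> rt (l * y)"
  proof -
    have "(1 - a)\<^sup>2 * (y\<^sup>2 - 1) \<le> (l * y)\<^sup>2 - 1"
    proof -
      have y4: "4 \<le> y\<^sup>2" using power_mono[of 2 y 2] y by simp
      have pos: "0 \<le> a - 3 * a\<^sup>2 / 4" using a by (simp add: power2_eq_square)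
      have "(l * y)\<^sup>2 - 1 - (1 - a)\<^sup>2 * (y\<^sup>2 - 1) = y\<^sup>2 * (a - 3 * a\<^sup>2 / 4) - 2 * a + a\<^sup>2"
        unfolding l_def by (simp add: power2_eq_square field_simps)
      moreover have "4 * (a - 3 * a\<^sup>2 / 4) \<le> y\<^sup>2 * (a - 3 * a\<^sup>2 / 4)" using y4 pos by (rule mult_right_mono)
      moreover have "4 * (a - 3 * a\<^sup>2 / 4) - 2 * a + a\<^sup>2 = 2 * (a * (1 - a))" by (simp add: power2_eq_square algebra_simps)
      moreover have "0 \<le> a * (1 - a)" using a by simp
      ultimately show ?thesis by linarith
    qed
    then have "sqrt ((1 - a)\<^sup>2 * (y\<^sup>2 - 1)) \<le> sqrt ((l * y)\<^sup>2 - 1)" by (rule real_sqrt_le_mono)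
    then show ?thesis using a by (simp add: rt_def real_sqrt_mult)
  qed
  moreover have "(1 - a) * y \<le> l * y" using a y by (intro mult_right_mono) (auto simp: l_def)
  ultimately have "(1 - a) * zh y \<le> zh (l * y)" by (simp add: zh_def distrib_left)
  also have "\<dots> \<le> zh x" using l1 lx by (rule zh_mono)
  finally show ?thesis .
qed

lemma wt_le_1: "x \<ge> 1 \<Longrightarrow> n \<ge> 1 \<Longrightarrow> rt x / zh x ^ n \<le> 1"
proof -
  assume x: "x \<ge> 1" and n: "n \<ge> 1"
  have "rt x \<le> zh x ^ 1" using x by (simp add: zh_def)
  also have "\<dots> \<le> zh x ^ n" using zh_ge[OF x] x n by (intro power_increasing) auto
  finally show ?thesis using zh_pos[OF x] by simp
qed

text \<open>The scale $1/(2m)$ is chosen so that $\zeta^{2m}$ changes only by a bounded factor.\<close>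

lemma wt_near:
  assumes y: "y \<ge> 2" and m: "m \<ge> 2" and xy: "\<bar>x - y\<bar> \<le> 1 / real (2 * m)" and x: "x \<ge> 1"
  shows "rt x / zh x ^ (2 * m) \<le> 6 * y / zh y ^ (2 * m)"
proof -
  define a where "a = 1 / real (2 * m)"
  have a: "0 < a" "a \<le> 1/4" using m by (auto simp: a_def field_simps)
  have zy: "zh y > 0" "zh x > 0" using zh_pos y x by auto
  have "(1 - a) * zh y \<le> zh x" using xy by (intro zh_scaled_ge[OF a y]) (auto simp: a_def)
  then have "((1 - a) * zh y) ^ (2 * m) \<le> zh x ^ (2 * m)" using a zy by (intro power_mono) auto
  moreover have "1/4 \<le> (1 - a) ^ (2 * m)"
  proof -
    have "1 + real m * (- a) \<le> (1 + (- a)) ^ m" using a by (intro Bernoulli_inequality) auto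
    then have "1/2 \<le> (1 - a) ^ m" using m by (simp add: a_def)
    then have "1/2 * (1/2) \<le> (1 - a) ^ m * (1 - a) ^ m" by (intro mult_mono) auto
    then show ?thesis by (simp add: mult_2 power_add)
  qed
  then have "1/4 * zh y ^ (2 * m) \<le> (1 - a) ^ (2 * m) * zh y ^ (2 * m)"
    using zy by (intro mult_right_mono) auto
  ultimately have "1/4 * zh y ^ (2 * m) \<le> zh x ^ (2 * m)"
    unfolding power_mult_distrib by (rule order_trans[rotated])
  moreover have "rt x \<le> 3/2 * y" using rt_le[OF x] xy a y unfolding a_def[symmetric] by linarith
  ultimately have "rt x / zh x ^ (2 * m) \<le> (3/2 * y) / (1/4 * zh y ^ (2 * m))"
    using zy y by (intro frac_le) auto
  then show ?thesis by simp
qed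

lemma nn_integral_wt:
  assumes "n \<ge> 4"
  shows "(\<integral>\<^sup>+x. ennreal (indicator {1<..} x * (rt x / zh x ^ n)) \<partial>lborel) \<le> ennreal (1/2)"
proof -
  have "(\<integral>\<^sup>+x. ennreal (indicator {1<..} x * (rt x / zh x ^ n)) \<partial>lborel) \<le> (\<integral>\<^sup>+x. ennreal (x powr - 3) * indicator {1..} x \<partial>lborel)"
  proof (intro nn_integral_mono)
    fix x :: real
    have "rt x / zh x ^ n \<le> x powr - 3" if x: "x > 1"
    proof -
      have "x ^ n \<le> zh x ^ n" using zh_ge[of x] x by (intro power_mono) auto
      moreover have "x ^ 4 \<le> x ^ n" using x assms by (intro power_increasing) auto
      ultimately have "x ^ 4 \<le> zh x ^ n" by (rule order_trans[rotated])
      then have "rt x / zh x ^ n \<le> x / x ^ 4" using rt_le[of x] x by (intro frac_le) auto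
      also have "\<dots> = x powr - 3" using x powr_minus_divide[of x 3] by (simp add: powr_numeral field_simps eval_nat_numeral)
      finally show ?thesis .
    qed
    then show "ennreal (indicator {1<..} x * (rt x / zh x ^ n)) \<le> ennreal (x powr - 3) * indicator {1..} x"
      by (auto split: split_indicator intro!: ennreal_leI)
  qed
  also have "\<dots> = ennreal (1/2)" using nn_integral_powr_tail[of 1 3] by simp
  finally show ?thesis .
qed

text \<open>The part of the Poisson kernel within $d = 1/(2m)$ of its centre sees an almost constant weight. The rest
  has mass at most $\eta/d = 2m\eta$ and contributes $K^2\eta m$, which vanishes as $\eta \to 0$ for
  fixed $m$. The weight loses its factor $\sqrt{x^2-1}$ to the cruder $y$ on the way.\<close>

lemma weighted_poisson_bound:
  assumes f: "bdd_fun K f" and small: "\<And>y. \<bar>y\<bar> < 2 \<Longrightarrow> \<bar>f y\<bar> \<le> \<epsilon>" and "\<eta> > 0" and m: "m \<ge> 2"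
  shows "(\<integral>\<^sup>+x. ennreal (indicator {1<..} x * ((corr (poisson \<eta>) f x)\<^sup>2 * (rt x / zh x ^ (2 * m)))) \<partial>lborel)
    \<le> 6 * (\<integral>\<^sup>+y. ennreal (indicator {2..} y * ((f y)\<^sup>2 * (y / zh y ^ (2 * m)))) \<partial>lborel) + ennreal (2 * \<epsilon>\<^sup>2 + K\<^sup>2 * \<eta> * real m)"
proof -
  have [measurable]: "f \<in> borel_measurable borel" using bdd_funD(1)[OF f] .
  have P: "poisson \<eta> y \<ge> 0" for y using poisson_nonneg assms by simp
  define w where "w = (\<lambda>x. indicator {1<..} x * (rt x / zh x ^ (2 * m)))"
  have [measurable]: "w \<in> borel_measurable borel" unfolding w_def by measurable
  have w0: "w x \<ge> 0" for x using rt_pos[of x] zh_pos[of x] by (cases "x > 1") (auto simp: w_def)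
  define d where "d = 1 / real (2 * m)"
  have d: "d > 0" "d \<le> 1/4" using m by (auto simp: d_def field_simps)
  (* A majorant at y of the weight at any x with |x - y| < d; for y < 2 the function f is small and weight at most 1 suffices. *)
  define s where "s = (\<lambda>y. 6 * (indicator {2..} y * (y / zh y ^ (2 * m))) + indicator {0..<2::real} y)"
  have [measurable]: "s \<in> borel_measurable borel" unfolding s_def by measurable
  have s0: "s y \<ge> 0" for y using zh_pos[of y] by (cases "y \<ge> 2") (auto simp: s_def)
  have ws: "w x \<le> s y" if "\<bar>y - x\<bar> < d" for x y
  proof (cases "x > 1")
    case True
    show ?thesis
    proof (cases "y \<ge> 2")
      case y: True
      then show ?thesis using wt_near[OF y m, of x] that True by (simp add: w_def s_def d_def abs_minus_commute)
    next
      case False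
      then have "y \<in> {0..<2}" using that True d by auto
      then show ?thesis using wt_le_1[of x "2 * m"] True m by (simp add: w_def s_def)
    qed
  qed (simp add: w_def s0)
  have "(\<integral>\<^sup>+x. ennreal (indicator {1<..} x * ((corr (poisson \<eta>) f x)\<^sup>2 * (rt x / zh x ^ (2 * m)))) \<partial>lborel)
     \<le> (\<integral>\<^sup>+x. (\<integral>\<^sup>+y. ennreal ((f y)\<^sup>2) * ennreal (poisson \<eta> (y - x)) * ennreal (w x) \<partial>lborel) \<partial>lborel)"
  proof (intro nn_integral_mono)
    fix x
    have "ennreal (indicator {1<..} x * ((corr (poisson \<eta>) f x)\<^sup>2 * (rt x / zh x ^ (2 * m)))) = ennreal ((corr (poisson \<eta>) f x)\<^sup>2) * ennreal (w x)"
      using w0[of x] by (simp add: w_def ennreal_mult[symmetric] mult_ac)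
    also have "\<dots> \<le> (\<integral>\<^sup>+y. ennreal ((f y)\<^sup>2) * ennreal (poisson \<eta> (y - x)) \<partial>lborel) * ennreal (w x)"
      using corr_poisson_Jensen[OF f \<open>\<eta> > 0\<close>, of x] by (rule mult_right_mono) simp
    also have "\<dots> = (\<integral>\<^sup>+y. ennreal ((f y)\<^sup>2) * ennreal (poisson \<eta> (y - x)) * ennreal (w x) \<partial>lborel)"
      by (rule nn_integral_multc[symmetric]) measurable
    finally show "ennreal (indicator {1<..} x * ((corr (poisson \<eta>) f x)\<^sup>2 * (rt x / zh x ^ (2 * m)))) \<le> (\<integral>\<^sup>+y. ennreal ((f y)\<^sup>2) * ennreal (poisson \<eta> (y - x)) * ennreal (w x) \<partial>lborel)" .
  qed
  also have "\<dots> \<le> (\<integral>\<^sup>+x. (\<integral>\<^sup>+y. ennreal ((f y)\<^sup>2 * s y) * ennreal (poisson \<eta> (y - x)) + ennreal (K\<^sup>2 * w x) * (ennreal (poisson \<eta> (y - x)) * indicator {y. \<bar>y - x\<bar> \<ge> d} y) \<partial>lborel) \<partial>lborel)"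
  proof (intro nn_integral_mono)
    fix x y
    have f2: "(f y)\<^sup>2 \<le> K\<^sup>2" using bdd_funD(2)[OF f, of y] by (metis abs_le_square_iff abs_of_nonneg bdd_funD(3)[OF f])
    have "(f y)\<^sup>2 * w x \<le> (f y)\<^sup>2 * s y + K\<^sup>2 * w x * indicator {y. \<bar>y - x\<bar> \<ge> d} y"
    proof (cases "\<bar>y - x\<bar> < d")
      case True
      then show ?thesis using mult_left_mono[OF ws[OF True], of "(f y)\<^sup>2"] by simp
    next
      case False
      then show ?thesis using mult_right_mono[OF f2 w0[of x]] s0[of y] by (simp add: add_increasing)
    qed
    then have "((f y)\<^sup>2 * w x) * poisson \<eta> (y - x) \<le> ((f y)\<^sup>2 * s y + K\<^sup>2 * w x * indicator {y. \<bar>y - x\<bar> \<ge> d} y) * poisson \<eta> (y - x)"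
      using P by (rule mult_right_mono)
    then have "(f y)\<^sup>2 * poisson \<eta> (y - x) * w x \<le> (f y)\<^sup>2 * s y * poisson \<eta> (y - x) + K\<^sup>2 * w x * (poisson \<eta> (y - x) * indicator {y. \<bar>y - x\<bar> \<ge> d} y)"
      by (simp add: algebra_simps)
    then show "ennreal ((f y)\<^sup>2) * ennreal (poisson \<eta> (y - x)) * ennreal (w x) \<le> ennreal ((f y)\<^sup>2 * s y) * ennreal (poisson \<eta> (y - x)) + ennreal (K\<^sup>2 * w x) * (ennreal (poisson \<eta> (y - x)) * indicator {y. \<bar>y - x\<bar> \<ge> d} y)"
      using P[of "y - x"] w0[of x] s0[of y]
      by (cases "\<bar>y - x\<bar> \<ge> d") (simp_all add: ennreal_mult[symmetric] ennreal_plus[symmetric] ennreal_leI del: ennreal_plus)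
  qed
  also have "\<dots> = (\<integral>\<^sup>+x. (\<integral>\<^sup>+y. ennreal ((f y)\<^sup>2 * s y) * ennreal (poisson \<eta> (y - x)) \<partial>lborel) \<partial>lborel) +
      (\<integral>\<^sup>+x. ennreal (K\<^sup>2 * w x) * (\<integral>\<^sup>+y. ennreal (poisson \<eta> (y - x)) * indicator {y. \<bar>y - x\<bar> \<ge> d} y \<partial>lborel) \<partial>lborel)"
  proof -
    have ind: "(\<lambda>(x, y). indicator {y. \<bar>y - x\<bar> \<ge> d} y :: ennreal) = (\<lambda>(x, y). if \<bar>y - x\<bar> \<ge> d then 1 else 0)"
      by (auto simp: fun_eq_iff)
    have [measurable]: "(\<lambda>(x, y). indicator {y. \<bar>y - x\<bar> \<ge> d} y :: ennreal) \<in> borel_measurable (borel \<Otimes>\<^sub>M borel)"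
      unfolding ind by measurable
    have [measurable]: "(\<lambda>y. indicator {y. \<bar>y - x\<bar> \<ge> d} y :: ennreal) \<in> borel_measurable borel" for x by measurable
    show ?thesis
      by (subst nn_integral_add[symmetric], measurable) (intro nn_integral_cong, subst nn_integral_add, measurable, subst nn_integral_cmult, measurable)
  qed
  also have "(\<integral>\<^sup>+x. (\<integral>\<^sup>+y. ennreal ((f y)\<^sup>2 * s y) * ennreal (poisson \<eta> (y - x)) \<partial>lborel) \<partial>lborel) = (\<integral>\<^sup>+y. (\<integral>\<^sup>+x. ennreal ((f y)\<^sup>2 * s y) * ennreal (poisson \<eta> (y - x)) \<partial>lborel) \<partial>lborel)"
    by (rule lborel_pair.Fubini') measurable
  also have "\<dots> = (\<integral>\<^sup>+y. ennreal ((f y)\<^sup>2 * s y) \<partial>lborel)"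
    using nn_integral_poisson(2)[OF \<open>\<eta> > 0\<close>] by (intro nn_integral_cong) (simp add: nn_integral_cmult)
  also have "\<dots> \<le> (\<integral>\<^sup>+y. 6 * ennreal (indicator {2..} y * ((f y)\<^sup>2 * (y / zh y ^ (2 * m)))) + ennreal (\<epsilon>\<^sup>2) * indicator {0..<2} y \<partial>lborel)"
  proof (intro nn_integral_mono)
    fix y
    show "ennreal ((f y)\<^sup>2 * s y) \<le> 6 * ennreal (indicator {2..} y * ((f y)\<^sup>2 * (y / zh y ^ (2 * m)))) + ennreal (\<epsilon>\<^sup>2) * indicator {0..<2} y"
    proof (cases "y \<in> {0..<2}")
      case True
      then have "\<bar>f y\<bar> \<le> \<epsilon>" using small[of y] by simp
      then have "(f y)\<^sup>2 \<le> \<epsilon>\<^sup>2" using abs_le_square_iff[of "f y" \<epsilon>] by simp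
      then show ?thesis using True by (simp add: s_def ennreal_leI)
    next
      case False
      have "ennreal (6 * (indicator {2..} y * ((f y)\<^sup>2 * (y / zh y ^ (2 * m))))) = 6 * ennreal (indicator {2..} y * ((f y)\<^sup>2 * (y / zh y ^ (2 * m))))"
        by (subst ennreal_mult') auto
      then show ?thesis using False by (simp add: s_def mult_ac)
    qed
  qed
  also have "\<dots> = 6 * (\<integral>\<^sup>+y. ennreal (indicator {2..} y * ((f y)\<^sup>2 * (y / zh y ^ (2 * m)))) \<partial>lborel) + ennreal (2 * \<epsilon>\<^sup>2)"
    by (subst nn_integral_add, simp, simp, subst nn_integral_cmult) (auto simp: nn_integral_cmult_indicator ennreal_mult' mult.commute)
  also have "(\<integral>\<^sup>+x. ennreal (K\<^sup>2 * w x) * (\<integral>\<^sup>+y. ennreal (poisson \<eta> (y - x)) * indicator {y. \<bar>y - x\<bar> \<ge> d} y \<partial>lborel) \<partial>lborel) \<le> ennreal (K\<^sup>2 * \<eta> * real m)"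
  proof -
    have "(\<integral>\<^sup>+x. ennreal (K\<^sup>2 * w x) * (\<integral>\<^sup>+y. ennreal (poisson \<eta> (y - x)) * indicator {y. \<bar>y - x\<bar> \<ge> d} y \<partial>lborel) \<partial>lborel) \<le> (\<integral>\<^sup>+x. ennreal (K\<^sup>2) * ennreal (w x) * ennreal (\<eta> / d) \<partial>lborel)"
      using nn_integral_poisson_far[OF \<open>\<eta> > 0\<close> d(1)] w0 by (intro nn_integral_mono) (simp add: ennreal_mult mult_left_mono)
    also have "\<dots> = ennreal (K\<^sup>2) * (\<integral>\<^sup>+x. ennreal (w x) \<partial>lborel) * ennreal (\<eta> / d)"
      by (subst nn_integral_multc, simp, subst nn_integral_cmult) auto
    also have "\<dots> \<le> ennreal (K\<^sup>2) * ennreal (1/2) * ennreal (\<eta> / d)"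
      unfolding w_def using nn_integral_wt[of "2 * m"] m by (intro mult_right_mono mult_left_mono) auto
    also have "\<dots> = ennreal (K\<^sup>2 * (1/2) * (\<eta> / d))"
      using d \<open>\<eta> > 0\<close> by (subst ennreal_mult[symmetric], simp, simp, subst ennreal_mult[symmetric]) auto
    also have "K\<^sup>2 * (1/2) * (\<eta> / d) = K\<^sup>2 * \<eta> * real m" by (simp add: d_def)
    finally show ?thesis .
  qed
  finally show ?thesis by (simp add: add.assoc ennreal_plus[symmetric] \<open>\<eta> > 0\<close> less_imp_le del: ennreal_plus)
qed

lemma poisson_dominated_weight:
  assumes "0 < \<eta>" "\<eta> \<le> 1" and [measurable]: "\<omega> \<in> borel_measurable borel" and \<omega>: "\<And>x. \<omega> x \<ge> 0" "\<And>x. \<omega> x \<le> C / (1 + x\<^sup>2)"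
  shows "(\<integral>\<^sup>+x. ennreal (poisson \<eta> (y - x)) * ennreal (\<omega> x) \<partial>lborel) \<le> ennreal (4 * C / (1 + y\<^sup>2))"
proof -
  have C: "C \<ge> 0" using \<omega>(1)[of 0] \<omega>(2)[of 0] by simp
  have P: "poisson \<eta> y \<ge> 0" for y using poisson_nonneg assms by simp
  have py: "1 + y\<^sup>2 > 0" by (simp add: add_pos_nonneg)
  have pw: "(1 + y\<^sup>2) * (poisson \<eta> (y - x) * \<omega> x) \<le> 2 * C * poisson \<eta> (y - x) + 2 * C / pi * (1 / (1 + x\<^sup>2))" for x
  proof -
    have px: "1 + x\<^sup>2 > 0" by (simp add: add_pos_nonneg)
    have "1 + y\<^sup>2 \<le> 2 * (1 + x\<^sup>2) + 2 * (y - x)\<^sup>2"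
      using zero_le_power2[of "y - 2 * x"] zero_le_power2[of x] by (simp add: power2_eq_square algebra_simps)
    then have "(1 + y\<^sup>2) * (poisson \<eta> (y - x) * \<omega> x) \<le> (2 * (1 + x\<^sup>2) + 2 * (y - x)\<^sup>2) * (poisson \<eta> (y - x) * \<omega> x)"
      using P \<omega>(1) by (intro mult_right_mono) auto
    also have "\<dots> = 2 * poisson \<eta> (y - x) * ((1 + x\<^sup>2) * \<omega> x) + 2 * ((y - x)\<^sup>2 * poisson \<eta> (y - x)) * \<omega> x"
      by (simp add: algebra_simps)
    also have "\<dots> \<le> 2 * poisson \<eta> (y - x) * C + 2 * (1 / pi) * (C / (1 + x\<^sup>2))"
    proof (intro add_mono mult_left_mono mult_mono)
      show "(1 + x\<^sup>2) * \<omega> x \<le> C" using \<omega>(2)[of x] px by (simp add: pos_le_divide_eq mult.commute)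
      have "(y - x)\<^sup>2 * poisson \<eta> (y - x) = \<eta> / pi * ((y - x)\<^sup>2 / ((y - x)\<^sup>2 + \<eta>\<^sup>2))" by (simp add: poisson_def)
      also have "\<dots> \<le> 1 / pi * 1"
        using assms(1,2) by (intro mult_mono divide_right_mono) (auto simp: divide_le_eq_1 add_nonneg_pos)
      finally show "(y - x)\<^sup>2 * poisson \<eta> (y - x) \<le> 1 / pi" by simp
    qed (use P \<omega> C in auto)
    finally show ?thesis by (simp add: mult_ac)
  qed
  have "(\<integral>\<^sup>+x. ennreal (poisson \<eta> (y - x)) * ennreal (\<omega> x) \<partial>lborel) \<le>
    (\<integral>\<^sup>+x. ennreal (2 * C / (1 + y\<^sup>2)) * ennreal (poisson \<eta> (y - x)) + ennreal (2 * C / pi / (1 + y\<^sup>2)) * ennreal (1 / (1 + x\<^sup>2)) \<partial>lborel)"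
  proof (intro nn_integral_mono)
    fix x
    have "poisson \<eta> (y - x) * \<omega> x \<le> (2 * C * poisson \<eta> (y - x) + 2 * C / pi * (1 / (1 + x\<^sup>2))) / (1 + y\<^sup>2)"
      using pw[of x] py by (simp add: pos_le_divide_eq mult_ac)
    also have "\<dots> = 2 * C / (1 + y\<^sup>2) * poisson \<eta> (y - x) + 2 * C / pi / (1 + y\<^sup>2) * (1 / (1 + x\<^sup>2))"
      by (simp add: add_divide_distrib)
    finally show "ennreal (poisson \<eta> (y - x)) * ennreal (\<omega> x) \<le> ennreal (2 * C / (1 + y\<^sup>2)) * ennreal (poisson \<eta> (y - x)) + ennreal (2 * C / pi / (1 + y\<^sup>2)) * ennreal (1 / (1 + x\<^sup>2))"
      using C P[of "y - x"] \<omega>(1)[of x] py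
      by (simp add: ennreal_mult[symmetric] ennreal_plus[symmetric] add_pos_nonneg less_imp_le del: ennreal_plus)
  qed
  also have "\<dots> = ennreal (2 * C / (1 + y\<^sup>2)) * 1 + ennreal (2 * C / pi / (1 + y\<^sup>2)) * ennreal pi"
    using nn_integral_poisson(2)[OF \<open>0 < \<eta>\<close>, of y] nn_integral_inverse_1_plus_square by (simp add: nn_integral_add nn_integral_cmult)
  also have "\<dots> = ennreal (4 * C / (1 + y\<^sup>2))"
    using C py by (simp add: ennreal_mult[symmetric] ennreal_plus[symmetric] add_divide_distrib[symmetric] del: ennreal_plus)
  finally show ?thesis .
qed

lemma corr_poisson_shift:
  assumes "\<eta> > 0"
  shows "corr (poisson \<eta>) g x = (LINT s|lborel. g (x + \<eta> * s) * poisson 1 s)"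
proof -
  have "corr (poisson \<eta>) g x = \<eta> * (LINT s|lborel. g (x + \<eta> * s) * poisson \<eta> (x + \<eta> * s - x))"
    unfolding corr_def using assms by (subst lborel_integral_real_affine[where c=\<eta> and t=x]) auto
  also have "\<dots> = (LINT s|lborel. \<eta> * (g (x + \<eta> * s) * poisson \<eta> (x + \<eta> * s - x)))"
    by simp
  also have "\<dots> = (LINT s|lborel. g (x + \<eta> * s) * poisson 1 s)"
  proof (intro Bochner_Integration.integral_cong refl)
    fix s
    have "\<eta> * poisson \<eta> (\<eta> * s) = poisson 1 s"
    proof -
      have "(\<eta> * s)\<^sup>2 + \<eta>\<^sup>2 = \<eta>\<^sup>2 * (s\<^sup>2 + 1)" by (simp add: power_mult_distrib algebra_simps)
      then show ?thesis using assms by (simp add: poisson_def power2_eq_square)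
    qed
    then show "\<eta> * (g (x + \<eta> * s) * poisson \<eta> (x + \<eta> * s - x)) = g (x + \<eta> * s) * poisson 1 s"
      by (simp add: mult.left_commute)
  qed
  finally show ?thesis .
qed

lemma corr_poisson_continuous_tendsto:
  assumes g: "bdd_fun K g" and cont: "continuous_on UNIV g"
  shows "(\<lambda>k. corr (poisson (1 / real (Suc k))) g x) \<longlonglongrightarrow> g x"
proof -
  have [measurable]: "g \<in> borel_measurable borel" using bdd_funD(1)[OF g] .
  have P: "poisson 1 s \<ge> 0" for s by (simp add: poisson_nonneg)
  have i1: "integrable lborel (\<lambda>s. poisson 1 s)"
    using nn_integral_poisson(1)[of 1 0] P by (intro integrable_of_nn_integral_le[where B=1]) auto
  have v1: "(LINT s|lborel. poisson 1 s) = 1"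
    using nn_integral_poisson(1)[of 1 0] P by (simp add: integral_eq_nn_integral)
  have "(\<lambda>k. LINT s|lborel. g (x + 1 / real (Suc k) * s) * poisson 1 s) \<longlonglongrightarrow> (LINT s|lborel. g x * poisson 1 s)"
  proof (rule integral_dominated_convergence[where w="\<lambda>s. K * poisson 1 s"])
    show "integrable lborel (\<lambda>s. K * poisson 1 s)" using i1 by (rule integrable_mult_right)
    show "AE s in lborel. (\<lambda>k. g (x + 1 / real (Suc k) * s) * poisson 1 s) \<longlonglongrightarrow> g x * poisson 1 s"
    proof (intro AE_I2 tendsto_mult tendsto_const)
      fix s :: real
      have "(\<lambda>k. x + (1 / real (Suc k)) * s) \<longlonglongrightarrow> x + 0 * s"
        by (intro tendsto_intros LIMSEQ_Suc[OF lim_1_over_n])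
      moreover have "isCont g x" using cont by (simp add: continuous_on_eq_continuous_at)
      ultimately show "(\<lambda>k. g (x + (1 / real (Suc k)) * s)) \<longlonglongrightarrow> g x"
        using isCont_tendsto_compose by fastforce
    qed
    show "AE s in lborel. norm (g (x + 1 / real (Suc k) * s) * poisson 1 s) \<le> K * poisson 1 s" for k
      using bdd_funD(2)[OF g] P by (intro AE_I2) (simp add: abs_mult mult_right_mono)
  qed measurable
  then show ?thesis using v1 by (simp add: corr_poisson_shift)
qed

lemma bdd_fun_corr_poisson:
  assumes g: "bdd_fun K g" and "\<eta> > 0"
  shows "bdd_fun K (corr (poisson \<eta>) g)"
proof -
  have [measurable]: "g \<in> borel_measurable borel" using bdd_funD(1)[OF g] .
  have P: "poisson \<eta> s \<ge> 0" for s using assms by (simp add: poisson_nonneg)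
  have K: "K \<ge> 0" using bdd_funD(3)[OF g] .
  have "\<bar>corr (poisson \<eta>) g x\<bar> \<le> K" for x
  proof -
    have "(\<integral>\<^sup>+y. ennreal (norm (g y * poisson \<eta> (y - x))) \<partial>lborel) \<le> (\<integral>\<^sup>+y. ennreal K * ennreal (poisson \<eta> (y - x)) \<partial>lborel)"
      using bdd_funD(2)[OF g] P K by (intro nn_integral_mono) (auto simp: ennreal_mult[symmetric] abs_mult intro!: ennreal_leI mult_right_mono)
    also have "\<dots> = ennreal K" using nn_integral_poisson(1)[OF \<open>\<eta> > 0\<close>, of x] by (subst nn_integral_cmult) auto
    finally have "norm (LINT y|lborel. g y * poisson \<eta> (y - x)) \<le> K" using K by (intro norm_integral_le_of_nn_integral)
    then show ?thesis by (simp add: corr_def)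
  qed
  moreover have "corr (poisson \<eta>) g \<in> borel_measurable borel" unfolding corr_def[abs_def] by measurable
  ultimately show ?thesis by (simp add: bdd_fun_def)
qed

lemma nn_integral_corr_poisson_le:
  assumes g: "bdd_fun K g" and "0 < \<eta>" "\<eta> \<le> 1" and [measurable]: "\<omega> \<in> borel_measurable borel"
    and \<omega>: "\<And>x. \<omega> x \<ge> 0" "\<And>x. \<omega> x \<le> C / (1 + x\<^sup>2)"
  shows "(\<integral>\<^sup>+x. ennreal (\<bar>corr (poisson \<eta>) g x\<bar> * \<omega> x) \<partial>lborel) \<le> (\<integral>\<^sup>+y. ennreal (\<bar>g y\<bar> * (4 * C / (1 + y\<^sup>2))) \<partial>lborel)"
proof -
  have [measurable]: "g \<in> borel_measurable borel" using bdd_funD(1)[OF g] .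
  have P: "poisson \<eta> s \<ge> 0" for s using assms by (simp add: poisson_nonneg)
  obtain D where nP: "nice_kernel D (poisson \<eta>)" using poisson_nice[OF \<open>0 < \<eta>\<close>] by blast
  have int: "integrable lborel (\<lambda>y. g y * poisson \<eta> (y - x))" for x
    using integrable_bounded_mult_kernel[OF nP bdd_funD(1)[OF g] bdd_funD(2)[OF g]] .
  have C: "C \<ge> 0" using \<omega>(1)[of 0] \<omega>(2)[of 0] by simp
  have "(\<integral>\<^sup>+x. ennreal (\<bar>corr (poisson \<eta>) g x\<bar> * \<omega> x) \<partial>lborel) \<le> (\<integral>\<^sup>+x. (\<integral>\<^sup>+y. ennreal \<bar>g y\<bar> * (ennreal (poisson \<eta> (y - x)) * ennreal (\<omega> x)) \<partial>lborel) \<partial>lborel)"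
  proof (intro nn_integral_mono)
    fix x
    have "ennreal (\<bar>corr (poisson \<eta>) g x\<bar> * \<omega> x) = ennreal (norm (LINT y|lborel. g y * poisson \<eta> (y - x))) * ennreal (\<omega> x)"
      using \<omega>(1) by (simp add: corr_def ennreal_mult)
    also have "\<dots> \<le> (\<integral>\<^sup>+y. ennreal (norm (g y * poisson \<eta> (y - x))) \<partial>lborel) * ennreal (\<omega> x)"
      using int by (intro mult_right_mono integral_norm_bound_ennreal) auto
    also have "\<dots> = (\<integral>\<^sup>+y. ennreal (norm (g y * poisson \<eta> (y - x))) * ennreal (\<omega> x) \<partial>lborel)"
      by (rule nn_integral_multc[symmetric]) measurable
    also have "\<dots> = (\<integral>\<^sup>+y. ennreal \<bar>g y\<bar> * (ennreal (poisson \<eta> (y - x)) * ennreal (\<omega> x)) \<partial>lborel)"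
      using P by (intro nn_integral_cong) (simp add: abs_mult ennreal_mult mult.assoc)
    finally show "ennreal (\<bar>corr (poisson \<eta>) g x\<bar> * \<omega> x) \<le> (\<integral>\<^sup>+y. ennreal \<bar>g y\<bar> * (ennreal (poisson \<eta> (y - x)) * ennreal (\<omega> x)) \<partial>lborel)" .
  qed
  also have "\<dots> = (\<integral>\<^sup>+y. (\<integral>\<^sup>+x. ennreal \<bar>g y\<bar> * (ennreal (poisson \<eta> (y - x)) * ennreal (\<omega> x)) \<partial>lborel) \<partial>lborel)"
    by (rule lborel_pair.Fubini') measurable
  also have "\<dots> = (\<integral>\<^sup>+y. ennreal \<bar>g y\<bar> * (\<integral>\<^sup>+x. ennreal (poisson \<eta> (y - x)) * ennreal (\<omega> x) \<partial>lborel) \<partial>lborel)"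
    by (intro nn_integral_cong nn_integral_cmult) measurable
  also have "\<dots> \<le> (\<integral>\<^sup>+y. ennreal \<bar>g y\<bar> * ennreal (4 * C / (1 + y\<^sup>2)) \<partial>lborel)"
    using poisson_dominated_weight[OF assms(2,3,4) \<omega>] by (intro nn_integral_mono mult_left_mono) auto
  also have "\<dots> = (\<integral>\<^sup>+y. ennreal (\<bar>g y\<bar> * (4 * C / (1 + y\<^sup>2))) \<partial>lborel)"
    using C by (intro nn_integral_cong ennreal_mult[symmetric]) (auto intro!: divide_nonneg_nonneg add_nonneg_nonneg)
  finally show ?thesis .
qed

text \<open>A measurable function is almost everywhere a limit of continuous functions; truncation at $\pm K$ keeps
  the bound.\<close>

lemma continuous_approximation:
  assumes v: "bdd_fun K v"
  shows "\<exists>\<psi>. (\<forall>n. bdd_fun K (\<psi> n) \<and> continuous_on UNIV (\<psi> n)) \<and> (AE x in lborel. (\<lambda>n. \<psi> n x) \<longlonglongrightarrow> v x)"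
proof -
  have K: "K \<ge> 0" using bdd_funD(3)[OF v] .
  have "v \<in> borel_measurable lborel" using bdd_funD(1)[OF v] by simp
  then have "v \<in> borel_measurable lebesgue" by (rule measurable_completion)
  then have "v measurable_on UNIV" by (simp add: measurable_on_iff_borel_measurable lebesgue_on_UNIV_eq)
  then obtain N g where N: "negligible N" and g: "\<And>n. continuous_on UNIV (g n)" and lim: "\<And>x. x \<notin> N \<Longrightarrow> (\<lambda>n. g n x) \<longlonglongrightarrow> v x"
    unfolding measurable_on_def by auto
  define \<psi> where "\<psi> = (\<lambda>n x. max (- K) (min K (g n x)))"
  have c: "continuous_on UNIV (\<psi> n)" for n unfolding \<psi>_def by (intro continuous_intros g)
  have b: "bdd_fun K (\<psi> n)" for n
    using K borel_measurable_continuous_onI[OF c[of n]] by (auto simp: bdd_fun_def \<psi>_def)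
  have "N \<in> null_sets lebesgue" using N by (simp add: negligible_iff_null_sets)
  then have "AE x in lebesgue. x \<notin> N" by (rule AE_not_in)
  then have "AE x in lebesgue. (\<lambda>n. \<psi> n x) \<longlonglongrightarrow> v x"
  proof eventually_elim
    case (elim x)
    have "(\<lambda>n. \<psi> n x) \<longlonglongrightarrow> max (- K) (min K (v x))" unfolding \<psi>_def using lim[OF elim] by (intro tendsto_intros)
    moreover have "max (- K) (min K (v x)) = v x" using bdd_funD(2)[OF v, of x] by (auto simp: abs_le_iff)
    ultimately show ?case by simp
  qed
  then have "AE x in lborel. (\<lambda>n. \<psi> n x) \<longlonglongrightarrow> v x" by (simp add: AE_completion_iff)
  then show ?thesis using b c by blast
qed

lemma bdd_fun_diff: "bdd_fun K f \<Longrightarrow> bdd_fun K' g \<Longrightarrow> bdd_fun (K + K') (\<lambda>x. f x - g x)"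
  unfolding bdd_fun_def by (auto intro: order_trans[OF abs_triangle_ineq4 add_mono])

text \<open>Approximate $v$ by continuous functions, for which the Poisson averages converge pointwise. The
  averaging operators are bounded on $L^1(\omega)$ uniformly in $\eta \le 1$, because the average of a
  weight $\omega$ of size $(1+x^2)^{-1}$ has the same decay (\<open>poisson_dominated_weight\<close>).\<close>

lemma poisson_L1_approx:
  assumes v: "bdd_fun K v" and [measurable]: "\<omega> \<in> borel_measurable borel"
    and \<omega>: "\<And>x. \<omega> x \<ge> 0" "\<And>x. \<omega> x \<le> C / (1 + x\<^sup>2)" and e: "e > 0"
  shows "eventually (\<lambda>k. (\<integral>\<^sup>+x. ennreal (\<bar>corr (poisson (1 / real (Suc k))) v x - v x\<bar> * \<omega> x) \<partial>lborel) \<le> ennreal e) sequentially"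
proof -
  have [measurable]: "v \<in> borel_measurable borel" using bdd_funD(1)[OF v] .
  have K: "K \<ge> 0" using bdd_funD(3)[OF v] .
  have C: "C \<ge> 0" using \<omega>(1)[of 0] \<omega>(2)[of 0] by simp
  have Iw: "integrable lborel (\<lambda>y. D / (1 + y\<^sup>2))" if "D \<ge> 0" for D :: real
    using nn_integral_cmult_inverse_1_plus_square[OF that] that
    by (intro integrable_of_nn_integral_le[where B="pi * D"]) (auto simp: abs_div_pos add_pos_nonneg)
  obtain \<psi> where \<psi>: "\<And>n. bdd_fun K (\<psi> n)" "\<And>n. continuous_on UNIV (\<psi> n)" and ae: "AE x in lborel. (\<lambda>n. \<psi> n x) \<longlonglongrightarrow> v x"
    using continuous_approximation[OF v] by blast
  have [measurable]: "\<psi> n \<in> borel_measurable borel" for n using bdd_funD(1)[OF \<psi>(1)] .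
  have "(\<lambda>n. LINT y|lborel. \<bar>v y - \<psi> n y\<bar> * (4 * C / (1 + y\<^sup>2))) \<longlonglongrightarrow> (LINT y|lborel. \<bar>v y - v y\<bar> * (4 * C / (1 + y\<^sup>2)))"
  proof (rule integral_dominated_convergence[where w="\<lambda>y. (2 * K * (4 * C)) / (1 + y\<^sup>2)"])
    show "integrable lborel (\<lambda>y. (2 * K * (4 * C)) / (1 + y\<^sup>2))" using K C by (intro Iw) auto
    show "AE y in lborel. (\<lambda>n. \<bar>v y - \<psi> n y\<bar> * (4 * C / (1 + y\<^sup>2))) \<longlonglongrightarrow> \<bar>v y - v y\<bar> * (4 * C / (1 + y\<^sup>2))"
      using ae by eventually_elim (intro tendsto_intros)
    show "AE y in lborel. norm (\<bar>v y - \<psi> n y\<bar> * (4 * C / (1 + y\<^sup>2))) \<le> (2 * K * (4 * C)) / (1 + y\<^sup>2)" for n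
    proof (intro AE_I2)
      fix y
      have "\<bar>v y - \<psi> n y\<bar> \<le> 2 * K" using bdd_funD(2)[OF v, of y] bdd_funD(2)[OF \<psi>(1), of n y] by linarith
      then have "\<bar>v y - \<psi> n y\<bar> * (4 * C / (1 + y\<^sup>2)) \<le> 2 * K * (4 * C / (1 + y\<^sup>2))" using C by (intro mult_right_mono) (auto intro!: divide_nonneg_nonneg add_nonneg_nonneg)
      moreover have "4 * C / (1 + y\<^sup>2) \<ge> 0" using C by (auto intro!: divide_nonneg_nonneg add_nonneg_nonneg)
      ultimately show "norm (\<bar>v y - \<psi> n y\<bar> * (4 * C / (1 + y\<^sup>2))) \<le> (2 * K * (4 * C)) / (1 + y\<^sup>2)" using C by (simp add: abs_mult)
    qed
  qed measurable
  then have "(\<lambda>n. LINT y|lborel. \<bar>v y - \<psi> n y\<bar> * (4 * C / (1 + y\<^sup>2))) \<longlonglongrightarrow> 0" by simp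
  then have "eventually (\<lambda>n. (LINT y|lborel. \<bar>v y - \<psi> n y\<bar> * (4 * C / (1 + y\<^sup>2))) < e / 3) sequentially"
    by (rule order_tendstoD) (use e in auto)
  then obtain n where n: "(LINT y|lborel. \<bar>v y - \<psi> n y\<bar> * (4 * C / (1 + y\<^sup>2))) < e / 3"
    by (auto simp: eventually_sequentially)
  define h where "h = (\<lambda>y. v y - \<psi> n y)"
  have h: "bdd_fun (K + K) h" unfolding h_def by (rule bdd_fun_diff[OF v \<psi>(1)])
  have [measurable]: "h \<in> borel_measurable borel" using bdd_funD(1)[OF h] .
  have hI: "(\<integral>\<^sup>+y. ennreal (\<bar>h y\<bar> * (4 * C / (1 + y\<^sup>2))) \<partial>lborel) \<le> ennreal (e / 3)"
  proof -
    have p: "4 * C / (1 + y\<^sup>2) \<ge> 0" for y :: real using C by (auto intro!: divide_nonneg_nonneg add_nonneg_nonneg)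
    have "integrable lborel (\<lambda>y. \<bar>h y\<bar> * (4 * C / (1 + y\<^sup>2)))"
    proof (rule Bochner_Integration.integrable_bound[OF Iw[of "(K + K) * (4 * C)"]])
      show "AE y in lborel. norm (\<bar>h y\<bar> * (4 * C / (1 + y\<^sup>2))) \<le> norm ((K + K) * (4 * C) / (1 + y\<^sup>2))"
      proof (intro AE_I2)
        fix y
        have "\<bar>h y\<bar> * (4 * C / (1 + y\<^sup>2)) \<le> (K + K) * (4 * C / (1 + y\<^sup>2))" using bdd_funD(2)[OF h, of y] p[of y] by (rule mult_right_mono)
        then show "norm (\<bar>h y\<bar> * (4 * C / (1 + y\<^sup>2))) \<le> norm ((K + K) * (4 * C) / (1 + y\<^sup>2))" using p[of y] K C by (simp add: abs_mult)
      qed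
    qed (use K C in auto)
    then have "(\<integral>\<^sup>+y. ennreal (\<bar>h y\<bar> * (4 * C / (1 + y\<^sup>2))) \<partial>lborel) = ennreal (LINT y|lborel. \<bar>h y\<bar> * (4 * C / (1 + y\<^sup>2)))"
      by (intro nn_integral_eq_integral AE_I2 mult_nonneg_nonneg abs_ge_zero p)
    also have "\<dots> \<le> ennreal (e / 3)" using n by (intro ennreal_leI) (simp add: h_def)
    finally show ?thesis .
  qed
  have hw: "(\<integral>\<^sup>+y. ennreal (\<bar>h y\<bar> * \<omega> y) \<partial>lborel) \<le> ennreal (e / 3)"
  proof (rule order_trans[OF _ hI], intro nn_integral_mono ennreal_leI mult_left_mono)
    fix y :: real
    have "C / (1 + y\<^sup>2) \<le> 4 * C / (1 + y\<^sup>2)" using C by (intro divide_right_mono) (auto simp: add_nonneg_nonneg)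
    then show "\<omega> y \<le> 4 * C / (1 + y\<^sup>2)" using \<omega>(2)[of y] by linarith
  qed simp
  have pk: "bdd_fun K (corr (poisson (1 / real (Suc k))) (\<psi> n))" for k by (rule bdd_fun_corr_poisson[OF \<psi>(1)]) simp
  have [measurable]: "corr (poisson (1 / real (Suc k))) (\<psi> n) \<in> borel_measurable borel" for k using bdd_funD(1)[OF pk] .
  have [measurable]: "corr (poisson (1 / real (Suc k))) h \<in> borel_measurable borel" for k
    using bdd_funD(1)[OF bdd_fun_corr_poisson[OF h, of "1 / real (Suc k)"]] by simp
  have wI: "integrable lborel \<omega>"
    by (rule Bochner_Integration.integrable_bound[OF Iw[OF C]]) (use \<omega> C in \<open>auto simp: abs_div_pos add_pos_nonneg\<close>)
  have "(\<lambda>k. LINT x|lborel. \<bar>corr (poisson (1 / real (Suc k))) (\<psi> n) x - \<psi> n x\<bar> * \<omega> x) \<longlonglongrightarrow> (LINT x|lborel. \<bar>\<psi> n x - \<psi> n x\<bar> * \<omega> x)"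
  proof (rule integral_dominated_convergence[where w="\<lambda>x. 2 * K * \<omega> x"])
    show "integrable lborel (\<lambda>x. 2 * K * \<omega> x)" using wI by (rule integrable_mult_right)
    show "AE x in lborel. (\<lambda>k. \<bar>corr (poisson (1 / real (Suc k))) (\<psi> n) x - \<psi> n x\<bar> * \<omega> x) \<longlonglongrightarrow> \<bar>\<psi> n x - \<psi> n x\<bar> * \<omega> x"
      by (intro AE_I2 tendsto_intros corr_poisson_continuous_tendsto[OF \<psi>])
    show "AE x in lborel. norm (\<bar>corr (poisson (1 / real (Suc k))) (\<psi> n) x - \<psi> n x\<bar> * \<omega> x) \<le> 2 * K * \<omega> x" for k
    proof (intro AE_I2)
      fix x
      have "\<bar>corr (poisson (1 / real (Suc k))) (\<psi> n) x - \<psi> n x\<bar> \<le> 2 * K"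
        using bdd_funD(2)[OF pk, of k x] bdd_funD(2)[OF \<psi>(1), of n x] by linarith
      then show "norm (\<bar>corr (poisson (1 / real (Suc k))) (\<psi> n) x - \<psi> n x\<bar> * \<omega> x) \<le> 2 * K * \<omega> x"
        using \<omega>(1)[of x] by (simp add: mult_right_mono)
    qed
  qed measurable
  then have "(\<lambda>k. LINT x|lborel. \<bar>corr (poisson (1 / real (Suc k))) (\<psi> n) x - \<psi> n x\<bar> * \<omega> x) \<longlonglongrightarrow> 0" by simp
  then have "eventually (\<lambda>k. (LINT x|lborel. \<bar>corr (poisson (1 / real (Suc k))) (\<psi> n) x - \<psi> n x\<bar> * \<omega> x) < e / 3) sequentially"
    by (rule order_tendstoD) (use e in auto)
  then show ?thesis
  proof eventually_elim
    case (elim k)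
    define \<eta> where "\<eta> = 1 / real (Suc k)"
    have \<eta>: "0 < \<eta>" "\<eta> \<le> 1" by (auto simp: \<eta>_def)
    obtain D where nP: "nice_kernel D (poisson \<eta>)" using poisson_nice[OF \<eta>(1)] by blast
    have split: "corr (poisson \<eta>) v x = corr (poisson \<eta>) h x + corr (poisson \<eta>) (\<psi> n) x" for x
    proof -
      have "integrable lborel (\<lambda>y. h y * poisson \<eta> (y - x))" "integrable lborel (\<lambda>y. \<psi> n y * poisson \<eta> (y - x))"
        using integrable_bounded_mult_kernel[OF nP bdd_funD(1)[OF h] bdd_funD(2)[OF h]]
          integrable_bounded_mult_kernel[OF nP bdd_funD(1)[OF \<psi>(1)] bdd_funD(2)[OF \<psi>(1)]] by auto
      from Bochner_Integration.integral_add[OF this] show ?thesis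
        unfolding corr_def by (simp add: h_def distrib_right[symmetric])
    qed
    have m2: "(\<lambda>x. corr (poisson \<eta>) (\<psi> n) x) \<in> borel_measurable borel" "(\<lambda>x. corr (poisson \<eta>) h x) \<in> borel_measurable borel"
      unfolding \<eta>_def by measurable
    have "(\<integral>\<^sup>+x. ennreal (\<bar>corr (poisson \<eta>) v x - v x\<bar> * \<omega> x) \<partial>lborel) \<le>
      (\<integral>\<^sup>+x. ennreal (\<bar>corr (poisson \<eta>) h x\<bar> * \<omega> x) + (ennreal (\<bar>h x\<bar> * \<omega> x) + ennreal (\<bar>corr (poisson \<eta>) (\<psi> n) x - \<psi> n x\<bar> * \<omega> x)) \<partial>lborel)"
    proof (intro nn_integral_mono)
      fix x
      have "\<bar>corr (poisson \<eta>) v x - v x\<bar> \<le> \<bar>corr (poisson \<eta>) h x\<bar> + (\<bar>h x\<bar> + \<bar>corr (poisson \<eta>) (\<psi> n) x - \<psi> n x\<bar>)"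
        unfolding split by (simp add: h_def)
      then have "\<bar>corr (poisson \<eta>) v x - v x\<bar> * \<omega> x \<le> \<bar>corr (poisson \<eta>) h x\<bar> * \<omega> x + (\<bar>h x\<bar> * \<omega> x + \<bar>corr (poisson \<eta>) (\<psi> n) x - \<psi> n x\<bar> * \<omega> x)"
        unfolding distrib_right[symmetric] using \<omega>(1)[of x] by (rule mult_right_mono)
      then show "ennreal (\<bar>corr (poisson \<eta>) v x - v x\<bar> * \<omega> x) \<le> ennreal (\<bar>corr (poisson \<eta>) h x\<bar> * \<omega> x) + (ennreal (\<bar>h x\<bar> * \<omega> x) + ennreal (\<bar>corr (poisson \<eta>) (\<psi> n) x - \<psi> n x\<bar> * \<omega> x))"
        using \<omega>(1)[of x] by (simp add: ennreal_plus[symmetric] ennreal_leI del: ennreal_plus)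
    qed
    also have "\<dots> = (\<integral>\<^sup>+x. ennreal (\<bar>corr (poisson \<eta>) h x\<bar> * \<omega> x) \<partial>lborel) + ((\<integral>\<^sup>+x. ennreal (\<bar>h x\<bar> * \<omega> x) \<partial>lborel) + (\<integral>\<^sup>+x. ennreal (\<bar>corr (poisson \<eta>) (\<psi> n) x - \<psi> n x\<bar> * \<omega> x) \<partial>lborel))"
      using m2 by (simp add: nn_integral_add)
    also have "\<dots> \<le> ennreal (e / 3) + (ennreal (e / 3) + ennreal (e / 3))"
    proof (intro add_mono hw)
      show "(\<integral>\<^sup>+x. ennreal (\<bar>corr (poisson \<eta>) h x\<bar> * \<omega> x) \<partial>lborel) \<le> ennreal (e / 3)"
        using nn_integral_corr_poisson_le[OF h \<eta> _ \<omega>] hI by (meson assms(2) order_trans)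
      have "integrable lborel (\<lambda>x. \<bar>corr (poisson \<eta>) (\<psi> n) x - \<psi> n x\<bar> * \<omega> x)"
      proof (rule Bochner_Integration.integrable_bound[OF integrable_mult_right[OF wI, of "2 * K"]])
        show "AE x in lborel. norm (\<bar>corr (poisson \<eta>) (\<psi> n) x - \<psi> n x\<bar> * \<omega> x) \<le> norm (2 * K * \<omega> x)"
        proof (intro AE_I2)
          fix x
          have "\<bar>corr (poisson \<eta>) (\<psi> n) x - \<psi> n x\<bar> \<le> 2 * K"
            using bdd_funD(2)[OF pk, of k x] bdd_funD(2)[OF \<psi>(1), of n x] unfolding \<eta>_def by linarith
          then show "norm (\<bar>corr (poisson \<eta>) (\<psi> n) x - \<psi> n x\<bar> * \<omega> x) \<le> norm (2 * K * \<omega> x)"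
            using \<omega>(1)[of x] K by (simp add: abs_mult mult_right_mono)
        qed
      qed (use m2 in auto)
      then have "(\<integral>\<^sup>+x. ennreal (\<bar>corr (poisson \<eta>) (\<psi> n) x - \<psi> n x\<bar> * \<omega> x) \<partial>lborel) = ennreal (LINT x|lborel. \<bar>corr (poisson \<eta>) (\<psi> n) x - \<psi> n x\<bar> * \<omega> x)"
        using \<omega>(1) by (intro nn_integral_eq_integral) auto
      then show "(\<integral>\<^sup>+x. ennreal (\<bar>corr (poisson \<eta>) (\<psi> n) x - \<psi> n x\<bar> * \<omega> x) \<partial>lborel) \<le> ennreal (e / 3)"
        using elim unfolding \<eta>_def by (simp add: ennreal_leI less_imp_le)
    qed
    also have "\<dots> = ennreal e" using e by (simp add: ennreal_plus[symmetric] del: ennreal_plus)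
    finally show ?case by (simp add: \<eta>_def)
  qed
qed

section \<open>Solutions that are small near the origin\<close>

definition rpart :: "(real \<Rightarrow> real) \<Rightarrow> real \<Rightarrow> real" where "rpart u y = indicator {1..} y * u y"
definition lpart :: "(real \<Rightarrow> real) \<Rightarrow> real \<Rightarrow> real" where "lpart u y = indicator {..-1} y * u y"
definition mpart :: "(real \<Rightarrow> real) \<Rightarrow> real \<Rightarrow> real" where "mpart u y = indicator {-1<..<1} y * u y"

text \<open>The factor $i$ makes both summands almost real where they are not singular: the first one to the left of
  1, the second one to the right of $-1$ (see \<open>i_jtrans_lpart\<close>).\<close>

definition outer :: "(real \<Rightarrow> real) \<Rightarrow> complex \<Rightarrow> complex" where
  "outer u z = jtrans (rpart u) z + \<i> * jtrans (lpart u) z"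

lemma lpart_reflect: "lpart u (- y) = rpart (\<lambda>y. u (- y)) y"
  by (auto simp: rpart_def lpart_def split: split_indicator)

lemma bdd_fun_parts:
  assumes "bdd_fun K u"
  shows "bdd_fun K (rpart u)" "bdd_fun K (lpart u)"
proof -
  have [measurable]: "u \<in> borel_measurable borel" using bdd_funD(1)[OF assms] .
  have "K \<ge> 0" using bdd_funD(3)[OF assms] .
  then show "bdd_fun K (rpart u)" "bdd_fun K (lpart u)"
    using bdd_funD(2)[OF assms] unfolding bdd_fun_def rpart_def[abs_def] lpart_def[abs_def]
    by (auto split: split_indicator)
qed

lemma bdd_fun_reflect:
  assumes "bdd_fun K u"
  shows "bdd_fun K (\<lambda>y. u (- y))"
proof -
  have [measurable]: "u \<in> borel_measurable borel" using bdd_funD(1)[OF assms] .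
  show ?thesis using bdd_funD(2)[OF assms] unfolding bdd_fun_def by auto
qed

lemma corr_poisson_reflect: "corr (poisson \<eta>) (\<lambda>y. f (- y)) x = corr (poisson \<eta>) f (- x)"
proof -
  have "corr (poisson \<eta>) f (- x) = (LINT y|lborel. f (- y) * poisson \<eta> (- y + x))"
    unfolding corr_def by (subst lborel_integral_real_affine[where c="-1" and t=0]) auto
  also have "\<dots> = (LINT y|lborel. f (- y) * poisson \<eta> (y - x))"
    by (intro Bochner_Integration.integral_cong refl) (simp add: poisson_def power2_commute)
  finally show ?thesis by (simp add: corr_def)
qed

lemma minus_cnj_Complex: "- cnj (Complex x \<eta>) = Complex (- x) \<eta>"
  by (simp add: complex_eq_iff)

lemma i_jtrans_lpart:
  assumes "\<eta> > 0"
  shows "\<i> * jtrans (lpart u) (Complex x \<eta>) = cnj (jtrans (rpart (\<lambda>y. u (- y))) (Complex (- x) \<eta>))"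
  using jtrans_reflect[of "Complex x \<eta>" "lpart u"] assms by (simp add: minus_cnj_Complex lpart_reflect)

lemma outer_reflect:
  assumes "\<eta> > 0"
  shows "outer (\<lambda>y. u (- y)) (Complex x \<eta>) = cnj (outer u (Complex (- x) \<eta>))"
  using i_jtrans_lpart[OF assms, of u "- x"] i_jtrans_lpart[OF assms, of "\<lambda>y. u (- y)" x]
  by (simp add: outer_def)

text \<open>A solution after translation and scaling, flat of size $\epsilon$ near the origin. The relation
  between $u$ and $f$ at this point is only the linear boundary relation \<open>equation\<close>; that $|f| \le |u|$
  enters in the absorption step.\<close>

locale flat_solution =
  fixes K \<epsilon> \<kappa> :: real and u f :: "real \<Rightarrow> real"
  assumes u: "bdd_fun K u" and f: "bdd_fun K f"
    and u_small: "\<And>y. \<bar>y\<bar> < 2 \<Longrightarrow> \<bar>u y\<bar> \<le> \<epsilon>" and f_small: "\<And>y. \<bar>y\<bar> < 2 \<Longrightarrow> \<bar>f y\<bar> \<le> \<epsilon>"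
    and \<epsilon>: "0 < \<epsilon>" "\<epsilon> \<le> 1" and K: "1 \<le> K" and \<kappa>: "\<kappa> > 0"
    and equation: "\<And>x \<eta>. \<eta> > 0 \<Longrightarrow> Re (jtrans u (Complex x \<eta>)) - Im (jtrans u (Complex x \<eta>)) = - \<kappa> * corr (poisson \<eta>) f x"
begin

text \<open>Hence only the right half-line needs to be treated.\<close>

lemma reflected: "flat_solution K \<epsilon> \<kappa> (\<lambda>y. u (- y)) (\<lambda>y. f (- y))"
proof
  fix x \<eta> :: real assume \<eta>: "\<eta> > 0"
  have "\<i> * jtrans u (Complex (- x) \<eta>) = cnj (jtrans (\<lambda>y. u (- y)) (Complex x \<eta>))"
    using jtrans_reflect[of "Complex (- x) \<eta>" u] \<eta> by (simp add: minus_cnj_Complex)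
  then have "Re (jtrans (\<lambda>y. u (- y)) (Complex x \<eta>)) = - Im (jtrans u (Complex (- x) \<eta>))"
    "Im (jtrans (\<lambda>y. u (- y)) (Complex x \<eta>)) = - Re (jtrans u (Complex (- x) \<eta>))"
    by (auto simp: complex_eq_iff)
  then show "Re (jtrans (\<lambda>y. u (- y)) (Complex x \<eta>)) - Im (jtrans (\<lambda>y. u (- y)) (Complex x \<eta>)) = - \<kappa> * corr (poisson \<eta>) (\<lambda>y. f (- y)) x"
    using equation[OF \<eta>, of "- x"] by (simp add: corr_poisson_reflect)
qed (use u f u_small f_small \<epsilon> K \<kappa> bdd_fun_reflect in auto)

lemma mpart: "bdd_fun \<epsilon> (mpart u)"
proof -
  have [measurable]: "u \<in> borel_measurable borel" using bdd_funD(1)[OF u] .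
  show ?thesis using u_small \<epsilon> unfolding bdd_fun_def mpart_def[abs_def]
    by (auto split: split_indicator)
qed

lemma outer_equation:
  assumes "\<eta> > 0"
  shows "Re (outer u (Complex x \<eta>)) - Im (outer u (Complex x \<eta>)) = - \<kappa> * corr (poisson \<eta>) f x
    - (Re (jtrans (mpart u) (Complex x \<eta>)) - Im (jtrans (mpart u) (Complex x \<eta>)))
    - 2 * Im (\<i> * jtrans (lpart u) (Complex x \<eta>))"
proof -
  have r: "bdd_fun K (rpart u)" and l: "bdd_fun K (lpart u)" using bdd_fun_parts[OF u] by auto
  have lm: "bdd_fun (K + \<epsilon>) (\<lambda>y. lpart u y + mpart u y)"
    using bdd_funD(1,2)[OF l] bdd_funD(1,2)[OF mpart] unfolding bdd_fun_def
    by (auto intro!: borel_measurable_add order_trans[OF abs_triangle_ineq] add_mono)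
  have "u = (\<lambda>y. rpart u y + (lpart u y + mpart u y))"
    by (auto simp: rpart_def lpart_def mpart_def fun_eq_iff split: split_indicator)
  then have "jtrans u (Complex x \<eta>) = jtrans (\<lambda>y. rpart u y + (lpart u y + mpart u y)) (Complex x \<eta>)" by simp
  also have "\<dots> = jtrans (rpart u) (Complex x \<eta>) + (jtrans (lpart u) (Complex x \<eta>) + jtrans (mpart u) (Complex x \<eta>))"
    using jtrans_add[OF r lm assms] jtrans_add[OF l mpart assms] by simp
  finally show ?thesis using equation[OF assms, of x] by (simp add: outer_def)
qed

lemma norm_mpart_right:
  assumes "x > 1" "\<eta> > 0"
  shows "norm (jtrans (mpart u) (Complex x \<eta>)) \<le> \<epsilon> * (2 * (x - 1) powr (-1/2))"
proof -
  have "norm (jtrans (mpart u) (Complex x \<eta>)) = norm (\<i> * jtrans (mpart u) (Complex x \<eta>))" by (simp add: norm_mult)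
  also have "\<dots> = norm (jtrans (\<lambda>y. mpart u (- y)) (Complex (- x) \<eta>))"
    using jtrans_reflect[of "Complex x \<eta>" "mpart u"] assms by (simp add: minus_cnj_Complex)
  also have "\<dots> \<le> \<epsilon> * (2 * (x - 1) powr (-1/2))"
    by (rule jtrans_right_bound[OF bdd_fun_reflect[OF mpart]]) (use assms in \<open>auto simp: mpart_def\<close>)
  finally show ?thesis .
qed

lemma rpart_estimates:
  assumes "x < 1" "\<eta> > 0"
  shows "norm (jtrans (rpart u) (Complex x \<eta>)) \<le> 2 * K * (1 - x) powr (-1/2)"
    and "\<bar>Im (jtrans (rpart u) (Complex x \<eta>))\<bar> \<le> K * \<eta> * (1 - x) powr (-3/2)"
    and "\<eta>' > 0 \<Longrightarrow> norm (jtrans (rpart u) (Complex x \<eta>) - jtrans (rpart u) (Complex x \<eta>')) \<le> K * \<bar>\<eta> - \<eta>'\<bar> * (1 - x) powr (-3/2)"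
proof -
  have d: "1 - x > 0" using assms by simp
  have s: "\<And>y. y < x + (1 - x) \<Longrightarrow> rpart u y = 0" by (simp add: rpart_def)
  note r = bdd_fun_parts(1)[OF u]
  show "norm (jtrans (rpart u) (Complex x \<eta>)) \<le> 2 * K * (1 - x) powr (-1/2)"
    using jtrans_right_bound[OF r d s] by (simp add: mult_ac)
  show "\<bar>Im (jtrans (rpart u) (Complex x \<eta>))\<bar> \<le> K * \<eta> * (1 - x) powr (-3/2)"
    using jtrans_right_Im[OF r d s assms(2)] by (simp add: mult_ac)
  show "norm (jtrans (rpart u) (Complex x \<eta>) - jtrans (rpart u) (Complex x \<eta>')) \<le> K * \<bar>\<eta> - \<eta>'\<bar> * (1 - x) powr (-3/2)" if "\<eta>' > 0"
    using jtrans_right_vertical[OF r d s assms(2) that] by (simp add: mult_ac)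
qed

end

lemma (in flat_solution) lpart_estimates:
  assumes "x > -1" "\<eta> > 0"
  shows "norm (\<i> * jtrans (lpart u) (Complex x \<eta>)) \<le> 2 * K * (1 + x) powr (-1/2)"
    and "\<bar>Im (\<i> * jtrans (lpart u) (Complex x \<eta>))\<bar> \<le> K * \<eta> * (1 + x) powr (-3/2)"
    and "\<eta>' > 0 \<Longrightarrow> norm (\<i> * jtrans (lpart u) (Complex x \<eta>) - \<i> * jtrans (lpart u) (Complex x \<eta>')) \<le> K * \<bar>\<eta> - \<eta>'\<bar> * (1 + x) powr (-3/2)"
proof -
  interpret r: flat_solution K \<epsilon> \<kappa> "\<lambda>y. u (- y)" "\<lambda>y. f (- y)" by (rule reflected)
  have x: "- x < 1" using assms by simp
  note e = r.rpart_estimates[OF x assms(2)]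
  show "norm (\<i> * jtrans (lpart u) (Complex x \<eta>)) \<le> 2 * K * (1 + x) powr (-1/2)"
    using e(1) by (simp only: i_jtrans_lpart[OF assms(2)] complex_mod_cnj) simp
  show "\<bar>Im (\<i> * jtrans (lpart u) (Complex x \<eta>))\<bar> \<le> K * \<eta> * (1 + x) powr (-3/2)"
    using e(2) by (simp only: i_jtrans_lpart[OF assms(2)]) simp
  show "norm (\<i> * jtrans (lpart u) (Complex x \<eta>) - \<i> * jtrans (lpart u) (Complex x \<eta>')) \<le> K * \<bar>\<eta> - \<eta>'\<bar> * (1 + x) powr (-3/2)" if "\<eta>' > 0"
    using e(3)[OF that] by (simp only: i_jtrans_lpart[OF assms(2)] i_jtrans_lpart[OF that] complex_cnj_diff[symmetric] complex_mod_cnj) simp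
qed

lemma abs_lpart_right:
  assumes "flat_solution K \<epsilon> \<kappa> u f" "x > 1" "\<eta> > 0"
  shows "\<bar>Im (\<i> * jtrans (lpart u) (Complex x \<eta>))\<bar> \<le> K * \<eta>"
proof -
  interpret flat_solution K \<epsilon> \<kappa> u f by fact
  have "(1 + x) powr (-3/2) \<le> (1 + x) powr 0" using assms by (intro powr_mono) auto
  then have "K * \<eta> * (1 + x) powr (-3/2) \<le> K * \<eta> * 1" using K assms by (intro mult_left_mono) auto
  then show ?thesis using lpart_estimates(2)[of x \<eta>] assms by simp
qed

text \<open>Geometric interpolation between the size $d^{-1/2}$ of the transform and the size $\eta\,d^{-3/2}$ of its
  variation, with the crossover at $d = \eta$.\<close>

lemma powr_interpolate:
  fixes \<eta> d p q :: real
  assumes "\<eta> > 0" "d > 0" "q \<ge> 0" "q \<le> 1"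
  shows "\<eta> \<le> d \<Longrightarrow> \<eta> * d powr (-3/2) \<le> \<eta> powr q * d powr (-1/2 - q)"
    and "d \<le> \<eta> \<Longrightarrow> d powr (-1/2) \<le> \<eta> powr q * d powr (-1/2 - q)"
proof -
  assume "\<eta> \<le> d"
  then have "\<eta> powr (1 - q) \<le> d powr (1 - q)" using assms by (intro powr_mono2) auto
  then have "\<eta> powr q * \<eta> powr (1 - q) * d powr (-3/2) \<le> \<eta> powr q * d powr (1 - q) * d powr (-3/2)"
    by (intro mult_right_mono mult_left_mono) auto
  then show "\<eta> * d powr (-3/2) \<le> \<eta> powr q * d powr (-1/2 - q)"
    using assms by (simp add: powr_add[symmetric] mult.assoc)
next
  assume "d \<le> \<eta>"
  then have "d powr q \<le> \<eta> powr q" using assms by (intro powr_mono2) auto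
  then have "d powr q * d powr (-1/2 - q) \<le> \<eta> powr q * d powr (-1/2 - q)" by (intro mult_right_mono) auto
  then show "d powr (-1/2) \<le> \<eta> powr q * d powr (-1/2 - q)" by (simp add: powr_add[symmetric])
qed

text \<open>In the gap $\mathrm{Im}\,G$ is small because both parts are nearly real, and $\mathrm{Re}\,G$ is then small by
  the boundary relation. But the transform of the middle part of $u$ is bounded only by
  $\epsilon\,\eta^{-1/2}$, so the relation is used at height $\epsilon$, where this is
  $\epsilon^{1/2}$, and carried down to $\eta$ by the vertical Lipschitz bound. This costs
  $\epsilon\,d^{-3/2}$ at distance $d$ from the end points; the exponent $5/8$ is an interpolation whose
  square remains integrable against $\sqrt{1-x^2}$.\<close>

lemma (in flat_solution) norm_outer_middle:
  assumes x: "\<bar>x\<bar> < 1" and \<eta>: "0 < \<eta>" "\<eta> \<le> \<epsilon>"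
  shows "norm (outer u (Complex x \<eta>)) \<le> (4 * \<kappa> + 24) * K * (\<epsilon> powr (1/8) * (1 - \<bar>x\<bar>) powr (-5/8))"
proof -
  define d where "d = 1 - \<bar>x\<bar>"
  have d: "0 < d" "d \<le> 1" using x by (auto simp: d_def)
  define A where "A = (\<lambda>\<eta>. jtrans (rpart u) (Complex x \<eta>))"
  define B where "B = (\<lambda>\<eta>. \<i> * jtrans (lpart u) (Complex x \<eta>))"
  have dp: "(1 - x) powr p \<le> d powr p" "(1 + x) powr p \<le> d powr p" if "p \<le> 0" for p
    using x that d by (auto simp: d_def intro!: powr_mono2')
  have x1: "x < 1" "x > -1" using x by auto
  define E where "E = \<epsilon> powr (1/8) * d powr (-5/8)"
  have E0: "E \<ge> 0" by (simp add: E_def)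
  have G: "outer u (Complex x s) = A s + B s" for s by (simp add: outer_def A_def B_def)
  have K0: "K \<ge> 0" using K by simp
  have m: "K * c * p \<le> K * c * q" if "p \<le> q" "c \<ge> 0" for c p q using that K0 by (intro mult_left_mono) auto
  show ?thesis
  (* Within epsilon of an end point the crude size bound is already good enough. *)
  proof (cases "\<epsilon> \<le> d")
    case False
    have "norm (A \<eta>) \<le> 2 * K * d powr (-1/2)" "norm (B \<eta>) \<le> 2 * K * d powr (-1/2)"
      using rpart_estimates(1)[OF x1(1) \<eta>(1)] lpart_estimates(1)[OF x1(2) \<eta>(1)] m[OF dp(1)[of "-1/2"], of 2] m[OF dp(2)[of "-1/2"], of 2]
      unfolding A_def B_def by (auto simp: mult_ac)
    then have "norm (A \<eta> + B \<eta>) \<le> 4 * K * d powr (-1/2)" using norm_triangle_ineq[of "A \<eta>" "B \<eta>"] by linarith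
    also have "\<dots> \<le> 4 * K * E" unfolding E_def
      using powr_interpolate(2)[of \<epsilon> d "1/8"] False d \<epsilon> K0 by (intro mult_left_mono) auto
    also have "\<dots> \<le> (4 * \<kappa> + 24) * K * E" using K0 E0 \<kappa> by (intro mult_right_mono) auto
    finally show ?thesis by (simp add: G E_def d_def)
  next
    case True
    have e1: "\<epsilon> * d powr (-3/2) \<le> E" unfolding E_def using powr_interpolate(1)[of \<epsilon> d "1/8"] True d \<epsilon> by simp
    have d1: "1 \<le> d powr (-5/8)" using powr_mono2'[of "-5/8" d 1] d by simp
    have e2: "\<epsilon> powr (1/2) \<le> E"
    proof -
      have "\<epsilon> powr (1/2) \<le> \<epsilon> powr (1/8)" using \<epsilon> by (intro powr_mono') auto
      also have "\<dots> \<le> \<epsilon> powr (1/8) * d powr (-5/8)" using d1 by (simp add: mult_le_cancel_left1)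
      finally show ?thesis by (simp add: E_def)
    qed
    have e3: "\<epsilon> \<le> E"
    proof -
      have "\<epsilon> powr 1 \<le> \<epsilon> powr (1/2)" using \<epsilon> by (intro powr_mono') auto
      then show ?thesis using e2 \<epsilon> by simp
    qed
    have ImA: "\<bar>Im (A \<epsilon>)\<bar> \<le> K * E" and ImB: "\<bar>Im (B \<epsilon>)\<bar> \<le> K * E"
    proof -
      have "\<bar>Im (A \<epsilon>)\<bar> \<le> K * \<epsilon> * d powr (-3/2)" "\<bar>Im (B \<epsilon>)\<bar> \<le> K * \<epsilon> * d powr (-3/2)"
        using rpart_estimates(2)[OF x1(1) \<epsilon>(1)] lpart_estimates(2)[OF x1(2) \<epsilon>(1)] m[OF dp(1)[of "-3/2"], of \<epsilon>] m[OF dp(2)[of "-3/2"], of \<epsilon>] \<epsilon>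
        unfolding A_def B_def by auto
      moreover have "K * \<epsilon> * d powr (-3/2) \<le> K * E" using e1 K0 by (simp add: mult.assoc mult_left_mono)
      ultimately show "\<bar>Im (A \<epsilon>)\<bar> \<le> K * E" "\<bar>Im (B \<epsilon>)\<bar> \<le> K * E" by linarith+
    qed
    have VA: "norm (A \<eta> - A \<epsilon>) \<le> K * E" and VB: "norm (B \<eta> - B \<epsilon>) \<le> K * E"
    proof -
      have "K * \<bar>\<eta> - \<epsilon>\<bar> * p \<le> K * \<epsilon> * q" if "0 \<le> p" "p \<le> q" for p q
        using \<eta> K0 that \<epsilon> by (intro mult_mono) auto
      from this[OF _ dp(1)[of "-3/2"]] this[OF _ dp(2)[of "-3/2"]]
      have "norm (A \<eta> - A \<epsilon>) \<le> K * \<epsilon> * d powr (-3/2)" "norm (B \<eta> - B \<epsilon>) \<le> K * \<epsilon> * d powr (-3/2)"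
        using rpart_estimates(3)[OF x1(1) \<eta>(1) \<epsilon>(1)] lpart_estimates(3)[OF x1(2) \<eta>(1) \<epsilon>(1)]
        unfolding A_def B_def by auto
      moreover have "K * \<epsilon> * d powr (-3/2) \<le> K * E" using e1 K0 by (simp add: mult.assoc mult_left_mono)
      ultimately show "norm (A \<eta> - A \<epsilon>) \<le> K * E" "norm (B \<eta> - B \<epsilon>) \<le> K * E" by linarith+
    qed
    have c: "\<bar>\<kappa> * corr (poisson \<epsilon>) f x\<bar> \<le> 2 * \<kappa> * (K * E)"
    proof -
      have "\<bar>corr (poisson \<epsilon>) f x\<bar> \<le> \<epsilon> + K * \<epsilon>" by (rule corr_poisson_near[OF f f_small x \<epsilon>(1)])
      also have "\<dots> \<le> 2 * (K * E)"
      proof -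
        have "1 * \<epsilon> \<le> K * \<epsilon>" using K \<epsilon> by (intro mult_right_mono) auto
        moreover have "K * \<epsilon> \<le> K * E" using e3 K0 by (rule mult_left_mono)
        ultimately show ?thesis by simp
      qed
      finally show ?thesis using \<kappa> by (simp add: abs_mult mult_ac)
    qed
    define M where "M = jtrans (mpart u) (Complex x \<epsilon>)"
    have "norm M \<le> \<epsilon> * (6 * \<epsilon> powr (-1/2))" unfolding M_def by (rule jtrans_bound[OF mpart \<epsilon>(1)])
    also have "\<dots> = 6 * \<epsilon> powr (1/2)" using \<epsilon> powr_mult_base[of \<epsilon> "-1/2"] by simp
    also have "\<dots> \<le> 6 * (K * E)" using e2 mult_right_mono[OF K E0] by simp
    finally have M: "norm M \<le> 6 * (K * E)" .
    have "\<bar>Re (A \<epsilon> + B \<epsilon>)\<bar> \<le> (2 * \<kappa> + 14) * (K * E)"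
    proof -
      have "Re (A \<epsilon> + B \<epsilon>) = - (\<kappa> * corr (poisson \<epsilon>) f x) - (Re M - Im M) + Im (A \<epsilon>) - Im (B \<epsilon>)"
        using outer_equation[OF \<epsilon>(1), of x] unfolding G M_def by (simp add: B_def)
      moreover have "\<bar>Re M\<bar> \<le> 6 * (K * E)" "\<bar>Im M\<bar> \<le> 6 * (K * E)"
        using M abs_Re_le_cmod[of M] abs_Im_le_cmod[of M] by linarith+
      ultimately have "\<bar>Re (A \<epsilon> + B \<epsilon>)\<bar> \<le> 2 * \<kappa> * (K * E) + 14 * (K * E)" using c ImA ImB by linarith
      then show ?thesis by (simp add: distrib_right)
    qed
    moreover have "\<bar>Im (A \<epsilon> + B \<epsilon>)\<bar> \<le> 2 * (K * E)" using ImA ImB by simp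
    ultimately have "norm (A \<epsilon> + B \<epsilon>) \<le> (2 * \<kappa> + 14) * (K * E) + 2 * (K * E)"
      using cmod_le[of "A \<epsilon> + B \<epsilon>"] by linarith
    moreover have "norm (A \<eta> + B \<eta>) \<le> norm (A \<epsilon> + B \<epsilon>) + norm (A \<eta> - A \<epsilon>) + norm (B \<eta> - B \<epsilon>)"
    proof -
      have "A \<eta> + B \<eta> = (A \<epsilon> + B \<epsilon>) + (A \<eta> - A \<epsilon>) + (B \<eta> - B \<epsilon>)" by simp
      then show ?thesis using norm_triangle_ineq[of "A \<epsilon> + B \<epsilon> + (A \<eta> - A \<epsilon>)" "B \<eta> - B \<epsilon>"] norm_triangle_ineq[of "A \<epsilon> + B \<epsilon>" "A \<eta> - A \<epsilon>"] by simp
    qed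
    ultimately have "norm (A \<eta> + B \<eta>) \<le> (2 * \<kappa> + 14) * (K * E) + 4 * (K * E)" using VA VB by linarith
    also have "\<dots> = (2 * \<kappa> + 18) * (K * E)" by (simp add: distrib_right)
    also have "\<dots> \<le> (4 * \<kappa> + 24) * (K * E)" using \<kappa> K0 E0 by (intro mult_right_mono) auto
    finally show ?thesis by (simp add: G E_def d_def mult.assoc)
  qed
qed

section \<open>Estimates for the boundary values\<close>

lemma sum3_sq_le: "(a + b + c)\<^sup>2 \<le> 3 * (a\<^sup>2 + b\<^sup>2 + (c::real)\<^sup>2)"
  using zero_le_power2[of "a - b"] zero_le_power2[of "b - c"] zero_le_power2[of "a - c"]
  by (simp add: power2_eq_square algebra_simps)

text \<open>The transform of the middle part is of size $\epsilon\,(x-1)^{-1/2}$ near 1; its square is compensated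
  by the zero of the weight.\<close>

lemma wt_singular_le:
  assumes x: "x > 1" and n: "n \<ge> 4"
  shows "(1 / (x - 1)) * (rt x / zh x ^ n) \<le> 2 * ((x - 1) powr (-1/2) / (1 + 1 * (x - 1)))"
proof -
  have "rt x = sqrt (x - 1) * sqrt (x + 1)"
    unfolding rt_def by (simp add: real_sqrt_mult[symmetric] power2_eq_square algebra_simps)
  also have "\<dots> \<le> sqrt (x - 1) * (2 * x)"
  proof (intro mult_left_mono real_le_lsqrt)
    have "x * 1 \<le> x * x" using x by (intro mult_left_mono) auto
    moreover have "(2 * x)\<^sup>2 = 4 * (x * x)" by (simp add: power2_eq_square)
    ultimately show "x + 1 \<le> (2 * x)\<^sup>2" using x by linarith
  qed (use x in auto)
  finally have r: "rt x \<le> sqrt (x - 1) * (2 * x)" .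
  have z: "x\<^sup>2 \<le> zh x ^ n"
  proof -
    have "x\<^sup>2 \<le> x ^ n" using x n by (intro power_increasing) auto
    also have "\<dots> \<le> zh x ^ n" using x zh_ge[of x] by (intro power_mono) auto
    finally show ?thesis .
  qed
  have "(1 / (x - 1)) * (rt x / zh x ^ n) \<le> (1 / (x - 1)) * (sqrt (x - 1) * (2 * x) / x\<^sup>2)"
    using r z x by (intro mult_left_mono frac_le) auto
  also have "\<dots> = 2 * ((sqrt (x - 1) / (x - 1)) / x)" using x by (simp add: power2_eq_square)
  also have "sqrt (x - 1) / (x - 1) = (x - 1) powr (-1/2)"
  proof -
    have "(x - 1) powr (-1/2) = 1 / sqrt (x - 1)" using x by (simp add: powr_minus_divide powr_half_sqrt)
    also have "\<dots> = sqrt (x - 1) / (x - 1)" using x by (simp add: field_simps flip: real_sqrt_mult)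
    finally show ?thesis by simp
  qed
  finally show ?thesis by simp
qed

lemma nn_integral_wt_singular:
  assumes n: "n \<ge> 4"
  shows "(\<integral>\<^sup>+x. ennreal (indicator {1<..} x * ((1 / (x - 1)) * (rt x / zh x ^ n))) \<partial>lborel) \<le> ennreal 8"
proof -
  have "(\<integral>\<^sup>+x. ennreal (indicator {1<..} x * ((1 / (x - 1)) * (rt x / zh x ^ n))) \<partial>lborel)
    \<le> (\<integral>\<^sup>+x. ennreal 2 * (ennreal ((x - 1) powr (-1/2) / (1 + 1 * (x - 1))) * indicator {0<..} (x - 1)) \<partial>lborel)"
  proof (intro nn_integral_mono)
    fix x :: real
    show "ennreal (indicator {1<..} x * ((1 / (x - 1)) * (rt x / zh x ^ n))) \<le> ennreal 2 * (ennreal ((x - 1) powr (-1/2) / (1 + 1 * (x - 1))) * indicator {0<..} (x - 1))"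
    proof (cases "x > 1")
      case True
      have "ennreal ((1 / (x - 1)) * (rt x / zh x ^ n)) \<le> ennreal (2 * ((x - 1) powr (-1/2) / (1 + 1 * (x - 1))))"
        by (intro ennreal_leI wt_singular_le[OF True n])
      also have "\<dots> = ennreal 2 * ennreal ((x - 1) powr (-1/2) / (1 + 1 * (x - 1)))"
        using True by (intro ennreal_mult) auto
      finally show ?thesis using True by simp
    qed auto
  qed
  also have "\<dots> = ennreal 2 * (\<integral>\<^sup>+x. ennreal ((x - 1) powr (-1/2) / (1 + 1 * (x - 1))) * indicator {0<..} (x - 1) \<partial>lborel)"
    by (intro nn_integral_cmult) measurable
  also have "(\<integral>\<^sup>+x. ennreal ((x - 1) powr (-1/2) / (1 + 1 * (x - 1))) * indicator {0<..} (x - 1) \<partial>lborel)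
     = (\<integral>\<^sup>+s. ennreal (s powr (-1/2) / (1 + 1 * s)) * indicator {0<..} s \<partial>lborel)"
    by (subst nn_integral_real_affine[where c=1 and t=1]) auto
  also have "ennreal 2 * \<dots> \<le> ennreal 2 * ennreal (4 * 1 powr (-1/2))"
    using nn_integral_inverse_sqrt_linear[of 1] by (intro mult_left_mono) auto
  also have "\<dots> = ennreal 8" by (simp add: ennreal_mult[symmetric])
  finally show ?thesis .
qed

lemma measurable_jtrans:
  assumes "bdd_fun K g" "\<eta> > 0"
  shows "(\<lambda>x. jtrans g (Complex x \<eta>)) \<in> borel_measurable borel"
proof -
  have [measurable]: "g \<in> borel_measurable borel" using bdd_funD(1)[OF assms(1)] .
  show ?thesis unfolding jtrans_Complex by measurable
qed

context flat_solution begin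

lemma measurable_outer [measurable]: "\<eta> > 0 \<Longrightarrow> (\<lambda>x. outer u (Complex x \<eta>)) \<in> borel_measurable borel"
  unfolding outer_def
  by (intro borel_measurable_add borel_measurable_times measurable_jtrans[OF bdd_fun_parts(1)[OF u]] measurable_jtrans[OF bdd_fun_parts(2)[OF u]]) auto

text \<open>The weight is the majorant produced by \<open>weighted_poisson_bound\<close>, which has $y$ in place of
  $\sqrt{y^2-1}$.\<close>

definition source :: "nat \<Rightarrow> ennreal" where
  "source m = (\<integral>\<^sup>+y. ennreal (indicator {2..} y * ((f y)\<^sup>2 * (y / zh y ^ (2 * m)))) \<partial>lborel)"

text \<open>By \<open>outer_equation\<close> the difference $\mathrm{Re}\,G - \mathrm{Im}\,G$ consists of the Poisson average of
  $f$, the transform of the middle part, and the imaginary part of the left part, which is $O(K\eta)$.\<close>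

lemma skew_part_bound:
  assumes \<eta>: "0 < \<eta>" "\<eta> \<le> 1" and m: "m \<ge> 2"
  shows "(\<integral>\<^sup>+x. ennreal (indicator {1<..} x * ((Re (outer u (Complex x \<eta>)) - Im (outer u (Complex x \<eta>)))\<^sup>2 * (rt x / zh x ^ (2 * m)))) \<partial>lborel)
    \<le> ennreal (18 * \<kappa>\<^sup>2) * source m + ennreal ((6 * \<kappa>\<^sup>2 + 192) * \<epsilon>\<^sup>2 + (3 * \<kappa>\<^sup>2 * real m + 6) * K\<^sup>2 * \<eta>)"
proof -
  define w where "w = (\<lambda>x. rt x / zh x ^ (2 * m))"
  have [measurable]: "w \<in> borel_measurable borel" unfolding w_def by measurable
  have [measurable]: "corr (poisson \<eta>) f \<in> borel_measurable borel"
    using bdd_funD(1)[OF bdd_fun_corr_poisson[OF f \<eta>(1)]] .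
  have w0: "w x \<ge> 0" if "x > 1" for x using rt_pos[OF that] zh_pos[of x] that by (simp add: w_def)
  have pt: "(Re (outer u (Complex x \<eta>)) - Im (outer u (Complex x \<eta>)))\<^sup>2
      \<le> (3 * \<kappa>\<^sup>2) * (corr (poisson \<eta>) f x)\<^sup>2 + (24 * \<epsilon>\<^sup>2) * (1 / (x - 1)) + 12 * K\<^sup>2 * \<eta>" if x: "x > 1" for x
  proof -
    define M where "M = jtrans (mpart u) (Complex x \<eta>)"
    define b where "b = Im (\<i> * jtrans (lpart u) (Complex x \<eta>))"
    have "\<bar>Re M - Im M\<bar>\<^sup>2 \<le> 2 * (norm M)\<^sup>2"
      unfolding cmod_power2 using zero_le_power2[of "Re M + Im M"] by (simp add: power2_eq_square algebra_simps)
    also have "\<dots> \<le> 2 * (\<epsilon> * (2 * (x - 1) powr (-1/2)))\<^sup>2"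
      using norm_mpart_right[OF x \<eta>(1)] unfolding M_def by (intro mult_left_mono power_mono) auto
    also have "\<dots> = 8 * \<epsilon>\<^sup>2 * (1 / (x - 1))"
      using x by (simp add: power_mult_distrib powr_minus_divide powr_half_sqrt power_divide)
    finally have M: "(Re M - Im M)\<^sup>2 \<le> 8 * \<epsilon>\<^sup>2 * (1 / (x - 1))" by simp
    have "\<bar>b\<bar>\<^sup>2 \<le> (K * \<eta>)\<^sup>2"
      unfolding b_def using abs_lpart_right[OF flat_solution_axioms x \<eta>(1)] by (intro power_mono) auto
    also have "\<dots> \<le> K\<^sup>2 * \<eta>"
      using \<eta> by (simp add: power_mult_distrib power2_eq_square[of \<eta>] mult_left_le mult_left_mono)
    finally have b: "b\<^sup>2 \<le> K\<^sup>2 * \<eta>" by simp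
    have "(Re (outer u (Complex x \<eta>)) - Im (outer u (Complex x \<eta>)))\<^sup>2 = (- (\<kappa> * corr (poisson \<eta>) f x) + - (Re M - Im M) + - (2 * b))\<^sup>2"
      unfolding outer_equation[OF \<eta>(1)] M_def b_def by (simp add: algebra_simps)
    also have "\<dots> \<le> 3 * ((- (\<kappa> * corr (poisson \<eta>) f x))\<^sup>2 + (- (Re M - Im M))\<^sup>2 + (- (2 * b))\<^sup>2)" by (rule sum3_sq_le)
    also have "\<dots> = (3 * \<kappa>\<^sup>2) * (corr (poisson \<eta>) f x)\<^sup>2 + 3 * (Re M - Im M)\<^sup>2 + 12 * b\<^sup>2"
      by (simp add: power_mult_distrib power2_commute)
    also have "\<dots> \<le> (3 * \<kappa>\<^sup>2) * (corr (poisson \<eta>) f x)\<^sup>2 + 3 * (8 * \<epsilon>\<^sup>2 * (1 / (x - 1))) + 12 * (K\<^sup>2 * \<eta>)"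
      using M b by (intro add_mono mult_left_mono) auto
    finally show ?thesis by (simp add: mult_ac)
  qed
  have "(\<integral>\<^sup>+x. ennreal (indicator {1<..} x * ((Re (outer u (Complex x \<eta>)) - Im (outer u (Complex x \<eta>)))\<^sup>2 * w x)) \<partial>lborel)
    \<le> (\<integral>\<^sup>+x. ennreal (3 * \<kappa>\<^sup>2) * ennreal (indicator {1<..} x * ((corr (poisson \<eta>) f x)\<^sup>2 * w x))
        + (ennreal (24 * \<epsilon>\<^sup>2) * ennreal (indicator {1<..} x * ((1 / (x - 1)) * w x))
        + ennreal (12 * K\<^sup>2 * \<eta>) * ennreal (indicator {1<..} x * w x)) \<partial>lborel)"
  proof (intro nn_integral_mono)
    fix x :: real
    show "ennreal (indicator {1<..} x * ((Re (outer u (Complex x \<eta>)) - Im (outer u (Complex x \<eta>)))\<^sup>2 * w x))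
      \<le> ennreal (3 * \<kappa>\<^sup>2) * ennreal (indicator {1<..} x * ((corr (poisson \<eta>) f x)\<^sup>2 * w x))
        + (ennreal (24 * \<epsilon>\<^sup>2) * ennreal (indicator {1<..} x * ((1 / (x - 1)) * w x))
        + ennreal (12 * K\<^sup>2 * \<eta>) * ennreal (indicator {1<..} x * w x))"
    proof (cases "x > 1")
      case True
      have "(Re (outer u (Complex x \<eta>)) - Im (outer u (Complex x \<eta>)))\<^sup>2 * w x
         \<le> ((3 * \<kappa>\<^sup>2) * (corr (poisson \<eta>) f x)\<^sup>2 + (24 * \<epsilon>\<^sup>2) * (1 / (x - 1)) + 12 * K\<^sup>2 * \<eta>) * w x"
        using pt[OF True] w0[OF True] by (rule mult_right_mono)
      also have "\<dots> = (3 * \<kappa>\<^sup>2) * ((corr (poisson \<eta>) f x)\<^sup>2 * w x) + ((24 * \<epsilon>\<^sup>2) * ((1 / (x - 1)) * w x) + (12 * K\<^sup>2 * \<eta>) * w x)"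
        by (simp add: algebra_simps)
      finally have "ennreal ((Re (outer u (Complex x \<eta>)) - Im (outer u (Complex x \<eta>)))\<^sup>2 * w x)
         \<le> ennreal ((3 * \<kappa>\<^sup>2) * ((corr (poisson \<eta>) f x)\<^sup>2 * w x) + ((24 * \<epsilon>\<^sup>2) * ((1 / (x - 1)) * w x) + (12 * K\<^sup>2 * \<eta>) * w x))" by (rule ennreal_leI)
      also have "\<dots> = ennreal ((3 * \<kappa>\<^sup>2) * ((corr (poisson \<eta>) f x)\<^sup>2 * w x)) + (ennreal ((24 * \<epsilon>\<^sup>2) * ((1 / (x - 1)) * w x)) + ennreal ((12 * K\<^sup>2 * \<eta>) * w x))"
        using w0[OF True] True \<eta> by (subst ennreal_plus; (intro add_nonneg_nonneg mult_nonneg_nonneg)?) (auto simp: ennreal_plus)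
      also have "\<dots> = ennreal (3 * \<kappa>\<^sup>2) * ennreal ((corr (poisson \<eta>) f x)\<^sup>2 * w x)
        + (ennreal (24 * \<epsilon>\<^sup>2) * ennreal ((1 / (x - 1)) * w x) + ennreal (12 * K\<^sup>2 * \<eta>) * ennreal (w x))"
        using w0[OF True] True \<eta> by (intro arg_cong2[where f="(+)"] ennreal_mult mult_nonneg_nonneg) auto
      finally show ?thesis using True by simp
    qed simp
  qed
  also have "\<dots> = ennreal (3 * \<kappa>\<^sup>2) * (\<integral>\<^sup>+x. ennreal (indicator {1<..} x * ((corr (poisson \<eta>) f x)\<^sup>2 * w x)) \<partial>lborel)
        + (ennreal (24 * \<epsilon>\<^sup>2) * (\<integral>\<^sup>+x. ennreal (indicator {1<..} x * ((1 / (x - 1)) * w x)) \<partial>lborel)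
        + ennreal (12 * K\<^sup>2 * \<eta>) * (\<integral>\<^sup>+x. ennreal (indicator {1<..} x * w x) \<partial>lborel))"
    by (simp add: nn_integral_add nn_integral_cmult)
  also have "\<dots> \<le> ennreal (3 * \<kappa>\<^sup>2) * (6 * source m + ennreal (2 * \<epsilon>\<^sup>2 + K\<^sup>2 * \<eta> * real m))
        + (ennreal (24 * \<epsilon>\<^sup>2) * ennreal 8 + ennreal (12 * K\<^sup>2 * \<eta>) * ennreal (1/2))"
  proof (intro add_mono mult_left_mono)
    show "(\<integral>\<^sup>+x. ennreal (indicator {1<..} x * ((corr (poisson \<eta>) f x)\<^sup>2 * w x)) \<partial>lborel) \<le> 6 * source m + ennreal (2 * \<epsilon>\<^sup>2 + K\<^sup>2 * \<eta> * real m)"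
      unfolding w_def source_def by (rule weighted_poisson_bound[OF f f_small \<eta>(1) m])
    show "(\<integral>\<^sup>+x. ennreal (indicator {1<..} x * ((1 / (x - 1)) * w x)) \<partial>lborel) \<le> ennreal 8"
      unfolding w_def using m by (intro nn_integral_wt_singular) auto
    show "(\<integral>\<^sup>+x. ennreal (indicator {1<..} x * w x) \<partial>lborel) \<le> ennreal (1/2)"
      unfolding w_def using m by (intro nn_integral_wt) auto
  qed auto
  also have "\<dots> = ennreal (18 * \<kappa>\<^sup>2) * source m + ennreal ((6 * \<kappa>\<^sup>2 + 192) * \<epsilon>\<^sup>2 + (3 * \<kappa>\<^sup>2 * real m + 6) * K\<^sup>2 * \<eta>)"
  proof -
    have "ennreal (3 * \<kappa>\<^sup>2) * 6 = ennreal (18 * \<kappa>\<^sup>2)"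
      using ennreal_mult[of "3 * \<kappa>\<^sup>2" 6] by simp
    then have 1: "ennreal (3 * \<kappa>\<^sup>2) * (6 * source m) = ennreal (18 * \<kappa>\<^sup>2) * source m" by (simp add: mult.assoc[symmetric])
    have 2: "ennreal (3 * \<kappa>\<^sup>2) * ennreal (2 * \<epsilon>\<^sup>2 + K\<^sup>2 * \<eta> * real m) + (ennreal (24 * \<epsilon>\<^sup>2) * ennreal 8 + ennreal (12 * K\<^sup>2 * \<eta>) * ennreal (1/2))
      = ennreal (3 * \<kappa>\<^sup>2 * (2 * \<epsilon>\<^sup>2 + K\<^sup>2 * \<eta> * real m) + (24 * \<epsilon>\<^sup>2 * 8 + 12 * K\<^sup>2 * \<eta> * (1/2)))"
    proof -
      have "ennreal (3 * \<kappa>\<^sup>2) * ennreal (2 * \<epsilon>\<^sup>2 + K\<^sup>2 * \<eta> * real m) = ennreal (3 * \<kappa>\<^sup>2 * (2 * \<epsilon>\<^sup>2 + K\<^sup>2 * \<eta> * real m))"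
        "ennreal (24 * \<epsilon>\<^sup>2) * ennreal 8 = ennreal (24 * \<epsilon>\<^sup>2 * 8)"
        "ennreal (12 * K\<^sup>2 * \<eta>) * ennreal (1/2) = ennreal (12 * K\<^sup>2 * \<eta> * (1/2))"
        using \<eta> by (intro ennreal_mult[symmetric]; auto)+
      then show ?thesis using \<eta> by (simp only:) (subst ennreal_plus[symmetric]; (intro add_nonneg_nonneg mult_nonneg_nonneg)?; auto simp: ennreal_plus[symmetric] simp del: ennreal_plus)+
    qed
    show ?thesis by (simp only: distrib_left 1 add.assoc 2) (simp add: algebra_simps)
  qed
  finally show ?thesis unfolding w_def .
qed

text \<open>The bound of \<open>norm_outer_middle\<close> squares to $d^{-5/4}$, and the weight supplies $d^{1/2}$.\<close>

lemma outer_middle_integral: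
  assumes \<eta>: "0 < \<eta>" "\<eta> \<le> \<epsilon>"
  shows "(\<integral>\<^sup>+x. ennreal (indicator {-1<..<1} x * ((norm (outer u (Complex x \<eta>)))\<^sup>2 * sqrt (1 - x\<^sup>2))) \<partial>lborel)
    \<le> ennreal (16 * (4 * \<kappa> + 24)\<^sup>2 * K\<^sup>2 * \<epsilon> powr (1/4))"
proof -
  define c where "c = ((4 * \<kappa> + 24) * K)\<^sup>2 * \<epsilon> powr (1/4)"
  have c0: "c \<ge> 0" by (simp add: c_def)
  have pt: "(norm (outer u (Complex x \<eta>)))\<^sup>2 * sqrt (1 - x\<^sup>2) \<le> (2 * c) * (1 - \<bar>x\<bar>) powr (-3/4)" if x: "\<bar>x\<bar> < 1" for x
  proof -
    define d where "d = 1 - \<bar>x\<bar>"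
    have d: "d > 0" using x by (simp add: d_def)
    have "(norm (outer u (Complex x \<eta>)))\<^sup>2 \<le> ((4 * \<kappa> + 24) * K * (\<epsilon> powr (1/8) * d powr (-5/8)))\<^sup>2"
      unfolding d_def by (intro power_mono norm_outer_middle x \<eta>) auto
    also have "\<dots> = c * d powr (-5/4)"
    proof -
      have "(\<epsilon> powr (1/8))\<^sup>2 = \<epsilon> powr (1/4)" "(d powr (-5/8))\<^sup>2 = d powr (-5/4)"
        by (simp_all add: power2_eq_square powr_add[symmetric])
      then show ?thesis unfolding c_def by (simp only: power_mult_distrib mult_ac)
    qed
    finally have 1: "(norm (outer u (Complex x \<eta>)))\<^sup>2 \<le> c * d powr (-5/4)" .
    have "1 - x\<^sup>2 = (1 - \<bar>x\<bar>) * (1 + \<bar>x\<bar>)" by (simp add: algebra_simps power2_eq_square)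
    also have "\<dots> \<le> d * 4" using x d unfolding d_def by (intro mult_left_mono) auto
    finally have "sqrt (1 - x\<^sup>2) \<le> sqrt (d * 4)" by (rule real_sqrt_le_mono)
    also have "\<dots> = 2 * d powr (1/2)" using d by (simp add: real_sqrt_mult powr_half_sqrt)
    finally have 2: "sqrt (1 - x\<^sup>2) \<le> 2 * d powr (1/2)" .
    have "(norm (outer u (Complex x \<eta>)))\<^sup>2 * sqrt (1 - x\<^sup>2) \<le> (c * d powr (-5/4)) * (2 * d powr (1/2))"
      using x by (intro mult_mono 1 2) (auto simp: c0 power_le_one abs_square_le_1)
    also have "\<dots> = (2 * c) * (d powr (-5/4) * d powr (1/2))" by simp
    also have "d powr (-5/4) * d powr (1/2) = d powr (-3/4)" by (simp add: powr_add[symmetric])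
    finally show ?thesis by (simp add: d_def)
  qed
  define h where "h = (\<lambda>s::real. ennreal (s powr (-3/4)) * indicator {0<..<1} s)"
  have [measurable]: "h \<in> borel_measurable borel" unfolding h_def by measurable
  have hI: "(\<integral>\<^sup>+s. h s \<partial>lborel) \<le> ennreal 4"
  proof -
    have "(\<integral>\<^sup>+s. h s \<partial>lborel) \<le> (\<integral>\<^sup>+s. ennreal (s powr (-3/4)) * indicator {0..1} s \<partial>lborel)"
      by (intro nn_integral_mono) (auto simp: h_def split: split_indicator)
    also have "\<dots> = ennreal 4" by (subst nn_integral_powr_head) auto
    finally show ?thesis .
  qed
  have "(\<integral>\<^sup>+x. ennreal (indicator {-1<..<1} x * ((norm (outer u (Complex x \<eta>)))\<^sup>2 * sqrt (1 - x\<^sup>2))) \<partial>lborel)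
     \<le> (\<integral>\<^sup>+x. ennreal (2 * c) * (h (1 - x) + h (1 + x)) \<partial>lborel)"
  proof (rule nn_integral_mono_AE, rule AE_mp[OF AE_lborel_singleton[of 0]], intro AE_I2 impI)
    fix x :: real assume x0: "x \<noteq> 0"
    show "ennreal (indicator {-1<..<1} x * ((norm (outer u (Complex x \<eta>)))\<^sup>2 * sqrt (1 - x\<^sup>2))) \<le> ennreal (2 * c) * (h (1 - x) + h (1 + x))"
    proof (cases "\<bar>x\<bar> < 1")
      case True
      have "ennreal ((1 - \<bar>x\<bar>) powr (-3/4)) \<le> h (1 - x) + h (1 + x)"
        using True x0 by (cases "x > 0") (auto simp: h_def)
      then have "ennreal (2 * c) * ennreal ((1 - \<bar>x\<bar>) powr (-3/4)) \<le> ennreal (2 * c) * (h (1 - x) + h (1 + x))"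
        by (intro mult_left_mono) auto
      moreover have "ennreal ((norm (outer u (Complex x \<eta>)))\<^sup>2 * sqrt (1 - x\<^sup>2)) \<le> ennreal (2 * c) * ennreal ((1 - \<bar>x\<bar>) powr (-3/4))"
        using pt[OF True] c0 by (subst ennreal_mult[symmetric]) (auto intro!: ennreal_leI)
      ultimately show ?thesis using True by (auto simp: abs_less_iff split: split_indicator)
    qed (auto simp: abs_less_iff split: split_indicator)
  qed
  also have "\<dots> = ennreal (2 * c) * ((\<integral>\<^sup>+x. h (1 - x) \<partial>lborel) + (\<integral>\<^sup>+x. h (1 + x) \<partial>lborel))"
    by (simp add: nn_integral_add nn_integral_cmult)
  also have "(\<integral>\<^sup>+x. h (1 - x) \<partial>lborel) = (\<integral>\<^sup>+x. h x \<partial>lborel)"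
    by (subst (2) nn_integral_real_affine[where c="-1" and t=1]) auto
  also have "(\<integral>\<^sup>+x. h (1 + x) \<partial>lborel) = (\<integral>\<^sup>+x. h x \<partial>lborel)"
    by (subst (2) nn_integral_real_affine[where c=1 and t=1]) auto
  also have "ennreal (2 * c) * ((\<integral>\<^sup>+x. h x \<partial>lborel) + (\<integral>\<^sup>+x. h x \<partial>lborel)) \<le> ennreal (2 * c) * (ennreal 4 + ennreal 4)"
    by (intro mult_left_mono add_mono hI) auto
  also have "\<dots> = ennreal (2 * c) * ennreal 8" by (simp flip: ennreal_plus)
  also have "\<dots> = ennreal (2 * c * 8)" using c0 by (intro ennreal_mult[symmetric]) auto
  also have "\<dots> = ennreal (16 * c)" using c0 by (simp add: ennreal_plus[symmetric] ennreal_mult[symmetric] del: ennreal_plus)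
  finally show ?thesis by (simp add: c_def power_mult_distrib mult_ac)
qed

end

section \<open>The energy identity and recovery of the solution\<close>

text \<open>The form in which the contour integral is used: $F$ has no sign, but it integrates to 0, so it can be
  added to the majorant $D$ for free.\<close>

lemma nn_integral_le_of_cancelling:
  fixes F D Q :: "real \<Rightarrow> real"
  assumes F: "integrable lborel F" "(LINT x|lborel. F x) = 0"
    and [measurable]: "D \<in> borel_measurable borel" and D: "\<And>x. D x \<ge> 0"
    and Q: "AE x in lborel. Q x \<le> D x + F x" "\<And>x. Q x \<ge> 0"
  shows "(\<integral>\<^sup>+x. ennreal (Q x) \<partial>lborel) \<le> (\<integral>\<^sup>+x. ennreal (D x) \<partial>lborel)"
proof (cases "(\<integral>\<^sup>+x. ennreal (D x) \<partial>lborel) = \<infinity>")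
  case False
  have DI: "integrable lborel D"
    using D False by (intro integrableI_nonneg) (auto simp: less_top[symmetric])
  have "(\<integral>\<^sup>+x. ennreal (Q x) \<partial>lborel) \<le> (\<integral>\<^sup>+x. ennreal (D x + F x) \<partial>lborel)"
    using Q(1) by (intro nn_integral_mono_AE) (auto elim!: eventually_mono intro!: ennreal_leI)
  also have "\<dots> = ennreal (LINT x|lborel. D x + F x)"
    using Q by (intro nn_integral_eq_integral Bochner_Integration.integrable_add DI F(1)) (auto elim!: eventually_mono intro: order_trans)
  also have "(LINT x|lborel. D x + F x) = (LINT x|lborel. D x)"
    using F DI by simp
  also have "ennreal (LINT x|lborel. D x) = (\<integral>\<^sup>+x. ennreal (D x) \<partial>lborel)"
    using D by (intro nn_integral_eq_integral[symmetric] DI) auto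
  finally show ?thesis .
qed simp

lemma ennreal_add_sq_le: "(a + b)\<^sup>2 \<le> 2 * a\<^sup>2 + 2 * (b::ennreal)\<^sup>2"
proof (cases a; cases b)
  fix r s :: real assume *: "0 \<le> r" "a = ennreal r" "0 \<le> s" "b = ennreal s"
  have "(r + s)\<^sup>2 \<le> 2 * r\<^sup>2 + 2 * s\<^sup>2"
    using zero_le_power2[of "r - s"] by (simp add: power2_eq_square algebra_simps)
  then have "ennreal ((r + s)\<^sup>2) \<le> ennreal (2 * r\<^sup>2 + 2 * s\<^sup>2)" by (rule ennreal_leI)
  moreover have "ennreal (2 * r\<^sup>2 + 2 * s\<^sup>2) = 2 * (ennreal r)\<^sup>2 + 2 * (ennreal s)\<^sup>2"
    using * by (simp add: ennreal_plus ennreal_mult ennreal_power)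
  moreover have "ennreal ((r + s)\<^sup>2) = (ennreal r + ennreal s)\<^sup>2"
    using * by (simp add: ennreal_plus[symmetric] ennreal_power del: ennreal_plus)
  ultimately show ?thesis using * by simp
qed (auto simp: power2_eq_square ennreal_mult_top ennreal_top_mult)

context flat_solution begin

text \<open>The right half of the energy that the contour integral controls; the left half is the same quantity for
  the reflected solution.\<close>

definition mass :: "nat \<Rightarrow> real \<Rightarrow> ennreal" where
  "mass m \<eta> = (\<integral>\<^sup>+x. ennreal (indicator {1<..} x * ((norm (outer u (Complex x \<eta>)))\<^sup>2 * (rt x / zh x ^ (2 * m)))) \<partial>lborel)"

end

text \<open>Take the imaginary part of \<open>contour_identity\<close>. On the right ray the weight is $w > 0$ and
  $|G|^2 = (\mathrm{Re}\,G - \mathrm{Im}\,G)^2 + \mathrm{Im}\,G^2$; on the left ray it is $-w$ and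
  $|G|^2 = (\mathrm{Re}\,G + \mathrm{Im}\,G)^2 - \mathrm{Im}\,G^2$. So on both rays the energy is the
  imaginary part of the integrand plus a controlled square, and in the gap everything is small. The
  left square is the right one of the reflected solution.\<close>

lemma (in flat_solution) mass_bound:
  assumes \<eta>: "0 < \<eta>" "\<eta> \<le> \<epsilon>" and m: "m \<ge> 2"
  shows "mass m \<eta> \<le> ennreal (18 * \<kappa>\<^sup>2) * (source m + flat_solution.source (\<lambda>y. f (- y)) m)
    + ennreal (2 * ((6 * \<kappa>\<^sup>2 + 192) * \<epsilon>\<^sup>2) + 16 * (4 * \<kappa> + 24)\<^sup>2 * K\<^sup>2 * \<epsilon> powr (1/4) + 2 * ((3 * \<kappa>\<^sup>2 * real m + 6) * K\<^sup>2) * \<eta>)"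
proof -
  let ?d = "(6 * \<kappa>\<^sup>2 + 192) * \<epsilon>\<^sup>2 + (3 * \<kappa>\<^sup>2 * real m + 6) * K\<^sup>2 * \<eta>"
  interpret r: flat_solution K \<epsilon> \<kappa> "\<lambda>y. u (- y)" "\<lambda>y. f (- y)" by (rule reflected)
  have \<eta>1: "\<eta> \<le> 1" using \<eta> \<epsilon> by simp
  define w where "w = (\<lambda>x. rt x / zh x ^ (2 * m))"
  have [measurable]: "w \<in> borel_measurable borel" unfolding w_def by measurable
  define G where "G = (\<lambda>x. outer u (Complex x \<eta>))"
  have [measurable]: "G \<in> borel_measurable borel" unfolding G_def by (rule measurable_outer[OF \<eta>(1)])
  have w0: "w x \<ge> 0" if "x > 1" for x using rt_pos[OF that] zh_pos[of x] that by (simp add: w_def)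
  have "(\<lambda>x. (G x)\<^sup>2 * wgt (2 * m) (complex_of_real x)) = (\<lambda>x. (jtrans (rpart u) (Complex x \<eta>) + \<i> * jtrans (lpart u) (Complex x \<eta>))\<^sup>2 * wgt (2 * m) (complex_of_real x))"
    by (simp add: G_def outer_def)
  then have ci: "integrable lborel (\<lambda>x. (G x)\<^sup>2 * wgt (2 * m) (complex_of_real x))"
      "(LINT x|lborel. (G x)\<^sup>2 * wgt (2 * m) (complex_of_real x)) = 0"
    using contour_identity[OF bdd_fun_parts[OF u] \<eta>(1), of "2 * m"] m by auto
  define F where "F = (\<lambda>x. Im ((G x)\<^sup>2 * wgt (2 * m) (complex_of_real x)))"
  have F: "integrable lborel F" "(LINT x|lborel. F x) = 0"
    unfolding F_def using integrable_Im[OF ci(1)] integral_Im[OF ci(1)] ci(2) by (simp_all del: times_complex.sel)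
  define D1 where "D1 = (\<lambda>x. indicator {1<..} x * ((Re (G x) - Im (G x))\<^sup>2 * w x))"
  define D2 where "D2 = (\<lambda>x. indicator {1<..} (- x) * ((Re (G x) + Im (G x))\<^sup>2 * w (- x)))"
  define D3 where "D3 = (\<lambda>x. indicator {-1<..<1} x * ((norm (G x))\<^sup>2 * sqrt (1 - x\<^sup>2)))"
  have [measurable]: "D1 \<in> borel_measurable borel" "D2 \<in> borel_measurable borel" "D3 \<in> borel_measurable borel"
    unfolding D1_def D2_def D3_def by measurable
  have D0: "D1 x \<ge> 0" "D2 x \<ge> 0" "D3 x \<ge> 0" for x
  proof -
    show "D1 x \<ge> 0" using w0[of x] by (cases "x > 1") (auto simp: D1_def)
    show "D2 x \<ge> 0" using w0[of "- x"] by (cases "- x > 1") (auto simp: D2_def)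
    show "D3 x \<ge> 0" by (auto simp: D3_def abs_square_le_1 abs_le_iff split: split_indicator)
  qed
  define Q where "Q = (\<lambda>x. indicator {1<..} x * ((norm (G x))\<^sup>2 * w x))"
  have Q0: "Q x \<ge> 0" for x using w0[of x] by (cases "x > 1") (auto simp: Q_def)
  have "(\<integral>\<^sup>+x. ennreal (Q x) \<partial>lborel) \<le> (\<integral>\<^sup>+x. ennreal (D1 x + D2 x + D3 x) \<partial>lborel)"
  proof (rule nn_integral_le_of_cancelling[OF F])
    show "AE x in lborel. Q x \<le> D1 x + D2 x + D3 x + F x"
    proof (rule AE_mp[OF AE_lborel_singleton[of 1]], rule AE_mp[OF AE_lborel_singleton[of "-1"]], intro AE_I2 impI)
      fix x :: real assume ne: "x \<noteq> -1" "x \<noteq> 1"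
      consider "x > 1" | "x < -1" | "\<bar>x\<bar> < 1" using ne by linarith
      then show "Q x \<le> D1 x + D2 x + D3 x + F x"
      proof cases
        case 1
        have "F x = 2 * Re (G x) * Im (G x) * w x"
          unfolding F_def wgt_right[OF 1] w_def by (simp add: power2_eq_square)
        then have "(norm (G x))\<^sup>2 * w x = (Re (G x) - Im (G x))\<^sup>2 * w x + F x"
          unfolding cmod_power2 by (simp add: power2_eq_square algebra_simps)
        then show ?thesis using 1 D0[of x] by (simp add: Q_def D1_def)
      next
        case 2
        have "F x = - (2 * Re (G x) * Im (G x) * w (- x))"
          unfolding F_def wgt_left[OF 2] w_def by (simp add: power2_eq_square)
        then have "(norm (G x))\<^sup>2 * w (- x) = (Re (G x) + Im (G x))\<^sup>2 * w (- x) + F x"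
          unfolding cmod_power2 by (simp add: power2_eq_square algebra_simps)
        moreover have "(norm (G x))\<^sup>2 * w (- x) \<ge> 0" using w0[of "- x"] 2 by simp
        ultimately show ?thesis using 2 D0[of x] by (simp add: Q_def D2_def)
      next
        case 3
        have "\<bar>F x\<bar> \<le> norm ((G x)\<^sup>2 * wgt (2 * m) (complex_of_real x))" unfolding F_def by (rule abs_Im_le_cmod)
        also have "\<dots> \<le> (norm (G x))\<^sup>2 * sqrt (1 - x\<^sup>2)"
          unfolding norm_mult norm_power by (intro mult_left_mono norm_wgt_middle 3) auto
        finally show ?thesis using 3 D0[of x] by (auto simp: Q_def D3_def abs_less_iff)
      qed
    qed
  qed (use Q0 D0 in auto)
  also have "\<dots> = (\<integral>\<^sup>+x. ennreal (D1 x) \<partial>lborel) + (\<integral>\<^sup>+x. ennreal (D2 x) \<partial>lborel) + (\<integral>\<^sup>+x. ennreal (D3 x) \<partial>lborel)"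
    using D0 by (simp add: ennreal_plus nn_integral_add)
  also have "(\<integral>\<^sup>+x. ennreal (D2 x) \<partial>lborel) = (\<integral>\<^sup>+x. ennreal (D2 (- x)) \<partial>lborel)"
    by (subst nn_integral_real_affine[where c="-1" and t=0]) auto
  also have "(\<lambda>x. D2 (- x)) = (\<lambda>x. indicator {1<..} x * ((Re (outer (\<lambda>y. u (- y)) (Complex x \<eta>)) - Im (outer (\<lambda>y. u (- y)) (Complex x \<eta>)))\<^sup>2 * (rt x / zh x ^ (2 * m))))"
    by (simp add: D2_def outer_reflect[OF \<eta>(1)] G_def w_def fun_eq_iff)
  finally have "mass m \<eta> \<le> (\<integral>\<^sup>+x. ennreal (D1 x) \<partial>lborel)
      + (\<integral>\<^sup>+x. ennreal (indicator {1<..} x * ((Re (outer (\<lambda>y. u (- y)) (Complex x \<eta>)) - Im (outer (\<lambda>y. u (- y)) (Complex x \<eta>)))\<^sup>2 * (rt x / zh x ^ (2 * m)))) \<partial>lborel)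
      + (\<integral>\<^sup>+x. ennreal (D3 x) \<partial>lborel)"
    by (simp add: mass_def Q_def G_def w_def)
  also have "\<dots> \<le> (ennreal (18 * \<kappa>\<^sup>2) * source m + ennreal (?d))
    + (ennreal (18 * \<kappa>\<^sup>2) * r.source m + ennreal (?d))
    + ennreal (16 * (4 * \<kappa> + 24)\<^sup>2 * K\<^sup>2 * \<epsilon> powr (1/4))"
    unfolding D1_def D3_def G_def w_def
    by (intro add_mono skew_part_bound r.skew_part_bound outer_middle_integral \<eta> \<eta>1 m)
  also have "\<dots> = ennreal (18 * \<kappa>\<^sup>2) * (source m + r.source m) +
     (ennreal (?d) + ennreal (?d)
      + ennreal (16 * (4 * \<kappa> + 24)\<^sup>2 * K\<^sup>2 * \<epsilon> powr (1/4)))"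
    by (simp only: distrib_left add_ac)
  also have "(ennreal (?d) + ennreal (?d)
      + ennreal (16 * (4 * \<kappa> + 24)\<^sup>2 * K\<^sup>2 * \<epsilon> powr (1/4)))
     = ennreal (?d + (?d) + 16 * (4 * \<kappa> + 24)\<^sup>2 * K\<^sup>2 * \<epsilon> powr (1/4))"
    using \<eta> by (simp only: ennreal_plus[symmetric] add_nonneg_nonneg mult_nonneg_nonneg zero_le_power2 of_nat_0_le_iff zero_le_numeral powr_ge_zero less_imp_le)
  also have "?d + (?d) + 16 * (4 * \<kappa> + 24)\<^sup>2 * K\<^sup>2 * \<epsilon> powr (1/4)
     = 2 * ((6 * \<kappa>\<^sup>2 + 192) * \<epsilon>\<^sup>2) + 16 * (4 * \<kappa> + 24)\<^sup>2 * K\<^sup>2 * \<epsilon> powr (1/4) + 2 * ((3 * \<kappa>\<^sup>2 * real m + 6) * K\<^sup>2) * \<eta>"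
    by (simp only: mult_2 distrib_right distrib_left)
  finally show ?thesis .
qed

context flat_solution begin

text \<open>Interpolated so that the singularity at 1 becomes integrable while a power of $\eta$ remains.\<close>

lemma abs_Im_rpart_left:
  assumes "t < 1" "\<eta> > 0"
  shows "\<bar>Im (jtrans (rpart u) (Complex t \<eta>))\<bar> \<le> 2 * K * \<eta> powr (1/4) * (1 - t) powr (-3/4)"
proof (cases "\<eta> \<le> 1 - t")
  case True
  have "\<bar>Im (jtrans (rpart u) (Complex t \<eta>))\<bar> \<le> K * (\<eta> * (1 - t) powr (-3/2))"
    using rpart_estimates(2)[OF assms] by (simp add: mult.assoc)
  also have "\<dots> \<le> K * (\<eta> powr (1/4) * (1 - t) powr (-3/4))"
    using powr_interpolate(1)[of \<eta> "1 - t" "1/4"] True assms K by (intro mult_left_mono) auto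
  also have "\<dots> \<le> (2 * K) * (\<eta> powr (1/4) * (1 - t) powr (-3/4))"
    using K by (intro mult_right_mono) auto
  finally show ?thesis by (simp add: mult.assoc)
next
  case False
  have "\<bar>Im (jtrans (rpart u) (Complex t \<eta>))\<bar> \<le> 2 * K * (1 - t) powr (-1/2)"
    using rpart_estimates(1)[OF assms] abs_Im_le_cmod order_trans by blast
  also have "\<dots> \<le> (2 * K) * (\<eta> powr (1/4) * (1 - t) powr (-3/4))"
    using powr_interpolate(2)[of \<eta> "1 - t" "1/4"] False assms K by (intro mult_left_mono) auto
  finally show ?thesis by (simp add: mult.assoc)
qed

end

lemma nn_integral_left_tail:
  assumes x: "x \<ge> 2"
  shows "(\<integral>\<^sup>+t. ennreal (indicator {..<1} t * ((x - t) powr (-1/2) * (1 - t) powr (-3/4))) \<partial>lborel) \<le> ennreal 8"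
proof -
  define h where "h = (\<lambda>s::real. ennreal (s powr (-3/4)) * indicator {0..1} s + ennreal (s powr - (5/4)) * indicator {1..} s)"
  have [measurable]: "h \<in> borel_measurable borel" unfolding h_def by measurable
  have "(\<integral>\<^sup>+t. ennreal (indicator {..<1} t * ((x - t) powr (-1/2) * (1 - t) powr (-3/4))) \<partial>lborel) \<le> (\<integral>\<^sup>+t. h (1 - t) \<partial>lborel)"
  proof (intro nn_integral_mono)
    fix t :: real
    show "ennreal (indicator {..<1} t * ((x - t) powr (-1/2) * (1 - t) powr (-3/4))) \<le> h (1 - t)"
    proof (cases "t < 1")
      case True
      define s where "s = 1 - t"
      have s: "s > 0" using True by (simp add: s_def)
      have xt: "x - t \<ge> 1" "x - t \<ge> s" using x True by (auto simp: s_def)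
      have "(x - t) powr (-1/2) * s powr (-3/4) \<le> (if s \<le> 1 then s powr (-3/4) else s powr (- (5/4)))"
      proof (cases "s \<le> 1")
        case True
        have "(x - t) powr (-1/2) \<le> 1 powr (-1/2)" using xt by (intro powr_mono2') auto
        then show ?thesis using True by (simp add: mult_left_le_one_le)
      next
        case False
        have "(x - t) powr (-1/2) \<le> s powr (-1/2)" using xt s by (intro powr_mono2') auto
        then have "(x - t) powr (-1/2) * s powr (-3/4) \<le> s powr (-1/2) * s powr (-3/4)" by (intro mult_right_mono) auto
        then show ?thesis using False by (simp add: powr_add[symmetric])
      qed
      then have "ennreal ((x - t) powr (-1/2) * s powr (-3/4)) \<le> ennreal (if s \<le> 1 then s powr (-3/4) else s powr (- (5/4)))"
        by (rule ennreal_leI)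
      also have "\<dots> \<le> h s" using s by (auto simp: h_def)
      finally show ?thesis using True by (simp add: s_def)
    qed simp
  qed
  also have "\<dots> = (\<integral>\<^sup>+t. h t \<partial>lborel)"
    by (subst (2) nn_integral_real_affine[where c="-1" and t=1]) auto
  also have "\<dots> = (\<integral>\<^sup>+s. ennreal (s powr (-3/4)) * indicator {0..1::real} s \<partial>lborel) + (\<integral>\<^sup>+s. ennreal (s powr - (5/4)) * indicator {1..} s \<partial>lborel)"
    unfolding h_def by (intro nn_integral_add) measurable
  also have "\<dots> = ennreal 4 + ennreal 4"
    by (subst nn_integral_powr_head, simp, simp, subst nn_integral_powr_tail) auto
  also have "\<dots> = ennreal 8" by (simp flip: ennreal_plus)
  finally show ?thesis .
qed

context flat_solution begin

text \<open>Half-integration of $|G|$ over $(1,x)$, the operator estimated by \<open>schur_bound\<close>.\<close>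

definition half_mass :: "real \<Rightarrow> real \<Rightarrow> ennreal" where
  "half_mass \<eta> x = (\<integral>\<^sup>+t. ennreal (indicator {1<..<x} t * (x - t) powr (-1/2) * norm (outer u (Complex t \<eta>))) \<partial>lborel)"

text \<open>By \<open>half_integral_jtrans\<close> the Poisson average of $u_R$ is a half-integral of $\mathrm{Im}\,T u_R$.
  On $(1,x)$ this differs from $\mathrm{Im}\,G$ by $O(K\eta)$, and on $t < 1$ it is $O(\eta^{1/4})$ after
  integration; the loss of a factor $2\pi$ is harmless.\<close>

lemma recovery:
  assumes \<eta>: "0 < \<eta>" "\<eta> \<le> 1" and x: "x \<ge> 2"
  shows "ennreal \<bar>corr (poisson \<eta>) (rpart u) x\<bar> \<le> half_mass \<eta> x + ennreal (10 * K * \<eta> powr (1/4) * x)"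
proof -
  define A where "A = (\<lambda>t. Im (jtrans (rpart u) (Complex t \<eta>)))"
  have [measurable]: "A \<in> borel_measurable borel" unfolding A_def
    using measurable_jtrans[OF bdd_fun_parts(1)[OF u] \<eta>(1)] by measurable
  have [measurable]: "(\<lambda>t. outer u (Complex t \<eta>)) \<in> borel_measurable borel" by (rule measurable_outer[OF \<eta>(1)])
  have K0: "K \<ge> 0" using K by simp
  have "2 * pi * corr (poisson \<eta>) (rpart u) x = (LINT s|lborel. indicator {0<..} s * (s powr (-1/2) * A (x - s)))"
    unfolding A_def by (rule half_integral_jtrans[OF bdd_fun_parts(1)[OF u] _ \<eta>(1), symmetric]) (simp add: rpart_def)
  then have "ennreal \<bar>2 * pi * corr (poisson \<eta>) (rpart u) x\<bar> = ennreal (norm (LINT s|lborel. indicator {0<..} s * (s powr (-1/2) * A (x - s))))" by simp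
  also have "\<dots> \<le> (\<integral>\<^sup>+s. ennreal (norm (indicator {0<..} s * (s powr (-1/2) * A (x - s)))) \<partial>lborel)"
  proof (cases "integrable lborel (\<lambda>s. indicator {0<..} s * (s powr (-1/2) * A (x - s)))")
    case True then show ?thesis by (rule integral_norm_bound_ennreal)
  qed (simp add: not_integrable_integral_eq)
  also have "\<dots> = (\<integral>\<^sup>+t. ennreal (norm (indicator {0<..} (x - t) * ((x - t) powr (-1/2) * A t))) \<partial>lborel)"
    by (subst nn_integral_real_affine[where c="-1" and t=x]) auto
  also have "\<dots> \<le> (\<integral>\<^sup>+t. ennreal (indicator {1<..<x} t * (x - t) powr (-1/2) * norm (outer u (Complex t \<eta>)))
      + (ennreal (K * \<eta>) * (ennreal ((x - t) powr (-1/2)) * indicator {0..x - 1} (x - t))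
      + ennreal (2 * K * \<eta> powr (1/4)) * ennreal (indicator {..<1} t * ((x - t) powr (-1/2) * (1 - t) powr (-3/4)))) \<partial>lborel)"
  proof (rule nn_integral_mono_AE, rule AE_mp[OF AE_lborel_singleton[of 1]], intro AE_I2 impI)
    fix t :: real assume t1: "t \<noteq> 1"
    let ?p = "(x - t) powr (-1/2)"
    consider "t \<ge> x" | "1 < t" "t < x" | "t < 1" using t1 by linarith
    then show "ennreal (norm (indicator {0<..} (x - t) * (?p * A t))) \<le> ennreal (indicator {1<..<x} t * ?p * norm (outer u (Complex t \<eta>)))
      + (ennreal (K * \<eta>) * (ennreal ?p * indicator {0..x - 1} (x - t))
      + ennreal (2 * K * \<eta> powr (1/4)) * ennreal (indicator {..<1} t * (?p * (1 - t) powr (-3/4))))"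
    proof cases
      case 2
      have "A t = Im (outer u (Complex t \<eta>)) - Im (\<i> * jtrans (lpart u) (Complex t \<eta>))"
        by (simp add: A_def outer_def)
      then have "\<bar>A t\<bar> \<le> norm (outer u (Complex t \<eta>)) + K * \<eta>"
        using abs_Im_le_cmod[of "outer u (Complex t \<eta>)"] abs_lpart_right[OF flat_solution_axioms 2(1) \<eta>(1)] by linarith
      then have "?p * \<bar>A t\<bar> \<le> ?p * (norm (outer u (Complex t \<eta>)) + K * \<eta>)" by (intro mult_left_mono) auto
      then have "ennreal (?p * \<bar>A t\<bar>) \<le> ennreal (?p * norm (outer u (Complex t \<eta>)) + K * \<eta> * ?p)"
        by (intro ennreal_leI) (simp add: algebra_simps)
      also have "\<dots> = ennreal (?p * norm (outer u (Complex t \<eta>))) + ennreal (K * \<eta> * ?p)"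
        using K0 \<eta> by (intro ennreal_plus) auto
      also have "ennreal (K * \<eta> * ?p) = ennreal (K * \<eta>) * ennreal ?p"
        using K0 \<eta> by (intro ennreal_mult) auto
      finally show ?thesis using 2 by (simp add: abs_mult)
    next
      case 3
      have "?p * \<bar>A t\<bar> \<le> ?p * (2 * K * \<eta> powr (1/4) * (1 - t) powr (-3/4))"
        unfolding A_def by (intro mult_left_mono abs_Im_rpart_left 3 \<eta>) auto
      then have "ennreal (?p * \<bar>A t\<bar>) \<le> ennreal ((2 * K * \<eta> powr (1/4)) * (?p * (1 - t) powr (-3/4)))"
        by (intro ennreal_leI) (simp add: mult_ac)
      also have "\<dots> = ennreal (2 * K * \<eta> powr (1/4)) * ennreal (?p * (1 - t) powr (-3/4))"
        using K0 by (intro ennreal_mult) auto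
      finally show ?thesis using 3 x by (simp add: abs_mult)
    qed simp
  qed
  also have "\<dots> = half_mass \<eta> x + (ennreal (K * \<eta>) * (\<integral>\<^sup>+t. ennreal ((x - t) powr (-1/2)) * indicator {0..x - 1} (x - t) \<partial>lborel)
      + ennreal (2 * K * \<eta> powr (1/4)) * (\<integral>\<^sup>+t. ennreal (indicator {..<1} t * ((x - t) powr (-1/2) * (1 - t) powr (-3/4))) \<partial>lborel))"
    unfolding half_mass_def by (simp add: nn_integral_add nn_integral_cmult)
  also have "(\<integral>\<^sup>+t. ennreal ((x - t) powr (-1/2)) * indicator {0..x - 1} (x - t) \<partial>lborel) = (\<integral>\<^sup>+s. ennreal (s powr (-1/2)) * indicator {0..x - 1} s \<partial>lborel)"
    by (subst (2) nn_integral_real_affine[where c="-1" and t=x]) auto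
  also have "\<dots> = ennreal ((x - 1) powr (1/2) / (1/2))"
    using x by (subst nn_integral_powr_head) auto
  also have "half_mass \<eta> x + (ennreal (K * \<eta>) * ennreal ((x - 1) powr (1/2) / (1/2))
      + ennreal (2 * K * \<eta> powr (1/4)) * (\<integral>\<^sup>+t. ennreal (indicator {..<1} t * ((x - t) powr (-1/2) * (1 - t) powr (-3/4))) \<partial>lborel))
     \<le> half_mass \<eta> x + (ennreal (K * \<eta> powr (1/4)) * ennreal (2 * x) + ennreal (2 * K * \<eta> powr (1/4)) * ennreal (4 * x))"
  proof -
    have "\<eta> powr 1 \<le> \<eta> powr (1/4)" using \<eta> by (intro powr_mono') auto
    then have 1: "K * \<eta> \<le> K * \<eta> powr (1/4)" using K0 \<eta> by (intro mult_left_mono) auto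
    have "(x - 1) powr (1/2) \<le> (x - 1) powr 1" using x by (intro powr_mono) auto
    then have 2: "(x - 1) powr (1/2) / (1/2) \<le> 2 * x" using x by simp
    have "ennreal 8 \<le> ennreal (4 * x)" using x by (intro ennreal_leI) auto
    then have 3: "(\<integral>\<^sup>+t. ennreal (indicator {..<1} t * ((x - t) powr (-1/2) * (1 - t) powr (-3/4))) \<partial>lborel) \<le> ennreal (4 * x)"
      by (rule order_trans[OF nn_integral_left_tail[OF x]])
    show ?thesis
      by (rule add_mono[OF order_refl add_mono[OF mult_mono[OF ennreal_leI[OF 1] ennreal_leI[OF 2]] mult_left_mono[OF 3]]]) auto
  qed
  also have "ennreal (K * \<eta> powr (1/4)) * ennreal (2 * x) + ennreal (2 * K * \<eta> powr (1/4)) * ennreal (4 * x) = ennreal (10 * K * \<eta> powr (1/4) * x)"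
  proof -
    have "ennreal (K * \<eta> powr (1/4)) * ennreal (2 * x) = ennreal (K * \<eta> powr (1/4) * (2 * x))"
      "ennreal (2 * K * \<eta> powr (1/4)) * ennreal (4 * x) = ennreal (2 * K * \<eta> powr (1/4) * (4 * x))"
      using K0 x by (intro ennreal_mult[symmetric]; auto)+
    then have "ennreal (K * \<eta> powr (1/4)) * ennreal (2 * x) + ennreal (2 * K * \<eta> powr (1/4)) * ennreal (4 * x)
       = ennreal (K * \<eta> powr (1/4) * (2 * x) + 2 * K * \<eta> powr (1/4) * (4 * x))"
      using K0 x by (simp only:) (rule ennreal_plus[symmetric]; auto)
    then show ?thesis by (simp add: algebra_simps)
  qed
  finally have "ennreal \<bar>2 * pi * corr (poisson \<eta>) (rpart u) x\<bar> \<le> half_mass \<eta> x + ennreal (10 * K * \<eta> powr (1/4) * x)" .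
  moreover have "\<bar>corr (poisson \<eta>) (rpart u) x\<bar> \<le> \<bar>2 * pi * corr (poisson \<eta>) (rpart u) x\<bar>"
    using pi_ge_two by (simp add: abs_mult mult_le_cancel_right1)
  ultimately show ?thesis using ennreal_leI order_trans by blast
qed

end

section \<open>The Carleman inequality\<close>

lemma nn_integral_weight_square:
  assumes "m \<ge> 2"
  shows "(\<integral>\<^sup>+x. ennreal (indicator {2..} x * (x\<^sup>2 / zh x ^ (2 * m))) \<partial>lborel) \<le> ennreal (1/2)"
proof -
  have "(\<integral>\<^sup>+x. ennreal (indicator {2..} x * (x\<^sup>2 / zh x ^ (2 * m))) \<partial>lborel) \<le> (\<integral>\<^sup>+x. ennreal (x powr - 2) * indicator {2..} x \<partial>lborel)"
  proof (intro nn_integral_mono)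
    fix x :: real
    show "ennreal (indicator {2..} x * (x\<^sup>2 / zh x ^ (2 * m))) \<le> ennreal (x powr - 2) * indicator {2..} x"
    proof (cases "x \<ge> 2")
      case True
      have "x ^ 4 \<le> x ^ (2 * m)" using True assms by (intro power_increasing) auto
      also have "\<dots> \<le> zh x ^ (2 * m)" using True zh_ge[of x] by (intro power_mono) auto
      finally have "x\<^sup>2 / zh x ^ (2 * m) \<le> x\<^sup>2 / x ^ 4" using True by (intro divide_left_mono) (auto simp: zh_pos)
      also have "\<dots> = x powr - 2" using True by (simp add: powr_minus_divide powr_numeral eval_nat_numeral divide_simps)
      finally show ?thesis using True by (simp add: ennreal_leI)
    qed simp
  qed
  also have "\<dots> = ennreal (1/2)" by (subst nn_integral_powr_tail) (auto simp: powr_minus_divide)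
  finally show ?thesis .
qed

context flat_solution begin

lemma measurable_half_mass:
  assumes "\<eta> > 0"
  shows "half_mass \<eta> \<in> borel_measurable borel"
proof -
  have [measurable]: "(\<lambda>t. outer u (Complex t \<eta>)) \<in> borel_measurable borel" by (rule measurable_outer[OF assms])
  have "half_mass \<eta> = (\<lambda>x. \<integral>\<^sup>+t. ennreal (if 1 < t \<and> t < x then (x - t) powr (-1/2) * norm (outer u (Complex t \<eta>)) else 0) \<partial>lborel)"
    unfolding half_mass_def[abs_def] by (intro ext nn_integral_cong) (auto simp: indicator_def)
  also have "\<dots> \<in> borel_measurable borel" by measurable
  finally show ?thesis .
qed

lemma recovered_energy:
  assumes \<eta>: "0 < \<eta>" "\<eta> \<le> 1" and m: "m \<ge> 2"
  shows "(\<integral>\<^sup>+x. ennreal ((corr (poisson \<eta>) (rpart u) x)\<^sup>2 * (indicator {2..} x / zh x ^ (2 * m))) \<partial>lborel)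
    \<le> ennreal (96 / real m) * mass m \<eta> + ennreal (100 * K\<^sup>2 * sqrt \<eta>)"
proof -
  have [measurable]: "(\<lambda>t. outer u (Complex t \<eta>)) \<in> borel_measurable borel" by (rule measurable_outer[OF \<eta>(1)])
  have [measurable]: "half_mass \<eta> \<in> borel_measurable borel" by (rule measurable_half_mass[OF \<eta>(1)])
  have "(\<integral>\<^sup>+x. ennreal ((corr (poisson \<eta>) (rpart u) x)\<^sup>2 * (indicator {2..} x / zh x ^ (2 * m))) \<partial>lborel)
    \<le> (\<integral>\<^sup>+x. 2 * ((half_mass \<eta> x)\<^sup>2 * ennreal (indicator {2..} x / zh x ^ (2 * m)))
        + ennreal (200 * K\<^sup>2 * sqrt \<eta>) * ennreal (indicator {2..} x * (x\<^sup>2 / zh x ^ (2 * m))) \<partial>lborel)"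
  proof (intro nn_integral_mono)
    fix x :: real
    show "ennreal ((corr (poisson \<eta>) (rpart u) x)\<^sup>2 * (indicator {2..} x / zh x ^ (2 * m)))
      \<le> 2 * ((half_mass \<eta> x)\<^sup>2 * ennreal (indicator {2..} x / zh x ^ (2 * m)))
        + ennreal (200 * K\<^sup>2 * sqrt \<eta>) * ennreal (indicator {2..} x * (x\<^sup>2 / zh x ^ (2 * m)))"
    proof (cases "x \<ge> 2")
      case True
      have z: "zh x > 0" using True by (simp add: zh_pos)
      have "(\<eta> powr (1/4))\<^sup>2 = sqrt \<eta>" using \<eta> by (simp add: power2_eq_square powr_add[symmetric] powr_half_sqrt)
      then have b: "2 * (10 * K * \<eta> powr (1/4) * x)\<^sup>2 = 200 * K\<^sup>2 * sqrt \<eta> * x\<^sup>2" by (simp add: power_mult_distrib)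
      have "ennreal ((corr (poisson \<eta>) (rpart u) x)\<^sup>2) = (ennreal \<bar>corr (poisson \<eta>) (rpart u) x\<bar>)\<^sup>2"
        by (simp add: ennreal_power)
      also have "\<dots> \<le> (half_mass \<eta> x + ennreal (10 * K * \<eta> powr (1/4) * x))\<^sup>2"
        by (intro power_mono recovery \<eta> True) auto
      also have "\<dots> \<le> 2 * (half_mass \<eta> x)\<^sup>2 + 2 * (ennreal (10 * K * \<eta> powr (1/4) * x))\<^sup>2" by (rule ennreal_add_sq_le)
      also have "2 * (ennreal (10 * K * \<eta> powr (1/4) * x))\<^sup>2 = ennreal (200 * K\<^sup>2 * sqrt \<eta> * x\<^sup>2)"
      proof -
        have "2 * (ennreal (10 * K * \<eta> powr (1/4) * x))\<^sup>2 = ennreal (2 * (10 * K * \<eta> powr (1/4) * x)\<^sup>2)"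
        proof -
          have "2 * (ennreal a)\<^sup>2 = ennreal (2 * a\<^sup>2)" if "a \<ge> 0" for a
            using that by (simp add: ennreal_power ennreal_mult)
          then show ?thesis using True K by (meson mult_nonneg_nonneg order_trans powr_ge_zero zero_le_numeral zero_le_one)
        qed
        then show ?thesis by (simp only: b)
      qed
      finally have "ennreal ((corr (poisson \<eta>) (rpart u) x)\<^sup>2) * ennreal (1 / zh x ^ (2 * m))
        \<le> (2 * (half_mass \<eta> x)\<^sup>2 + ennreal (200 * K\<^sup>2 * sqrt \<eta> * x\<^sup>2)) * ennreal (1 / zh x ^ (2 * m))" by (intro mult_right_mono) auto
      also have "\<dots> = 2 * ((half_mass \<eta> x)\<^sup>2 * ennreal (1 / zh x ^ (2 * m))) + ennreal (200 * K\<^sup>2 * sqrt \<eta> * x\<^sup>2) * ennreal (1 / zh x ^ (2 * m))"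
        by (simp only: distrib_right mult.assoc)
      also have "ennreal (200 * K\<^sup>2 * sqrt \<eta> * x\<^sup>2) * ennreal (1 / zh x ^ (2 * m)) = ennreal (200 * K\<^sup>2 * sqrt \<eta> * (x\<^sup>2 / zh x ^ (2 * m)))"
        using z \<eta> by (subst ennreal_mult[symmetric]) auto
      also have "\<dots> = ennreal (200 * K\<^sup>2 * sqrt \<eta>) * ennreal (x\<^sup>2 / zh x ^ (2 * m))"
        using z \<eta> by (intro ennreal_mult) auto
      finally show ?thesis using True z by (simp add: ennreal_mult[symmetric])
    qed simp
  qed
  also have "\<dots> = 2 * (\<integral>\<^sup>+x. (half_mass \<eta> x)\<^sup>2 * ennreal (indicator {2..} x / zh x ^ (2 * m)) \<partial>lborel)
        + ennreal (200 * K\<^sup>2 * sqrt \<eta>) * (\<integral>\<^sup>+x. ennreal (indicator {2..} x * (x\<^sup>2 / zh x ^ (2 * m))) \<partial>lborel)"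
    by (simp add: nn_integral_add nn_integral_cmult)
  also have "\<dots> \<le> 2 * (ennreal (48 / real m) * mass m \<eta>) + ennreal (200 * K\<^sup>2 * sqrt \<eta>) * ennreal (1/2)"
  proof (intro add_mono mult_left_mono)
    show "(\<integral>\<^sup>+x. (half_mass \<eta> x)\<^sup>2 * ennreal (indicator {2..} x / zh x ^ (2 * m)) \<partial>lborel) \<le> ennreal (48 / real m) * mass m \<eta>"
      unfolding half_mass_def mass_def by (rule schur_bound) (use m in auto)
    show "(\<integral>\<^sup>+x. ennreal (indicator {2..} x * (x\<^sup>2 / zh x ^ (2 * m))) \<partial>lborel) \<le> ennreal (1/2)"
      by (rule nn_integral_weight_square[OF m])
  qed auto
  also have "2 * (ennreal (48 / real m) * mass m \<eta>) = ennreal (96 / real m) * mass m \<eta>"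
  proof -
    have "2 * ennreal (48 / real m) = ennreal (96 / real m)" using ennreal_mult[of 2 "48 / real m"] by simp
    then show ?thesis by (simp only: mult.assoc[symmetric])
  qed
  also have "ennreal (200 * K\<^sup>2 * sqrt \<eta>) * ennreal (1/2) = ennreal (100 * K\<^sup>2 * sqrt \<eta>)"
    using \<eta> by (subst ennreal_mult[symmetric]) auto
  finally show ?thesis .
qed

definition energy :: "nat \<Rightarrow> ennreal" where
  "energy m = (\<integral>\<^sup>+x. ennreal (indicator {2..} x * ((u x)\<^sup>2 / zh x ^ (2 * m))) \<partial>lborel)"

end

text \<open>Combine \<open>recovered_energy\<close> with \<open>mass_bound\<close> and let $\eta = 1/(k+1)$ tend to 0. The remainders
  containing $\eta$ vanish for fixed $m$, and the Poisson averages of $u_R$ converge to $u_R$ in the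
  weighted $L^1$ space, which suffices for the square because $u$ is bounded.\<close>

lemma (in flat_solution) carleman:
  assumes m: "m \<ge> 2"
  shows "energy m \<le> ennreal (192 / real m) * (ennreal (18 * \<kappa>\<^sup>2) * (source m + flat_solution.source (\<lambda>y. f (- y)) m)
    + ennreal (2 * ((6 * \<kappa>\<^sup>2 + 192) * \<epsilon>\<^sup>2) + 16 * (4 * \<kappa> + 24)\<^sup>2 * K\<^sup>2 * \<epsilon> powr (1/4)))"
    (is "_ \<le> ennreal (192 / real m) * (?S + ennreal ?c)")
proof (rule ennreal_le_epsilon)
  fix e :: real assume e: "e > 0"
  have K0: "K > 0" using K by simp
  define \<omega> where "\<omega> = (\<lambda>x. indicator {2..} x / zh x ^ (2 * m))"
  have [measurable]: "\<omega> \<in> borel_measurable borel" unfolding \<omega>_def by measurable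
  have \<omega>0: "\<omega> x \<ge> 0" for x by (cases "x \<ge> 2") (auto simp: \<omega>_def zh_pos less_imp_le)
  have \<omega>1: "\<omega> x \<le> 1 / (1 + x\<^sup>2)" for x
  proof (cases "x \<ge> 2")
    case True
    have "1 + x\<^sup>2 \<le> x ^ 4"
    proof -
      have x2: "x\<^sup>2 \<ge> 4" using power_mono[of 2 x 2] True by simp
      then have "x\<^sup>2 * 4 \<le> x\<^sup>2 * x\<^sup>2" by (intro mult_left_mono) auto
      moreover have "x ^ 4 = x\<^sup>2 * x\<^sup>2" by (simp add: power_add[symmetric])
      ultimately show ?thesis using x2 by linarith
    qed
    also have "x ^ 4 \<le> x ^ (2 * m)" using True m by (intro power_increasing) auto
    also have "\<dots> \<le> zh x ^ (2 * m)" using True zh_ge[of x] by (intro power_mono) auto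
    finally have "1 / zh x ^ (2 * m) \<le> 1 / (1 + x\<^sup>2)" using True by (intro divide_left_mono) (auto simp: zh_pos add_pos_nonneg)
    then show ?thesis using True by (simp add: \<omega>_def)
  qed (simp add: \<omega>_def)
  note r = bdd_fun_parts(1)[OF u]
  have [measurable]: "rpart u \<in> borel_measurable borel" using bdd_funD(1)[OF r] .
  (* The coefficient of eta in mass_bound. *)
  define s where "s = 2 * ((3 * \<kappa>\<^sup>2 * real m + 6) * K\<^sup>2)"
  have s0: "s \<ge> 0" by (simp add: s_def)
  have "eventually (\<lambda>k. (\<integral>\<^sup>+x. ennreal (\<bar>corr (poisson (1 / real (Suc k))) (rpart u) x - rpart u x\<bar> * \<omega> x) \<partial>lborel) \<le> ennreal (e / (8 * K))) sequentially"
    by (rule poisson_L1_approx[OF r _ \<omega>0 \<omega>1]) (use e K0 in auto)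
  moreover have lim: "(\<lambda>k. 1 / real (Suc k)) \<longlonglongrightarrow> 0"
    using LIMSEQ_inverse_real_of_nat by (simp add: inverse_eq_divide)
  then have "eventually (\<lambda>k. 1 / real (Suc k) < \<epsilon>) sequentially" by (rule order_tendstoD) (use \<epsilon> in auto)
  moreover have "(\<lambda>k. 192 / real m * s * (1 / real (Suc k)) + 200 * K\<^sup>2 * sqrt (1 / real (Suc k))) \<longlonglongrightarrow> 192 / real m * s * 0 + 200 * K\<^sup>2 * sqrt 0"
    by (intro tendsto_intros lim)
  then have "eventually (\<lambda>k. 192 / real m * s * (1 / real (Suc k)) + 200 * K\<^sup>2 * sqrt (1 / real (Suc k)) < e / 2) sequentially"
    by (rule order_tendstoD) (use e in auto)
  ultimately have "eventually (\<lambda>k. (\<integral>\<^sup>+x. ennreal (\<bar>corr (poisson (1 / real (Suc k))) (rpart u) x - rpart u x\<bar> * \<omega> x) \<partial>lborel) \<le> ennreal (e / (8 * K))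
     \<and> 1 / real (Suc k) < \<epsilon> \<and> 192 / real m * s * (1 / real (Suc k)) + 200 * K\<^sup>2 * sqrt (1 / real (Suc k)) < e / 2) sequentially"
    by eventually_elim auto
  then obtain k where k: "(\<integral>\<^sup>+x. ennreal (\<bar>corr (poisson (1 / real (Suc k))) (rpart u) x - rpart u x\<bar> * \<omega> x) \<partial>lborel) \<le> ennreal (e / (8 * K))"
     "1 / real (Suc k) < \<epsilon>" "192 / real m * s * (1 / real (Suc k)) + 200 * K\<^sup>2 * sqrt (1 / real (Suc k)) < e / 2"
    by (auto simp: eventually_sequentially)
  define \<eta> where "\<eta> = 1 / real (Suc k)"
  have \<eta>: "0 < \<eta>" "\<eta> \<le> \<epsilon>" "\<eta> \<le> 1" using k(2) by (auto simp: \<eta>_def)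
  note k1 = k(1)[folded \<eta>_def] and k3 = k(3)[folded \<eta>_def]
  define P where "P = corr (poisson \<eta>) (rpart u)"
  have P: "bdd_fun K P" unfolding P_def by (rule bdd_fun_corr_poisson[OF r \<eta>(1)])
  have [measurable]: "P \<in> borel_measurable borel" using bdd_funD(1)[OF P] .
  have "energy m \<le> (\<integral>\<^sup>+x. 2 * ennreal ((P x)\<^sup>2 * \<omega> x) + ennreal (4 * K) * ennreal (\<bar>P x - rpart u x\<bar> * \<omega> x) \<partial>lborel)"
    unfolding energy_def
  proof (intro nn_integral_mono)
    fix x :: real
    show "ennreal (indicator {2..} x * ((u x)\<^sup>2 / zh x ^ (2 * m))) \<le> 2 * ennreal ((P x)\<^sup>2 * \<omega> x) + ennreal (4 * K) * ennreal (\<bar>P x - rpart u x\<bar> * \<omega> x)"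
    proof (cases "x \<ge> 2")
      case True
      then have ur: "u x = rpart u x" by (simp add: rpart_def)
      have "\<bar>P x - u x\<bar> \<le> 2 * K" using bdd_funD(2)[OF P, of x] bdd_funD(2)[OF u, of x] by linarith
      then have "\<bar>P x - u x\<bar> * \<bar>P x - u x\<bar> \<le> 2 * K * \<bar>P x - u x\<bar>" by (intro mult_right_mono) auto
      moreover have "(u x)\<^sup>2 \<le> 2 * (P x)\<^sup>2 + 2 * (P x - u x)\<^sup>2"
        using zero_le_power2[of "2 * P x - u x"] by (simp add: power2_eq_square algebra_simps)
      moreover have "\<bar>P x - u x\<bar> * \<bar>P x - u x\<bar> = (P x - u x)\<^sup>2" by (simp add: power2_eq_square)
      ultimately have "(u x)\<^sup>2 \<le> 2 * (P x)\<^sup>2 + 4 * K * \<bar>P x - u x\<bar>" by linarith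
      then have "(u x)\<^sup>2 * \<omega> x \<le> (2 * (P x)\<^sup>2 + 4 * K * \<bar>P x - u x\<bar>) * \<omega> x" using \<omega>0 by (rule mult_right_mono)
      then have "ennreal ((u x)\<^sup>2 * \<omega> x) \<le> ennreal 2 * ennreal ((P x)\<^sup>2 * \<omega> x) + ennreal (4 * K) * ennreal (\<bar>P x - u x\<bar> * \<omega> x)"
        using \<omega>0 K0 by (intro ennreal_le_mult_add_mult) (auto simp: distrib_right mult.assoc)
      then show ?thesis using True by (simp add: ur[symmetric] \<omega>_def)
    qed simp
  qed
  also have "\<dots> = 2 * (\<integral>\<^sup>+x. ennreal ((P x)\<^sup>2 * \<omega> x) \<partial>lborel) + ennreal (4 * K) * (\<integral>\<^sup>+x. ennreal (\<bar>P x - rpart u x\<bar> * \<omega> x) \<partial>lborel)"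
    by (simp add: nn_integral_add nn_integral_cmult)
  also have "\<dots> \<le> 2 * (ennreal (96 / real m) * (?S + ennreal (?c + s * \<eta>)) + ennreal (100 * K\<^sup>2 * sqrt \<eta>)) + ennreal (4 * K) * ennreal (e / (8 * K))"
  proof (intro add_mono mult_left_mono)
    have "(\<integral>\<^sup>+x. ennreal ((P x)\<^sup>2 * \<omega> x) \<partial>lborel) \<le> ennreal (96 / real m) * mass m \<eta> + ennreal (100 * K\<^sup>2 * sqrt \<eta>)"
      unfolding P_def \<omega>_def by (rule recovered_energy[OF \<eta>(1,3) m])
    also have "\<dots> \<le> ennreal (96 / real m) * (?S + ennreal (?c + s * \<eta>)) + ennreal (100 * K\<^sup>2 * sqrt \<eta>)"
      unfolding s_def by (intro add_mono mult_left_mono mass_bound \<eta> m) auto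
    finally show "(\<integral>\<^sup>+x. ennreal ((P x)\<^sup>2 * \<omega> x) \<partial>lborel) \<le> ennreal (96 / real m) * (?S + ennreal (?c + s * \<eta>)) + ennreal (100 * K\<^sup>2 * sqrt \<eta>)" .
    show "(\<integral>\<^sup>+x. ennreal (\<bar>P x - rpart u x\<bar> * \<omega> x) \<partial>lborel) \<le> ennreal (e / (8 * K))" unfolding P_def by (rule k1)
  qed auto
  also have "\<dots> = ennreal (192 / real m) * (?S + ennreal ?c) + ennreal (192 / real m * s * \<eta> + 200 * K\<^sup>2 * sqrt \<eta> + e / 2)"
  proof -
    have c0: "?c \<ge> 0" by (intro add_nonneg_nonneg mult_nonneg_nonneg) auto
    have 1: "ennreal (?c + s * \<eta>) = ennreal ?c + ennreal (s * \<eta>)" using c0 s0 \<eta> by (intro ennreal_plus) auto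
    have 2: "2 * ennreal (96 / real m) = ennreal (192 / real m)" using ennreal_mult[of 2 "96 / real m"] by simp
    have 3: "2 * ennreal (100 * K\<^sup>2 * sqrt \<eta>) = ennreal (200 * K\<^sup>2 * sqrt \<eta>)" using ennreal_mult[of 2 "100 * K\<^sup>2 * sqrt \<eta>"] \<eta> by (simp add: mult.assoc)
    have 4: "ennreal (192 / real m) * ennreal (s * \<eta>) = ennreal (192 / real m * s * \<eta>)" using s0 \<eta> by (subst ennreal_mult[symmetric]) (auto simp: mult_ac)
    have 5: "ennreal (4 * K) * ennreal (e / (8 * K)) = ennreal (e / 2)" using K0 e by (subst ennreal_mult[symmetric]) auto
    have "2 * (ennreal (96 / real m) * (?S + ennreal (?c + s * \<eta>)) + ennreal (100 * K\<^sup>2 * sqrt \<eta>)) + ennreal (4 * K) * ennreal (e / (8 * K))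
      = (2 * ennreal (96 / real m)) * ((?S + ennreal ?c) + ennreal (s * \<eta>)) + 2 * ennreal (100 * K\<^sup>2 * sqrt \<eta>) + ennreal (4 * K) * ennreal (e / (8 * K))"
      unfolding 1 by (simp only: distrib_left mult.assoc add.assoc)
    also have "\<dots> = ennreal (192 / real m) * (?S + ennreal ?c) + (ennreal (192 / real m * s * \<eta>) + ennreal (200 * K\<^sup>2 * sqrt \<eta>) + ennreal (e / 2))"
      unfolding 2 3 5 distrib_left[of _ _ "ennreal (s * \<eta>)"] 4 by (simp only: add.assoc)
    also have "ennreal (192 / real m * s * \<eta>) + ennreal (200 * K\<^sup>2 * sqrt \<eta>) + ennreal (e / 2) = ennreal (192 / real m * s * \<eta> + 200 * K\<^sup>2 * sqrt \<eta> + e / 2)"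
      using s0 \<eta> e by simp
    finally show ?thesis .
  qed
  also have "\<dots> \<le> ennreal (192 / real m) * (?S + ennreal ?c) + ennreal e"
    using k3 by (intro add_left_mono ennreal_leI) auto
  finally show "energy m \<le> ennreal (192 / real m) * (?S + ennreal ?c) + ennreal e" .
qed

section \<open>Absorption of the potential\<close>

lemma zh_bounds:
  assumes "x \<ge> 2"
  shows "3/2 * x \<le> zh x" "zh x \<le> 2 * x"
proof -
  have "x\<^sup>2 \<ge> 2\<^sup>2" using assms by (intro power_mono) auto
  then have "(x / 2)\<^sup>2 \<le> x\<^sup>2 - 1" by (simp add: power_divide)
  then have "x / 2 \<le> rt x" unfolding rt_def by (rule real_le_rsqrt)
  then show "3/2 * x \<le> zh x" by (simp add: zh_def)
  show "zh x \<le> 2 * x" using rt_le[of x] assms by (simp add: zh_def)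
qed

text \<open>Here $\zeta(y) \ge 3y/2$ beats the growth of $X^{2m}$, the inverse of the weight where the solution is known to
  have mass.\<close>

lemma weight_tail:
  assumes X: "X \<ge> 2" and m: "m \<ge> 2"
  shows "(\<integral>\<^sup>+y. ennreal (y / zh y ^ (2 * m)) * indicator {X..} y \<partial>lborel) \<le> ennreal ((2/3) ^ (2 * m) * (X\<^sup>2 / X ^ (2 * m)))"
proof -
  have "(\<integral>\<^sup>+y. ennreal (y / zh y ^ (2 * m)) * indicator {X..} y \<partial>lborel)
    \<le> (\<integral>\<^sup>+y. ennreal ((2/3) ^ (2 * m)) * (ennreal (y powr - (2 * real m - 1)) * indicator {X..} y) \<partial>lborel)"
  proof (intro nn_integral_mono)
    fix y :: real
    show "ennreal (y / zh y ^ (2 * m)) * indicator {X..} y \<le> ennreal ((2/3) ^ (2 * m)) * (ennreal (y powr - (2 * real m - 1)) * indicator {X..} y)"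
    proof (cases "y \<ge> X")
      case True
      then have y: "y \<ge> 2" using X by simp
      have "(3/2 * y) ^ (2 * m) \<le> zh y ^ (2 * m)" using zh_bounds[OF y] y by (intro power_mono) auto
      then have "y / zh y ^ (2 * m) \<le> y / (3/2 * y) ^ (2 * m)" using y by (intro divide_left_mono) (auto simp: zh_pos)
      also have "\<dots> = (2/3) ^ (2 * m) * (y / y ^ (2 * m))" by (simp add: power_mult_distrib power_divide)
      also have "y / y ^ (2 * m) = y powr - (2 * real m - 1)"
      proof -
        have "y powr - (2 * real m - 1) = y powr (1 - real (2 * m))" by (rule arg_cong[where f="\<lambda>p. y powr p"]) simp
        also have "\<dots> = y powr 1 / y powr real (2 * m)" by (rule powr_diff)
        also have "\<dots> = y / y ^ (2 * m)" using y by (simp only: powr_realpow powr_one_gt_zero_iff powr_one)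
        finally show ?thesis by simp
      qed
      finally have "ennreal (y / zh y ^ (2 * m)) \<le> ennreal ((2/3) ^ (2 * m) * y powr - (2 * real m - 1))" by (rule ennreal_leI)
      also have "\<dots> = ennreal ((2/3) ^ (2 * m)) * ennreal (y powr - (2 * real m - 1))" by (intro ennreal_mult) auto
      finally show ?thesis using True by simp
    qed simp
  qed
  also have "\<dots> = ennreal ((2/3) ^ (2 * m)) * ennreal (X powr (1 - (2 * real m - 1)) / (2 * real m - 1 - 1))"
    using X m by (subst nn_integral_cmult, simp, subst nn_integral_powr_tail) auto
  also have "\<dots> \<le> ennreal ((2/3) ^ (2 * m)) * ennreal (X\<^sup>2 / X ^ (2 * m))"
  proof (intro mult_left_mono ennreal_leI)
    have "X powr (1 - (2 * real m - 1)) / (2 * real m - 1 - 1) \<le> X powr (1 - (2 * real m - 1)) / 1"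
      using m X by (intro divide_left_mono) auto
    also have "\<dots> = X powr (2 - real (2 * m))" by simp
    also have "\<dots> = X powr 2 / X powr real (2 * m)" by (rule powr_diff)
    also have "X powr real (2 * m) = X ^ (2 * m)" using X by (intro powr_realpow) simp
    also have "X powr 2 = X\<^sup>2" using X by simp
    finally show "X powr (1 - (2 * real m - 1)) / (2 * real m - 1 - 1) \<le> X\<^sup>2 / X ^ (2 * m)" .
  qed auto
  also have "\<dots> = ennreal ((2/3) ^ (2 * m) * (X\<^sup>2 / X ^ (2 * m)))" using X by (intro ennreal_mult[symmetric]) auto
  finally show ?thesis .
qed

lemma (in flat_solution) energy_finite:
  assumes m: "m \<ge> 2"
  shows "energy m < \<infinity>"
proof -
  have "energy m \<le> (\<integral>\<^sup>+x. ennreal (K\<^sup>2) * ennreal (indicator {2..} x * (x\<^sup>2 / zh x ^ (2 * m))) \<partial>lborel)"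
    unfolding energy_def
  proof (intro nn_integral_mono)
    fix x :: real
    show "ennreal (indicator {2..} x * ((u x)\<^sup>2 / zh x ^ (2 * m))) \<le> ennreal (K\<^sup>2) * ennreal (indicator {2..} x * (x\<^sup>2 / zh x ^ (2 * m)))"
    proof (cases "x \<ge> 2")
      case True
      have "\<bar>u x\<bar>\<^sup>2 \<le> K\<^sup>2" using bdd_funD(2)[OF u, of x] by (intro power_mono) auto
      moreover have "1 \<le> x\<^sup>2" using True by simp
      ultimately have "(u x)\<^sup>2 * 1 \<le> K\<^sup>2 * x\<^sup>2" by (intro mult_mono) auto
      then have "(u x)\<^sup>2 / zh x ^ (2 * m) \<le> K\<^sup>2 * x\<^sup>2 / zh x ^ (2 * m)" using True by (intro divide_right_mono) (auto simp: zh_pos less_imp_le)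
      then have "ennreal ((u x)\<^sup>2 / zh x ^ (2 * m)) \<le> ennreal (K\<^sup>2 * (x\<^sup>2 / zh x ^ (2 * m)))" by (intro ennreal_leI) simp
      also have "\<dots> = ennreal (K\<^sup>2) * ennreal (x\<^sup>2 / zh x ^ (2 * m))"
        using True by (intro ennreal_mult) (auto simp: zh_pos less_imp_le)
      finally show ?thesis using True by simp
    qed simp
  qed
  also have "\<dots> = ennreal (K\<^sup>2) * (\<integral>\<^sup>+x. ennreal (indicator {2..} x * (x\<^sup>2 / zh x ^ (2 * m))) \<partial>lborel)"
    by (intro nn_integral_cmult) measurable
  also have "\<dots> \<le> ennreal (K\<^sup>2) * ennreal (1/2)" by (intro mult_left_mono nn_integral_weight_square m) auto
  also have "\<dots> < \<infinity>" by (subst ennreal_mult[symmetric]) auto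
  finally show ?thesis .
qed

text \<open>Up to $X$ the extra factor $y$ is at most $X$ and $|f| \le |u|$ leads back to the energy; beyond $X$ only the
  bound by $K$ is used.\<close>

lemma (in flat_solution) source_le:
  assumes fu: "\<And>y. \<bar>f y\<bar> \<le> \<bar>u y\<bar>" and X: "X \<ge> 2" and m: "m \<ge> 2"
  shows "source m \<le> ennreal X * energy m + ennreal (K\<^sup>2 * ((2/3) ^ (2 * m) * (X\<^sup>2 / X ^ (2 * m))))"
proof -
  have [measurable]: "u \<in> borel_measurable borel" using bdd_funD(1)[OF u] .
  have "source m \<le> (\<integral>\<^sup>+y. ennreal X * ennreal (indicator {2..} y * ((u y)\<^sup>2 / zh y ^ (2 * m))) + ennreal (K\<^sup>2) * (ennreal (y / zh y ^ (2 * m)) * indicator {X..} y) \<partial>lborel)"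
    unfolding source_def
  proof (intro nn_integral_mono)
    fix y :: real
    show "ennreal (indicator {2..} y * ((f y)\<^sup>2 * (y / zh y ^ (2 * m)))) \<le> ennreal X * ennreal (indicator {2..} y * ((u y)\<^sup>2 / zh y ^ (2 * m))) + ennreal (K\<^sup>2) * (ennreal (y / zh y ^ (2 * m)) * indicator {X..} y)"
    proof (cases "y \<ge> 2")
      case True
      have z: "zh y ^ (2 * m) > 0" using True by (simp add: zh_pos)
      have fu2: "(f y)\<^sup>2 \<le> (u y)\<^sup>2" using fu[of y] by (rule abs_le_square_iff[THEN iffD1])
      have fK: "(f y)\<^sup>2 \<le> K\<^sup>2" using power_mono[OF bdd_funD(2)[OF f, of y], of 2] by simp
      show ?thesis
      proof (cases "y \<ge> X")
        case False
        have "(f y)\<^sup>2 * (y / zh y ^ (2 * m)) \<le> (u y)\<^sup>2 * (X / zh y ^ (2 * m))"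
          using False True z fu2 by (intro mult_mono divide_right_mono) auto
        then have "ennreal ((f y)\<^sup>2 * (y / zh y ^ (2 * m))) \<le> ennreal (X * ((u y)\<^sup>2 / zh y ^ (2 * m)))"
          by (intro ennreal_leI) (simp add: mult_ac)
        also have "\<dots> = ennreal X * ennreal ((u y)\<^sup>2 / zh y ^ (2 * m))" using X z by (intro ennreal_mult) auto
        finally show ?thesis using True False by simp
      next
        case yX: True
        have "(f y)\<^sup>2 * (y / zh y ^ (2 * m)) \<le> K\<^sup>2 * (y / zh y ^ (2 * m))"
          using True z fK by (intro mult_right_mono) auto
        then have "ennreal ((f y)\<^sup>2 * (y / zh y ^ (2 * m))) \<le> ennreal (K\<^sup>2 * (y / zh y ^ (2 * m)))" by (rule ennreal_leI)
        also have "\<dots> = ennreal (K\<^sup>2) * ennreal (y / zh y ^ (2 * m))" using True z by (intro ennreal_mult) auto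
        finally have h: "ennreal ((f y)\<^sup>2 * (y / zh y ^ (2 * m))) \<le> ennreal (K\<^sup>2) * ennreal (y / zh y ^ (2 * m))" .
        show ?thesis using add_increasing[OF zero_le h, of "ennreal X * ennreal ((u y)\<^sup>2 / zh y ^ (2 * m))"] True yX by simp
      qed
    qed simp
  qed
  also have "\<dots> = ennreal X * energy m + ennreal (K\<^sup>2) * (\<integral>\<^sup>+y. ennreal (y / zh y ^ (2 * m)) * indicator {X..} y \<partial>lborel)"
    unfolding energy_def by (simp add: nn_integral_add nn_integral_cmult)
  also have "\<dots> \<le> ennreal X * energy m + ennreal (K\<^sup>2) * ennreal ((2/3) ^ (2 * m) * (X\<^sup>2 / X ^ (2 * m)))"
    by (intro add_left_mono mult_left_mono weight_tail X m) auto
  also have "ennreal (K\<^sup>2) * ennreal ((2/3) ^ (2 * m) * (X\<^sup>2 / X ^ (2 * m))) = ennreal (K\<^sup>2 * ((2/3) ^ (2 * m) * (X\<^sup>2 / X ^ (2 * m))))"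
    using X by (intro ennreal_mult[symmetric]) auto
  finally show ?thesis .
qed

text \<open>Collects the constants in front of $K^2\epsilon^{1/4}$ in \<open>carleman\<close>.\<close>

definition flat_const :: "real \<Rightarrow> real" where
  "flat_const \<kappa> = 12 * \<kappa>\<^sup>2 + 384 + 16 * (4 * \<kappa> + 24)\<^sup>2"

text \<open>Add the Carleman inequalities of $u$ and of its reflection, since the sources of both sides enter in
  each. For $m \ge 13824\,\kappa^2 X$ the energy on the right has a factor at most $1/2$ and is absorbed,
  which is legitimate because it is finite.\<close>

lemma (in flat_solution) energy_le:
  assumes fu: "\<And>y. \<bar>f y\<bar> \<le> \<bar>u y\<bar>" and X: "X \<ge> 2" and m: "m \<ge> 2" "real m \<ge> 13824 * \<kappa>\<^sup>2 * X"
  shows "energy m \<le> ennreal (K\<^sup>2 * (2 * ((2/3) ^ (2 * m) * (X\<^sup>2 / X ^ (2 * m))) + 384 * (flat_const \<kappa> * \<epsilon> powr (1/4))))"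
proof -
  interpret r: flat_solution K \<epsilon> \<kappa> "\<lambda>y. u (- y)" "\<lambda>y. f (- y)" by (rule reflected)
  define c where "c = 2 * ((6 * \<kappa>\<^sup>2 + 192) * \<epsilon>\<^sup>2) + 16 * (4 * \<kappa> + 24)\<^sup>2 * K\<^sup>2 * \<epsilon> powr (1/4)"
  define T where "T = K\<^sup>2 * ((2/3) ^ (2 * m) * (X\<^sup>2 / X ^ (2 * m)))"
  define a where "a = enn2real (energy m)"
  define b where "b = enn2real (r.energy m)"
  have c0: "c \<ge> 0" and T0: "T \<ge> 0" and ab0: "a \<ge> 0" "b \<ge> 0" using X by (auto simp: c_def T_def a_def b_def)
  have a: "energy m = ennreal a" and b: "r.energy m = ennreal b"
    using energy_finite[OF m(1)] r.energy_finite[OF m(1)] by (auto simp: a_def b_def)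
  define S where "S = X * (a + b) + 2 * T"
  have S0: "S \<ge> 0" using X ab0 T0 by (simp add: S_def)
  have "source m + r.source m \<le> (ennreal X * ennreal a + ennreal T) + (ennreal X * ennreal b + ennreal T)"
    unfolding a[symmetric] b[symmetric] T_def by (intro add_mono source_le r.source_le fu X m)
  also have "\<dots> = ennreal S"
    using X ab0 T0 by (simp add: S_def ennreal_mult[symmetric] ennreal_plus[symmetric] algebra_simps del: ennreal_plus)
  finally have src: "source m + r.source m \<le> ennreal S" .
  have fin: "ennreal (192 / real m) * (ennreal (18 * \<kappa>\<^sup>2) * (source m + r.source m) + ennreal c) \<le> ennreal (192 / real m * (18 * \<kappa>\<^sup>2 * S + c))"
  proof -
    have "ennreal (192 / real m) * (ennreal (18 * \<kappa>\<^sup>2) * (source m + r.source m) + ennreal c)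
       \<le> ennreal (192 / real m) * (ennreal (18 * \<kappa>\<^sup>2) * ennreal S + ennreal c)"
      by (intro mult_left_mono add_right_mono src) auto
    also have "\<dots> = ennreal (192 / real m * (18 * \<kappa>\<^sup>2 * S + c))"
    proof -
      have "ennreal (18 * \<kappa>\<^sup>2) * ennreal S = ennreal (18 * \<kappa>\<^sup>2 * S)" using S0 by (intro ennreal_mult[symmetric]) auto
      moreover have "ennreal (18 * \<kappa>\<^sup>2 * S) + ennreal c = ennreal (18 * \<kappa>\<^sup>2 * S + c)" using S0 c0 by (intro ennreal_plus[symmetric]) auto
      moreover have "ennreal (192 / real m) * ennreal (18 * \<kappa>\<^sup>2 * S + c) = ennreal (192 / real m * (18 * \<kappa>\<^sup>2 * S + c))"
        using S0 c0 by (intro ennreal_mult[symmetric]) auto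
      ultimately show ?thesis by (simp only:)
    qed
    finally show ?thesis .
  qed
  have rhs0: "192 / real m * (18 * \<kappa>\<^sup>2 * S + c) \<ge> 0" using S0 c0 by (intro mult_nonneg_nonneg add_nonneg_nonneg) auto
  have "ennreal a \<le> ennreal (192 / real m * (18 * \<kappa>\<^sup>2 * S + c))"
    unfolding a[symmetric] using carleman[OF m(1)] fin unfolding c_def by (rule order_trans)
  then have a_le: "a \<le> 192 / real m * (18 * \<kappa>\<^sup>2 * S + c)" using rhs0 by simp
  have "r.energy m \<le> ennreal (192 / real m) * (ennreal (18 * \<kappa>\<^sup>2) * (source m + r.source m) + ennreal c)"
    using r.carleman[OF m(1)] by (simp add: c_def add.commute)
  then have "ennreal b \<le> ennreal (192 / real m * (18 * \<kappa>\<^sup>2 * S + c))"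
    unfolding b[symmetric] using fin by (rule order_trans)
  then have b_le: "b \<le> 192 / real m * (18 * \<kappa>\<^sup>2 * S + c)" using rhs0 by simp
  have m0: "real m > 0" using m by simp
  have "a + b \<le> 2 * (192 / real m * (18 * \<kappa>\<^sup>2 * S + c))" using add_mono[OF a_le b_le] by (simp only: mult_2)
  also have "\<dots> = 384 / real m * (18 * \<kappa>\<^sup>2 * S + c)" by simp
  also have "\<dots> = (6912 * \<kappa>\<^sup>2 * S + 384 * c) / real m" by (simp add: algebra_simps add_divide_distrib)
  also have "6912 * \<kappa>\<^sup>2 * S + 384 * c \<le> ((a + b) / 2 + T + 192 * c) * real m"
  proof -
    have 1: "6912 * \<kappa>\<^sup>2 * X * (a + b) \<le> real m / 2 * (a + b)" using m ab0 by (intro mult_right_mono) auto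
    have "13824 * \<kappa>\<^sup>2 * 1 \<le> 13824 * \<kappa>\<^sup>2 * X" using X by (intro mult_left_mono) auto
    then have 2: "13824 * \<kappa>\<^sup>2 * T \<le> real m * T" using m T0 by (intro mult_right_mono) auto
    have "2 * c \<le> real m * c" using m c0 by (intro mult_right_mono) auto
    then have 3: "384 * c \<le> 192 * c * real m" by (simp add: mult.commute)
    have "6912 * \<kappa>\<^sup>2 * S + 384 * c = 6912 * \<kappa>\<^sup>2 * X * (a + b) + 13824 * \<kappa>\<^sup>2 * T + 384 * c"
      by (simp add: S_def algebra_simps)
    also have "\<dots> \<le> real m / 2 * (a + b) + real m * T + 192 * c * real m" using 1 2 3 by linarith
    finally show ?thesis by (simp add: algebra_simps)
  qed
  then have "(6912 * \<kappa>\<^sup>2 * S + 384 * c) / real m \<le> (a + b) / 2 + T + 192 * c"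
    using m0 by (simp add: divide_le_eq)
  finally have "a + b \<le> (a + b) / 2 + T + 192 * c" .
  then have "a + b \<le> 2 * T + 384 * c"
  proof -
    have "s \<le> 2 * t + 384 * d" if "s \<le> s / 2 + t + 192 * d" for s t d :: real using that by (simp add: field_simps)
    from this[OF \<open>a + b \<le> (a + b) / 2 + T + 192 * c\<close>] show ?thesis .
  qed
  then have "a \<le> 2 * T + 384 * c" using ab0 by simp
  also have "c \<le> K\<^sup>2 * (flat_const \<kappa> * \<epsilon> powr (1/4))"
  proof -
    have "\<epsilon>\<^sup>2 = \<epsilon> powr 2" using \<epsilon> by simp
    also have "\<dots> \<le> \<epsilon> powr (1/4)" using \<epsilon> by (intro powr_mono') auto
    also have "\<dots> \<le> K\<^sup>2 * \<epsilon> powr (1/4)" using K by (simp add: mult_le_cancel_right1)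
    finally have "(12 * \<kappa>\<^sup>2 + 384) * \<epsilon>\<^sup>2 \<le> (12 * \<kappa>\<^sup>2 + 384) * (K\<^sup>2 * \<epsilon> powr (1/4))" by (intro mult_left_mono) auto
    then show ?thesis unfolding c_def flat_const_def by (simp add: algebra_simps)
  qed
  finally have "a \<le> K\<^sup>2 * (2 * ((2/3) ^ (2 * m) * (X\<^sup>2 / X ^ (2 * m))) + 384 * (flat_const \<kappa> * \<epsilon> powr (1/4)))"
    by (simp add: T_def algebra_simps)
  then show ?thesis unfolding a by (rule ennreal_leI)
qed

text \<open>On $(\rho-4,\rho)$ the weight is at least $(2\rho)^{-2m}$, so the unit mass there gives a lower bound for the
  energy; multiply the upper bound \<open>energy_le\<close> by $(2\rho)^{2m}$.\<close>

lemma (in flat_solution) quantitative_nonvanishing: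
  assumes fu: "\<And>y. \<bar>f y\<bar> \<le> \<bar>u y\<bar>" and \<rho>: "\<rho> \<ge> 6" and m: "m \<ge> 2" "real m \<ge> 13824 * \<kappa>\<^sup>2 * (2 * \<rho>)"
    and big: "1 \<le> (\<integral>\<^sup>+y. ennreal ((u y)\<^sup>2) * indicator {\<rho> - 4<..<\<rho>} y \<partial>lborel)"
  shows "1 \<le> K\<^sup>2 * (2 * (2 * \<rho>)\<^sup>2 * (2/3) ^ (2 * m) + 384 * flat_const \<kappa> * \<epsilon> powr (1/4) * (2 * \<rho>) ^ (2 * m))"
proof -
  have [measurable]: "u \<in> borel_measurable borel" using bdd_funD(1)[OF u] .
  define X where "X = 2 * \<rho>"
  have X: "X \<ge> 2" using \<rho> by (simp add: X_def)
  have Xm: "X ^ (2 * m) > 0" using X by simp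
  define B where "B = K\<^sup>2 * (2 * ((2/3) ^ (2 * m) * (X\<^sup>2 / X ^ (2 * m))) + 384 * (flat_const \<kappa> * \<epsilon> powr (1/4)))"
  have "ennreal (1 / X ^ (2 * m)) * 1 \<le> ennreal (1 / X ^ (2 * m)) * (\<integral>\<^sup>+y. ennreal ((u y)\<^sup>2) * indicator {\<rho> - 4<..<\<rho>} y \<partial>lborel)"
    by (intro mult_left_mono big) auto
  also have "\<dots> = (\<integral>\<^sup>+y. ennreal (1 / X ^ (2 * m)) * (ennreal ((u y)\<^sup>2) * indicator {\<rho> - 4<..<\<rho>} y) \<partial>lborel)"
    by (intro nn_integral_cmult[symmetric]) measurable
  also have "\<dots> \<le> energy m"
    unfolding energy_def
  proof (intro nn_integral_mono)
    fix y :: real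
    show "ennreal (1 / X ^ (2 * m)) * (ennreal ((u y)\<^sup>2) * indicator {\<rho> - 4<..<\<rho>} y) \<le> ennreal (indicator {2..} y * ((u y)\<^sup>2 / zh y ^ (2 * m)))"
    proof (cases "y \<in> {\<rho> - 4<..<\<rho>}")
      case True
      then have y: "y \<ge> 2" "y \<le> \<rho>" using \<rho> by auto
      have "zh y \<le> X" using zh_bounds(2)[OF y(1)] y by (simp add: X_def)
      then have "zh y ^ (2 * m) \<le> X ^ (2 * m)" using y by (intro power_mono) (auto simp: zh_pos less_imp_le)
      then have "(u y)\<^sup>2 / X ^ (2 * m) \<le> (u y)\<^sup>2 / zh y ^ (2 * m)" using y Xm by (intro divide_left_mono) (auto simp: zh_pos)
      then have 1: "ennreal (1 / X ^ (2 * m) * (u y)\<^sup>2) \<le> ennreal ((u y)\<^sup>2 / zh y ^ (2 * m))" by (intro ennreal_leI) simp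
      have 2: "ennreal (1 / X ^ (2 * m) * (u y)\<^sup>2) = ennreal (1 / X ^ (2 * m)) * ennreal ((u y)\<^sup>2)"
        using Xm by (intro ennreal_mult) auto
      show ?thesis using 1[unfolded 2] True y by simp
    qed simp
  qed
  also have "\<dots> \<le> ennreal B"
    unfolding B_def by (rule energy_le[OF fu X m(1)]) (use m in \<open>simp add: X_def\<close>)
  finally have "ennreal (1 / X ^ (2 * m)) \<le> ennreal B" by simp
  moreover have "B \<ge> 0" using X by (auto simp: B_def flat_const_def intro!: mult_nonneg_nonneg add_nonneg_nonneg)
  ultimately have "1 / X ^ (2 * m) \<le> B" by simp
  then have "1 \<le> B * X ^ (2 * m)" using Xm by (simp add: divide_le_eq)
  also have "B * X ^ (2 * m) = K\<^sup>2 * (2 * X\<^sup>2 * (2/3) ^ (2 * m) + 384 * flat_const \<kappa> * \<epsilon> powr (1/4) * X ^ (2 * m))"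
    using Xm unfolding B_def by (simp add: field_simps)
  finally show ?thesis by (simp only: X_def)
qed

text \<open>With $X = 4R + 4$ take $m$ to be the integer above $cX$. The first term on the right is at most
  $2K^2X^2(4/9)^X$, which is below $1/2$ for large $R$; the second one must then exceed $1/2$, so
  $\epsilon \ge X^{-O(X)}$.\<close>

lemma exponential_lower_bound:
  fixes K \<kappa> :: real
  assumes K: "K \<ge> 1" and \<kappa>: "\<kappa> > 0"
  obtains C R\<^sub>0 where "C > 0" "R\<^sub>0 \<ge> 2"
    "\<And>R \<epsilon>. R \<ge> R\<^sub>0 \<Longrightarrow> \<epsilon> > 0 \<Longrightarrow>
      (\<And>m. m \<ge> 2 \<Longrightarrow> real m \<ge> 13824 * \<kappa>\<^sup>2 * (2 * (2 * R + 2)) \<Longrightarrow>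
        1 \<le> K\<^sup>2 * (2 * (2 * (2 * R + 2))\<^sup>2 * (2/3) ^ (2 * m) + 384 * flat_const \<kappa> * \<epsilon> powr (1/4) * (2 * (2 * R + 2)) ^ (2 * m)))
      \<Longrightarrow> exp (- C * R * ln R) \<le> \<epsilon>"
proof -
  define c where "c = 13824 * \<kappa>\<^sup>2 + 1"
  have c: "c \<ge> 1" by (simp add: c_def)
  define B where "B = 768 * K\<^sup>2 * flat_const \<kappa>"
  have fc: "flat_const \<kappa> \<ge> 0" by (simp add: flat_const_def)
  have B: "B \<ge> 0" using fc by (simp add: B_def)
  have "((\<lambda>R::real. (2 * (2 * R + 2))\<^sup>2 * (4/9) powr (2 * (2 * R + 2))) \<longlongrightarrow> 0) at_top" by real_asymp
  then have "eventually (\<lambda>R::real. (2 * (2 * R + 2))\<^sup>2 * (4/9) powr (2 * (2 * R + 2)) < 1 / (4 * K\<^sup>2)) at_top"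
    by (rule order_tendstoD) (use K in auto)
  moreover have "eventually (\<lambda>R::real. R \<ge> max 2 B) at_top" by (rule eventually_ge_at_top)
  ultimately have "eventually (\<lambda>R::real. (2 * (2 * R + 2))\<^sup>2 * (4/9) powr (2 * (2 * R + 2)) < 1 / (4 * K\<^sup>2) \<and> R \<ge> max 2 B) at_top"
    by eventually_elim auto
  then obtain R\<^sub>0 where R0: "\<And>R. R \<ge> R\<^sub>0 \<Longrightarrow> (2 * (2 * R + 2))\<^sup>2 * (4/9) powr (2 * (2 * R + 2)) < 1 / (4 * K\<^sup>2) \<and> R \<ge> max 2 B"
    unfolding eventually_at_top_linorder by blast
  have R02: "R\<^sub>0 \<ge> 2" using R0[of R\<^sub>0] by simp
  define C where "C = 32 * (8 * c + 12)"
  have C: "C > 0" using c by (simp add: C_def)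
  show thesis
  proof (rule that[OF C R02])
    fix R \<epsilon> :: real
    assume R: "R \<ge> R\<^sub>0" and \<epsilon>: "\<epsilon> > 0"
    assume main: "\<And>m. m \<ge> 2 \<Longrightarrow> real m \<ge> 13824 * \<kappa>\<^sup>2 * (2 * (2 * R + 2)) \<Longrightarrow>
        1 \<le> K\<^sup>2 * (2 * (2 * (2 * R + 2))\<^sup>2 * (2/3) ^ (2 * m) + 384 * flat_const \<kappa> * \<epsilon> powr (1/4) * (2 * (2 * R + 2)) ^ (2 * m))"
    define X where "X = 2 * (2 * R + 2)"
    have Rb: "R \<ge> 2" "R \<ge> B" and dec: "X\<^sup>2 * (4/9) powr X < 1 / (4 * K\<^sup>2)" using R0[OF R] by (auto simp: X_def)
    have X: "X \<ge> 2" "X \<ge> B" "X \<le> 8 * R" "X > 1" using Rb by (auto simp: X_def)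
    define m where "m = nat \<lceil>c * X\<rceil>"
    have cX: "X \<le> c * X" using c X by simp
    have mr: "c * X \<le> real m" "real m \<le> c * X + 1" using cX X unfolding m_def by linarith+
    have m2: "m \<ge> 2" using mr cX X by linarith
    have "13824 * \<kappa>\<^sup>2 * X \<le> c * X" using X by (intro mult_right_mono) (auto simp: c_def)
    then have mge: "13824 * \<kappa>\<^sup>2 * X \<le> real m" using mr by linarith
    have "(2/3 :: real) ^ (2 * m) = (4/9) ^ m" by (simp add: power_mult power_divide)
    also have "\<dots> = (4/9) powr real m" by (simp add: powr_realpow)
    also have "\<dots> \<le> (4/9) powr X" using mr cX by (intro powr_mono') auto
    finally have "X\<^sup>2 * (2/3) ^ (2 * m) \<le> X\<^sup>2 * (4/9) powr X" by (intro mult_left_mono) auto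
    then have "X\<^sup>2 * (2/3) ^ (2 * m) \<le> 1 / (4 * K\<^sup>2)" using dec by linarith
    then have "K\<^sup>2 * (2 * X\<^sup>2 * (2/3) ^ (2 * m)) \<le> 1 / 2" using K by (simp add: field_simps)
    moreover have "1 \<le> K\<^sup>2 * (2 * X\<^sup>2 * (2/3) ^ (2 * m) + 384 * flat_const \<kappa> * \<epsilon> powr (1/4) * X ^ (2 * m))"
      using main[OF m2] mge unfolding X_def by simp
    ultimately have "1/2 \<le> K\<^sup>2 * (384 * flat_const \<kappa> * \<epsilon> powr (1/4) * X ^ (2 * m))" unfolding distrib_left by linarith
    then have "1 \<le> B * (\<epsilon> powr (1/4) * X ^ (2 * m))" by (simp add: B_def mult_ac)
    (* For large R the constant B is at most X and costs only one more power of X. *)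
    also have "\<dots> \<le> X * (\<epsilon> powr (1/4) * X ^ (2 * m))" using X by (intro mult_right_mono) auto
    also have "\<dots> = \<epsilon> powr (1/4) * X ^ (2 * m + 1)" by (simp add: mult_ac)
    finally have "1 ^ 4 \<le> (\<epsilon> powr (1/4) * X ^ (2 * m + 1)) ^ 4" by (intro power_mono) auto
    also have "\<dots> = \<epsilon> * X ^ (8 * m + 4)"
    proof -
      have "(\<epsilon> powr (1/4)) ^ 4 = \<epsilon> powr (1/4) * \<epsilon> powr (1/4) * \<epsilon> powr (1/4) * \<epsilon> powr (1/4)"
        by (simp only: power4_eq_xxxx)
      also have "\<dots> = \<epsilon>" using \<epsilon> by (simp add: powr_add[symmetric])
      finally have "(\<epsilon> powr (1/4)) ^ 4 = \<epsilon>" .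
      moreover have "(X ^ (2 * m + 1)) ^ 4 = X ^ (8 * m + 4)" by (subst power_mult[symmetric]) (rule arg_cong[where f="\<lambda>n. X ^ n"], simp)
      ultimately show ?thesis by (simp only: power_mult_distrib)
    qed
    finally have e1: "1 \<le> \<epsilon> * X ^ (8 * m + 4)" by simp
    have Xp: "X ^ (8 * m + 4) = exp (real (8 * m + 4) * ln X)"
      using exp_of_nat_mult[of "8 * m + 4" "ln X"] X(4) by (simp only: exp_ln)
    have lnX: "ln X \<le> 4 * ln R" "ln X \<ge> 0"
    proof -
      have "8 * R \<le> R ^ 3 * R" using power_mono[of 2 R 3] Rb by (intro mult_right_mono) auto
      moreover have "R ^ 3 * R = R ^ 4" by (simp add: power_numeral_reduce)
      ultimately have "X \<le> R ^ 4" using X by linarith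
      then have "ln X \<le> ln (R ^ 4)" using X by simp
      then show "ln X \<le> 4 * ln R" using Rb by (simp add: ln_realpow)
      show "ln X \<ge> 0" using X by simp
    qed
    have "real (8 * m + 4) \<le> (8 * c + 12) * X"
    proof -
      have "real (8 * m + 4) \<le> 8 * (c * X) + 12" using mr by simp
      also have "\<dots> \<le> 8 * (c * X) + 12 * X" using X by simp
      finally show ?thesis by (simp add: distrib_right mult.assoc)
    qed
    also have "\<dots> \<le> (8 * c + 12) * (8 * R)" using X c by (intro mult_left_mono) auto
    finally have "real (8 * m + 4) * ln X \<le> (8 * c + 12) * (8 * R) * (4 * ln R)"
      using lnX Rb c by (intro mult_mono) auto
    also have "\<dots> = C * R * ln R" by (simp add: C_def mult_ac)
    finally have "X ^ (8 * m + 4) \<le> exp (C * R * ln R)" unfolding Xp by simp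
    then have "\<epsilon> * X ^ (8 * m + 4) \<le> \<epsilon> * exp (C * R * ln R)" using \<epsilon> by (intro mult_left_mono) auto
    then have "1 \<le> \<epsilon> * exp (C * R * ln R)" using e1 by linarith
    then have "1 / exp (C * R * ln R) \<le> \<epsilon>" by (simp add: divide_le_eq)
    then show "exp (- C * R * ln R) \<le> \<epsilon>" by (simp add: exp_minus inverse_eq_divide)
  qed
qed

section \<open>From the weak equation to the flat solution\<close>

lemma jker_scale: "jker (complex_of_real 2 * w) = complex_of_real (1 / (2 * sqrt 2)) * jker w"
proof -
  have "csqrt (complex_of_real 2 * w) = complex_of_real (sqrt 2) * csqrt w" by (rule csqrt_of_real_mult) simp
  then have "jker (complex_of_real 2 * w) = 1 / ((complex_of_real 2 * w) * (complex_of_real (sqrt 2) * csqrt w))" by (simp only: jker_def)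
  also have "\<dots> = complex_of_real (1 / (2 * sqrt 2)) * (1 / (w * csqrt w))"
    by (simp only: of_real_divide of_real_mult of_real_1 times_divide_times_eq mult_1_left mult_1_right mult_ac)
  finally show ?thesis by (simp only: jker_def)
qed

text \<open>The kernel has degree $-3/2$ and the measure degree 1, so the dilation by 2 yields $2^{-1/2}$. This is
  the factor by which the source is divided in \<open>flat_solution_rescale\<close>.\<close>

lemma jtrans_rescale:
  "jtrans (\<lambda>y. u (x0 + y / 2)) (Complex x \<eta>) = complex_of_real (1 / sqrt 2) * jtrans u (Complex (x0 + x / 2) (\<eta> / 2))"
proof -
  have e: "x0 + (- 2 * x0 + 2 * t) / 2 = t" "- 2 * x0 + 2 * t - x = 2 * t - 2 * x0 - x" for t by (simp_all add: field_simps)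
  have w: "Complex (2 * t - 2 * x0 - x) (- \<eta>) = complex_of_real 2 * Complex (t - (x0 + x / 2)) (- (\<eta> / 2))" for t
    by (simp add: complex_eq_iff)
  have "jtrans (\<lambda>y. u (x0 + y / 2)) (Complex x \<eta>) = 2 *\<^sub>R (LINT t|lborel. u t *\<^sub>R jker (Complex (2 * t - 2 * x0 - x) (- \<eta>)))"
    unfolding jtrans_Complex
    by (subst lborel_integral_real_affine[where c=2 and t="- 2 * x0"], simp, simp only: e abs_numeral)
  also have "\<dots> = 2 *\<^sub>R (LINT t|lborel. complex_of_real (1 / (2 * sqrt 2)) * (u t *\<^sub>R jker (Complex (t - (x0 + x / 2)) (- (\<eta> / 2)))))"
    unfolding w jker_scale by (simp only: mult_scaleR_right)
  also have "\<dots> = 2 *\<^sub>R (complex_of_real (1 / (2 * sqrt 2)) * (LINT t|lborel. u t *\<^sub>R jker (Complex (t - (x0 + x / 2)) (- (\<eta> / 2)))))"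
    by (simp only: integral_mult_right_zero)
  finally show ?thesis unfolding jtrans_Complex by (simp add: scaleR_conv_of_real)
qed

lemma corr_poisson_rescale:
  "corr (poisson \<eta>) (\<lambda>y. f (x0 + y / 2)) x = corr (poisson (\<eta> / 2)) f (x0 + x / 2)"
proof -
  have e: "x0 + (- 2 * x0 + 2 * t) / 2 = t" "- 2 * x0 + 2 * t - x = 2 * t - 2 * x0 - x" for t by (simp_all add: field_simps)
  have p: "2 * poisson \<eta> (2 * t - 2 * x0 - x) = poisson (\<eta> / 2) (t - (x0 + x / 2))" for t
  proof -
    have "(2 * t - 2 * x0 - x)\<^sup>2 + \<eta>\<^sup>2 = 4 * ((t - (x0 + x / 2))\<^sup>2 + (\<eta> / 2)\<^sup>2)" by (simp add: power2_eq_square algebra_simps)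
    moreover have "2 * (\<eta> / (pi * (4 * q))) = (\<eta> / 2) / (pi * q)" for q by simp
    ultimately show ?thesis unfolding poisson_def by (simp only:)
  qed
  have "corr (poisson \<eta>) (\<lambda>y. f (x0 + y / 2)) x = 2 * (LINT t|lborel. f t * poisson \<eta> (2 * t - 2 * x0 - x))"
    unfolding corr_def by (subst lborel_integral_real_affine[where c=2 and t="- 2 * x0"], simp, simp only: e abs_numeral real_scaleR_def)
  also have "\<dots> = (LINT t|lborel. 2 * (f t * poisson \<eta> (2 * t - 2 * x0 - x)))" by (rule integral_mult_right_zero[symmetric])
  also have "\<dots> = corr (poisson (\<eta> / 2)) f (x0 + x / 2)" unfolding corr_def p[symmetric] by (simp add: mult_ac)
  finally show ?thesis .
qed

lemma abs_divide_sqrt2_le: "\<bar>a / sqrt 2\<bar> \<le> \<bar>a :: real\<bar>"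
proof -
  have "\<bar>a\<bar> / sqrt 2 \<le> \<bar>a\<bar> / 1" by (rule divide_left_mono) auto
  then show ?thesis by simp
qed

text \<open>The dilation by 2 turns the neighbourhood of radius 1 on which $u$ is small into $(-2,2)$, as
  \<open>flat_solution\<close> requires.\<close>

lemma flat_solution_rescale:
  assumes u: "bdd_fun K u" and f: "bdd_fun K f" and fu: "\<And>y. \<bar>f y\<bar> \<le> \<bar>u y\<bar>"
    and small: "\<And>y. \<bar>y - x0\<bar> < 1 \<Longrightarrow> \<bar>u y\<bar> \<le> \<epsilon>"
    and \<epsilon>: "0 < \<epsilon>" "\<epsilon> \<le> 1" and K: "1 \<le> K"
    and weak: "\<And>a \<sigma>. \<sigma> > 0 \<Longrightarrow> (LINT y|lborel. u y * frac_lap (normal_density a \<sigma>) y) = frac_const * (LINT y|lborel. f y * normal_density a \<sigma> y)"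
  shows "flat_solution K \<epsilon> frac_const (\<lambda>y. u (x0 + y / 2)) (\<lambda>y. f (x0 + y / 2) / sqrt 2)"
proof
  have [measurable]: "u \<in> borel_measurable borel" "f \<in> borel_measurable borel" using bdd_funD(1)[OF u] bdd_funD(1)[OF f] by auto
  note s2 = abs_divide_sqrt2_le
  show "bdd_fun K (\<lambda>y. u (x0 + y / 2))" unfolding bdd_fun_def using bdd_funD(2)[OF u] by auto
  show "bdd_fun K (\<lambda>y. f (x0 + y / 2) / sqrt 2)" unfolding bdd_fun_def using order_trans[OF s2 bdd_funD(2)[OF f]] by auto
  show "\<bar>u (x0 + y / 2)\<bar> \<le> \<epsilon>" if "\<bar>y\<bar> < 2" for y using that by (intro small) auto
  then show "\<bar>f (x0 + y / 2) / sqrt 2\<bar> \<le> \<epsilon>" if "\<bar>y\<bar> < 2" for y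
    using order_trans[OF s2 order_trans[OF fu]] that by blast
  fix x \<eta> :: real assume \<eta>: "\<eta> > 0"
  define x' where "x' = x0 + x / 2"
  have \<eta>2: "\<eta> / 2 > 0" using \<eta> by simp
  have i: "integrable lborel (\<lambda>y. u y * Re (jker (Complex (y - x') (- (\<eta> / 2)))))" "integrable lborel (\<lambda>y. u y * Im (jker (Complex (y - x') (- (\<eta> / 2)))))"
    using integrable_Re[OF jtrans_integrable[OF u \<eta>2, of x']] integrable_Im[OF jtrans_integrable[OF u \<eta>2, of x']] by auto
  have "Re (jtrans u (Complex x' (\<eta> / 2))) - Im (jtrans u (Complex x' (\<eta> / 2))) =
    (LINT y|lborel. u y * (Re (jker (Complex (y - x') (- (\<eta> / 2)))) - Im (jker (Complex (y - x') (- (\<eta> / 2))))))"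
    unfolding Im_jtrans[OF u \<eta>2] right_diff_distrib by (rule Bochner_Integration.integral_diff[OF i, symmetric])
  also have "\<dots> = - frac_const * corr (poisson (\<eta> / 2)) f x'"
    by (rule poisson_identity[OF _ _ bdd_funD(2)[OF u] bdd_funD(2)[OF f] weak \<eta>2]) auto
  finally have eq: "Re (jtrans u (Complex x' (\<eta> / 2))) - Im (jtrans u (Complex x' (\<eta> / 2))) = - frac_const * corr (poisson (\<eta> / 2)) f x'" .
  have "corr (poisson \<eta>) (\<lambda>y. f (x0 + y / 2) / sqrt 2) x = (1 / sqrt 2) * corr (poisson \<eta>) (\<lambda>y. f (x0 + y / 2)) x"
    unfolding corr_def integral_mult_right_zero[symmetric] by (simp add: mult_ac)
  also have "\<dots> = (1 / sqrt 2) * corr (poisson (\<eta> / 2)) f x'" unfolding corr_poisson_rescale x'_def ..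
  finally have c: "corr (poisson \<eta>) (\<lambda>y. f (x0 + y / 2) / sqrt 2) x = (1 / sqrt 2) * corr (poisson (\<eta> / 2)) f x'" .
  have "Re (complex_of_real (1 / sqrt 2) * z) - Im (complex_of_real (1 / sqrt 2) * z) = (1 / sqrt 2) * (Re z - Im z)" for z
    by (simp add: diff_divide_distrib)
  then show "Re (jtrans (\<lambda>y. u (x0 + y / 2)) (Complex x \<eta>)) - Im (jtrans (\<lambda>y. u (x0 + y / 2)) (Complex x \<eta>))
    = - frac_const * corr (poisson \<eta>) (\<lambda>y. f (x0 + y / 2) / sqrt 2) x"
    unfolding jtrans_rescale c x'_def[symmetric] by (simp only: eq) simp
qed (use \<epsilon> K frac_const_pos in auto)

text \<open>After the rescaling the original interval $(-1,1)$ is $(\rho-4,\rho)$ or its mirror image with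
  $\rho = 2R+2$, according to the sign of $x_0$; in the second case the reflected solution is used. The
  dilation doubles the mass.\<close>

lemma local_lower_bound:
  assumes u: "bdd_fun K u" and f: "bdd_fun K f" and fu: "\<And>y. \<bar>f y\<bar> \<le> \<bar>u y\<bar>"
    and small: "\<And>y. \<bar>y - x0\<bar> < 1 \<Longrightarrow> \<bar>u y\<bar> \<le> \<epsilon>"
    and \<epsilon>: "0 < \<epsilon>" "\<epsilon> \<le> 1" and K: "1 \<le> K"
    and weak: "\<And>a \<sigma>. \<sigma> > 0 \<Longrightarrow> (LINT y|lborel. u y * frac_lap (normal_density a \<sigma>) y) = frac_const * (LINT y|lborel. f y * normal_density a \<sigma> y)"
    and big: "1 \<le> (\<integral>\<^sup>+y. ennreal ((u y)\<^sup>2) * indicator {-1<..<1} y \<partial>lborel)"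
    and R: "R \<ge> 2" "\<bar>x0\<bar> = R" and m: "m \<ge> 2" "real m \<ge> 13824 * frac_const\<^sup>2 * (2 * (2 * R + 2))"
  shows "1 \<le> K\<^sup>2 * (2 * (2 * (2 * R + 2))\<^sup>2 * (2/3) ^ (2 * m) + 384 * flat_const frac_const * \<epsilon> powr (1/4) * (2 * (2 * R + 2)) ^ (2 * m))"
proof -
  have [measurable]: "u \<in> borel_measurable borel" using bdd_funD(1)[OF u] .
  interpret flat_solution K \<epsilon> frac_const "\<lambda>y. u (x0 + y / 2)" "\<lambda>y. f (x0 + y / 2) / sqrt 2"
    by (rule flat_solution_rescale[OF u f fu small \<epsilon> K weak])
  have fu': "\<bar>f y / sqrt 2\<bar> \<le> \<bar>u y\<bar>" for y
  proof -
    show ?thesis by (rule order_trans[OF abs_divide_sqrt2_le fu])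
  qed
  have mass: "1 \<le> (\<integral>\<^sup>+y. ennreal ((u (x0 + s * (y / 2)))\<^sup>2) * indicator {2 * R + 2 - 4<..<2 * R + 2} y \<partial>lborel)"
    if s: "s = 1 \<or> s = -1" "x0 = - s * R" for s
  proof -
    define g where "g = (\<lambda>t. ennreal ((u t)\<^sup>2) * indicator {-1<..<1::real} t)"
    have [measurable]: "g \<in> borel_measurable borel" unfolding g_def by measurable
    have "(\<integral>\<^sup>+y. g (x0 + s * (y / 2)) \<partial>lborel) = 2 * (\<integral>\<^sup>+t. g t \<partial>lborel)"
    proof -
      have "(\<integral>\<^sup>+t. g t \<partial>lborel) = ennreal \<bar>s / 2\<bar> * (\<integral>\<^sup>+y. g (x0 + s / 2 * y) \<partial>lborel)"
        by (rule nn_integral_real_affine) (use s in auto)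
      then have "2 * (\<integral>\<^sup>+t. g t \<partial>lborel) = (2 * ennreal (1/2)) * (\<integral>\<^sup>+y. g (x0 + s / 2 * y) \<partial>lborel)"
        using s by (auto simp: mult.assoc)
      also have "2 * ennreal (1/2) = 1" using ennreal_mult[of 2 "1/2"] by simp
      finally show ?thesis by simp
    qed
    moreover have "g (x0 + s * (y / 2)) = ennreal ((u (x0 + s * (y / 2)))\<^sup>2) * indicator {2 * R + 2 - 4<..<2 * R + 2} y" for y
      using s unfolding g_def by (auto split: split_indicator)
    moreover have "1 \<le> 2 * (\<integral>\<^sup>+t. g t \<partial>lborel)"
      using big unfolding g_def by (simp add: mult_2 add_increasing)
    ultimately show ?thesis by simp
  qed
  have \<rho>: "2 * R + 2 \<ge> 6" using R by simp
  consider "x0 = - R" | "x0 = R" using R by linarith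
  then show ?thesis
  proof cases
    case 1
    show ?thesis by (rule quantitative_nonvanishing[OF _ \<rho> m]) (use fu' mass[of 1] 1 in auto)
  next
    case 2
    interpret r: flat_solution K \<epsilon> frac_const "\<lambda>y. u (x0 + (- y) / 2)" "\<lambda>y. f (x0 + (- y) / 2) / sqrt 2" by (rule reflected)
    show ?thesis by (rule r.quantitative_nonvanishing[OF _ \<rho> m]) (use fu' mass[of "-1"] 2 in auto)
  qed
qed

text \<open>Passing to a Borel representative and clamping it makes the almost everywhere bound hold at every
  point.\<close>

lemma clamp_AE:
  fixes u :: "real \<Rightarrow> real"
  assumes "u \<in> borel_measurable lebesgue" and [measurable]: "k \<in> borel_measurable borel" and k: "\<And>x. k x \<ge> 0"
    and "AE x in lebesgue. \<bar>u x\<bar> \<le> k x"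
  obtains u' where "u' \<in> borel_measurable borel" "\<And>x. \<bar>u' x\<bar> \<le> k x" "AE x in lebesgue. u x = u' x"
proof -
  obtain v where v: "v \<in> borel_measurable lborel" "AE x in lborel. u x = v x"
    using completion_ex_borel_measurable_real[OF assms(1)] by blast
  then have [measurable]: "v \<in> borel_measurable borel" by simp
  have "AE x in lebesgue. u x = v x" using v(2) by (rule AE_completion)
  then have "AE x in lebesgue. u x = max (- k x) (min (k x) (v x))"
    using assms(4) by eventually_elim auto
  moreover have "\<bar>max (- k x) (min (k x) (v x))\<bar> \<le> k x" for x using k[of x] by (auto simp: abs_le_iff max_def min_def)
  moreover have "(\<lambda>x. max (- k x) (min (k x) (v x))) \<in> borel_measurable borel" by measurable
  ultimately show thesis using that by blast
qed

lemma Linf_norm_on_AE: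
  assumes "Linf_norm_on S f \<le> ereal c" "S \<in> sets lebesgue"
  shows "AE x in lebesgue. x \<in> S \<longrightarrow> \<bar>f x\<bar> \<le> c"
proof -
  have "AE x in lebesgue_on S. ereal \<bar>f x\<bar> \<le> esssup (lebesgue_on S) (\<lambda>x. ereal \<bar>f x\<bar>)" by (rule esssup_AE)
  then have "AE x in lebesgue_on S. \<bar>f x\<bar> \<le> c"
  proof eventually_elim
    case (elim x)
    then have "ereal \<bar>f x\<bar> \<le> ereal c" using assms(1) unfolding Linf_norm_on_def by (rule order_trans)
    then show ?case by simp
  qed
  then show ?thesis using assms(2) by (simp add: AE_restrict_space_iff)
qed

text \<open>The only test functions that are needed are Gaussians.\<close>

lemma weak_equation_gaussian:
  assumes u: "u \<in> borel_measurable lebesgue" "AE x in lebesgue. u x = u' x" "u' \<in> borel_measurable borel"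
    and V: "V \<in> borel_measurable lebesgue" "AE x in lebesgue. V x = V' x" "V' \<in> borel_measurable borel"
    and weak: "\<forall>\<phi> \<in> schwartz. lap_quarter_dist u \<phi> + dist_of_fun (\<lambda>x. V x * u x) \<phi> = 0"
    and \<sigma>: "\<sigma> > 0"
  shows "(LINT y|lborel. u' y * frac_lap (normal_density a \<sigma>) y) = frac_const * (LINT y|lborel. - (V' y * u' y) * normal_density a \<sigma> y)"
proof -
  note [measurable] = u(3) V(3)
  define \<phi> where "\<phi> = (\<lambda>x. complex_of_real (normal_density a \<sigma> x))"
  have [measurable]: "frac_lap (normal_density a \<sigma>) \<in> borel_measurable borel" unfolding frac_lap_def[abs_def] by measurable
  have up: "u' \<in> borel_measurable lebesgue" "V' \<in> borel_measurable lebesgue" "frac_lap (normal_density a \<sigma>) \<in> borel_measurable lebesgue" "normal_density a \<sigma> \<in> borel_measurable lebesgue"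
    by (auto intro!: measurable_completion)
  note [measurable] = up u(1) V(1)
  have "lap_quarter_dist u \<phi> = (LINT x|lebesgue. u x *\<^sub>R complex_of_real (frac_lap (normal_density a \<sigma>) x / frac_const))"
    unfolding lap_quarter_dist_def \<phi>_def lap_quarter_normal_density[OF \<sigma>] ..
  also have "\<dots> = (LINT x|lebesgue. complex_of_real (u' x * frac_lap (normal_density a \<sigma>) x / frac_const))"
  proof (rule integral_cong_AE)
    show "AE x in lebesgue. u x *\<^sub>R complex_of_real (frac_lap (normal_density a \<sigma>) x / frac_const) = complex_of_real (u' x * frac_lap (normal_density a \<sigma>) x / frac_const)"
      using u(2) by eventually_elim (simp add: scaleR_conv_of_real)
  qed measurable
  also have "\<dots> = (LINT x|lborel. complex_of_real (u' x * frac_lap (normal_density a \<sigma>) x / frac_const))"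
    by (rule integral_completion) measurable
  also have "\<dots> = complex_of_real (LINT x|lborel. u' x * frac_lap (normal_density a \<sigma>) x / frac_const)" by (rule integral_complex_of_real)
  also have "(LINT x|lborel. u' x * frac_lap (normal_density a \<sigma>) x / frac_const) = (LINT x|lborel. u' x * frac_lap (normal_density a \<sigma>) x) / frac_const"
    by (rule integral_divide_zero)
  finally have 1: "lap_quarter_dist u \<phi> = complex_of_real ((LINT x|lborel. u' x * frac_lap (normal_density a \<sigma>) x) / frac_const)" .
  have "dist_of_fun (\<lambda>x. V x * u x) \<phi> = (LINT x|lebesgue. complex_of_real (V' x * u' x * normal_density a \<sigma> x))"
    unfolding dist_of_fun_def \<phi>_def
  proof (rule integral_cong_AE)
    show "AE x in lebesgue. (V x * u x) *\<^sub>R complex_of_real (normal_density a \<sigma> x) = complex_of_real (V' x * u' x * normal_density a \<sigma> x)"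
      using u(2) V(2) by eventually_elim (simp add: scaleR_conv_of_real)
  qed measurable
  also have "\<dots> = (LINT x|lborel. complex_of_real (V' x * u' x * normal_density a \<sigma> x))"
    by (rule integral_completion) measurable
  also have "\<dots> = complex_of_real (LINT x|lborel. V' x * u' x * normal_density a \<sigma> x)" by (rule integral_complex_of_real)
  finally have 2: "dist_of_fun (\<lambda>x. V x * u x) \<phi> = complex_of_real (LINT x|lborel. V' x * u' x * normal_density a \<sigma> x)" .
  have "\<phi> \<in> schwartz" unfolding \<phi>_def by (rule normal_density_schwartz[OF \<sigma>])
  then have "lap_quarter_dist u \<phi> + dist_of_fun (\<lambda>x. V x * u x) \<phi> = 0" using weak by blast
  then have "complex_of_real ((LINT x|lborel. u' x * frac_lap (normal_density a \<sigma>) x) / frac_const + (LINT x|lborel. V' x * u' x * normal_density a \<sigma> x)) = 0"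
    unfolding 1 2 by simp
  then have "(LINT x|lborel. u' x * frac_lap (normal_density a \<sigma>) x) / frac_const + (LINT x|lborel. V' x * u' x * normal_density a \<sigma> x) = 0"
    by (simp only: of_real_eq_0_iff)
  moreover have "(LINT y|lborel. - (V' y * u' y) * normal_density a \<sigma> y) = - (LINT x|lborel. V' x * u' x * normal_density a \<sigma> x)" by simp
  ultimately show ?thesis using frac_const_pos by (simp add: field_simps)
qed

lemma nn_integral_ge_L2_norm:
  assumes "L2_norm_on {-1<..<1} u \<ge> 1" "u \<in> borel_measurable lebesgue" "AE x in lebesgue. u x = u' x" and [measurable]: "u' \<in> borel_measurable borel"
  shows "1 \<le> (\<integral>\<^sup>+y. ennreal ((u' y)\<^sup>2) * indicator {-1<..<1} y \<partial>lborel)"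
proof -
  have [measurable]: "u' \<in> borel_measurable lebesgue" by (auto intro!: measurable_completion)
  note [measurable] = assms(2)
  have "1 \<le> (LINT x|lebesgue_on {-1<..<1}. (u x)\<^sup>2)"
    using assms(1) unfolding L2_norm_on_def by (simp add: real_le_rsqrt real_sqrt_ge_1_iff)
  also have "\<dots> = (LINT x|lebesgue. indicator {-1<..<1} x *\<^sub>R (u x)\<^sup>2)"
    by (subst integral_restrict_space) auto
  also have "\<dots> = (LINT x|lebesgue. indicator {-1<..<1} x *\<^sub>R (u' x)\<^sup>2)"
  proof (rule integral_cong_AE)
    have [measurable]: "{-1<..<1::real} \<in> sets lebesgue" by simp
    show "(\<lambda>x. indicator {-1<..<1} x *\<^sub>R (u x)\<^sup>2) \<in> borel_measurable lebesgue"
      "(\<lambda>x. indicator {-1<..<1} x *\<^sub>R (u' x)\<^sup>2) \<in> borel_measurable lebesgue" by measurable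
    show "AE x in lebesgue. indicator {-1<..<1} x *\<^sub>R (u x)\<^sup>2 = indicator {-1<..<1} x *\<^sub>R (u' x)\<^sup>2"
      using assms(3) by eventually_elim simp
  qed
  also have "\<dots> = (LINT x|lborel. indicator {-1<..<1} x *\<^sub>R (u' x)\<^sup>2)" by (rule integral_completion) measurable
  finally have 1: "1 \<le> (LINT x|lborel. indicator {-1<..<1} x *\<^sub>R (u' x)\<^sup>2)" .
  then have "integrable lborel (\<lambda>x. indicator {-1<..<1} x *\<^sub>R (u' x)\<^sup>2)"
    using not_integrable_integral_eq by fastforce
  then have "(\<integral>\<^sup>+x. ennreal (indicator {-1<..<1} x *\<^sub>R (u' x)\<^sup>2) \<partial>lborel) = ennreal (LINT x|lborel. indicator {-1<..<1} x *\<^sub>R (u' x)\<^sup>2)"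
    by (intro nn_integral_eq_integral) auto
  moreover have "(\<integral>\<^sup>+x. ennreal (indicator {-1<..<1} x *\<^sub>R (u' x)\<^sup>2) \<partial>lborel) = (\<integral>\<^sup>+y. ennreal ((u' y)\<^sup>2) * indicator {-1<..<1} y \<partial>lborel)"
    by (intro nn_integral_cong) (auto split: split_indicator)
  ultimately show ?thesis using 1 by (metis ennreal_1 ennreal_leI)
qed

theorem theorem2p1:
  fixes C\<^sub>0 :: real
  assumes "C\<^sub>0 > 0"
  shows "\<exists>C > 0. \<exists>R\<^sub>0 > 0. \<forall>V \<in> Linf. \<forall>u \<in> Linf.
           (\<forall>\<phi> \<in> schwartz. lap_quarter_dist u \<phi> + dist_of_fun (\<lambda>x. V x * u x) \<phi> = 0) \<longrightarrow>
           Linf_norm_on UNIV V \<le> 1 \<longrightarrow>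
           Linf_norm_on UNIV u \<le> ereal C\<^sub>0 \<longrightarrow>
           L2_norm_on {-1<..<1} u \<ge> 1 \<longrightarrow>
           (\<forall>R \<ge> R\<^sub>0. (INF x\<^sub>0 \<in> {x\<^sub>0 :: real. \<bar>x\<^sub>0\<bar> = R}. Linf_norm_on {x\<^sub>0 - 1<..<x\<^sub>0 + 1} u)
                       \<ge> ereal (exp (- C * R * ln R)))"
proof -
  define K where "K = max 1 C\<^sub>0"
  have K: "K \<ge> 1" "K \<ge> C\<^sub>0" by (auto simp: K_def)
  obtain C R\<^sub>0 where C: "C > 0" and R0: "R\<^sub>0 \<ge> 2"
    and concl: "\<And>R \<epsilon>. R \<ge> R\<^sub>0 \<Longrightarrow> \<epsilon> > 0 \<Longrightarrow>
      (\<And>m. m \<ge> 2 \<Longrightarrow> real m \<ge> 13824 * frac_const\<^sup>2 * (2 * (2 * R + 2)) \<Longrightarrow>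
        1 \<le> K\<^sup>2 * (2 * (2 * (2 * R + 2))\<^sup>2 * (2/3) ^ (2 * m) + 384 * flat_const frac_const * \<epsilon> powr (1/4) * (2 * (2 * R + 2)) ^ (2 * m)))
      \<Longrightarrow> exp (- C * R * ln R) \<le> \<epsilon>"
    by (rule exponential_lower_bound[OF K(1) frac_const_pos]) blast
  show ?thesis
  proof (rule exI[of _ C], intro conjI C, rule exI[of _ R\<^sub>0], intro conjI ballI impI allI)
    show "R\<^sub>0 > 0" using R0 by simp
    fix V u :: "real \<Rightarrow> real" and R :: real
    assume V: "V \<in> Linf" and u: "u \<in> Linf"
      and weak: "\<forall>\<phi> \<in> schwartz. lap_quarter_dist u \<phi> + dist_of_fun (\<lambda>x. V x * u x) \<phi> = 0"
      and V1: "Linf_norm_on UNIV V \<le> 1" and uC: "Linf_norm_on UNIV u \<le> ereal C\<^sub>0"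
      and L2: "L2_norm_on {-1<..<1} u \<ge> 1" and R: "R \<ge> R\<^sub>0"
    have Vm: "V \<in> borel_measurable lebesgue" and um: "u \<in> borel_measurable lebesgue"
      using V u by (auto simp: Linf_def)
    have VA: "AE x in lebesgue. \<bar>V x\<bar> \<le> 1" using Linf_norm_on_AE[of UNIV V 1] V1 by (simp add: one_ereal_def)
    have uA: "AE x in lebesgue. \<bar>u x\<bar> \<le> K"
    proof -
      have "AE x in lebesgue. \<bar>u x\<bar> \<le> C\<^sub>0" using Linf_norm_on_AE[OF uC] by simp
      then show ?thesis by eventually_elim (use K in linarith)
    qed
    show "ereal (exp (- C * R * ln R)) \<le> (INF x\<^sub>0 \<in> {x\<^sub>0 :: real. \<bar>x\<^sub>0\<bar> = R}. Linf_norm_on {x\<^sub>0 - 1<..<x\<^sub>0 + 1} u)"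
    proof (rule INF_greatest, rule ccontr)
      fix x0 :: real
      assume x0: "x0 \<in> {x\<^sub>0. \<bar>x\<^sub>0\<bar> = R}" and "\<not> ereal (exp (- C * R * ln R)) \<le> Linf_norm_on {x0 - 1<..<x0 + 1} u"
      then have "Linf_norm_on {x0 - 1<..<x0 + 1} u < ereal (exp (- C * R * ln R))" by simp
      then obtain e where e: "Linf_norm_on {x0 - 1<..<x0 + 1} u < ereal e" "ereal e < ereal (exp (- C * R * ln R))"
        using ereal_dense2 by blast
      (* The maximum keeps epsilon positive when the norm vanishes, and it stays below the claimed bound. *)
      define \<epsilon> where "\<epsilon> = max e (exp (- C * R * ln R) / 2)"
      have \<epsilon>0: "\<epsilon> > 0" by (simp add: \<epsilon>_def less_max_iff_disj)
      have \<epsilon>E: "\<epsilon> < exp (- C * R * ln R)" using e(2) by (simp add: \<epsilon>_def)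
      have "- C * R * ln R \<le> 0" using C R R0 by (simp add: mult_nonneg_nonneg)
      then have "exp (- C * R * ln R) \<le> 1" by simp
      then have \<epsilon>1: "\<epsilon> \<le> 1" using \<epsilon>E by linarith
      have "Linf_norm_on {x0 - 1<..<x0 + 1} u \<le> ereal e" using e(1) by simp
      then have "AE x in lebesgue. x \<in> {x0 - 1<..<x0 + 1} \<longrightarrow> \<bar>u x\<bar> \<le> e" by (rule Linf_norm_on_AE) auto
      then have kA: "AE x in lebesgue. \<bar>u x\<bar> \<le> (if \<bar>x - x0\<bar> < 1 then min \<epsilon> K else K)"
        using uA by eventually_elim (auto simp: \<epsilon>_def abs_less_iff)
      have km: "(\<lambda>x. if \<bar>x - x0\<bar> < 1 then min \<epsilon> K else K) \<in> borel_measurable borel" by measurable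
      have k0: "(if \<bar>x - x0\<bar> < 1 then min \<epsilon> K else K) \<ge> 0" for x using \<epsilon>0 K by auto
      obtain u' where u': "u' \<in> borel_measurable borel" "\<And>x. \<bar>u' x\<bar> \<le> (if \<bar>x - x0\<bar> < 1 then min \<epsilon> K else K)" "AE x in lebesgue. u x = u' x"
        using clamp_AE[OF um km k0 kA] by blast
      obtain V' where V': "V' \<in> borel_measurable borel" "\<And>x. \<bar>V' x\<bar> \<le> 1" "AE x in lebesgue. V x = V' x"
        using clamp_AE[OF Vm _ _ VA] by auto
      define f where "f = (\<lambda>x. - (V' x * u' x))"
      have ub: "bdd_fun K u'" unfolding bdd_fun_def using u'(1) order_trans[OF u'(2)] by auto
      have fu: "\<bar>f x\<bar> \<le> \<bar>u' x\<bar>" for x using V'(2)[of x] by (simp add: f_def abs_mult mult_left_le_one_le)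
      have fb: "bdd_fun K f" unfolding bdd_fun_def
        using u'(1) V'(1) order_trans[OF fu bdd_funD(2)[OF ub]] unfolding f_def by auto
      have small: "\<bar>u' y\<bar> \<le> \<epsilon>" if "\<bar>y - x0\<bar> < 1" for y using u'(2)[of y] that by simp
      have "exp (- C * R * ln R) \<le> \<epsilon>"
      proof (rule concl[OF R \<epsilon>0])
        fix m :: nat assume m: "m \<ge> 2" "real m \<ge> 13824 * frac_const\<^sup>2 * (2 * (2 * R + 2))"
        show "1 \<le> K\<^sup>2 * (2 * (2 * (2 * R + 2))\<^sup>2 * (2/3) ^ (2 * m) + 384 * flat_const frac_const * \<epsilon> powr (1/4) * (2 * (2 * R + 2)) ^ (2 * m))"
        proof (rule local_lower_bound[OF ub fb fu small \<epsilon>0 \<epsilon>1 K(1) _ _ _ _ m])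
          show "(LINT y|lborel. u' y * frac_lap (normal_density a \<sigma>) y) = frac_const * (LINT y|lborel. f y * normal_density a \<sigma> y)" if "\<sigma> > 0" for a \<sigma>
            unfolding f_def by (rule weak_equation_gaussian[OF um u'(3,1) Vm V'(3,1) weak that])
          show "1 \<le> (\<integral>\<^sup>+y. ennreal ((u' y)\<^sup>2) * indicator {-1<..<1} y \<partial>lborel)"
            by (rule nn_integral_ge_L2_norm[OF L2 um u'(3,1)])
        qed (use R R0 x0 in auto)
      qed
      then show False using \<epsilon>E by simp
    qed
  qed
qed

end
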